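(* Let $X$ be a compact Kähler manifold of dimension $n$ and let $T$ be a diffuse foliated cycle of dimension $q\ge n/2$ directed by an embedded transversally Lipschitz lamination on $X$. Then $T\curlywedge T=0$, where $\curlywedge$ is the Dinh–Sibony intersection product of positive closed currents.
   Context: Complex manifolds are connected; $\mathbb D^m\subset\mathbb C^m$ is the unit polydisc. Lamination. Let $\Sigma$ be a compact metric space. A lamination $\mathcal L$ of $\Sigma$ by complex manifolds of dimension $q\ge 1$ is an atlas of homeomorphisms $\varphi_i:U_i\to\mathbb D^q\times K_i$ ($K_i$ a topological space, $U_i$ open in $\Sigma$) whose coordinate changes have the form $\varphi_j\circ\varphi_i^{-1}(z,t)=(f_{ij}(z,t),\gamma_{ij}(t))$ with $f_{ij}$ holomorphic in $z$. The $U_i$ are flow boxes, and the sets $\varphi_i^{-1}(\mathbb D^q\times\{t\})$ are plaques. Embedded lamination. $\mathcal L$ is embedded in a compact complex manifold $X$ of dimension $n$ if $\Sigma\subset X$, $K_i\subset\mathbb D^{n-q}$, and each $\varphi_i^{-1}$ extends to a homeomorphism from $\mathbb D^q\times\mathbb D^{n-q}$ onto an open subset of $X$ which is holomorphic in the first $q$ coordinates. Near each point $p\in\Sigma$ there are then holomorphic coordinates $(z',z'')\in\mathbb D^q\times\mathbb D^{n-q}$ of $X$ centered at $p$ in which the plaques are disjoint graphs $\{z''=h_a(z')\}$ of uniformly bounded holomorphic maps $h_a$, depending continuously on the parameter $a=h_a(0)$ (ranging over a set $K\ni 0$), with $h_0\equiv0$. Transversally Lipschitz. $\mathcal L$ is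 transversally Lipschitz if around every point of $\Sigma$ such coordinates can be chosen so that the dependence on $a$ is bi-Lipschitz: for every $0<\rho<1$ there is $c>0$ with $c^{-1}\|a-b\|\le\|h_a(z')-h_b(z')\|\le c\|a-b\|$ for all parameters $a,b$ and all $\|z'\|\le\rho$. Foliated cycle. A foliated cycle (of dimension $q$) directed by $\mathcal L$ is a positive closed current $T$ on $X$ of bidimension $(q,q)$ which in each flow box equals $T=\int_{K_i}[\mathbb D^q\times\{t\}]\,d\mu_i(t)$ (read through $\varphi_i$), with $[\cdot]$ the current of integration and $\mu_i$ a positive measure on $K_i$. It is diffuse if no $\mu_i$ has atoms. Density currents and $\curlywedge$. Let $T_1,T_2$ be positive closed currents on $X$ of bidegrees $(p_1,p_1),(p_2,p_2)$ with $p_1+p_2\le n$. Let $\Delta\subset X\times X$ be the diagonal, $E$ its normal bundle (isomorphic to the tangent bundle of $X$ under $\Delta\simeq X$), $\pi:E\to\Delta$ the projection, and $A_\lambda:E\to E$ the fiberwise multiplication by $\lambda\in\mathbb C^*$. An admissible map is a diffeomorphism $\tau$ from a neighborhood of $\Delta$ in $X\times X$ onto a neighborhood of the zero section in $E$, equal to the identity on $\Delta$, whose differential along $\Delta$ induces the identity on $E$. A density current of $(T_1,T_2)$ is any limit $\lim_{k}(A_{\lambda_k})_*\tau_*(T_1\otimes T_2)$ on $E$ along a sequence $\lambda_k\to\infty$. If there is exactly one density current $S$ and it has the form $S=\pi^*R$ for a positive closed $(p_1+p_2,p_1+p_2)$-current $R$ on $\Delta\simeq X$, then $T_1\curlywedge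 T_2$ is defined to be $R$. In particular, $T_1\curlywedge T_2=0$ means that the zero current is the only density current of $(T_1,T_2)$. *)

theory Defs
  imports "HOL-Analysis.Analysis"
begin

section \<open>Smooth and holomorphic maps between open subsets of complex number spaces\<close>

primrec iterated_deriv ::
  "'v list \<Rightarrow> ('v::real_normed_vector \<Rightarrow> 'w::real_normed_vector) \<Rightarrow> 'v \<Rightarrow> 'w" where
  "iterated_deriv [] f = f"
| "iterated_deriv (v # vs) f = (\<lambda>x. frechet_derivative (iterated_deriv vs f) (at x) v)"

text \<open>For open \<open>S\<close> this is the class of \<open>C\<close>-infinity maps: every iterated directional
  derivative exists and is differentiable, hence continuous.\<close>

definition smooth_on :: "'v::real_normed_vector set \<Rightarrow> ('v \<Rightarrow> 'w::real_normed_vector) \<Rightarrow> bool" where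
  "smooth_on S f \<longleftrightarrow> (\<forall>vs. \<forall>x\<in>S. iterated_deriv vs f differentiable (at x))"

definition complex_differentiable_on ::
  "(complex^'m) set \<Rightarrow> (complex^'m \<Rightarrow> complex^'k) \<Rightarrow> bool" where
  "complex_differentiable_on S f \<longleftrightarrow>
     (\<forall>x\<in>S. \<exists>D. (f has_derivative D) (at x) \<and> (\<forall>c v. D (c *s v) = c *s D v))"

section \<open>Complex manifolds\<close>

text \<open>A chart is a pair of its domain and the coordinate map; values of the coordinate map
  outside the domain are irrelevant.\<close>

type_synonym ('a, 'm) chart = "'a set \<times> ('a \<Rightarrow> complex^'m)"

definition points :: "('a, 'm) chart set \<Rightarrow> 'a set" where
  "points A = (\<Union>c\<in>A. fst c)"

abbreviation chart_image :: "('a, 'm) chart \<Rightarrow> (complex^'m) set" where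
  "chart_image c \<equiv> snd c ` fst c"

abbreviation chart_inv :: "('a, 'm) chart \<Rightarrow> complex^'m \<Rightarrow> 'a" where
  "chart_inv c \<equiv> inv_into (fst c) (snd c)"

definition atlas_topology :: "('a, 'm::finite) chart set \<Rightarrow> 'a topology" where
  "atlas_topology A = topology_generated_by {fst c \<inter> snd c -` W | c W. c \<in> A \<and> open W}"

definition coord_rep ::
  "('a, 'm) chart \<Rightarrow> ('b, 'k) chart \<Rightarrow> ('a \<Rightarrow> 'b) \<Rightarrow> complex^'m \<Rightarrow> complex^'k" where
  "coord_rep c d f = snd d \<circ> f \<circ> chart_inv c"

abbreviation transition_deriv ::
  "('a, 'm::finite) chart \<Rightarrow> ('a, 'm) chart \<Rightarrow> 'a \<Rightarrow> complex^'m \<Rightarrow> complex^'m" where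
  "transition_deriv c d p \<equiv> frechet_derivative (coord_rep c d id) (at (snd c p))"

definition is_chart :: "('a, 'm::finite) chart \<Rightarrow> bool" where
  "is_chart c \<longleftrightarrow> inj_on (snd c) (fst c) \<and> open (chart_image c)"

definition charts_compatible :: "('a, 'm::finite) chart \<Rightarrow> ('a, 'm) chart \<Rightarrow> bool" where
  "charts_compatible c d \<longleftrightarrow>
     open (snd c ` (fst c \<inter> fst d)) \<and>
     complex_differentiable_on (snd c ` (fst c \<inter> fst d)) (coord_rep c d id)"

definition complex_manifold :: "('a, 'm::finite) chart set \<Rightarrow> bool" where
  "complex_manifold A \<longleftrightarrow>
     (\<forall>c\<in>A. is_chart c) \<and> (\<forall>c\<in>A. \<forall>d\<in>A. charts_compatible c d) \<and>
     Hausdorff_space (atlas_topology A) \<and> second_countable (atlas_topology A) \<and>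
     connected_space (atlas_topology A)"

definition holomorphic_coordinates :: "('a, 'm::finite) chart set \<Rightarrow> ('a, 'm) chart \<Rightarrow> bool" where
  "holomorphic_coordinates A c \<longleftrightarrow>
     is_chart c \<and> fst c \<subseteq> points A \<and> (\<forall>d\<in>A. charts_compatible c d \<and> charts_compatible d c)"

definition manifold_map ::
  "((complex^'m::finite) set \<Rightarrow> (complex^'m \<Rightarrow> complex^'k::finite) \<Rightarrow> bool) \<Rightarrow>
   ('a, 'm) chart set \<Rightarrow> ('b, 'k) chart set \<Rightarrow> 'a set \<Rightarrow> ('a \<Rightarrow> 'b) \<Rightarrow> bool" where
  "manifold_map P A B S f \<longleftrightarrow>
     continuous_map (subtopology (atlas_topology A) S) (atlas_topology B) f \<and>
     (\<forall>c\<in>A. \<forall>d\<in>B. P (snd c ` {p \<in> fst c \<inter> S. f p \<in> fst d}) (coord_rep c d f))"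

abbreviation "smooth_map \<equiv> manifold_map smooth_on"
abbreviation "holomorphic_map \<equiv> manifold_map complex_differentiable_on"

section \<open>Differential forms\<close>

text \<open>A form is the family of its coordinate expressions: \<open>\<alpha> c x us\<close> is the value, at the point
  with coordinates \<open>x\<close> in the chart \<open>c\<close>, on the tangent vectors with coordinates \<open>us\<close>.
  Forms vanish outside their natural domain so that equal forms are equal as functions.\<close>

type_synonym ('a, 'm) mform = "('a, 'm) chart \<Rightarrow> complex^'m \<Rightarrow> (complex^'m) list \<Rightarrow> complex"

definition alternating_multilinear :: "nat \<Rightarrow> ((complex^'m::finite) list \<Rightarrow> complex) \<Rightarrow> bool" where
  "alternating_multilinear k g \<longleftrightarrow>
     (\<forall>us. length us \<noteq> k \<longrightarrow> g us = 0) \<and>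
     (\<forall>us i. length us = k \<and> i < k \<longrightarrow> linear (\<lambda>v. g (us[i := v]))) \<and>
     (\<forall>us. length us = k \<and> \<not> distinct us \<longrightarrow> g us = 0)"

definition smooth_form :: "('a, 'm::finite) chart set \<Rightarrow> nat \<Rightarrow> ('a, 'm) mform \<Rightarrow> bool" where
  "smooth_form A k \<alpha> \<longleftrightarrow>
     (\<forall>c x us. \<not> (c \<in> A \<and> x \<in> chart_image c) \<longrightarrow> \<alpha> c x us = 0) \<and>
     (\<forall>c\<in>A. \<forall>x\<in>chart_image c. alternating_multilinear k (\<alpha> c x)) \<and>
     (\<forall>c\<in>A. \<forall>us. smooth_on (chart_image c) (\<lambda>x. \<alpha> c x us)) \<and>
     (\<forall>c\<in>A. \<forall>d\<in>A. \<forall>p \<in> fst c \<inter> fst d. \<forall>us.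
        \<alpha> c (snd c p) us = \<alpha> d (snd d p) (map (transition_deriv c d p) us))"

definition form_support :: "('a, 'm::finite) chart set \<Rightarrow> ('a, 'm) mform \<Rightarrow> 'a set" where
  "form_support A \<alpha> =
     (atlas_topology A) closure_of {p. \<exists>c\<in>A. p \<in> fst c \<and> (\<exists>us. \<alpha> c (snd c p) us \<noteq> 0)}"

definition test_form :: "('a, 'm::finite) chart set \<Rightarrow> nat \<Rightarrow> ('a, 'm) mform \<Rightarrow> bool" where
  "test_form A k \<alpha> \<longleftrightarrow> smooth_form A k \<alpha> \<and> compactin (atlas_topology A) (form_support A \<alpha>)"

definition ext_deriv :: "('a, 'm::finite) mform \<Rightarrow> ('a, 'm) mform" where
  "ext_deriv \<alpha> = (\<lambda>c x vs. if x \<in> chart_image c then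
     (\<Sum>i<length vs. (-1) ^ i *
        frechet_derivative (\<lambda>y. \<alpha> c y (take i vs @ drop (Suc i) vs)) (at x) (vs ! i)) else 0)"

text \<open>The pullback to \<open>S\<close> of a form by \<open>f\<close>, extended by zero; the choice of the target chart
  is immaterial because the coordinate expressions of a form are compatible.\<close>

definition form_pullback ::
  "('a, 'm::finite) chart set \<Rightarrow> ('b, 'k::finite) chart set \<Rightarrow> 'a set \<Rightarrow> ('a \<Rightarrow> 'b) \<Rightarrow>
   ('b, 'k) mform \<Rightarrow> ('a, 'm) mform" where
  "form_pullback A B S f \<beta> = (\<lambda>c x us.
     if c \<in> A \<and> x \<in> snd c ` (fst c \<inter> S) then
       (let d = (SOME d. d \<in> B \<and> f (chart_inv c x) \<in> fst d) in
          \<beta> d (coord_rep c d f x) (map (frechet_derivative (coord_rep c d f) (at x)) us))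
     else 0)"

text \<open>A form of degree \<open>a + b\<close> has bidegree \<open>(a, b)\<close> iff it is homogeneous in this sense: under
  \<open>v \<mapsto> lv\<close> each factor \<open>dz\<^sub>i\<close> is multiplied by \<open>l\<close> and each conjugate factor by \<open>cnj l\<close>.\<close>

definition has_bidegree :: "nat \<Rightarrow> nat \<Rightarrow> ('a, 'm::finite) mform \<Rightarrow> bool" where
  "has_bidegree a b \<alpha> \<longleftrightarrow>
     (\<forall>c x us l. length us = a + b \<longrightarrow>
        \<alpha> c x (map (\<lambda>v. l *s v) us) = l ^ a * cnj l ^ b * \<alpha> c x us)"

text \<open>An \<open>(m, m)\<close>-form is positive if it restricts to a nonnegative volume form on every complex
  subspace of dimension \<open>m\<close> of each tangent space.\<close>

definition positive_form :: "nat \<Rightarrow> ('a, 'm::finite) mform \<Rightarrow> bool" where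
  "positive_form m \<alpha> \<longleftrightarrow> has_bidegree m m \<alpha> \<and>
     (\<forall>c x vs. length vs = m \<longrightarrow> \<alpha> c x (concat (map (\<lambda>v. [v, \<i> *s v]) vs)) \<in> \<real>\<^sub>\<ge>\<^sub>0)"

definition kaehler_form :: "('a, 'm::finite) chart set \<Rightarrow> ('a, 'm) mform \<Rightarrow> bool" where
  "kaehler_form A \<omega> \<longleftrightarrow>
     smooth_form A 2 \<omega> \<and> ext_deriv \<omega> = (\<lambda>c x us. 0) \<and>
     (\<forall>c\<in>A. \<forall>x\<in>chart_image c. \<forall>u v.
        \<omega> c x [u, v] \<in> \<real> \<and> \<omega> c x [\<i> *s u, \<i> *s v] = \<omega> c x [u, v] \<and>
        (u \<noteq> 0 \<longrightarrow> 0 < Re (\<omega> c x [u, \<i> *s u])))"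

definition compact_kaehler_manifold :: "('a, 'm::finite) chart set \<Rightarrow> bool" where
  "compact_kaehler_manifold A \<longleftrightarrow>
     complex_manifold A \<and> compact_space (atlas_topology A) \<and> (\<exists>\<omega>. kaehler_form A \<omega>)"

text \<open>The oriented real basis \<open>e\<^sub>1, \<i>e\<^sub>1, e\<^sub>2, \<i>e\<^sub>2, \<dots>\<close>; the order of the pairs does not
  affect the value of an alternating form.\<close>

definition oriented_basis :: "(complex^'m::finite) list" where
  "oriented_basis =
     concat (map (\<lambda>i. [axis i 1, axis i \<i>]) (SOME is. distinct is \<and> set is = (UNIV :: 'm set)))"

section \<open>Currents\<close>

type_synonym ('a, 'm) current = "('a, 'm) mform \<Rightarrow> complex"

definition test_forms_tendsto_zero ::
  "('a, 'm::finite) chart set \<Rightarrow> nat \<Rightarrow> (nat \<Rightarrow> ('a, 'm) mform) \<Rightarrow> bool" where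
  "test_forms_tendsto_zero A k \<alpha> \<longleftrightarrow>
     (\<forall>j. test_form A k (\<alpha> j)) \<and>
     (\<exists>C. compactin (atlas_topology A) C \<and> (\<forall>j. form_support A (\<alpha> j) \<subseteq> C)) \<and>
     (\<forall>c\<in>A. \<forall>L. compact L \<and> L \<subseteq> chart_image c \<longrightarrow>
        (\<forall>us vs. uniform_limit L (\<lambda>j. iterated_deriv vs (\<lambda>x. \<alpha> j c x us)) (\<lambda>_. 0) sequentially))"

text \<open>Currents of dimension \<open>k\<close>, acting on test forms of degree \<open>k\<close>. They are set to zero on all
  other arguments, so that equal currents are equal as functions.\<close>

definition is_current :: "('a, 'm::finite) chart set \<Rightarrow> nat \<Rightarrow> ('a, 'm) current \<Rightarrow> bool" where
  "is_current A k T \<longleftrightarrow>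
     (\<forall>\<alpha>. \<not> test_form A k \<alpha> \<longrightarrow> T \<alpha> = 0) \<and>
     (\<forall>\<alpha> \<beta> a b. test_form A k \<alpha> \<and> test_form A k \<beta> \<longrightarrow>
        T (\<lambda>c x us. a * \<alpha> c x us + b * \<beta> c x us) = a * T \<alpha> + b * T \<beta>) \<and>
     (\<forall>\<alpha>. test_forms_tendsto_zero A k \<alpha> \<longrightarrow> (\<lambda>j. T (\<alpha> j)) \<longlonglongrightarrow> 0)"

definition closed_current :: "('a, 'm::finite) chart set \<Rightarrow> nat \<Rightarrow> ('a, 'm) current \<Rightarrow> bool" where
  "closed_current A k T \<longleftrightarrow> (\<forall>m \<alpha>. Suc m = k \<and> test_form A m \<alpha> \<longrightarrow> T (ext_deriv \<alpha>) = 0)"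

definition positive_closed_current ::
  "('a, 'm::finite) chart set \<Rightarrow> nat \<Rightarrow> ('a, 'm) current \<Rightarrow> bool" where
  "positive_closed_current A p T \<longleftrightarrow> p \<le> CARD('m) \<and>
     (let m = CARD('m) - p in
        is_current A (2 * m) T \<and>
        (\<forall>a b \<alpha>. a + b = 2 * m \<and> (a, b) \<noteq> (m, m) \<and> test_form A (2 * m) \<alpha> \<and> has_bidegree a b \<alpha>
           \<longrightarrow> T \<alpha> = 0) \<and>
        (\<forall>\<alpha>. test_form A (2 * m) \<alpha> \<and> positive_form m \<alpha> \<longrightarrow> T \<alpha> \<in> \<real>\<^sub>\<ge>\<^sub>0) \<and>
        closed_current A (2 * m) T)"

section \<open>The product manifold and the normal bundle of the diagonal\<close>

definition vjoin :: "complex^'m::finite \<Rightarrow> complex^'k::finite \<Rightarrow> complex^('m + 'k)" where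
  "vjoin x y = (\<chi> i. case i of Inl a \<Rightarrow> x $ a | Inr b \<Rightarrow> y $ b)"

definition vsnd :: "complex^('m::finite + 'k::finite) \<Rightarrow> complex^'k" where
  "vsnd z = (\<chi> b. z $ Inr b)"

definition prod_chart ::
  "('a, 'm::finite) chart \<Rightarrow> ('b, 'k::finite) chart \<Rightarrow> ('a \<times> 'b, 'm + 'k) chart" where
  "prod_chart c d = (fst c \<times> fst d, \<lambda>p. vjoin (snd c (fst p)) (snd d (snd p)))"

definition prod_atlas ::
  "('a, 'm::finite) chart set \<Rightarrow> ('b, 'k::finite) chart set \<Rightarrow> ('a \<times> 'b, 'm + 'k) chart set" where
  "prod_atlas A B = {prod_chart c d | c d. c \<in> A \<and> d \<in> B}"

text \<open>The tensor product is computed by first applying the second current in the second variable: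
  for fixed \<open>x\<close> and \<open>us\<close>, the innermost function is a form on the second factor.\<close>

definition current_tensor ::
  "('a, 'm::finite) chart set \<Rightarrow> ('b, 'k::finite) chart set \<Rightarrow>
   ('a, 'm) current \<Rightarrow> ('b, 'k) current \<Rightarrow> ('a \<times> 'b, 'm + 'k) current" where
  "current_tensor A B T1 T2 = (\<lambda>\<Phi>.
     T1 (\<lambda>c x us. if c \<in> A then
       T2 (\<lambda>d y ws. if d \<in> B then
         \<Phi> (prod_chart c d) (vjoin x y)
            (map (\<lambda>u. vjoin u 0) us @ map (\<lambda>w. vjoin 0 w) ws) else 0) else 0))"

text \<open>A tangent vector is given by its coordinates in all charts at once.\<close>

type_synonym ('a, 'm) tvec = "('a, 'm) chart \<Rightarrow> complex^'m"

definition tangent_space :: "('a, 'm::finite) chart set \<Rightarrow> 'a \<Rightarrow> ('a, 'm) tvec set" where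
  "tangent_space A p = {v.
     (\<forall>c\<in>A. \<forall>d\<in>A. p \<in> fst c \<inter> fst d \<longrightarrow> v d = transition_deriv c d p (v c)) \<and>
     (\<forall>c. \<not> (c \<in> A \<and> p \<in> fst c) \<longrightarrow> v c = 0)}"

text \<open>The normal bundle of the diagonal is realized as the tangent bundle, the class of a tangent
  vector \<open>(u, w)\<close> of the square at \<open>(p, p)\<close> being identified with \<open>w - u\<close>.\<close>

definition tangent_chart ::
  "('a, 'm::finite) chart set \<Rightarrow> ('a, 'm) chart \<Rightarrow> ('a \<times> ('a, 'm) tvec, 'm + 'm) chart" where
  "tangent_chart A c =
     (SIGMA p : fst c. tangent_space A p, \<lambda>e. vjoin (snd c (fst e)) (snd e c))"

definition tangent_atlas ::
  "('a, 'm::finite) chart set \<Rightarrow> ('a \<times> ('a, 'm) tvec, 'm + 'm) chart set" where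
  "tangent_atlas A = tangent_chart A ` A"

definition fibre_scale :: "complex \<Rightarrow> 'a \<times> ('a, 'm::finite) tvec \<Rightarrow> 'a \<times> ('a, 'm) tvec" where
  "fibre_scale l e = (fst e, \<lambda>c. l *s snd e c)"

definition admissible_map ::
  "('a, 'm::finite) chart set \<Rightarrow> ('a \<times> 'a) set \<Rightarrow> ('a \<times> 'a \<Rightarrow> 'a \<times> ('a, 'm) tvec) \<Rightarrow> bool" where
  "admissible_map A N \<tau> \<longleftrightarrow>
     openin (atlas_topology (prod_atlas A A)) N \<and> (\<forall>p\<in>points A. (p, p) \<in> N) \<and>
     inj_on \<tau> N \<and> openin (atlas_topology (tangent_atlas A)) (\<tau> ` N) \<and>
     smooth_map (prod_atlas A A) (tangent_atlas A) N \<tau> \<and>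
     smooth_map (tangent_atlas A) (prod_atlas A A) (\<tau> ` N) (inv_into N \<tau>) \<and>
     (\<forall>p\<in>points A. \<tau> (p, p) = (p, \<lambda>c. 0)) \<and>
     (\<forall>c\<in>A. \<forall>p\<in>fst c. \<forall>u w.
        vsnd (frechet_derivative (coord_rep (prod_chart c c) (tangent_chart A c) \<tau>)
                (at (vjoin (snd c p) (snd c p))) (vjoin u w)) = w - u)"

section \<open>Density currents and the Dinh--Sibony product\<close>

text \<open>\<open>(A\<^sub>\<lambda>)\<^sub>* \<tau>\<^sub>* (T\<^sub>1 \<otimes> T\<^sub>2)\<close> is evaluated on a test form \<open>\<Phi>\<close> by applying \<open>T\<^sub>1 \<otimes> T\<^sub>2\<close> to the
  pullback of \<open>\<Phi>\<close>. The latter has compact support in \<open>N\<close> as soon as \<open>\<bar>\<lambda>\<bar>\<close> is large, which is all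
  that matters for the limit.\<close>

definition density_current ::
  "('a, 'm::finite) chart set \<Rightarrow> nat \<Rightarrow> nat \<Rightarrow> ('a, 'm) current \<Rightarrow> ('a, 'm) current \<Rightarrow>
   ('a \<times> ('a, 'm) tvec, 'm + 'm) current \<Rightarrow> bool" where
  "density_current A p1 p2 T1 T2 S \<longleftrightarrow>
     (let k = 2 * (CARD('m) - p1) + 2 * (CARD('m) - p2) in
        is_current (tangent_atlas A) k S \<and>
        (\<exists>N \<tau> l. admissible_map A N \<tau> \<and>
           (\<forall>j. l j \<noteq> 0) \<and> filterlim l at_infinity sequentially \<and>
           (\<forall>\<Phi>. test_form (tangent_atlas A) k \<Phi> \<longrightarrow>
              (\<lambda>j. current_tensor A A T1 T2
                 (form_pullback (prod_atlas A A) (tangent_atlas A) N (fibre_scale (l j) \<circ> \<tau>) \<Phi>))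
              \<longlonglongrightarrow> S \<Phi>)))"

definition fibre_integral ::
  "('a, 'm::finite) chart set \<Rightarrow> ('a \<times> ('a, 'm) tvec, 'm + 'm) mform \<Rightarrow> ('a, 'm) mform" where
  "fibre_integral A \<Phi> = (\<lambda>c x us. if c \<in> A then
     (LINT v|lborel. \<Phi> (tangent_chart A c) (vjoin x v)
        (map (\<lambda>u. vjoin u 0) us @ map (\<lambda>w. vjoin 0 w) oriented_basis)) else 0)"

text \<open>The pullback under the bundle projection of a current of dimension \<open>k\<close>; it has dimension
  \<open>k\<close> plus the real dimension of the fibres.\<close>

definition current_pullback_proj ::
  "('a, 'm::finite) chart set \<Rightarrow> nat \<Rightarrow> ('a, 'm) current \<Rightarrow>
   ('a \<times> ('a, 'm) tvec, 'm + 'm) current" where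
  "current_pullback_proj A k R = (\<lambda>\<Phi>.
     if test_form (tangent_atlas A) (k + 2 * CARD('m)) \<Phi> then R (fibre_integral A \<Phi>) else 0)"

text \<open>\<open>T\<^sub>1 \<curlywedge> T\<^sub>2\<close> is defined and equal to \<open>R\<close>.\<close>

definition DS_product_is ::
  "('a, 'm::finite) chart set \<Rightarrow> nat \<Rightarrow> nat \<Rightarrow> ('a, 'm) current \<Rightarrow> ('a, 'm) current \<Rightarrow>
   ('a, 'm) current \<Rightarrow> bool" where
  "DS_product_is A p1 p2 T1 T2 R \<longleftrightarrow>
     positive_closed_current A (p1 + p2) R \<and>
     {S. density_current A p1 p2 T1 T2 S} =
       {current_pullback_proj A (2 * (CARD('m) - (p1 + p2))) R}"

section \<open>Embedded laminations\<close>

definition polydisc :: "(complex^'m) set" where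
  "polydisc = {z. \<forall>i. cmod (z $ i) < 1}"

definition polydisc_atlas :: "(complex^'m, 'm) chart set" where
  "polydisc_atlas = {(polydisc, \<lambda>z. z)}"

text \<open>The injection \<open>\<iota>\<close> selects which of the coordinates of complex \<open>n\<close>-space are the leaf
  coordinates. The transverse polydisc of dimension \<open>n - q\<close> lies in the subspace where these
  vanish (a single point if \<open>q = n\<close>), and the point \<open>(z', z'')\<close> is
  \<open>leaf_vec \<iota> z' + z''\<close>.\<close>

definition leaf_vec :: "('q \<Rightarrow> 'n) \<Rightarrow> complex^'q \<Rightarrow> complex^'n" where
  "leaf_vec \<iota> z = (\<chi> i. if i \<in> range \<iota> then z $ inv \<iota> i else 0)"

definition transverse_polydisc :: "('q \<Rightarrow> 'n) \<Rightarrow> (complex^'n) set" where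
  "transverse_polydisc \<iota> = {t \<in> polydisc. \<forall>j. t $ \<iota> j = 0}"

text \<open>A flow box is given by the inverse \<open>B\<close> of its chart together with the transversal \<open>K\<close>.
  In an embedded lamination, \<open>B\<close> is moreover the extended map.\<close>

type_synonym ('a, 'q, 'n) flow_box = "((complex^'q) \<times> (complex^'n) \<Rightarrow> 'a) \<times> (complex^'n) set"

abbreviation box_set :: "('a, 'q::finite, 'n::finite) flow_box \<Rightarrow> 'a set" where
  "box_set b \<equiv> fst b ` (polydisc \<times> snd b)"

definition is_flow_box ::
  "('a, 'n::finite) chart set \<Rightarrow> ('q::finite \<Rightarrow> 'n) \<Rightarrow> 'a set \<Rightarrow> ('a, 'q, 'n) flow_box \<Rightarrow> bool" where
  "is_flow_box A \<iota> \<Sigma> b \<longleftrightarrow>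
     snd b \<subseteq> transverse_polydisc \<iota> \<and>
     openin (subtopology (atlas_topology A) \<Sigma>) (box_set b) \<and>
     embedding_map (top_of_set (polydisc \<times> snd b)) (subtopology (atlas_topology A) \<Sigma>) (fst b)"

definition is_embedded_flow_box ::
  "('a, 'n::finite) chart set \<Rightarrow> ('q::finite \<Rightarrow> 'n) \<Rightarrow> 'a set \<Rightarrow> ('a, 'q, 'n) flow_box \<Rightarrow> bool" where
  "is_embedded_flow_box A \<iota> \<Sigma> b \<longleftrightarrow> is_flow_box A \<iota> \<Sigma> b \<and>
     openin (atlas_topology A) (fst b ` (polydisc \<times> transverse_polydisc \<iota>)) \<and>
     embedding_map (top_of_set (polydisc \<times> transverse_polydisc \<iota>)) (atlas_topology A) (fst b) \<and>
     (\<forall>t\<in>transverse_polydisc \<iota>.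
        holomorphic_map polydisc_atlas A polydisc (\<lambda>z. fst b (z, t)))"

definition flow_box_change ::
  "('a, 'q::finite, 'n::finite) flow_box \<Rightarrow> ('a, 'q, 'n) flow_box \<Rightarrow> bool" where
  "flow_box_change b b' \<longleftrightarrow> (\<exists>f \<gamma>.
     (\<forall>t\<in>snd b. \<forall>z\<in>polydisc. fst b (z, t) \<in> box_set b' \<longrightarrow>
        f z t \<in> polydisc \<and> \<gamma> t \<in> snd b' \<and> fst b (z, t) = fst b' (f z t, \<gamma> t)) \<and>
     (\<forall>t\<in>snd b.
        complex_differentiable_on {z \<in> polydisc. fst b (z, t) \<in> box_set b'} (\<lambda>z. f z t)))"

definition embedded_lamination ::
  "('a, 'n::finite) chart set \<Rightarrow> ('q::finite \<Rightarrow> 'n) \<Rightarrow> 'a set \<Rightarrow> ('a, 'q, 'n) flow_box set \<Rightarrow> bool" where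
  "embedded_lamination A \<iota> \<Sigma> L \<longleftrightarrow>
     inj \<iota> \<and> compactin (atlas_topology A) \<Sigma> \<and> \<Sigma> = (\<Union>b\<in>L. box_set b) \<and>
     (\<forall>b\<in>L. is_embedded_flow_box A \<iota> \<Sigma> b) \<and> (\<forall>b\<in>L. \<forall>b'\<in>L. flow_box_change b b')"

text \<open>Around each point there are centered holomorphic coordinates \<open>c\<close> in which plaques of the
  lamination are graphs of maps \<open>h a\<close>: these graphs are the plaques of a flow box around the point
  which is compatible with the atlas \<open>L\<close>.\<close>

definition transversally_Lipschitz ::
  "('a, 'n::finite) chart set \<Rightarrow> ('q::finite \<Rightarrow> 'n) \<Rightarrow> 'a set \<Rightarrow> ('a, 'q, 'n) flow_box set \<Rightarrow> bool" where
  "transversally_Lipschitz A \<iota> \<Sigma> L \<longleftrightarrow> (\<forall>p\<in>\<Sigma>. \<exists>c K h.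
     holomorphic_coordinates A c \<and> chart_image c = polydisc \<and> p \<in> fst c \<and> snd c p = 0 \<and>
     0 \<in> K \<and> K \<subseteq> transverse_polydisc \<iota> \<and> (\<forall>z\<in>polydisc. h 0 z = 0) \<and>
     (\<forall>a\<in>K. complex_differentiable_on polydisc (h a) \<and> h a ` polydisc \<subseteq> transverse_polydisc \<iota> \<and>
        h a 0 = a) \<and>
     (let b = (\<lambda>(z, a). chart_inv c (leaf_vec \<iota> z + h a z), K) in
        is_flow_box A \<iota> \<Sigma> b \<and> (\<forall>b'\<in>L. flow_box_change b b' \<and> flow_box_change b' b)) \<and>
     (\<forall>\<rho>. 0 < \<rho> \<and> \<rho> < 1 \<longrightarrow> (\<exists>C>0. \<forall>a\<in>K. \<forall>a'\<in>K. \<forall>z. (\<forall>i. cmod (z $ i) \<le> \<rho>) \<longrightarrow>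
        norm (a - a') / C \<le> norm (h a z - h a' z) \<and>
        norm (h a z - h a' z) \<le> C * norm (a - a'))))"

section \<open>Foliated cycles\<close>

definition plaque_integral ::
  "('a, 'n::finite) chart set \<Rightarrow> ('a, 'q::finite, 'n) flow_box \<Rightarrow> complex^'n \<Rightarrow>
   ('a, 'n) mform \<Rightarrow> complex" where
  "plaque_integral A b t \<alpha> = (LINT z:polydisc|lborel.
     form_pullback polydisc_atlas A polydisc (\<lambda>z. fst b (z, t)) \<alpha> (polydisc, \<lambda>z. z) z oriented_basis)"

text \<open>A cycle carried by \<open>\<Sigma>\<close> and disintegrated along the plaques of each flow box. The transverse
  measures are finite on compact sets (as they must be for a current), since the Lebesgue integral
  of the library is zero for non-integrable functions.\<close>

definition foliated_cycle ::
  "('a, 'n::finite) chart set \<Rightarrow> ('q::finite \<Rightarrow> 'n) \<Rightarrow> 'a set \<Rightarrow> ('a, 'q, 'n) flow_box set \<Rightarrow>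
   (('a, 'q, 'n) flow_box \<Rightarrow> (complex^'n) measure) \<Rightarrow> ('a, 'n) current \<Rightarrow> bool" where
  "foliated_cycle A \<iota> \<Sigma> L \<mu> T \<longleftrightarrow>
     positive_closed_current A (CARD('n) - CARD('q)) T \<and>
     (\<forall>\<alpha>. test_form A (2 * CARD('q)) \<alpha> \<and> form_support A \<alpha> \<inter> \<Sigma> = {} \<longrightarrow> T \<alpha> = 0) \<and>
     (\<forall>b\<in>L.
        sets (\<mu> b) = sets (restrict_space borel (snd b)) \<and>
        (\<forall>C. compact C \<and> C \<subseteq> snd b \<longrightarrow> emeasure (\<mu> b) C < \<infinity>) \<and>
        (\<forall>\<alpha>. test_form A (2 * CARD('q)) \<alpha> \<and>
             form_support A \<alpha> \<subseteq> fst b ` (polydisc \<times> transverse_polydisc \<iota>) \<and>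
             form_support A \<alpha> \<inter> \<Sigma> \<subseteq> box_set b \<longrightarrow>
           T \<alpha> = (LINT t|\<mu> b. plaque_integral A b t \<alpha>)))"

definition diffuse ::
  "('a, 'q::finite, 'n::finite) flow_box set \<Rightarrow> (('a, 'q, 'n) flow_box \<Rightarrow> (complex^'n) measure) \<Rightarrow> bool" where
  "diffuse L \<mu> \<longleftrightarrow> (\<forall>b\<in>L. \<forall>t\<in>snd b. emeasure (\<mu> b) {t} = 0)"

end

theory Submission
  imports Defs "HOL-Complex_Analysis.Cauchy_Integral_Formula"
begin

text \<open>On the product of two plaques, a form \<open>\<Phi>\<close> on the normal bundle pulled back by the dilated
  admissible map is supported on pairs of points at distance \<open>O(1/|\<lambda>|)\<close>. At such a pair the
  Lipschitz dependence of the plaques and Cauchy's estimate provide, for every vector \<open>u\<close> tangent to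
  the first plaque, a vector \<open>u'\<close> tangent to the second one with \<open>|u - u'| = O(|u|/|\<lambda>|)\<close>. Replacing
  \<open>(u, 0)\<close> by \<open>(u, u')\<close> does not change the value of the form on the tangent space of the product,
  and the dilated map stretches \<open>(u, u')\<close> by a bounded factor only; the remaining \<open>2q\<close> real directions
  \<open>(0, u')\<close> are stretched by \<open>O(|\<lambda>|)\<close>. So the integrand is \<open>O(|\<lambda>|^(2q))\<close>, while for a fixed point of
  the first plaque it lives on a subset of the second one of volume \<open>O(|\<lambda>|^(-2q))\<close>. The contributions
  of pairs of plaques are therefore bounded, and they vanish unless the two parameters have distance
  tending to \<open>0\<close>; as the transverse measures have no atoms, the mass of these pairs tends to \<open>0\<close>.
  That \<open>0\<close> really occurs as a density current needs an admissible map, which is glued from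
  differences of coordinates by a partition of unity.\<close>

section \<open>Calculus of smooth maps\<close>

text \<open>The powers of |\<lambda>| in the integrand and in the volume cancel exactly, so the
  dilation itself gains nothing: the Lipschitz dependence keeps the contributions bounded, and all
  smallness comes from the absence of atoms. The cut-off acts on the first variable only. The
  pulled-back form forces the second point close to the first one, so a cut-off supported in a
  closed set puts both points into one flow box once |\<lambda>| is large, and the partition of
  unity lives on the manifold instead of its square. Regularity of the inner form, obtained by
  applying the current in the second variable, is never established. A current is 0 off the test
  forms, so either the inner form is a test form and the disintegration along plaques applies, or
  there is nothing to estimate. Likewise integrals of non-integrable functions are 0, so a supremum
  times the measure of a set bounds every integral that occurs. Admissible maps are merely smooth,
  which asks for a calculus of smooth maps; charts and plaques are holomorphic and are controlled by
  Cauchy estimates.\<close>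

primrec Ck_on :: "nat \<Rightarrow> 'v::real_normed_vector set \<Rightarrow> ('v \<Rightarrow> 'w::real_normed_vector) \<Rightarrow> bool" where
  "Ck_on 0 S f \<longleftrightarrow> True"
| "Ck_on (Suc k) S f \<longleftrightarrow> (\<forall>x\<in>S. f differentiable (at x)) \<and>
     (\<forall>v. Ck_on k S (\<lambda>x. frechet_derivative f (at x) v))"

lemma iterated_deriv_snoc:
  "iterated_deriv (vs @ [v]) f = iterated_deriv vs (\<lambda>x. frechet_derivative f (at x) v)"
  by (induction vs) simp_all

text \<open>\<open>iterated_deriv\<close> puts the latest derivative outermost, where product and
  chain rule would have to be iterated. \<open>Ck_on\<close> peels off the first derivative instead,
  so that one differentiation rule and an induction on \<open>k\<close> suffice. The bound is
  strict: \<open>Ck_on (Suc 0)\<close> is differentiability and says nothing about the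
  derivative.\<close>

lemma Ck_on_iff: "Ck_on k S f \<longleftrightarrow> (\<forall>vs. length vs < k \<longrightarrow> (\<forall>x\<in>S. iterated_deriv vs f differentiable (at x)))"
proof (induction k arbitrary: f)
  case 0
  then show ?case by simp
next
  case (Suc k)
  show ?case
  proof
    assume L: "Ck_on (Suc k) S f"
    show "\<forall>vs. length vs < Suc k \<longrightarrow> (\<forall>x\<in>S. iterated_deriv vs f differentiable (at x))"
    proof (intro allI impI)
      fix vs :: "'a list" assume "length vs < Suc k"
      then show "\<forall>x\<in>S. iterated_deriv vs f differentiable (at x)"
        using L Suc by (cases vs rule: rev_cases) (auto simp: iterated_deriv_snoc)
    qed
  next
    assume R: "\<forall>vs. length vs < Suc k \<longrightarrow> (\<forall>x\<in>S. iterated_deriv vs f differentiable (at x))"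
    have "f differentiable (at x)" if "x \<in> S" for x
      using R[rule_format, of "[]" x] that by simp
    moreover have "Ck_on k S (\<lambda>x. frechet_derivative f (at x) v)" for v
      unfolding Suc using R[rule_format, of "_ @ [v]"] by (simp add: iterated_deriv_snoc)
    ultimately show "Ck_on (Suc k) S f" by simp
  qed
qed

lemma smooth_on_iff_Ck: "smooth_on S f \<longleftrightarrow> (\<forall>k. Ck_on k S f)"
  unfolding smooth_on_def Ck_on_iff by (metis lessI)

lemma Ck_on_Suc_imp: "Ck_on (Suc k) S f \<Longrightarrow> Ck_on k S f"
  unfolding Ck_on_iff by (metis less_SucI)

lemma Ck_on_cong_open:
  assumes "open S" "\<And>x. x \<in> S \<Longrightarrow> f x = g x" "Ck_on k S f"
  shows "Ck_on k S g"
  using assms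
proof (induction k arbitrary: f g)
  case (Suc k)
  have fd: "f differentiable (at x)" if "x \<in> S" for x using Suc.prems that by simp
  have gd: "g differentiable (at x)" if "x \<in> S" for x
    using fd[OF that] Suc.prems(1,2) that
    by (meson differentiable_def has_derivative_transform_within_open)
  have "Ck_on k S (\<lambda>x. frechet_derivative g (at x) v)" for v
  proof (rule Suc.IH[OF Suc.prems(1)])
    show "Ck_on k S (\<lambda>x. frechet_derivative f (at x) v)" using Suc.prems(3) by simp
    show "frechet_derivative f (at x) v = frechet_derivative g (at x) v" if "x \<in> S" for x
      using frechet_derivative_transform_within_open[OF fd[OF that] Suc.prems(1) that Suc.prems(2)] by simp
  qed
  then show ?case using gd by simp
qed simp

text \<open>The derivative is unique, so any formula \<open>D\<close> for it may stand in for
  \<open>frechet_derivative\<close>. This is how the concrete differentiation rules feed the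
  inductions below.\<close>

lemma Ck_on_SucI:
  assumes "open S" "\<And>x. x \<in> S \<Longrightarrow> (f has_derivative D x) (at x)" "\<And>v. Ck_on k S (\<lambda>x. D x v)"
  shows "Ck_on (Suc k) S f"
proof -
  have "D x = frechet_derivative f (at x)" if "x \<in> S" for x
    using assms(2)[OF that] by (rule frechet_derivative_at)
  then have "Ck_on k S (\<lambda>x. frechet_derivative f (at x) v)" for v
    using Ck_on_cong_open[OF assms(1) _ assms(3)[of v]] by simp
  then show ?thesis using assms(2) by (auto simp: differentiable_def)
qed

lemma Ck_on_SucD:
  assumes "Ck_on (Suc k) S f" "x \<in> S"
  shows "(f has_derivative frechet_derivative f (at x)) (at x)"
  using assms frechet_derivative_works by auto

lemma Ck_on_const: "open S \<Longrightarrow> Ck_on k S (\<lambda>x. c)"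
  by (induction k arbitrary: c) (auto simp del: Ck_on.simps(2) intro!: Ck_on_SucI derivative_eq_intros)

lemma Ck_on_linear_compose:
  assumes "bounded_linear L" "open S" "Ck_on k S f"
  shows "Ck_on k S (\<lambda>x. L (f x))"
  using assms(3)
proof (induction k arbitrary: f)
  case (Suc k)
  show ?case
    by (rule Ck_on_SucI[OF assms(2), where D="\<lambda>x v. L (frechet_derivative f (at x) v)"])
      (use Suc assms bounded_linear.has_derivative[OF assms(1) Ck_on_SucD[OF Suc.prems]] in auto)
qed simp

lemma Ck_on_bounded_linear:
  assumes "bounded_linear L" "open S"
  shows "Ck_on k S L"
proof (cases k)
  case (Suc m)
  then show ?thesis
    by (auto simp del: Ck_on.simps(2) intro!: Ck_on_SucI[OF assms(2), where D="\<lambda>x. L"] Ck_on_const assms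
        bounded_linear_imp_has_derivative)
qed simp

lemma Ck_on_add:
  assumes "open S" "Ck_on k S f" "Ck_on k S g"
  shows "Ck_on k S (\<lambda>x. f x + g x)"
  using assms(2,3)
proof (induction k arbitrary: f g)
  case (Suc k)
  show ?case
    by (rule Ck_on_SucI[OF assms(1), where D="\<lambda>x v. frechet_derivative f (at x) v + frechet_derivative g (at x) v"])
      (use Suc has_derivative_add[OF Ck_on_SucD[OF Suc.prems(1)] Ck_on_SucD[OF Suc.prems(2)]] in auto)
qed simp

lemma Ck_on_sum:
  assumes "open S" "\<And>i. i \<in> I \<Longrightarrow> Ck_on k S (f i)"
  shows "Ck_on k S (\<lambda>x. \<Sum>i\<in>I. f i x)"
  using assms(2)
  by (induction I rule: infinite_finite_induct) (auto intro: Ck_on_const Ck_on_add assms(1))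

lemma Ck_on_bilinear:
  assumes "bounded_bilinear p" "open S" "Ck_on k S f" "Ck_on k S g"
  shows "Ck_on k S (\<lambda>x. p (f x) (g x))"
  using assms(3,4)
proof (induction k arbitrary: f g)
  case (Suc k)
  interpret bounded_bilinear p by fact
  show ?case
  proof (rule Ck_on_SucI[OF assms(2), where
        D="\<lambda>x v. p (f x) (frechet_derivative g (at x) v) + p (frechet_derivative f (at x) v) (g x)"])
    fix x assume "x \<in> S"
    show "((\<lambda>x. p (f x) (g x)) has_derivative
         (\<lambda>v. p (f x) (frechet_derivative g (at x) v) + p (frechet_derivative f (at x) v) (g x))) (at x)"
      by (rule FDERIV[OF Ck_on_SucD[OF Suc.prems(1) \<open>x \<in> S\<close>] Ck_on_SucD[OF Suc.prems(2) \<open>x \<in> S\<close>]])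
  next
    fix v
    show "Ck_on k S (\<lambda>x. p (f x) (frechet_derivative g (at x) v) + p (frechet_derivative f (at x) v) (g x))"
      using Suc.prems Ck_on_Suc_imp[OF Suc.prems(1)] Ck_on_Suc_imp[OF Suc.prems(2)]
      by (intro Ck_on_add assms(2) Suc.IH) auto
  qed
qed simp

lemma Ck_on_compose:
  fixes g :: "'v::real_normed_vector \<Rightarrow> 'u::euclidean_space" and f :: "'u \<Rightarrow> 'w::real_normed_vector"
  assumes "open S" "open T" "g ` S \<subseteq> T" "Ck_on k S g" "Ck_on k T f"
  shows "Ck_on k S (\<lambda>x. f (g x))"
  using assms(4,5)
proof (induction k arbitrary: f)
  case (Suc k)
  show ?case
  proof (rule Ck_on_SucI[OF assms(1), where
        D="\<lambda>x v. frechet_derivative f (at (g x)) (frechet_derivative g (at x) v)"])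
    fix x assume x: "x \<in> S"
    have "g x \<in> T" using assms(3) x by blast
    then show "((\<lambda>x. f (g x)) has_derivative
       (\<lambda>v. frechet_derivative f (at (g x)) (frechet_derivative g (at x) v))) (at x)"
      by (intro has_derivative_compose[OF Ck_on_SucD[OF Suc.prems(1) x]] Ck_on_SucD[OF Suc.prems(2)])
  next
    fix v
    \<comment> \<open>In the chain rule both the base point \<open>g x\<close> and the vector move
      with \<open>x\<close>. Expanding the vector in \<open>Basis\<close> separates them: a scalar
      factor times the composite of a directional derivative of \<open>f\<close> with
      \<open>g\<close>, to which the induction hypothesis applies.\<close>
    have "Ck_on k S (\<lambda>x. \<Sum>b\<in>Basis. (frechet_derivative g (at x) v \<bullet> b) *\<^sub>R frechet_derivative f (at (g x)) b)"
      using Suc.prems Ck_on_Suc_imp[OF Suc.prems(1)]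
      by (intro Ck_on_sum assms(1) Ck_on_bilinear[OF bounded_bilinear_scaleR]
          Ck_on_linear_compose[OF bounded_linear_inner_left] Suc.IH) auto
    moreover have "(\<Sum>b\<in>Basis. (frechet_derivative g (at x) v \<bullet> b) *\<^sub>R frechet_derivative f (at (g x)) b)
        = frechet_derivative f (at (g x)) (frechet_derivative g (at x) v)" if "x \<in> S" for x
    proof -
      have "g x \<in> T" using assms(3) that by blast
      then have "linear (frechet_derivative f (at (g x)))"
        using Ck_on_SucD[OF Suc.prems(2)] has_derivative_linear by blast
      then show ?thesis
        using linear_sum[of "frechet_derivative f (at (g x))" "\<lambda>b. (frechet_derivative g (at x) v \<bullet> b) *\<^sub>R b" Basis]
        by (simp add: linear_cmul euclidean_representation)
    qed
    ultimately show "Ck_on k S (\<lambda>x. frechet_derivative f (at (g x)) (frechet_derivative g (at x) v))"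
      by (rule Ck_on_cong_open[OF assms(1), rotated])
  qed
qed simp

text \<open>The derivative is a polynomial in \<open>inverse (f x)\<close> and the derivative of
  \<open>f\<close>, so the induction on \<open>k\<close> closes on itself.\<close>

lemma Ck_on_inverse:
  fixes f :: "'v::real_normed_vector \<Rightarrow> real"
  assumes "open S" "\<And>x. x \<in> S \<Longrightarrow> f x \<noteq> 0" "Ck_on k S f"
  shows "Ck_on k S (\<lambda>x. inverse (f x))"
  using assms(3)
proof (induction k)
  case (Suc k)
  show ?case
  proof (rule Ck_on_SucI[OF assms(1), where
        D="\<lambda>x v. - (inverse (f x) * frechet_derivative f (at x) v * inverse (f x))"])
    fix x assume x: "x \<in> S"
    show "((\<lambda>x. inverse (f x)) has_derivative
      (\<lambda>v. - (inverse (f x) * frechet_derivative f (at x) v * inverse (f x)))) (at x)"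
      using Deriv.has_derivative_inverse[OF assms(2)[OF x] Ck_on_SucD[OF Suc.prems x]] by simp
  next
    fix v
    show "Ck_on k S (\<lambda>x. - (inverse (f x) * frechet_derivative f (at x) v * inverse (f x)))"
      using Suc.prems Suc.IH[OF Ck_on_Suc_imp[OF Suc.prems]] assms(1)
      by (intro Ck_on_linear_compose[OF bounded_linear_minus[OF bounded_linear_ident]]
         Ck_on_bilinear[OF bounded_bilinear_mult]) auto
  qed
qed simp

lemma smooth_onI: "(\<And>k. Ck_on k S f) \<Longrightarrow> smooth_on S f"
  and smooth_onD: "smooth_on S f \<Longrightarrow> Ck_on k S f"
  by (simp_all add: smooth_on_iff_Ck)

lemma smooth_on_subset: "smooth_on S f \<Longrightarrow> T \<subseteq> S \<Longrightarrow> smooth_on T f"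
  unfolding smooth_on_def by blast

lemma smooth_on_cong_open:
  "open S \<Longrightarrow> (\<And>x. x \<in> S \<Longrightarrow> f x = g x) \<Longrightarrow> smooth_on S f \<Longrightarrow> smooth_on S g"
  unfolding smooth_on_iff_Ck using Ck_on_cong_open by blast

lemma smooth_on_local:
  "(\<And>x. x \<in> S \<Longrightarrow> \<exists>T. x \<in> T \<and> smooth_on T f) \<Longrightarrow> smooth_on S f"
  unfolding smooth_on_def by blast

lemma smooth_on_has_derivative:
  "smooth_on S f \<Longrightarrow> x \<in> S \<Longrightarrow> (f has_derivative frechet_derivative f (at x)) (at x)"
  unfolding smooth_on_iff_Ck using Ck_on_SucD by blast

lemma smooth_on_deriv: "smooth_on S f \<Longrightarrow> smooth_on S (\<lambda>x. frechet_derivative f (at x) v)"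
  unfolding smooth_on_iff_Ck by (intro allI) (use Ck_on.simps(2)[of _ S f] in auto)

lemma smooth_on_imp_continuous_on: "smooth_on S f \<Longrightarrow> continuous_on S f"
  by (meson continuous_at_imp_continuous_on has_derivative_continuous smooth_on_has_derivative)

lemma smooth_on_const: "open S \<Longrightarrow> smooth_on S (\<lambda>x. c)"
  unfolding smooth_on_iff_Ck using Ck_on_const by blast

lemma smooth_on_bounded_linear: "bounded_linear L \<Longrightarrow> open S \<Longrightarrow> smooth_on S L"
  unfolding smooth_on_iff_Ck using Ck_on_bounded_linear by blast

lemma smooth_on_linear_compose:
  "bounded_linear L \<Longrightarrow> open S \<Longrightarrow> smooth_on S f \<Longrightarrow> smooth_on S (\<lambda>x. L (f x))"
  by (rule smooth_onI, rule Ck_on_linear_compose) (auto intro: smooth_onD)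

lemma smooth_on_add:
  "open S \<Longrightarrow> smooth_on S f \<Longrightarrow> smooth_on S g \<Longrightarrow> smooth_on S (\<lambda>x. f x + g x)"
  by (rule smooth_onI, rule Ck_on_add) (auto intro: smooth_onD)

lemma smooth_on_diff:
  assumes "open S" "smooth_on S f" "smooth_on S g"
  shows "smooth_on S (\<lambda>x. f x - g x)"
  using smooth_on_add[OF assms(1,2) smooth_on_linear_compose[OF bounded_linear_minus[OF bounded_linear_ident] assms(1,3)]]
  by simp

lemma smooth_on_sum:
  "open S \<Longrightarrow> (\<And>i. i \<in> I \<Longrightarrow> smooth_on S (f i)) \<Longrightarrow> smooth_on S (\<lambda>x. \<Sum>i\<in>I. f i x)"
  by (rule smooth_onI, rule Ck_on_sum) (auto intro: smooth_onD)

lemma smooth_on_bilinear: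
  "bounded_bilinear p \<Longrightarrow> open S \<Longrightarrow> smooth_on S f \<Longrightarrow> smooth_on S g \<Longrightarrow> smooth_on S (\<lambda>x. p (f x) (g x))"
  by (rule smooth_onI, rule Ck_on_bilinear) (auto intro: smooth_onD)

lemma smooth_on_compose:
  fixes g :: "'v::real_normed_vector \<Rightarrow> 'u::euclidean_space"
  shows "open S \<Longrightarrow> open T \<Longrightarrow> g ` S \<subseteq> T \<Longrightarrow> smooth_on S g \<Longrightarrow> smooth_on T f \<Longrightarrow> smooth_on S (\<lambda>x. f (g x))"
  by (rule smooth_onI, rule Ck_on_compose[of S T g]) (auto intro: smooth_onD)

lemma smooth_on_inverse:
  fixes f :: "'v::real_normed_vector \<Rightarrow> real"
  shows "open S \<Longrightarrow> (\<And>x. x \<in> S \<Longrightarrow> f x \<noteq> 0) \<Longrightarrow> smooth_on S f \<Longrightarrow> smooth_on S (\<lambda>x. inverse (f x))"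
  by (rule smooth_onI, rule Ck_on_inverse) (auto intro: smooth_onD)

subsection \<open>A bump function\<close>

text \<open>The flat function exp(-1/t) together with the powers of 1/t that differentiation
  produces. The family is closed under derivatives up to linear combinations, so all members are
  smooth at once; bumps use the exponent 0.\<close>

definition exp_cutoff :: "nat \<Rightarrow> real \<Rightarrow> real" where
  "exp_cutoff k t = (if t > 0 then inverse t ^ k * exp (- inverse t) else 0)"

lemma exp_cutoff_has_derivative:
  "(exp_cutoff k has_real_derivative exp_cutoff (k + 2) t - real k * exp_cutoff (k + 1) t) (at t)"
proof -
  consider "t > 0" | "t < 0" | "t = 0" by linarith
  then show ?thesis
  proof cases
    case 1
    have "((\<lambda>t. inverse t ^ k * exp (- inverse t)) has_real_derivative
        real k * (- (inverse t * inverse t) * inverse t ^ (k - 1)) * exp (- inverse t)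
          + inverse t ^ k * (exp (- inverse t) * (inverse t * inverse t))) (at t)"
      using 1 by (auto intro!: derivative_eq_intros simp: power2_eq_square)
    moreover have "real k * (- (inverse t * inverse t) * inverse t ^ (k - 1)) * exp (- inverse t)
          + inverse t ^ k * (exp (- inverse t) * (inverse t * inverse t))
        = exp_cutoff (k + 2) t - real k * exp_cutoff (k + 1) t"
      using 1 by (cases k) (auto simp: exp_cutoff_def algebra_simps)
    ultimately have "((\<lambda>t. inverse t ^ k * exp (- inverse t)) has_real_derivative
        exp_cutoff (k + 2) t - real k * exp_cutoff (k + 1) t) (at t)"
      by simp
    then show ?thesis
      by (rule has_field_derivative_transform_within_open[OF _ open_greaterThan[of 0]])
        (use 1 in \<open>auto simp: exp_cutoff_def\<close>)
  next
    case 2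
    have "((\<lambda>t. 0) has_real_derivative exp_cutoff (k + 2) t - real k * exp_cutoff (k + 1) t) (at t)"
      using 2 by (auto simp: exp_cutoff_def)
    then show ?thesis
      by (rule has_field_derivative_transform_within_open[OF _ open_lessThan[of 0]])
        (use 2 in \<open>auto simp: exp_cutoff_def\<close>)
  next
    case 3
    \<comment> \<open>The difference quotient at 0 costs one more power of 1/h, and the exponential
      beats every power.\<close>
    have "((\<lambda>h. inverse h ^ Suc k / exp (inverse h)) \<longlongrightarrow> 0) (at_right (0::real))"
      by (rule filterlim_compose[OF tendsto_power_div_exp_0 filterlim_inverse_at_top_right])
    then have "((\<lambda>h. inverse h ^ k * exp (- inverse h) / h) \<longlongrightarrow> 0) (at_right (0::real))"
      by (simp add: exp_minus field_simps)
    then have R: "((\<lambda>h. exp_cutoff k h / h) \<longlongrightarrow> 0) (at_right 0)"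
      by (rule Lim_transform_eventually)
        (auto simp: exp_cutoff_def eventually_at_filter)
    have L: "((\<lambda>h. exp_cutoff k h / h) \<longlongrightarrow> 0) (at_left 0)"
      by (rule Lim_transform_eventually[OF tendsto_const])
        (auto simp: exp_cutoff_def eventually_at_filter)
    have "((\<lambda>h. exp_cutoff k h / h) \<longlongrightarrow> 0) (at 0)"
      using L R filterlim_split_at by blast
    then show ?thesis
      using 3 by (simp add: DERIV_def exp_cutoff_def)
  qed
qed

lemma smooth_on_exp_cutoff: "smooth_on UNIV (exp_cutoff n)"
proof -
  have "Ck_on k UNIV (exp_cutoff n)" for k
  proof (induction k arbitrary: n)
    case (Suc k)
    show ?case
    proof (rule Ck_on_SucI[OF open_UNIV, where D="\<lambda>t v. v * (exp_cutoff (n + 2) t + (- real n) * exp_cutoff (n + 1) t)"])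
      show "(exp_cutoff n has_derivative (\<lambda>v. v * (exp_cutoff (n + 2) x + (- real n) * exp_cutoff (n + 1) x))) (at x)" for x
        using exp_cutoff_has_derivative[of n x] unfolding has_field_derivative_def
        by (simp add: mult_commute_abs)
      show "Ck_on k UNIV (\<lambda>t. v * (exp_cutoff (n + 2) t + (- real n) * exp_cutoff (n + 1) t))" for v
        by (intro Ck_on_bilinear[OF bounded_bilinear_mult] Ck_on_add Ck_on_const open_UNIV Suc)
    qed
  qed simp
  then show ?thesis unfolding smooth_on_iff_Ck by blast
qed

text \<open>The squared distance, written as an inner product, is smooth also at the centre
  \<open>a\<close>, where the norm is not.\<close>

definition bump :: "'v::real_inner \<Rightarrow> real \<Rightarrow> 'v \<Rightarrow> real" where
  "bump a r x = exp_cutoff 0 (r\<^sup>2 - (x - a) \<bullet> (x - a))"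

lemma smooth_on_bump:
  assumes "open S"
  shows "smooth_on S (bump a r)"
proof -
  have id: "smooth_on S (\<lambda>x. x)" by (rule smooth_on_bounded_linear[OF bounded_linear_ident assms])
  have "smooth_on S (\<lambda>x. r\<^sup>2 - (x - a) \<bullet> (x - a))"
    by (intro smooth_on_diff smooth_on_bilinear[OF bounded_bilinear_inner] smooth_on_const id assms)
  then show ?thesis
    unfolding bump_def
    using smooth_on_compose[OF assms open_UNIV _ _ smooth_on_exp_cutoff, of "\<lambda>x. r\<^sup>2 - (x - a) \<bullet> (x - a)"]
    by simp
qed

lemma bump_nonneg: "0 \<le> bump a r x"
  by (simp add: bump_def exp_cutoff_def)

lemma bump_pos_iff: "0 < r \<Longrightarrow> 0 < bump a r x \<longleftrightarrow> dist a x < r"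
proof -
  assume "0 < r"
  have "(x - a) \<bullet> (x - a) = (dist a x)\<^sup>2" by (simp add: dist_norm norm_minus_commute[of a] flip: power2_norm_eq_inner)
  moreover have "(dist a x)\<^sup>2 < r\<^sup>2 \<longleftrightarrow> dist a x < r"
    using \<open>0 < r\<close> power2_less_imp_less[of "dist a x" r] power_strict_mono[of "dist a x" r 2] by auto
  ultimately show ?thesis by (auto simp: bump_def exp_cutoff_def)
qed

lemma bump_zero: "0 < r \<Longrightarrow> r \<le> dist a x \<Longrightarrow> bump a r x = 0"
  using bump_pos_iff[of r a x] bump_nonneg[of a r x] by linarith

section \<open>Holomorphic maps in several variables\<close>

lemma norm_smult_complex: "norm (c *s v) = cmod c * norm (v :: complex^'m)"
  by (simp add: norm_vec_def L2_set_def norm_mult power_mult_distrib sum_nonneg real_sqrt_mult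
      flip: sum_distrib_left)

lemma scaleR_eq_smult: "r *\<^sub>R v = complex_of_real r *s (v :: complex^'m)"
  by (simp add: vec_eq_iff scaleR_conv_of_real[where 'a=complex])

lemma bounded_bilinear_smult: "bounded_bilinear (\<lambda>c v. c *s (v :: complex^'m))"
  by (rule bounded_bilinear.intro)
    (auto simp: vec_eq_iff algebra_simps norm_smult_complex intro!: exI[of _ 1])

lemmas bounded_linear_smult = bounded_bilinear.bounded_linear_right[OF bounded_bilinear_smult]

lemma add_mem_ball:
  fixes x :: "'v::real_normed_vector"
  assumes "x \<in> ball z a" "norm d \<le> b" "a + b \<le> c"
  shows "d + x \<in> ball z c"
proof -
  have "norm (z - (d + x)) \<le> norm (z - x) + norm d"
    using norm_triangle_ineq4[of "z - x" d] by (simp add: algebra_simps)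
  then show ?thesis using assms by (simp add: dist_norm)
qed

lemma complex_differentiable_onD:
  assumes "complex_differentiable_on S f" "x \<in> S"
  shows "(f has_derivative frechet_derivative f (at x)) (at x)"
    and "frechet_derivative f (at x) (c *s v) = c *s frechet_derivative f (at x) v"
proof -
  obtain D where D: "(f has_derivative D) (at x)" "\<forall>c v. D (c *s v) = c *s D v"
    using assms unfolding complex_differentiable_on_def by blast
  then have "D = frechet_derivative f (at x)" by (simp add: frechet_derivative_at)
  then show "(f has_derivative frechet_derivative f (at x)) (at x)"
    "frechet_derivative f (at x) (c *s v) = c *s frechet_derivative f (at x) v" using D by auto
qed

lemma complex_differentiable_onI:
  assumes "\<And>x. x \<in> S \<Longrightarrow> (f has_derivative D x) (at x)" "\<And>x c v. x \<in> S \<Longrightarrow> D x (c *s v) = c *s D x v"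
  shows "complex_differentiable_on S f"
  using assms unfolding complex_differentiable_on_def by blast

lemma complex_differentiable_on_subset:
  "complex_differentiable_on S f \<Longrightarrow> T \<subseteq> S \<Longrightarrow> complex_differentiable_on T f"
  unfolding complex_differentiable_on_def by blast

lemma complex_differentiable_on_cong_open:
  assumes "open S" "\<And>x. x \<in> S \<Longrightarrow> f x = g x" "complex_differentiable_on S f"
  shows "complex_differentiable_on S g"
proof (rule complex_differentiable_onI)
  fix x assume x: "x \<in> S"
  show "(g has_derivative frechet_derivative f (at x)) (at x)"
    using has_derivative_transform_within_open[OF complex_differentiable_onD(1)[OF assms(3) x] assms(1) x]
      assms(2) by blast
qed (rule complex_differentiable_onD(2)[OF assms(3)])

lemma complex_differentiable_on_imp_continuous_on:
  "complex_differentiable_on S f \<Longrightarrow> continuous_on S f"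
  by (meson continuous_at_imp_continuous_on has_derivative_continuous complex_differentiable_onD(1))

lemma complex_differentiable_on_compose:
  assumes "complex_differentiable_on S f" "complex_differentiable_on T g" "f ` S \<subseteq> T"
  shows "complex_differentiable_on S (\<lambda>x. g (f x))"
proof (rule complex_differentiable_onI)
  fix x assume x: "x \<in> S"
  then have fx: "f x \<in> T" using assms(3) by blast
  show "((\<lambda>x. g (f x)) has_derivative (\<lambda>v. frechet_derivative g (at (f x)) (frechet_derivative f (at x) v))) (at x)"
    by (rule has_derivative_compose[OF complex_differentiable_onD(1)[OF assms(1) x]
          complex_differentiable_onD(1)[OF assms(2) fx]])
  show "frechet_derivative g (at (f x)) (frechet_derivative f (at x) (c *s v)) =
    c *s frechet_derivative g (at (f x)) (frechet_derivative f (at x) v)" for c v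
    by (simp add: complex_differentiable_onD(2)[OF assms(1) x] complex_differentiable_onD(2)[OF assms(2) fx])
qed

lemma complex_differentiable_on_slice:
  assumes "complex_differentiable_on S f" "z + t *s v \<in> S"
  shows "((\<lambda>t. f (z + t *s v) $ i) has_field_derivative frechet_derivative f (at (z + t *s v)) v $ i) (at t)"
proof -
  have "((\<lambda>t. z + t *s v) has_derivative (\<lambda>h. h *s v)) (at t)"
    using bounded_linear_imp_has_derivative[OF bounded_bilinear.bounded_linear_left[OF bounded_bilinear_smult, of v]]
    by (auto intro!: derivative_eq_intros)
  from has_derivative_compose[OF this complex_differentiable_onD(1)[OF assms]]
  have "((\<lambda>t. f (z + t *s v)) has_derivative (\<lambda>h. h *s frechet_derivative f (at (z + t *s v)) v)) (at t)"
    by (simp add: complex_differentiable_onD(2)[OF assms])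
  from bounded_linear.has_derivative[OF bounded_linear_vec_nth[of i] this]
  show ?thesis by (simp add: has_field_derivative_def mult_commute_abs)
qed

section \<open>Cauchy estimates in several variables\<close>

lemma norm_vec_le_card:
  fixes x :: "complex^'k::finite" and M :: real
  assumes "\<And>i. cmod (x $ i) \<le> M"
  shows "norm x \<le> real CARD('k) * M"
proof -
  have "norm x \<le> (\<Sum>i\<in>UNIV. norm (x $ i))"
    unfolding norm_vec_def by (rule L2_set_le_sum) simp
  also have "\<dots> \<le> (\<Sum>i\<in>(UNIV::'k set). M)" by (rule sum_mono) (rule assms)
  finally show ?thesis by simp
qed

text \<open>Cauchy's inequality in one variable, applied to each component of \<open>f\<close> along
  the complex line through \<open>z\<close> in direction \<open>v\<close>. The factor
  \<open>CARD('k)\<close> is the price for passing from components to the norm.\<close>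

lemma Cauchy_estimate:
  fixes f :: "complex^'m::finite \<Rightarrow> complex^'k::finite" and M r :: real
  assumes f: "complex_differentiable_on (ball z r) f" and "0 < r"
    and M: "\<And>w. w \<in> ball z r \<Longrightarrow> norm (f w) \<le> M"
  shows "norm (frechet_derivative f (at z) v) \<le> 2 * real CARD('k) * M / r * norm v"
proof (cases "v = 0")
  case True
  have "bounded_linear (frechet_derivative f (at z))"
    using complex_differentiable_onD(1)[OF f, of z] \<open>0 < r\<close> has_derivative_bounded_linear by auto
  then show ?thesis using True by (simp add: linear_simps)
next
  case False
  \<comment> \<open>Half of the critical radius, so that the closed disc stays inside the open ball;
    this is the factor 2 of the estimate.\<close>
  define s where "s = r / (2 * norm v)"
  have s: "s > 0" "s * norm v < r" using False \<open>0 < r\<close> by (auto simp: s_def)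
  have inb: "z + t *s v \<in> ball z r" if "cmod t \<le> s" for t
  proof -
    have "cmod t * norm v \<le> s * norm v" using that by (simp add: mult_right_mono)
    then show ?thesis using s(2) by (simp add: dist_norm norm_smult_complex)
  qed
  have "cmod (frechet_derivative f (at z) v $ i) \<le> M / s" for i
  proof -
    let ?g = "\<lambda>t. f (z + t *s v) $ i"
    have D: "(?g has_field_derivative frechet_derivative f (at (z + t *s v)) v $ i) (at t)" if "cmod t \<le> s" for t
      by (rule complex_differentiable_on_slice[OF f inb[OF that]])
    have "?g holomorphic_on ball 0 s"
      by (rule holomorphic_onI) (use D in \<open>auto simp: field_differentiable_def dest: has_field_derivative_at_within intro: less_imp_le\<close>)
    moreover have "continuous_on (cball 0 s) ?g"
      by (rule continuous_at_imp_continuous_on) (use DERIV_isCont[OF D] in auto)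
    moreover have "cmod (?g x) \<le> M" if "cmod (0 - x) = s" for x
      using order_trans[OF Finite_Cartesian_Product.norm_nth_le[of "f (z + x *s v)" i] M[OF inb[of x]]] that by simp
    ultimately have "cmod ((deriv ^^ 1) ?g 0) \<le> fact 1 * M / s ^ 1"
      using s(1) by (intro Cauchy_inequality) auto
    moreover have "deriv ?g 0 = frechet_derivative f (at z) v $ i"
      using DERIV_imp_deriv[OF D[of 0]] s(1) by simp
    ultimately show ?thesis by simp
  qed
  then have "norm (frechet_derivative f (at z) v) \<le> real CARD('k) * (M / s)"
    by (rule norm_vec_le_card)
  also have "\<dots> = 2 * real CARD('k) * M / r * norm v"
    by (simp add: s_def)
  finally show ?thesis .
qed

lemma complex_differentiable_on_shift_diff:
  assumes f: "complex_differentiable_on ((+) \<delta> ` S) f" and g: "complex_differentiable_on S g"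
  shows "complex_differentiable_on S (\<lambda>\<zeta>. f (\<delta> + \<zeta>) - g \<zeta>)"
    and "x \<in> S \<Longrightarrow> frechet_derivative (\<lambda>\<zeta>. f (\<delta> + \<zeta>) - g \<zeta>) (at x) v
       = frechet_derivative f (at (\<delta> + x)) v - frechet_derivative g (at x) v"
proof -
  have D: "((\<lambda>\<zeta>. f (\<delta> + \<zeta>) - g \<zeta>) has_derivative
      (\<lambda>v. frechet_derivative f (at (\<delta> + x)) v - frechet_derivative g (at x) v)) (at x)" if "x \<in> S" for x
  proof (rule has_derivative_diff[OF has_derivative_compose[of _ "\<lambda>v. v"]])
    show "((+) \<delta> has_derivative (\<lambda>v. v)) (at x)" by (auto intro!: derivative_eq_intros)
    show "(f has_derivative frechet_derivative f (at (\<delta> + x))) (at (\<delta> + x))"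
      by (rule complex_differentiable_onD(1)[OF f]) (use that in auto)
  qed (rule complex_differentiable_onD(1)[OF g that])
  show "complex_differentiable_on S (\<lambda>\<zeta>. f (\<delta> + \<zeta>) - g \<zeta>)"
  proof (rule complex_differentiable_onI[OF D])
    fix x c v assume x: "x \<in> S"
    then have "\<delta> + x \<in> (+) \<delta> ` S" by auto
    then show "frechet_derivative f (at (\<delta> + x)) (c *s v) - frechet_derivative g (at x) (c *s v)
      = c *s (frechet_derivative f (at (\<delta> + x)) v - frechet_derivative g (at x) v)"
      using complex_differentiable_onD(2)[OF f] complex_differentiable_onD(2)[OF g x]
      by (simp add: bounded_bilinear.diff_right[OF bounded_bilinear_smult])
  qed
  show "frechet_derivative (\<lambda>\<zeta>. f (\<delta> + \<zeta>) - g \<zeta>) (at x) v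
       = frechet_derivative f (at (\<delta> + x)) v - frechet_derivative g (at x) v" if "x \<in> S"
    using fun_cong[OF frechet_derivative_at[OF D[OF that]], of v] by simp
qed

text \<open>Translating one map onto the other turns a comparison of derivatives at two different
  points into Cauchy's estimate for a single difference. With \<open>f = g\<close> it makes
  derivatives Lipschitz; with two plaques \<open>h a\<close> and \<open>h b\<close> it controls how
  tangent spaces depend on the parameter.\<close>

lemma Cauchy_estimate_diff:
  fixes f g :: "complex^'m::finite \<Rightarrow> complex^'k::finite" and M r :: real
  assumes f: "complex_differentiable_on (ball x r) f" and g: "complex_differentiable_on (ball y r) g"
    and "0 < r" and M: "\<And>\<zeta>. \<zeta> \<in> ball y r \<Longrightarrow> norm (f (x - y + \<zeta>) - g \<zeta>) \<le> M"
  shows "norm (frechet_derivative f (at x) v - frechet_derivative g (at y) v) \<le> 2 * real CARD('k) * M / r * norm v"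
proof -
  have im: "(+) (x - y) ` ball y r = ball x r"
    by (simp add: ball_translation[symmetric])
  have y: "y \<in> ball y r" using \<open>0 < r\<close> by simp
  show ?thesis
    using Cauchy_estimate[OF complex_differentiable_on_shift_diff(1)[of "x - y" "ball y r" f g, unfolded im, OF f g] \<open>0 < r\<close> M, of v]
      complex_differentiable_on_shift_diff(2)[of "x - y" "ball y r" f g y v, unfolded im, OF f g y]
    by simp
qed

text \<open>The doubled radius gives every point of the smaller ball a ball of radius
  \<open>r\<close> of its own for Cauchy's estimate.\<close>

lemma holomorphic_Lipschitz:
  fixes f :: "complex^'m::finite \<Rightarrow> complex^'k::finite" and M r :: real
  assumes f: "complex_differentiable_on (ball z (2 * r)) f" and "0 < r"
    and M: "\<And>w. w \<in> ball z (2 * r) \<Longrightarrow> norm (f w) \<le> M"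
  shows "x \<in> ball z r \<Longrightarrow> norm (frechet_derivative f (at x) v) \<le> 2 * real CARD('k) * M / r * norm v"
    and "x \<in> ball z r \<Longrightarrow> y \<in> ball z r \<Longrightarrow> norm (f x - f y) \<le> 2 * real CARD('k) * M / r * norm (x - y)"
proof -
  have D: "norm (frechet_derivative f (at x) v) \<le> 2 * real CARD('k) * M / r * norm v" if "x \<in> ball z r" for x v
  proof -
    have "ball x r \<subseteq> ball z (2 * r)"
      using that by (simp add: ball_subset_ball_iff dist_commute)
    then show ?thesis
      using M by (intro Cauchy_estimate complex_differentiable_on_subset[OF f] \<open>0 < r\<close>) auto
  qed
  then show "x \<in> ball z r \<Longrightarrow> norm (frechet_derivative f (at x) v) \<le> 2 * real CARD('k) * M / r * norm v" .
  show "norm (f x - f y) \<le> 2 * real CARD('k) * M / r * norm (x - y)" if "x \<in> ball z r" "y \<in> ball z r"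
  proof (rule differentiable_bound[OF convex_ball _ _ that])
    fix w assume w: "w \<in> ball z r"
    then have "w \<in> ball z (2 * r)" using \<open>0 < r\<close> by auto
    then show "(f has_derivative frechet_derivative f (at w)) (at w within ball z r)"
      using complex_differentiable_onD(1)[OF f] has_derivative_at_withinI by blast
    show "onorm (frechet_derivative f (at w)) \<le> 2 * real CARD('k) * M / r"
      by (rule onorm_le) (rule D[OF w])
  qed
qed

text \<open>\<open>f\<close> is compared with its own translate by \<open>x - y\<close>: the
  difference is small by the Lipschitz bound, hence so is its derivative by Cauchy. The translated
  points stay in the ball of radius \<open>4 * r\<close>, and the Lipschitz bound there asks for
  radius \<open>8 * r\<close>; the constant is the product of the two estimates.\<close>

lemma holomorphic_deriv_Lipschitz:
  fixes f :: "complex^'m::finite \<Rightarrow> complex^'k::finite" and M r :: real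
  assumes f: "complex_differentiable_on (ball z (8 * r)) f" and "0 < r"
    and M: "\<And>w. w \<in> ball z (8 * r) \<Longrightarrow> norm (f w) \<le> M"
    and x: "x \<in> ball z r" and y: "y \<in> ball z r"
  shows "norm (frechet_derivative f (at x) v - frechet_derivative f (at y) v)
    \<le> (real CARD('k))\<^sup>2 * M / r\<^sup>2 * norm (x - y) * norm v"
proof -
  have sub: "ball x r \<subseteq> ball z (8 * r)" "ball y r \<subseteq> ball z (8 * r)"
    using x y \<open>0 < r\<close> by (auto simp: ball_subset_ball_iff dist_commute)
  have "norm (frechet_derivative f (at x) v - frechet_derivative f (at y) v)
    \<le> 2 * real CARD('k) * (2 * real CARD('k) * M / (4 * r) * norm (x - y)) / r * norm v"
  proof (rule Cauchy_estimate_diff)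
    fix \<zeta> assume \<zeta>: "\<zeta> \<in> ball y r"
    have "x - y + \<zeta> \<in> ball z (4 * r)" "\<zeta> \<in> ball z (4 * r)"
    proof -
      have "dist z \<zeta> < 2 * r" using y \<zeta> dist_triangle[of z \<zeta> y] by auto
      moreover have "norm (x - y) < 2 * r" using x y dist_triangle2[of x y z] by (simp add: dist_norm dist_commute norm_minus_commute)
      ultimately show "x - y + \<zeta> \<in> ball z (4 * r)" "\<zeta> \<in> ball z (4 * r)"
        using add_mem_ball[of \<zeta> z "2 * r" "x - y" "2 * r" "4 * r"] \<open>0 < r\<close> by auto
    qed
    from holomorphic_Lipschitz(2)[of z "4 * r" f M, OF _ _ _ this]
    show "norm (f (x - y + \<zeta>) - f \<zeta>) \<le> 2 * real CARD('k) * M / (4 * r) * norm (x - y)"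
      using f \<open>0 < r\<close> M by simp
  qed (use f complex_differentiable_on_subset sub \<open>0 < r\<close> in blast)+
  also have "\<dots> = (real CARD('k))\<^sup>2 * M / r\<^sup>2 * norm (x - y) * norm v"
    using \<open>0 < r\<close> by (simp add: power2_eq_square field_simps)
  finally show ?thesis .
qed

section \<open>Holomorphic maps are smooth\<close>

lemma complex_differentiable_on_locally_bounded:
  fixes f :: "complex^'m::finite \<Rightarrow> complex^'k::finite"
  assumes "complex_differentiable_on S f" "open S" "x \<in> S"
  obtains r M :: real where "0 < r" "0 < M" "ball x r \<subseteq> S" "\<And>w. w \<in> ball x r \<Longrightarrow> norm (f w) \<le> M"
proof -
  have "isCont f x" using complex_differentiable_onD(1)[OF assms(1,3)] by (rule has_derivative_continuous)
  then obtain d where d: "d > 0" "\<And>w. dist w x < d \<Longrightarrow> dist (f w) (f x) < 1"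
    unfolding continuous_at_eps_delta by (metis zero_less_one)
  obtain e where e: "e > 0" "ball x e \<subseteq> S" using assms(2,3) openE by blast
  show thesis
  proof (rule that[of "min d e" "1 + norm (f x)"])
    fix w assume "w \<in> ball x (min d e)"
    then have "dist (f w) (f x) < 1" using d(2) by (simp add: dist_commute)
    then show "norm (f w) \<le> 1 + norm (f x)"
      using norm_triangle_ineq2[of "f w" "f x"] by (simp add: dist_norm)
  qed (use d e in \<open>auto simp: add_pos_nonneg\<close>)
qed

text \<open>Difference quotients in direction \<open>v\<close> are holomorphic and converge
  uniformly near each point to the directional derivative. By Cauchy's estimate their derivatives
  converge uniformly as well, so the limit can be differentiated term by term, and complex linearity
  passes to the limit.\<close>

lemma complex_differentiable_on_deriv:
  fixes f :: "complex^'m::finite \<Rightarrow> complex^'k::finite" and M r :: real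
  assumes f: "complex_differentiable_on S f" and "open S"
  shows "complex_differentiable_on S (\<lambda>x. frechet_derivative f (at x) v)"
  unfolding complex_differentiable_on_def
proof
  fix x0 assume x0: "x0 \<in> S"
  obtain R M where R: "0 < R" "0 < M" "ball x0 R \<subseteq> S" "\<And>w. w \<in> ball x0 R \<Longrightarrow> norm (f w) \<le> M"
    using complex_differentiable_on_locally_bounded[OF f \<open>open S\<close> x0] by metis
  define r where "r = R / 8"
  have r: "0 < r" "8 * r = R" using R by (auto simp: r_def)
  define Lc where "Lc = (real CARD('k))\<^sup>2 * M / r\<^sup>2"
  have Lc0: "Lc \<ge> 0" using R by (simp add: Lc_def)
  have fB: "complex_differentiable_on (ball x0 (8 * r)) f"
    using complex_differentiable_on_subset[OF f R(3)] r by simp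
  have Lip: "norm (frechet_derivative f (at x) u - frechet_derivative f (at y) u) \<le> Lc * norm (x - y) * norm u"
    if "x \<in> ball x0 r" "y \<in> ball x0 r" for x y u
    unfolding Lc_def using holomorphic_deriv_Lipschitz[OF fB r(1) _ that] R r by simp
  \<comment> \<open>Steps so short that translation by \<open>h n\<close> times \<open>v\<close>
    moves points by less than \<open>r / 2\<close> and stays where the derivative is Lipschitz. The
    summand 1 covers \<open>v = 0\<close>.\<close>
  define h where "h n = r / (2 * (norm v + 1)) / real (Suc n)" for n
  have h0: "h n > 0" for n using r by (simp add: h_def add_nonneg_pos)
  have hv: "norm (h n *\<^sub>R v) < r / 2" for n
  proof -
    have "h n \<le> r / (2 * (norm v + 1)) / 1"
      unfolding h_def by (rule divide_left_mono) (use r in \<open>auto simp: add_nonneg_pos\<close>)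
    then have "h n * norm v \<le> r / (2 * (norm v + 1)) * norm v"
      by (intro mult_right_mono) auto
    also have "\<dots> < r / 2"
    proof -
      have "norm v + 1 > 0" by (simp add: add_nonneg_pos)
      then show ?thesis using r by (simp add: field_simps)
    qed
    finally show ?thesis using h0[of n] by simp
  qed
  have h_lim: "h \<longlonglongrightarrow> 0"
    using tendsto_mult_left[OF LIMSEQ_inverse_real_of_nat, of "r / (2 * (norm v + 1))"]
    by (simp add: h_def[abs_def] divide_inverse ac_simps del: of_nat_Suc)
  define e where "e n x = complex_of_real (inverse (h n)) *s (f (h n *\<^sub>R v + x) - f x)" for n x
  define De where "De n x u = complex_of_real (inverse (h n)) *s (frechet_derivative f (at (h n *\<^sub>R v + x)) u - frechet_derivative f (at x) u)" for n x u
  have e_der: "(e n has_derivative De n x) (at x)" and De_lin: "De n x (c *s u) = c *s De n x u"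
    if x: "x \<in> ball x0 (r / 2)" for n x c u
  proof -
    have sub: "(+) (h n *\<^sub>R v) ` ball x0 (r / 2) \<subseteq> S" "ball x0 (r / 2) \<subseteq> S"
    proof -
      have "(+) (h n *\<^sub>R v) ` ball x0 (r / 2) \<subseteq> ball x0 R"
      proof safe
        fix w assume "w \<in> ball x0 (r / 2)"
        then show "h n *\<^sub>R v + w \<in> ball x0 R"
          using add_mem_ball[OF _ less_imp_le[OF hv[of n]], of w x0 "r / 2" R] r by simp
      qed
      then show "(+) (h n *\<^sub>R v) ` ball x0 (r / 2) \<subseteq> S" using R(3) by blast
      show "ball x0 (r / 2) \<subseteq> S" using order_trans[OF subset_ball[of "r / 2" R x0] R(3)] r by simp
    qed
    note sd = complex_differentiable_on_shift_diff[OF complex_differentiable_on_subset[OF f sub(1)]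
        complex_differentiable_on_subset[OF f sub(2)]]
    have *: "frechet_derivative (\<lambda>\<zeta>. f (h n *\<^sub>R v + \<zeta>) - f \<zeta>) (at x) =
       (\<lambda>u. frechet_derivative f (at (h n *\<^sub>R v + x)) u - frechet_derivative f (at x) u)"
      using sd(2)[OF x] by blast
    show "(e n has_derivative De n x) (at x)"
      using bounded_linear.has_derivative[OF bounded_linear_smult complex_differentiable_onD(1)[OF sd(1) x]]
      unfolding e_def[abs_def] De_def[abs_def] * .
    show "De n x (c *s u) = c *s De n x u"
      using complex_differentiable_onD(2)[OF sd(1) x, of c u] unfolding *
      by (simp only: De_def vector_smult_assoc mult.commute)
  qed
  \<comment> \<open>The derivative is Lipschitz along the segment, so the linearization error is
    quadratic in the step; division by \<open>h n\<close> leaves one factor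
    \<open>h n\<close>.\<close>
  have e_approx: "norm (e n x - frechet_derivative f (at x) v) \<le> Lc * (norm v)\<^sup>2 * h n"
    if x: "x \<in> ball x0 (r / 2)" for n x
  proof -
    have seg: "x + t *\<^sub>R (h n *\<^sub>R v + x - x) \<in> ball x r \<inter> ball x0 r" "norm (t *\<^sub>R (h n *\<^sub>R v + x - x)) \<le> norm (h n *\<^sub>R v)"
      if "t \<in> {0..1}" for t
    proof -
      have "norm (t *\<^sub>R h n *\<^sub>R v) \<le> 1 * norm (h n *\<^sub>R v)"
        unfolding norm_scaleR[of t] using that by (intro mult_right_mono) auto
      then show "norm (t *\<^sub>R (h n *\<^sub>R v + x - x)) \<le> norm (h n *\<^sub>R v)" by simp
      then show "x + t *\<^sub>R (h n *\<^sub>R v + x - x) \<in> ball x r \<inter> ball x0 r"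
        using add_mem_ball[of x x0 "r / 2" "t *\<^sub>R (h n *\<^sub>R v + x - x)" "r / 2" r]
          add_mem_ball[of x x "r / 2" "t *\<^sub>R (h n *\<^sub>R v + x - x)" "r / 2" r] x hv[of n] r(1)
        by (simp only: Int_iff add.commute[of x]) simp
    qed
    have "norm (f (h n *\<^sub>R v + x) - f x - frechet_derivative f (at x) (h n *\<^sub>R v + x - x))
      \<le> norm (h n *\<^sub>R v + x - x) * (Lc * norm (h n *\<^sub>R v))"
    proof (rule differentiable_bound_linearization[where S="(\<lambda>t. x + t *\<^sub>R (h n *\<^sub>R v + x - x)) ` {0..1}" and f'="\<lambda>x. frechet_derivative f (at x)"])
      fix w assume "w \<in> (\<lambda>t. x + t *\<^sub>R (h n *\<^sub>R v + x - x)) ` {0..1}"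
      then obtain t where t: "t \<in> {0..1}" "w = x + t *\<^sub>R (h n *\<^sub>R v + x - x)" by blast
      have w: "w \<in> ball x0 r" using seg(1)[OF t(1)] t(2) by blast
      have wx: "norm (w - x) \<le> norm (h n *\<^sub>R v)" using seg(2)[OF t(1)] t(2) by simp
      have "w \<in> S" using w R(3) r by auto
      then show "(f has_derivative frechet_derivative f (at w)) (at w within (\<lambda>t. x + t *\<^sub>R (h n *\<^sub>R v + x - x)) ` {0..1})"
        using complex_differentiable_onD(1)[OF f] has_derivative_at_withinI by blast
      have x': "x \<in> ball x0 r" using x r by auto
      show "onorm (frechet_derivative f (at w) - frechet_derivative f (at x)) \<le> Lc * norm (h n *\<^sub>R v)"
      proof (rule onorm_le)
        fix u
        have "norm (frechet_derivative f (at w) u - frechet_derivative f (at x) u) \<le> Lc * norm (w - x) * norm u"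
          by (rule Lip[OF w x'])
        also have "\<dots> \<le> Lc * norm (h n *\<^sub>R v) * norm u"
          using wx Lc0 by (intro mult_right_mono mult_left_mono) auto
        finally show "norm ((frechet_derivative f (at w) - frechet_derivative f (at x)) u) \<le> Lc * norm (h n *\<^sub>R v) * norm u"
          by simp
      qed
    next
      show "x \<in> (\<lambda>t. x + t *\<^sub>R (h n *\<^sub>R v + x - x)) ` {0..1}"
        by (rule image_eqI[of _ _ 0]) auto
    qed blast
    then have 1: "norm (f (h n *\<^sub>R v + x) - f x - frechet_derivative f (at x) (h n *\<^sub>R v)) \<le> Lc * (norm v)\<^sup>2 * (h n)\<^sup>2"
      by (simp add: power2_eq_square algebra_simps)
    have xS: "x \<in> S" using x R(3) r by auto
    have "e n x - frechet_derivative f (at x) v = complex_of_real (inverse (h n)) *s (f (h n *\<^sub>R v + x) - f x - frechet_derivative f (at x) (h n *\<^sub>R v))"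
      using h0[of n] unfolding scaleR_eq_smult complex_differentiable_onD(2)[OF f xS]
      by (simp add: e_def vec_eq_iff scaleR_eq_smult field_simps)
    then have "norm (e n x - frechet_derivative f (at x) v) = inverse (h n) * norm (f (h n *\<^sub>R v + x) - f x - frechet_derivative f (at x) (h n *\<^sub>R v))"
      using h0[of n] by (simp only: norm_smult_complex norm_of_real) simp
    also have "\<dots> \<le> inverse (h n) * (Lc * (norm v)\<^sup>2 * (h n)\<^sup>2)"
      using 1 h0[of n] by (intro mult_left_mono) auto
    also have "\<dots> = Lc * (norm v)\<^sup>2 * h n" using h0[of n] by (simp add: power2_eq_square)
    finally show ?thesis .
  qed
  \<comment> \<open>Cauchy's estimate on balls of radius \<open>r / 4\<close> converts the uniform
    rate for the quotients \<open>e\<close> into one for their derivatives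
    \<open>De\<close>.\<close>
  define C where "C = 2 * real CARD('k) / (r / 4) * (Lc * (norm v)\<^sup>2)"
  have C0: "C \<ge> 0" using Lc0 r by (simp add: C_def)
  have De_Cauchy: "norm (De n x u - De m x u) \<le> C * (h n + h m) * norm u"
    if x: "x \<in> ball x0 (r / 4)" for x u n m
  proof -
    have sub: "ball x (r / 4) \<subseteq> ball x0 (r / 2)" using x by (simp add: ball_subset_ball_iff dist_commute)
    have cd: "complex_differentiable_on (ball x (r / 4)) (e n)" for n
      by (rule complex_differentiable_onI[of _ _ "De n"]) (use sub e_der De_lin in blast)+
    have xx: "x \<in> ball x0 (r / 2)" using x r by auto
    have "norm (frechet_derivative (e n) (at x) u - frechet_derivative (e m) (at x) u)
      \<le> 2 * real CARD('k) * (Lc * (norm v)\<^sup>2 * h n + Lc * (norm v)\<^sup>2 * h m) / (r / 4) * norm u"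
    proof (rule Cauchy_estimate_diff[OF cd cd])
      fix \<zeta> assume "\<zeta> \<in> ball x (r / 4)"
      then have "\<zeta> \<in> ball x0 (r / 2)" using sub by blast
      from e_approx[OF this, of n] e_approx[OF this, of m]
      show "norm (e n (x - x + \<zeta>) - e m \<zeta>) \<le> Lc * (norm v)\<^sup>2 * h n + Lc * (norm v)\<^sup>2 * h m"
        using norm_triangle_ineq4[of "e n \<zeta> - frechet_derivative f (at \<zeta>) v" "e m \<zeta> - frechet_derivative f (at \<zeta>) v"] by simp
    qed (use r in auto)
    moreover have "frechet_derivative (e n) (at x) = De n x" for n
      using frechet_derivative_at[OF e_der[OF xx]] by simp
    ultimately have "norm (De n x u - De m x u)
      \<le> 2 * real CARD('k) * (Lc * (norm v)\<^sup>2 * h n + Lc * (norm v)\<^sup>2 * h m) / (r / 4) * norm u"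
      by simp
    then show ?thesis by (simp add: C_def algebra_simps)
  qed
  have De_conv: "\<exists>l. (\<lambda>n. De n x u) \<longlonglongrightarrow> l" if x: "x \<in> ball x0 (r / 4)" for x u
  proof -
    have "Cauchy (\<lambda>n. De n x u)"
    proof (rule metric_CauchyI)
      fix \<epsilon> :: real assume "\<epsilon> > 0"
      have "(\<lambda>n. 2 * C * norm u * h n) \<longlonglongrightarrow> 2 * C * norm u * 0" by (intro tendsto_intros h_lim)
      then have "(\<lambda>n. 2 * C * norm u * h n) \<longlonglongrightarrow> 0" by simp
      from order_tendstoD(2)[OF this \<open>\<epsilon> > 0\<close>] obtain N where N: "\<And>n. n \<ge> N \<Longrightarrow> 2 * C * norm u * h n < \<epsilon>"
        unfolding eventually_sequentially by blast
      show "\<exists>M. \<forall>m\<ge>M. \<forall>n\<ge>M. dist (De m x u) (De n x u) < \<epsilon>"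
      proof (intro exI allI impI)
        fix m n assume "N \<le> m" "N \<le> n"
        then show "dist (De m x u) (De n x u) < \<epsilon>"
          using De_Cauchy[OF x, of m u n] N[of m] N[of n] unfolding dist_norm by (simp add: algebra_simps)
      qed
    qed
    then show ?thesis using Cauchy_convergent convergent_def by blast
  qed
  then obtain G where G: "\<And>x u. x \<in> ball x0 (r / 4) \<Longrightarrow> (\<lambda>n. De n x u) \<longlonglongrightarrow> G x u" by metis
  have De_G: "norm (De n x u - G x u) \<le> C * h n * norm u" if x: "x \<in> ball x0 (r / 4)" for x u n
  proof (rule LIMSEQ_le[of "\<lambda>m. norm (De n x u - De m x u)" _ "\<lambda>m. C * (h n + h m) * norm u"])
    show "(\<lambda>m. norm (De n x u - De m x u)) \<longlonglongrightarrow> norm (De n x u - G x u)"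
      by (intro tendsto_intros G x)
    have "(\<lambda>m. C * (h n + h m) * norm u) \<longlonglongrightarrow> C * (h n + 0) * norm u"
      by (intro tendsto_intros h_lim)
    then show "(\<lambda>m. C * (h n + h m) * norm u) \<longlonglongrightarrow> C * h n * norm u" by simp
  qed (use De_Cauchy[OF x] in blast)
  have e_lim: "(\<lambda>n. e n x) \<longlonglongrightarrow> frechet_derivative f (at x) v" if "x \<in> ball x0 (r / 4)" for x
  proof (rule LIM_zero_cancel, rule Lim_null_comparison)
    have "x \<in> ball x0 (r / 2)" using that r by auto
    then show "\<forall>\<^sub>F n in sequentially. norm (e n x - frechet_derivative f (at x) v) \<le> Lc * (norm v)\<^sup>2 * h n"
      using e_approx by simp
    show "(\<lambda>n. Lc * (norm v)\<^sup>2 * h n) \<longlonglongrightarrow> 0"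
      using tendsto_mult_left[OF h_lim, of "Lc * (norm v)\<^sup>2"] by simp
  qed
  have x0b: "x0 \<in> ball x0 (r / 4)" using r by simp
  have "\<exists>g. \<forall>x\<in>ball x0 (r / 4). (\<lambda>n. e n x) \<longlonglongrightarrow> g x \<and> (g has_derivative G x) (at x within ball x0 (r / 4))"
  proof (rule has_derivative_sequence[of "ball x0 (r / 4)" e De G x0 "frechet_derivative f (at x0) v"])
    show "(\<lambda>n. e n x0) \<longlonglongrightarrow> frechet_derivative f (at x0) v" by (rule e_lim[OF x0b])
  next
    fix n x assume "x \<in> ball x0 (r / 4)"
    then have "x \<in> ball x0 (r / 2)" using r by auto
    then show "(e n has_derivative De n x) (at x within ball x0 (r / 4))"
      using e_der has_derivative_at_withinI by blast
  next
    fix \<epsilon> :: real assume "\<epsilon> > 0"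
    have "(\<lambda>n. C * h n) \<longlonglongrightarrow> 0" using tendsto_mult_left[OF h_lim, of C] by simp
    from order_tendstoD(2)[OF this \<open>\<epsilon> > 0\<close>] obtain N where N: "\<And>n. n \<ge> N \<Longrightarrow> C * h n < \<epsilon>"
        unfolding eventually_sequentially by blast
    show "\<forall>\<^sub>F n in sequentially. \<forall>x\<in>ball x0 (r / 4). \<forall>u. norm (De n x u - G x u) \<le> \<epsilon> * norm u"
      unfolding eventually_sequentially
    proof (intro exI allI impI ballI)
      fix n x and u :: "complex^'m" assume "N \<le> n" and x: "x \<in> ball x0 (r / 4)"
      have "C * h n * norm u \<le> \<epsilon> * norm u" using N[OF \<open>N \<le> n\<close>] by (intro mult_right_mono) auto
      then show "norm (De n x u - G x u) \<le> \<epsilon> * norm u" using De_G[OF x, of n u] by linarith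
    qed
  qed (rule convex_ball, rule x0b)
  then obtain g where g: "\<And>x. x \<in> ball x0 (r / 4) \<Longrightarrow> (\<lambda>n. e n x) \<longlonglongrightarrow> g x"
    "\<And>x. x \<in> ball x0 (r / 4) \<Longrightarrow> (g has_derivative G x) (at x within ball x0 (r / 4))" by blast
  have g_eq: "g x = frechet_derivative f (at x) v" if "x \<in> ball x0 (r / 4)" for x
    using LIMSEQ_unique[OF g(1)[OF that] e_lim[OF that]] .
  have g_der: "(g has_derivative G x0) (at x0)"
    using g(2)[OF x0b] at_within_open[OF x0b open_ball] by simp
  have "((\<lambda>x. frechet_derivative f (at x) v) has_derivative G x0) (at x0)"
    by (rule has_derivative_transform_within_open[OF g_der open_ball x0b g_eq])
  moreover have "G x0 (c *s u) = c *s G x0 u" for c u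
  proof (rule LIMSEQ_unique[OF G[OF x0b]])
    have "(\<lambda>n. c *s De n x0 u) \<longlonglongrightarrow> c *s G x0 u"
      by (rule bounded_linear.tendsto[OF bounded_linear_smult G[OF x0b]])
    moreover have "x0 \<in> ball x0 (r / 2)" using r by simp
    ultimately show "(\<lambda>n. De n x0 (c *s u)) \<longlonglongrightarrow> c *s G x0 u" using De_lin by simp
  qed
  ultimately show "\<exists>D. ((\<lambda>x. frechet_derivative f (at x) v) has_derivative D) (at x0) \<and> (\<forall>c u. D (c *s u) = c *s D u)"
    by blast
qed

lemma holomorphic_imp_smooth_on:
  fixes f :: "complex^'m::finite \<Rightarrow> complex^'k::finite" and M :: real
  assumes "complex_differentiable_on S f" "open S"
  shows "smooth_on S f"
proof (rule smooth_onI)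
  show "Ck_on k S f" for k
    using assms(1)
  proof (induction k arbitrary: f)
    case (Suc k)
    then show ?case
      using complex_differentiable_on_deriv[OF Suc.prems assms(2)] complex_differentiable_onD(1)[OF Suc.prems]
      by (auto simp: differentiable_def)
  qed simp
qed

section \<open>Atlases\<close>

text \<open>The local half of \<open>complex_manifold\<close>. Product and tangent atlases inherit
  it by computations in charts alone; Hausdorffness is a separate hypothesis of the lemmas that use
  it.\<close>

definition pre_manifold :: "('a, 'm::finite) chart set \<Rightarrow> bool" where
  "pre_manifold A \<longleftrightarrow> (\<forall>c\<in>A. is_chart c) \<and> (\<forall>c\<in>A. \<forall>d\<in>A. charts_compatible c d)"

lemma complex_manifold_imp_pre_manifold: "complex_manifold A \<Longrightarrow> pre_manifold A"
  by (simp add: complex_manifold_def pre_manifold_def)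

lemma pre_manifoldD:
  "pre_manifold A \<Longrightarrow> c \<in> A \<Longrightarrow> is_chart c"
  "pre_manifold A \<Longrightarrow> c \<in> A \<Longrightarrow> d \<in> A \<Longrightarrow> charts_compatible c d"
  by (auto simp: pre_manifold_def)

lemma chart_inv_chart: "is_chart c \<Longrightarrow> p \<in> fst c \<Longrightarrow> chart_inv c (snd c p) = p"
  by (simp add: is_chart_def)

lemma chart_inv_in: "x \<in> chart_image c \<Longrightarrow> chart_inv c x \<in> fst c"
  by (rule inv_into_into)

lemma chart_chart_inv: "x \<in> chart_image c \<Longrightarrow> snd c (chart_inv c x) = x"
  by (rule f_inv_into_f)

lemma coord_rep_chart: "is_chart c \<Longrightarrow> p \<in> fst c \<Longrightarrow> coord_rep c d f (snd c p) = snd d (f p)"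
  by (simp add: coord_rep_def chart_inv_chart)

lemma chart_eqD: "is_chart c \<Longrightarrow> p \<in> fst c \<Longrightarrow> q \<in> fst c \<Longrightarrow> snd c p = snd c q \<Longrightarrow> p = q"
  by (auto simp: is_chart_def dest: inj_onD)

lemma chart_image_mem_iff:
  "is_chart c \<Longrightarrow> p \<in> fst c \<Longrightarrow> S \<subseteq> fst c \<Longrightarrow> snd c p \<in> snd c ` S \<longleftrightarrow> p \<in> S"
  by (auto simp: is_chart_def dest: inj_onD)

lemma chart_image_open: "is_chart c \<Longrightarrow> open (chart_image c)"
  by (simp add: is_chart_def)

lemma charts_compatibleD:
  assumes "charts_compatible c d"
  shows "open (snd c ` (fst c \<inter> fst d))"
    and "complex_differentiable_on (snd c ` (fst c \<inter> fst d)) (coord_rep c d id)"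
  using assms by (auto simp: charts_compatible_def)

lemma transition_has_derivative:
  assumes "charts_compatible c d" "p \<in> fst c" "p \<in> fst d"
  shows "(coord_rep c d id has_derivative transition_deriv c d p) (at (snd c p))"
    and "transition_deriv c d p (a *s v) = a *s transition_deriv c d p v"
    and "linear (transition_deriv c d p)"
proof -
  have p: "snd c p \<in> snd c ` (fst c \<inter> fst d)" using assms by blast
  show D: "(coord_rep c d id has_derivative transition_deriv c d p) (at (snd c p))"
    by (rule complex_differentiable_onD(1)[OF charts_compatibleD(2)[OF assms(1)] p])
  show "transition_deriv c d p (a *s v) = a *s transition_deriv c d p v"
    by (rule complex_differentiable_onD(2)[OF charts_compatibleD(2)[OF assms(1)] p])
  show "linear (transition_deriv c d p)" using D by (rule has_derivative_linear)
qed

subsection \<open>The atlas topology\<close>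

lemma topspace_atlas: "topspace (atlas_topology A) = points A"
  unfolding atlas_topology_def topology_generated_by_topspace points_def
  by auto (metis Int_UNIV_right fst_conv open_UNIV vimage_UNIV)

lemma openin_atlas_basic:
  "c \<in> A \<Longrightarrow> open W \<Longrightarrow> openin (atlas_topology A) (fst c \<inter> snd c -` W)"
  unfolding atlas_topology_def by (rule topology_generated_by_Basis) blast

lemma openin_chart_domain: "c \<in> A \<Longrightarrow> openin (atlas_topology A) (fst c)"
  using openin_atlas_basic[of c A UNIV] by simp

lemma chart_subset_points: "c \<in> A \<Longrightarrow> fst c \<subseteq> points A"
  by (auto simp: points_def)

lemma open_chart_vimage:
  assumes "is_chart c" "charts_compatible c d" "open W"
  shows "open (snd c ` (fst c \<inter> (fst d \<inter> snd d -` W)))"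
proof -
  let ?U = "snd c ` (fst c \<inter> fst d)"
  have "continuous_on ?U (coord_rep c d id)"
    by (rule complex_differentiable_on_imp_continuous_on[OF charts_compatibleD(2)[OF assms(2)]])
  then have "open (?U \<inter> coord_rep c d id -` W)"
    by (rule continuous_open_preimage[OF _ charts_compatibleD(1)[OF assms(2)] assms(3)])
  also have "?U \<inter> coord_rep c d id -` W = snd c ` (fst c \<inter> (fst d \<inter> snd d -` W))"
    using assms(1) by (auto simp: coord_rep_chart)
  finally show ?thesis .
qed

text \<open>The topology is given by generators, so the proof follows the generation of
  \<open>U\<close>. Injectivity of the chart makes its image commute with intersections, and
  compatibility settles the generators.\<close>

lemma openin_atlas_imp_open:
  assumes A: "\<And>d. d \<in> A \<Longrightarrow> charts_compatible c d" and c: "is_chart c"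
    and U: "openin (atlas_topology A) U"
  shows "open (snd c ` (fst c \<inter> U))"
proof -
  have "generate_topology_on {fst d \<inter> snd d -` W | d W. d \<in> A \<and> open W} U"
    using U unfolding atlas_topology_def openin_topology_generated_by_iff .
  then show ?thesis
  proof induction
    case Empty
    then show ?case by simp
  next
    case (Int a b)
    have "snd c ` (fst c \<inter> (a \<inter> b)) = snd c ` (fst c \<inter> a) \<inter> snd c ` (fst c \<inter> b)"
      using c by (auto simp: is_chart_def dest: inj_onD)
    then show ?case using Int by auto
  next
    case (UN K)
    have "snd c ` (fst c \<inter> \<Union>K) = (\<Union>k\<in>K. snd c ` (fst c \<inter> k))" by blast
    then show ?case using UN by auto
  next
    case (Basis s)
    then show ?case using open_chart_vimage[OF c A] by blast
  qed
qed

lemma openin_atlas_iff: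
  assumes "pre_manifold A"
  shows "openin (atlas_topology A) U \<longleftrightarrow> U \<subseteq> points A \<and> (\<forall>c\<in>A. open (snd c ` (fst c \<inter> U)))"
proof
  assume "openin (atlas_topology A) U"
  then show "U \<subseteq> points A \<and> (\<forall>c\<in>A. open (snd c ` (fst c \<inter> U)))"
    using openin_atlas_imp_open pre_manifoldD[OF assms] openin_subset topspace_atlas by metis
next
  assume R: "U \<subseteq> points A \<and> (\<forall>c\<in>A. open (snd c ` (fst c \<inter> U)))"
  have "U = (\<Union>c\<in>A. fst c \<inter> snd c -` (snd c ` (fst c \<inter> U)))"
  proof -
    have i1: "p \<in> U" if "c \<in> A" "p \<in> fst c" "snd c p \<in> snd c ` (fst c \<inter> U)" for c p
      using chart_image_mem_iff[of c p "fst c \<inter> U"] pre_manifoldD(1)[OF assms] that by auto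
    have i2: "\<exists>c\<in>A. p \<in> fst c \<and> snd c p \<in> snd c ` (fst c \<inter> U)" if p: "p \<in> U" for p
    proof -
      obtain c where "c \<in> A" "p \<in> fst c" using R p unfolding points_def by blast
      then show ?thesis using p by blast
    qed
    show ?thesis
    proof (rule set_eqI)
      show "p \<in> U \<longleftrightarrow> p \<in> (\<Union>c\<in>A. fst c \<inter> snd c -` (snd c ` (fst c \<inter> U)))" for p
        unfolding UN_iff Int_iff vimage_eq using i1[of _ p] i2[of p] by metis
    qed
  qed
  moreover have "openin (atlas_topology A) (\<Union>c\<in>A. fst c \<inter> snd c -` (snd c ` (fst c \<inter> U)))"
  proof (rule openin_Union)
    fix V assume "V \<in> (\<lambda>c. fst c \<inter> snd c -` (snd c ` (fst c \<inter> U))) ` A"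
    then obtain c where c: "c \<in> A" "V = fst c \<inter> snd c -` (snd c ` (fst c \<inter> U))" by blast
    show "openin (atlas_topology A) V"
      unfolding c(2) by (rule openin_atlas_basic[OF c(1)]) (use R c(1) in blast)
  qed
  ultimately show "openin (atlas_topology A) U" by simp
qed

text \<open>Covers coordinates outside the atlas: the centred coordinates of
  \<open>transversally_Lipschitz\<close> are only compatible with the charts of
  \<open>A\<close>.\<close>

lemma openin_chart_vimage:
  assumes A: "pre_manifold A" and d: "holomorphic_coordinates A d" and "open W"
  shows "openin (atlas_topology A) (fst d \<inter> snd d -` W)"
  unfolding openin_atlas_iff[OF A]
  using d open_chart_vimage[OF pre_manifoldD(1)[OF A] _ assms(3)]
  unfolding holomorphic_coordinates_def by auto

lemma chart_holomorphic_coordinates: "pre_manifold A \<Longrightarrow> c \<in> A \<Longrightarrow> holomorphic_coordinates A c"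
  by (auto simp: holomorphic_coordinates_def pre_manifold_def points_def)

lemma holomorphic_coordinatesD:
  assumes "holomorphic_coordinates A c"
  shows "is_chart c" "fst c \<subseteq> points A" "d \<in> A \<Longrightarrow> charts_compatible c d" "d \<in> A \<Longrightarrow> charts_compatible d c"
  using assms by (auto simp: holomorphic_coordinates_def)

lemma holomorphic_coordinates_open_image:
  "holomorphic_coordinates A c \<Longrightarrow> openin (atlas_topology A) U \<Longrightarrow> open (snd c ` (fst c \<inter> U))"
  using openin_atlas_imp_open[of A c U] by (simp add: holomorphic_coordinates_def)

lemma holomorphic_coordinates_continuous_map:
  assumes A: "pre_manifold A" and d: "holomorphic_coordinates A d"
  shows "continuous_map (subtopology (atlas_topology A) (fst d)) euclidean (snd d)"
  unfolding continuous_map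
proof (intro conjI allI impI)
  fix W :: "(complex^'b) set" assume "openin euclidean W"
  then have "openin (atlas_topology A) (fst d \<inter> snd d -` W)"
    using openin_chart_vimage[OF A d] by simp
  moreover have "{x \<in> topspace (subtopology (atlas_topology A) (fst d)). snd d x \<in> W} = fst d \<inter> snd d -` W"
    using holomorphic_coordinatesD(2)[OF d] by (auto simp: topspace_atlas)
  ultimately show "openin (subtopology (atlas_topology A) (fst d))
      {x \<in> topspace (subtopology (atlas_topology A) (fst d)). snd d x \<in> W}"
    unfolding openin_subtopology by (auto intro!: exI[of _ "fst d \<inter> snd d -` W"])
qed simp

lemma chart_inv_continuous_map:
  assumes d: "holomorphic_coordinates A d"
  shows "continuous_map (top_of_set (chart_image d)) (atlas_topology A) (chart_inv d)"
  unfolding continuous_map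
proof (intro conjI allI impI)
  show "chart_inv d ` topspace (top_of_set (chart_image d)) \<subseteq> topspace (atlas_topology A)"
    using chart_inv_in[of _ d] holomorphic_coordinatesD(2)[OF d] unfolding topspace_atlas by auto
next
  fix U assume "openin (atlas_topology A) U"
  then have "open (snd d ` (fst d \<inter> U))" by (rule holomorphic_coordinates_open_image[OF d])
  moreover have "{x \<in> topspace (top_of_set (chart_image d)). chart_inv d x \<in> U} = snd d ` (fst d \<inter> U)"
    using holomorphic_coordinatesD(1)[OF d] by (auto simp: chart_inv_chart)
  ultimately show "openin (top_of_set (chart_image d)) {x \<in> topspace (top_of_set (chart_image d)). chart_inv d x \<in> U}"
    by (auto simp: openin_open)
qed

lemma compactin_chart_inv_image:
  assumes "holomorphic_coordinates A d" "compact K" "K \<subseteq> chart_image d"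
  shows "compactin (atlas_topology A) (chart_inv d ` K)"
  by (rule image_compactin[OF _ chart_inv_continuous_map[OF assms(1)]])
    (use assms in \<open>simp add: compactin_subtopology compactin_euclidean_iff\<close>)

lemma compact_chart_image:
  assumes "pre_manifold A" "holomorphic_coordinates A d" "compactin (atlas_topology A) K" "K \<subseteq> fst d"
  shows "compact (snd d ` K)"
  using image_compactin[OF _ holomorphic_coordinates_continuous_map[OF assms(1,2)], of K] assms(3,4)
  by (simp add: compactin_subtopology compactin_euclidean_iff)

subsection \<open>Changing coordinates\<close>

text \<open>\<open>coord_rep\<close> takes meaningless values where a point or its image leaves the
  chart domains. The set \<open>S\<close> and the continuity of the old representation ensure that
  near the point the new representation is the old one between two transition maps; the chain rule
  does the rest.\<close>

lemma coord_rep_change_eventually: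
  fixes c :: "('a, 'm::finite) chart" and d :: "('b, 'k::finite) chart"
    and c' :: "('a, 'm) chart" and d' :: "('b, 'k) chart"
  assumes c: "is_chart c" "is_chart c'" "charts_compatible c' c" and d: "is_chart d" "charts_compatible d d'"
    and p: "p \<in> fst c" "p \<in> fst c'" "f p \<in> fst d" "f p \<in> fst d'"
    and S: "open S" "snd c p \<in> S" "S \<subseteq> snd c ` {q \<in> fst c. f q \<in> fst d}"
    and D: "(coord_rep c d f has_derivative D) (at (snd c p))"
  shows "(coord_rep c' d' f has_derivative transition_deriv d d' (f p) \<circ> D \<circ> transition_deriv c' c p) (at (snd c' p))"
proof -
  have t1: "(coord_rep c' c id has_derivative transition_deriv c' c p) (at (snd c' p))"
    by (rule transition_has_derivative[OF c(3) p(2,1)])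
  have t2: "(coord_rep d d' id has_derivative transition_deriv d d' (f p)) (at (snd d (f p)))"
    by (rule transition_has_derivative[OF d(2) p(3,4)])
  have e1: "coord_rep c' c id (snd c' p) = snd c p" and e2: "coord_rep c d f (snd c p) = snd d (f p)"
    using c p by (simp_all add: coord_rep_chart)
  have A1: "((\<lambda>x. coord_rep c d f (coord_rep c' c id x)) has_derivative (\<lambda>v. D (transition_deriv c' c p v))) (at (snd c' p))"
    by (rule has_derivative_compose[OF t1]) (simp only: e1 D)
  have A2: "((\<lambda>x. coord_rep d d' id (coord_rep c d f (coord_rep c' c id x))) has_derivative
      (\<lambda>v. transition_deriv d d' (f p) (D (transition_deriv c' c p v)))) (at (snd c' p))"
    by (rule has_derivative_compose[OF A1]) (simp only: e1 e2 t2)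
  have ev1: "\<forall>\<^sub>F x in at (snd c' p). x \<in> snd c' ` (fst c' \<inter> fst c)"
    using charts_compatibleD(1)[OF c(3)] p by (intro eventually_at_in_open') auto
  have ev2: "\<forall>\<^sub>F x in at (snd c' p). coord_rep c' c id x \<in> S"
    using has_derivative_continuous[OF t1] S e1
    by (auto simp: continuous_within elim: topological_tendstoD)
  have ev3: "\<forall>\<^sub>F x in at (snd c' p). coord_rep c d f (coord_rep c' c id x) \<in> snd d ` (fst d \<inter> fst d')"
  proof (rule topological_tendstoD)
    show "((\<lambda>x. coord_rep c d f (coord_rep c' c id x)) \<longlongrightarrow> snd d (f p)) (at (snd c' p))"
      using has_derivative_continuous[OF A1] e1 e2 by (simp add: continuous_within)
  qed (use charts_compatibleD(1)[OF d(2)] p in auto)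
  have "\<forall>\<^sub>F x in at (snd c' p). coord_rep d d' id (coord_rep c d f (coord_rep c' c id x)) = coord_rep c' d' f x"
    using ev1 ev2 ev3
  proof eventually_elim
    case (elim x)
    then obtain q where q: "x = snd c' q" "q \<in> fst c'" "q \<in> fst c" by blast
    have "snd c q \<in> S" using elim q c by (simp add: coord_rep_chart)
    then have "f q \<in> fst d" using S(3) q chart_eqD[OF c(1)] by blast
    moreover then have "f q \<in> fst d'" using elim q c d chart_eqD[OF d(1), of "f q"] by (auto simp: coord_rep_chart)
    ultimately show ?case using q c d by (simp add: coord_rep_chart)
  qed
  then have "(coord_rep c' d' f has_derivative (\<lambda>v. transition_deriv d d' (f p) (D (transition_deriv c' c p v)))) (at (snd c' p))"
    using has_derivative_transform_eventually[OF A2] c d p by (simp add: coord_rep_chart)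
  then show ?thesis by (simp add: comp_def)
qed

lemma transition_deriv_chain:
  assumes "is_chart c" "is_chart d" "charts_compatible c d" "charts_compatible d e"
    and p: "p \<in> fst c" "p \<in> fst d" "p \<in> fst e"
  shows "transition_deriv c e p = transition_deriv d e p \<circ> transition_deriv c d p"
proof -
  have id: "(coord_rep d d id has_derivative (\<lambda>v. v)) (at (snd d p))"
    by (rule has_derivative_transform_within_open[of "\<lambda>x. x" _ _ _ "chart_image d"])
      (use assms in \<open>auto simp: coord_rep_chart chart_image_open\<close>)
  have "(coord_rep c e id has_derivative transition_deriv d e (id p) \<circ> (\<lambda>v. v) \<circ> transition_deriv c d p) (at (snd c p))"
    by (rule coord_rep_change_eventually[OF assms(2,1,3,2,4), of p id "chart_image d"])
      (use assms id in \<open>auto simp: chart_image_open\<close>)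
  then show ?thesis by (simp add: frechet_derivative_at[symmetric] comp_def)
qed

lemma transition_deriv_self:
  assumes "is_chart c" "p \<in> fst c"
  shows "transition_deriv c c p = id"
proof -
  have "(coord_rep c c id has_derivative (\<lambda>v. v)) (at (snd c p))"
    by (rule has_derivative_transform_within_open[of "\<lambda>x. x" _ _ _ "chart_image c"])
      (use assms in \<open>auto simp: coord_rep_chart chart_image_open\<close>)
  then show ?thesis by (simp add: frechet_derivative_at[symmetric] id_def)
qed

lemma transition_deriv_inverse:
  assumes "is_chart c" "is_chart d" "charts_compatible c d" "charts_compatible d c" "p \<in> fst c" "p \<in> fst d"
  shows "transition_deriv d c p (transition_deriv c d p v) = v"
  using fun_cong[OF transition_deriv_chain[OF assms(1-5,6,5)], of v] transition_deriv_self[OF assms(1,5)] by simp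

lemma coord_rep_change_smooth:
  fixes c :: "('a, 'm::finite) chart" and d :: "('b, 'k::finite) chart"
    and c' :: "('a, 'm) chart" and d' :: "('b, 'k) chart"
  assumes c: "is_chart c" "is_chart c'" "charts_compatible c' c" and d: "is_chart d" "charts_compatible d d'"
    and S: "open (snd c ` S)" "S \<subseteq> fst c" "f ` S \<subseteq> fst d" "smooth_on (snd c ` S) (coord_rep c d f)"
    and T: "T = {q \<in> S \<inter> fst c'. f q \<in> fst d'}"
  shows "open (snd c' ` T)" "smooth_on (snd c' ` T) (coord_rep c' d' f)"
proof -
  define V where "V = snd c ` S \<inter> coord_rep c d f -` (snd d ` (fst d \<inter> fst d'))"
  have V: "open V" unfolding V_def
    by (rule continuous_open_preimage[OF smooth_on_imp_continuous_on[OF S(4)] S(1) charts_compatibleD(1)[OF d(2)]])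
  let ?U = "snd c' ` (fst c' \<inter> fst c)"
  have cd: "complex_differentiable_on ?U (coord_rep c' c id)" by (rule charts_compatibleD(2)[OF c(3)])
  have "open (?U \<inter> coord_rep c' c id -` V)"
    by (rule continuous_open_preimage[OF complex_differentiable_on_imp_continuous_on[OF cd] charts_compatibleD(1)[OF c(3)] V])
  moreover have T_eq: "snd c' ` T = ?U \<inter> coord_rep c' c id -` V"
  proof (intro equalityI subsetI)
    fix x assume "x \<in> snd c' ` T"
    then obtain q where q: "x = snd c' q" "q \<in> S" "q \<in> fst c'" "f q \<in> fst d'" using T by blast
    then have "q \<in> fst c" "f q \<in> fst d" using S by auto
    then show "x \<in> ?U \<inter> coord_rep c' c id -` V"
      using q c by (auto simp: V_def coord_rep_chart)
  next
    fix x assume "x \<in> ?U \<inter> coord_rep c' c id -` V"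
    then obtain q where q: "x = snd c' q" "q \<in> fst c'" "q \<in> fst c" "snd c q \<in> V"
      using c by (auto simp: coord_rep_chart)
    have qS: "q \<in> S" using q(3,4) chart_image_mem_iff[OF c(1) q(3) S(2)] by (auto simp: V_def)
    then have "f q \<in> fst d" using S(3) by blast
    moreover have "snd d (f q) \<in> snd d ` (fst d \<inter> fst d')"
      using q(4) c q(3) by (auto simp: V_def coord_rep_chart)
    ultimately have "f q \<in> fst d'" using chart_image_mem_iff[OF d(1), of "f q" "fst d \<inter> fst d'"] by blast
    then show "x \<in> snd c' ` T" using q qS T by blast
  qed
  ultimately show oT: "open (snd c' ` T)" by simp
  have s1: "smooth_on (snd c' ` T) (coord_rep c' c id)"
    by (rule smooth_on_subset[OF holomorphic_imp_smooth_on[OF cd charts_compatibleD(1)[OF c(3)]]]) (auto simp: T_eq)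
  have s2: "smooth_on (snd c' ` T) (\<lambda>x. coord_rep c d f (coord_rep c' c id x))"
    by (rule smooth_on_compose[OF oT V _ s1 smooth_on_subset[OF S(4)]]) (auto simp: T_eq V_def)
  have s3: "smooth_on (snd c' ` T) (\<lambda>x. coord_rep d d' id (coord_rep c d f (coord_rep c' c id x)))"
    by (rule smooth_on_compose[OF oT charts_compatibleD(1)[OF d(2)] _ s2
          holomorphic_imp_smooth_on[OF charts_compatibleD(2,1)[OF d(2)]]]) (auto simp: T_eq V_def)
  show "smooth_on (snd c' ` T) (coord_rep c' d' f)"
  proof (rule smooth_on_cong_open[OF oT _ s3])
    fix x assume "x \<in> snd c' ` T"
    then obtain q where q: "x = snd c' q" "q \<in> S" "q \<in> fst c'" "f q \<in> fst d'" using T by blast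
    then have "q \<in> fst c" "f q \<in> fst d" using S by auto
    then show "coord_rep d d' id (coord_rep c d f (coord_rep c' c id x)) = coord_rep c' d' f x"
      using q c d by (simp add: coord_rep_chart)
  qed
qed

text \<open>\<open>smooth_map\<close> asks for continuity and for all pairs of charts. One pair near
  each point is enough: continuity follows from that of the coordinate expression, and other pairs
  differ from it by holomorphic transition maps.\<close>

lemma smooth_map_local:
  assumes A: "pre_manifold A" and B: "pre_manifold B" and S: "openin (atlas_topology A) S"
    and loc: "\<And>p. p \<in> S \<Longrightarrow> \<exists>c\<in>A. \<exists>d\<in>B. \<exists>U. openin (atlas_topology A) U \<and> p \<in> U \<and> U \<subseteq> fst c \<inter> S \<and>
       f ` U \<subseteq> fst d \<and> smooth_on (snd c ` U) (coord_rep c d f)"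
  shows "smooth_map A B S f"
  unfolding manifold_map_def
proof (intro conjI ballI)
  show "continuous_map (subtopology (atlas_topology A) S) (atlas_topology B) f"
    unfolding continuous_map
  proof (intro conjI allI impI)
    have "f p \<in> points B" if "p \<in> S" for p
      using loc[OF that] chart_subset_points[of _ B] by blast
    then show "f ` topspace (subtopology (atlas_topology A) S) \<subseteq> topspace (atlas_topology B)"
      by (auto simp: topspace_atlas)
  next
    fix V assume V: "openin (atlas_topology B) V"
    have SA: "S \<subseteq> points A" using openin_subset[OF S] by (simp add: topspace_atlas)
    have "openin (atlas_topology A) {p \<in> S. f p \<in> V}"
    proof (subst openin_subopen, intro ballI)
      fix p assume "p \<in> {p \<in> S. f p \<in> V}"
      then have p: "p \<in> S" "f p \<in> V" by auto
      obtain c d U where U: "c \<in> A" "d \<in> B" "openin (atlas_topology A) U" "p \<in> U" "U \<subseteq> fst c \<inter> S"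
        "f ` U \<subseteq> fst d" "smooth_on (snd c ` U) (coord_rep c d f)" using loc[OF p(1)] by blast
      note ch = pre_manifoldD(1)[OF A U(1)] pre_manifoldD(1)[OF B U(2)]
      have "fst c \<inter> U = U" using U(5) by blast
      then have oU: "open (snd c ` U)"
        using holomorphic_coordinates_open_image[OF chart_holomorphic_coordinates[OF A U(1)] U(3)] by simp
      have "open (snd d ` (fst d \<inter> V))"
        by (rule holomorphic_coordinates_open_image[OF chart_holomorphic_coordinates[OF B U(2)] V])
      then have o: "open (snd c ` U \<inter> coord_rep c d f -` (snd d ` (fst d \<inter> V)))" (is "open ?W")
        by (rule continuous_open_preimage[OF smooth_on_imp_continuous_on[OF U(7)] oU])
      have W: "f q \<in> V \<and> q \<in> S" if q: "q \<in> fst c" "snd c q \<in> ?W" for q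
      proof -
        have qU: "q \<in> U" using chart_image_mem_iff[OF ch(1) q(1), of U] U(5) q(2) by auto
        then have "f q \<in> fst d" using U(6) by blast
        moreover have "snd d (f q) \<in> snd d ` (fst d \<inter> V)" using q ch by (auto simp: coord_rep_chart)
        ultimately have "f q \<in> V" using chart_image_mem_iff[OF ch(2), of "f q" "fst d \<inter> V"] by blast
        then show ?thesis using qU U(5) by blast
      qed
      have "coord_rep c d f (snd c p) = snd d (f p)" "f p \<in> fst d"
        using U(4-6) coord_rep_chart[OF ch(1)] by blast+
      then have "p \<in> fst c \<inter> snd c -` ?W"
        using U(4,5) p by auto
      then show "\<exists>T. openin (atlas_topology A) T \<and> p \<in> T \<and> T \<subseteq> {p \<in> S. f p \<in> V}"
        using openin_atlas_basic[OF U(1) o] W by (intro exI[of _ "fst c \<inter> snd c -` ?W"]) auto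
    qed
    then show "openin (subtopology (atlas_topology A) S) {x \<in> topspace (subtopology (atlas_topology A) S). f x \<in> V}"
      using SA by (auto simp: openin_subtopology topspace_atlas intro!: exI[of _ "{p \<in> S. f p \<in> V}"])
  qed
next
  fix c' d' assume cd': "c' \<in> A" "d' \<in> B"
  show "smooth_on (snd c' ` {p \<in> fst c' \<inter> S. f p \<in> fst d'}) (coord_rep c' d' f)"
  proof (rule smooth_on_local)
    fix x assume "x \<in> snd c' ` {p \<in> fst c' \<inter> S. f p \<in> fst d'}"
    then obtain p where p: "x = snd c' p" "p \<in> fst c'" "p \<in> S" "f p \<in> fst d'" by blast
    obtain c d U where U: "c \<in> A" "d \<in> B" "openin (atlas_topology A) U" "p \<in> U" "U \<subseteq> fst c \<inter> S"
      "f ` U \<subseteq> fst d" "smooth_on (snd c ` U) (coord_rep c d f)" using loc[OF p(3)] by blast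
    have "fst c \<inter> U = U" using U(5) by blast
    then have oU: "open (snd c ` U)"
      using holomorphic_coordinates_open_image[OF chart_holomorphic_coordinates[OF A U(1)] U(3)] by simp
    have "smooth_on (snd c' ` {q \<in> U \<inter> fst c'. f q \<in> fst d'}) (coord_rep c' d' f)"
      by (rule coord_rep_change_smooth(2)[of c c' d d' U f])
        (use U oU cd' pre_manifoldD[OF A] pre_manifoldD[OF B] in auto)
    moreover have "x \<in> snd c' ` {q \<in> U \<inter> fst c'. f q \<in> fst d'}" using p U(4) by simp
    ultimately show "\<exists>T. x \<in> T \<and> smooth_on T (coord_rep c' d' f)" by metis
  qed
qed

lemma smooth_mapD:
  assumes A: "pre_manifold A" and B: "pre_manifold B" and S: "openin (atlas_topology A) S"
    and f: "smooth_map A B S f" and cd: "c \<in> A" "d \<in> B"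
  shows "openin (atlas_topology A) {p \<in> fst c \<inter> S. f p \<in> fst d}"
    "open (snd c ` {p \<in> fst c \<inter> S. f p \<in> fst d})"
    "smooth_on (snd c ` {p \<in> fst c \<inter> S. f p \<in> fst d}) (coord_rep c d f)"
proof -
  have "continuous_map (subtopology (atlas_topology A) S) (atlas_topology B) f"
    using f unfolding manifold_map_def by blast
  from openin_continuous_map_preimage[OF this openin_chart_domain[OF cd(2)]]
  have "openin (atlas_topology A) {p \<in> topspace (subtopology (atlas_topology A) S). f p \<in> fst d}"
    using openin_trans_full[OF _ S] by blast
  moreover have "{p \<in> fst c \<inter> S. f p \<in> fst d} = fst c \<inter> {p \<in> topspace (subtopology (atlas_topology A) S). f p \<in> fst d}"
    using chart_subset_points[OF cd(1)] by (auto simp: topspace_atlas)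
  ultimately show o: "openin (atlas_topology A) {p \<in> fst c \<inter> S. f p \<in> fst d}"
    using openin_chart_domain[OF cd(1)] by auto
  show "open (snd c ` {p \<in> fst c \<inter> S. f p \<in> fst d})"
    using holomorphic_coordinates_open_image[OF chart_holomorphic_coordinates[OF A cd(1)] o]
    by (simp add: Int_def conj_ac)
  show "smooth_on (snd c ` {p \<in> fst c \<inter> S. f p \<in> fst d}) (coord_rep c d f)"
    using f cd unfolding manifold_map_def by blast
qed

section \<open>Products and tangent bundles\<close>

definition vfst :: "complex^('m::finite + 'k::finite) \<Rightarrow> complex^'m" where
  "vfst z = (\<chi> a. z $ Inl a)"

lemma vfst_vjoin [simp]: "vfst (vjoin x y) = x"
  and vsnd_vjoin [simp]: "vsnd (vjoin x y) = y"
  and vjoin_vfst_vsnd [simp]: "vjoin (vfst z) (vsnd z) = z"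
  by (auto simp: vfst_def vsnd_def vjoin_def vec_eq_iff split: sum.split)

lemma vjoin_eq_iff [simp]: "vjoin x y = vjoin x' y' \<longleftrightarrow> x = x' \<and> y = y'"
  by (metis vfst_vjoin vsnd_vjoin)

lemma vjoin_add: "vjoin (x + x') (y + y') = vjoin x y + vjoin x' y'"
  and vjoin_diff: "vjoin (x - x') (y - y') = vjoin x y - vjoin x' y'"
  and vjoin_smult: "vjoin (a *s x) (a *s y) = a *s vjoin x y"
  and vjoin_scaleR: "vjoin (r *\<^sub>R x) (r *\<^sub>R y) = r *\<^sub>R vjoin x y"
  and vjoin_0 [simp]: "vjoin 0 0 = 0"
  by (auto simp: vjoin_def vec_eq_iff split: sum.split)

lemma norm_vjoin_power2: "(norm (vjoin x y))\<^sup>2 = (norm x)\<^sup>2 + (norm y)\<^sup>2"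
proof -
  have "(norm (vjoin x y))\<^sup>2 = (\<Sum>i\<in>UNIV <+> UNIV. (norm (vjoin x y $ i))\<^sup>2)"
    by (simp add: norm_vec_def L2_set_def sum_nonneg)
  also have "\<dots> = (norm x)\<^sup>2 + (norm y)\<^sup>2"
    by (subst sum.Plus) (auto simp: vjoin_def norm_vec_def L2_set_def sum_nonneg)
  finally show ?thesis .
qed

lemma norm_vjoin_le: "norm (vjoin x y) \<le> norm x + norm y"
  by (rule power2_le_imp_le) (auto simp: norm_vjoin_power2 power2_sum)

lemma norm_vfst_le: "norm (vfst z) \<le> norm z" and norm_vsnd_le: "norm (vsnd z) \<le> norm z"
  using norm_vjoin_power2[of "vfst z" "vsnd z"] by (auto intro: power2_le_imp_le)

lemma bounded_linear_vfst: "bounded_linear vfst"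
  by (rule bounded_linear_intro[of _ 1]) (auto simp: vfst_def vec_eq_iff norm_vfst_le[unfolded vfst_def])

lemma bounded_linear_vsnd: "bounded_linear vsnd"
  by (rule bounded_linear_intro[of _ 1]) (auto simp: vsnd_def vec_eq_iff norm_vsnd_le[unfolded vsnd_def])

lemma vfst_smult: "vfst (a *s z) = a *s vfst z" and vsnd_smult: "vsnd (a *s z) = a *s vsnd z"
  by (auto simp: vfst_def vsnd_def vec_eq_iff)

lemma bounded_linear_vjoin_left: "bounded_linear (\<lambda>x. vjoin x 0)"
  by (rule bounded_linear_intro[of _ 1])
    (use vjoin_add[of _ _ 0 0] vjoin_scaleR[of _ _ 0] norm_vjoin_le[of _ 0] in auto)

lemma bounded_linear_vjoin_right: "bounded_linear (\<lambda>y. vjoin 0 y)"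
  by (rule bounded_linear_intro[of _ 1])
    (use vjoin_add[of 0 0] vjoin_scaleR[of _ 0] norm_vjoin_le[of 0] in auto)

lemma vjoin_split: "vjoin x y = vjoin x 0 + vjoin 0 y"
  using vjoin_add[of x 0 0 y] by simp

lemmas vfst_linear_simps = linear_simps[OF bounded_linear_vfst]
lemmas vsnd_linear_simps = linear_simps[OF bounded_linear_vsnd]

lemma has_derivative_vjoin:
  assumes "(f has_derivative f') F" "(g has_derivative g') F"
  shows "((\<lambda>x. vjoin (f x) (g x)) has_derivative (\<lambda>v. vjoin (f' v) (g' v))) F"
  using has_derivative_add[OF bounded_linear.has_derivative[OF bounded_linear_vjoin_left assms(1)]
      bounded_linear.has_derivative[OF bounded_linear_vjoin_right assms(2)]]
  by (simp flip: vjoin_split)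

lemma smooth_on_vjoin:
  assumes "open S" "smooth_on S f" "smooth_on S g"
  shows "smooth_on S (\<lambda>x. vjoin (f x) (g x))"
  using smooth_on_add[OF assms(1) smooth_on_linear_compose[OF bounded_linear_vjoin_left assms(1,2)]
      smooth_on_linear_compose[OF bounded_linear_vjoin_right assms(1,3)]]
  by (simp flip: vjoin_split)

lemma open_vfst_vimage: "open U \<Longrightarrow> open (vfst -` U)"
  by (rule open_vimage) (auto intro: linear_continuous_on bounded_linear_vfst)

lemma open_vsnd_vimage: "open U \<Longrightarrow> open (vsnd -` U)"
  by (rule open_vimage) (auto intro: linear_continuous_on bounded_linear_vsnd)

subsection \<open>The product atlas\<close>

lemma fst_prod_chart [simp]: "fst (prod_chart c d) = fst c \<times> fst d"
  and snd_prod_chart [simp]: "snd (prod_chart c d) p = vjoin (snd c (fst p)) (snd d (snd p))"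
  by (simp_all add: prod_chart_def)

lemma prod_chart_image: "S \<subseteq> fst c \<Longrightarrow> T \<subseteq> fst d \<Longrightarrow>
  snd (prod_chart c d) ` (S \<times> T) = vfst -` (snd c ` S) \<inter> vsnd -` (snd d ` T)"
proof (intro equalityI subsetI)
  fix z assume "z \<in> vfst -` (snd c ` S) \<inter> vsnd -` (snd d ` T)"
  then obtain p q where "p \<in> S" "q \<in> T" "vfst z = snd c p" "vsnd z = snd d q" by blast
  then show "z \<in> snd (prod_chart c d) ` (S \<times> T)"
    by (intro image_eqI[of _ _ "(p, q)"]) (auto, metis vjoin_vfst_vsnd)
qed auto

lemma prod_chart_image_open:
  assumes "S \<subseteq> fst c" "T \<subseteq> fst d" "open (snd c ` S)" "open (snd d ` T)"
  shows "open (snd (prod_chart c d) ` (S \<times> T))"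
  unfolding prod_chart_image[OF assms(1,2)] using assms open_vfst_vimage open_vsnd_vimage by blast

lemma is_chart_prod: "is_chart c \<Longrightarrow> is_chart d \<Longrightarrow> is_chart (prod_chart c d)"
  unfolding is_chart_def using prod_chart_image_open[of "fst c" c "fst d" d]
  by (auto intro!: inj_onI dest: inj_onD)

lemma prod_transition:
  assumes "is_chart c" "is_chart d" "charts_compatible c c'" "charts_compatible d d'"
  shows "open (snd (prod_chart c d) ` (fst (prod_chart c d) \<inter> fst (prod_chart c' d')))"
    and "z \<in> snd (prod_chart c d) ` (fst (prod_chart c d) \<inter> fst (prod_chart c' d')) \<Longrightarrow>
      coord_rep (prod_chart c d) (prod_chart c' d') id z = vjoin (coord_rep c c' id (vfst z)) (coord_rep d d' id (vsnd z))"
    and "p \<in> fst c \<inter> fst c' \<Longrightarrow> q \<in> fst d \<inter> fst d' \<Longrightarrow> (coord_rep (prod_chart c d) (prod_chart c' d') id has_derivative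
      (\<lambda>v. vjoin (transition_deriv c c' p (vfst v)) (transition_deriv d d' q (vsnd v)))) (at (snd (prod_chart c d) (p, q)))"
proof -
  have eq: "fst (prod_chart c d) \<inter> fst (prod_chart c' d') = (fst c \<inter> fst c') \<times> (fst d \<inter> fst d')" by auto
  show o: "open (snd (prod_chart c d) ` (fst (prod_chart c d) \<inter> fst (prod_chart c' d')))"
    unfolding eq
    by (rule prod_chart_image_open[OF _ _ charts_compatibleD(1)[OF assms(3)] charts_compatibleD(1)[OF assms(4)]]) auto
  show e: "coord_rep (prod_chart c d) (prod_chart c' d') id z = vjoin (coord_rep c c' id (vfst z)) (coord_rep d d' id (vsnd z))"
    if z: "z \<in> snd (prod_chart c d) ` (fst (prod_chart c d) \<inter> fst (prod_chart c' d'))" for z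
  proof -
    obtain r where r: "z = snd (prod_chart c d) r" "r \<in> fst (prod_chart c d)" "r \<in> fst (prod_chart c' d')" using z by blast
    then show ?thesis
      using coord_rep_chart[OF is_chart_prod[OF assms(1,2)] r(2), of "prod_chart c' d'" id] assms
      by (auto simp: coord_rep_chart)
  qed
  show "(coord_rep (prod_chart c d) (prod_chart c' d') id has_derivative
      (\<lambda>v. vjoin (transition_deriv c c' p (vfst v)) (transition_deriv d d' q (vsnd v)))) (at (snd (prod_chart c d) (p, q)))"
    if pq: "p \<in> fst c \<inter> fst c'" "q \<in> fst d \<inter> fst d'"
  proof (rule has_derivative_transform_within_open[OF _ o])
    show "snd (prod_chart c d) (p, q) \<in> snd (prod_chart c d) ` (fst (prod_chart c d) \<inter> fst (prod_chart c' d'))"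
      using pq by (intro imageI) auto
    have 1: "((\<lambda>z. coord_rep c c' id (vfst z)) has_derivative (\<lambda>v. transition_deriv c c' p (vfst v))) (at (snd (prod_chart c d) (p, q)))"
      by (rule has_derivative_compose[OF bounded_linear_imp_has_derivative[OF bounded_linear_vfst]])
        (use transition_has_derivative(1)[OF assms(3), of p] pq in \<open>simp only: Int_iff snd_prod_chart fst_conv snd_conv vfst_vjoin\<close>)
    have 2: "((\<lambda>z. coord_rep d d' id (vsnd z)) has_derivative (\<lambda>v. transition_deriv d d' q (vsnd v))) (at (snd (prod_chart c d) (p, q)))"
      by (rule has_derivative_compose[OF bounded_linear_imp_has_derivative[OF bounded_linear_vsnd]])
        (use transition_has_derivative(1)[OF assms(4), of q] pq in \<open>simp only: Int_iff snd_prod_chart fst_conv snd_conv vsnd_vjoin\<close>)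
    show "((\<lambda>z. vjoin (coord_rep c c' id (vfst z)) (coord_rep d d' id (vsnd z))) has_derivative
      (\<lambda>v. vjoin (transition_deriv c c' p (vfst v)) (transition_deriv d d' q (vsnd v)))) (at (snd (prod_chart c d) (p, q)))"
      by (rule has_derivative_vjoin[OF 1 2])
  qed (rule e[symmetric])
qed

lemma charts_compatible_prod:
  assumes "is_chart c" "is_chart d" "charts_compatible c c'" "charts_compatible d d'"
  shows "charts_compatible (prod_chart c d) (prod_chart c' d')"
  unfolding charts_compatible_def
proof (intro conjI prod_transition(1) assms)
  show "complex_differentiable_on (snd (prod_chart c d) ` (fst (prod_chart c d) \<inter> fst (prod_chart c' d')))
      (coord_rep (prod_chart c d) (prod_chart c' d') id)"
    unfolding complex_differentiable_on_def
  proof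
    fix x assume "x \<in> snd (prod_chart c d) ` (fst (prod_chart c d) \<inter> fst (prod_chart c' d'))"
    then obtain p q where x: "x = snd (prod_chart c d) (p, q)" and p: "p \<in> fst c \<inter> fst c'" and q: "q \<in> fst d \<inter> fst d'"
      by auto
    then show "\<exists>D. (coord_rep (prod_chart c d) (prod_chart c' d') id has_derivative D) (at x) \<and> (\<forall>a v. D (a *s v) = a *s D v)"
      using prod_transition(3)[OF assms p q] transition_has_derivative(2)[OF assms(3), of p]
        transition_has_derivative(2)[OF assms(4), of q]
      by (auto simp: vfst_smult vsnd_smult vjoin_smult intro!: exI[of _ "\<lambda>v. vjoin (transition_deriv c c' p (vfst v)) (transition_deriv d d' q (vsnd v))"])
  qed
qed

lemma pre_manifold_prod: "pre_manifold A \<Longrightarrow> pre_manifold B \<Longrightarrow> pre_manifold (prod_atlas A B)"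
  unfolding pre_manifold_def prod_atlas_def
  using is_chart_prod charts_compatible_prod by blast

lemma prod_chart_in: "c \<in> A \<Longrightarrow> d \<in> B \<Longrightarrow> prod_chart c d \<in> prod_atlas A B"
  unfolding prod_atlas_def by blast

lemma points_prod: "points (prod_atlas A B) = points A \<times> points B"
  unfolding points_def prod_atlas_def by fastforce

lemma openin_prod_atlas:
  assumes A: "pre_manifold A" and B: "pre_manifold B"
    and U: "openin (atlas_topology A) U" and V: "openin (atlas_topology B) V"
  shows "openin (atlas_topology (prod_atlas A B)) (U \<times> V)"
  unfolding openin_atlas_iff[OF pre_manifold_prod[OF A B]]
proof (intro conjI ballI)
  show "U \<times> V \<subseteq> points (prod_atlas A B)"
    using openin_subset[OF U] openin_subset[OF V] by (auto simp: points_prod topspace_atlas)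
  fix e assume "e \<in> prod_atlas A B"
  then obtain c d where cd: "c \<in> A" "d \<in> B" "e = prod_chart c d" by (auto simp: prod_atlas_def)
  have "open (snd (prod_chart c d) ` ((fst c \<inter> U) \<times> (fst d \<inter> V)))"
    by (rule prod_chart_image_open)
      (use holomorphic_coordinates_open_image[OF chart_holomorphic_coordinates[OF A cd(1)] U]
          holomorphic_coordinates_open_image[OF chart_holomorphic_coordinates[OF B cd(2)] V] in auto)
  moreover have "fst e \<inter> U \<times> V = (fst c \<inter> U) \<times> (fst d \<inter> V)" using cd(3) by auto
  ultimately show "open (snd e ` (fst e \<inter> U \<times> V))" using cd(3) by simp
qed

text \<open>This set contains the diagonal as soon as every \<open>Z j\<close> lies in
  \<open>O' j\<close>. It serves twice: as the domain of the admissible map, and to keep the second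
  point near the support of a cut-off in the first.\<close>

lemma openin_near_diagonal:
  assumes A: "pre_manifold A" and fin: "finite J"
    and Z: "\<And>j. j \<in> J \<Longrightarrow> closedin (atlas_topology A) (Z j)"
    and O: "\<And>j. j \<in> J \<Longrightarrow> openin (atlas_topology A) (O' j)"
  shows "openin (atlas_topology (prod_atlas A A)) {p \<in> points A \<times> points A. \<forall>j\<in>J. fst p \<in> Z j \<longrightarrow> snd p \<in> O' j}"
  using fin Z O
proof (induction J)
  case empty
  have "openin (atlas_topology A) (points A)" by (metis openin_topspace topspace_atlas)
  from openin_prod_atlas[OF A A this this] show ?case by (simp add: points_prod)
next
  case (insert j J)
  have op: "openin (atlas_topology A) (points A)" by (metis openin_topspace topspace_atlas)
  have oz: "openin (atlas_topology A) (points A - Z j)"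
    using insert.prems(1)[of j] by (simp add: closedin_def topspace_atlas)
  have oO: "openin (atlas_topology A) (O' j)" using insert.prems(2) by simp
  then have "O' j \<subseteq> points A" using openin_subset[OF oO] by (simp add: topspace_atlas)
  then have "{p \<in> points A \<times> points A. \<forall>j\<in>insert j J. fst p \<in> Z j \<longrightarrow> snd p \<in> O' j} =
    {p \<in> points A \<times> points A. \<forall>j\<in>J. fst p \<in> Z j \<longrightarrow> snd p \<in> O' j} \<inter>
     ((points A - Z j) \<times> points A \<union> points A \<times> O' j)" by auto
  then show ?case
    using insert openin_prod_atlas[OF A A oz op] openin_prod_atlas[OF A A op oO] by auto
qed

subsection \<open>The tangent bundle\<close>

text \<open>The tangent vector with coordinates \<open>\<xi>\<close> in \<open>c\<close>, spelled
  out in all charts at once as \<open>tangent_space\<close> requires. The zeros elsewhere are the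
  normal form that makes equal vectors equal functions.\<close>

definition tvec_of :: "('a, 'm::finite) chart set \<Rightarrow> ('a, 'm) chart \<Rightarrow> 'a \<Rightarrow> complex^'m \<Rightarrow> ('a, 'm) tvec" where
  "tvec_of A c p \<xi> = (\<lambda>e. if e \<in> A \<and> p \<in> fst e then transition_deriv c e p \<xi> else 0)"

lemma tangent_spaceI:
  assumes "\<And>c d. c \<in> A \<Longrightarrow> d \<in> A \<Longrightarrow> p \<in> fst c \<Longrightarrow> p \<in> fst d \<Longrightarrow> v d = transition_deriv c d p (v c)"
    and "\<And>c. \<not> (c \<in> A \<and> p \<in> fst c) \<Longrightarrow> v c = 0"
  shows "v \<in> tangent_space A p"
  unfolding tangent_space_def
proof (intro CollectI conjI ballI allI impI)
  fix c d assume "c \<in> A" "d \<in> A" "p \<in> fst c \<inter> fst d"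
  then show "v d = transition_deriv c d p (v c)" using assms(1)[of c d] by (simp only: Int_iff)
qed (rule assms(2))

lemma tangent_spaceD:
  assumes "v \<in> tangent_space A p"
  shows "c \<in> A \<Longrightarrow> d \<in> A \<Longrightarrow> p \<in> fst c \<Longrightarrow> p \<in> fst d \<Longrightarrow> v d = transition_deriv c d p (v c)"
    and "\<not> (c \<in> A \<and> p \<in> fst c) \<Longrightarrow> v c = 0"
  using assms unfolding tangent_space_def by blast+

lemma tvec_of_self:
  "pre_manifold A \<Longrightarrow> c \<in> A \<Longrightarrow> p \<in> fst c \<Longrightarrow> tvec_of A c p \<xi> c = \<xi>"
  using transition_deriv_self[of c p] pre_manifoldD(1)[of A c] by (simp add: tvec_of_def)

lemma tvec_of_in_tangent_space:
  assumes "pre_manifold A" "c \<in> A" "p \<in> fst c"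
  shows "tvec_of A c p \<xi> \<in> tangent_space A p"
proof -
  have *: "transition_deriv c e' p \<xi> = transition_deriv e e' p (transition_deriv c e p \<xi>)"
    if "e \<in> A" "e' \<in> A" "p \<in> fst e" "p \<in> fst e'" for e e'
    using transition_deriv_chain[of c e e' p] pre_manifoldD[OF assms(1)] assms that by simp
  show ?thesis
  proof (rule tangent_spaceI)
    fix e e' assume "e \<in> A" "e' \<in> A" "p \<in> fst e" "p \<in> fst e'"
    then show "tvec_of A c p \<xi> e' = transition_deriv e e' p (tvec_of A c p \<xi> e)"
      using *[of e e'] by (simp add: tvec_of_def)
  qed (simp only: tvec_of_def if_False)
qed

lemma tangent_space_eq_tvec_of:
  assumes "c \<in> A" "p \<in> fst c" "v \<in> tangent_space A p"
  shows "v = tvec_of A c p (v c)"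
proof
  fix e show "v e = tvec_of A c p (v c) e"
    using tangent_spaceD(1)[OF assms(3,1) _ assms(2), of e] tangent_spaceD(2)[OF assms(3), of e] unfolding tvec_of_def
    by (cases "e \<in> A \<and> p \<in> fst e") metis+
qed

lemma zero_tangent: "pre_manifold A \<Longrightarrow> (\<lambda>c. 0) \<in> tangent_space A p"
  by (rule tangent_spaceI) (metis linear_0 transition_has_derivative(3) pre_manifoldD(2), simp)

lemma fst_tangent_chart: "fst (tangent_chart A c) = (SIGMA p : fst c. tangent_space A p)"
  and snd_tangent_chart: "snd (tangent_chart A c) e = vjoin (snd c (fst e)) (snd e c)"
  by (simp_all add: tangent_chart_def)

lemma tangent_chart_image:
  fixes A :: "('a, 'm::finite) chart set"
  assumes "pre_manifold A" "c \<in> A" "S \<subseteq> fst c"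
  shows "snd (tangent_chart A c) ` (SIGMA p : S. tangent_space A p) = vfst -` (snd c ` S)"
proof (intro equalityI subsetI)
  fix z :: "complex^('m + 'm)" assume "z \<in> vfst -` (snd c ` S)"
  then obtain p where p: "p \<in> S" "vfst z = snd c p" by blast
  have "z = snd (tangent_chart A c) (p, tvec_of A c p (vsnd z))"
    unfolding snd_tangent_chart using p assms tvec_of_self[OF assms(1,2), of p "vsnd z"]
    by (simp flip: p(2)) (use assms(3) p(1) in auto)
  then show "z \<in> snd (tangent_chart A c) ` (SIGMA p : S. tangent_space A p)"
    using p assms tvec_of_in_tangent_space[OF assms(1,2), of p] by blast
qed (auto simp: snd_tangent_chart)

lemma is_chart_tangent:
  assumes "pre_manifold A" "c \<in> A"
  shows "is_chart (tangent_chart A c)"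
proof -
  have c: "is_chart c" using pre_manifoldD(1) assms by blast
  have "e = e'" if e: "e \<in> fst (tangent_chart A c)" "e' \<in> fst (tangent_chart A c)"
    "snd (tangent_chart A c) e = snd (tangent_chart A c) e'" for e e'
  proof -
    obtain p v where pv: "e = (p, v)" "p \<in> fst c" "v \<in> tangent_space A p" using e(1) by (auto simp: fst_tangent_chart)
    obtain p' v' where pv': "e' = (p', v')" "p' \<in> fst c" "v' \<in> tangent_space A p'" using e(2) by (auto simp: fst_tangent_chart)
    have "snd c p = snd c p'" "v c = v' c" using e(3) pv(1) pv'(1) by (auto simp: snd_tangent_chart)
    moreover have "p = p'" using chart_eqD[OF c pv(2) pv'(2)] calculation(1) by simp
    ultimately show "e = e'"
      using tangent_space_eq_tvec_of[OF assms(2) pv(2,3)] tangent_space_eq_tvec_of[OF assms(2) pv'(2,3)] pv(1) pv'(1) by simp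
  qed
  then have "inj_on (snd (tangent_chart A c)) (fst (tangent_chart A c))" by (rule inj_onI)
  moreover have "open (chart_image (tangent_chart A c))"
    unfolding fst_tangent_chart tangent_chart_image[OF assms order_refl]
    by (rule open_vfst_vimage[OF chart_image_open[OF c]])
  ultimately show ?thesis by (simp add: is_chart_def)
qed

lemma complex_linear_expand:
  fixes D :: "complex^'m::finite \<Rightarrow> complex^'k::finite"
  assumes "linear D" "\<And>a v. D (a *s v) = a *s D v"
  shows "D x = (\<Sum>j\<in>UNIV. (x $ j) *s D (axis j 1))"
proof -
  have "x = (\<Sum>j\<in>UNIV. (x $ j) *s axis j 1)" by (simp add: basis_expansion)
  then have "D x = D (\<Sum>j\<in>UNIV. (x $ j) *s axis j 1)" by simp
  also have "\<dots> = (\<Sum>j\<in>UNIV. (x $ j) *s D (axis j 1))"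
    by (simp add: linear_sum[OF assms(1)] assms(2))
  finally show ?thesis .
qed

lemma complex_differentiable_on_linear:
  "bounded_linear L \<Longrightarrow> (\<And>a v. L (a *s v) = a *s L v) \<Longrightarrow> complex_differentiable_on S L"
  by (rule complex_differentiable_onI[of _ _ "\<lambda>x. L"]) (auto intro: bounded_linear_imp_has_derivative)

lemma complex_differentiable_on_sum:
  fixes f :: "'i \<Rightarrow> complex^'m::finite \<Rightarrow> complex^'k::finite"
  assumes "\<And>i. i \<in> I \<Longrightarrow> complex_differentiable_on S (f i)"
  shows "complex_differentiable_on S (\<lambda>x. \<Sum>i\<in>I. f i x)"
proof (rule complex_differentiable_onI)
  fix x assume x: "x \<in> S"
  show "((\<lambda>x. \<Sum>i\<in>I. f i x) has_derivative (\<lambda>v. \<Sum>i\<in>I. frechet_derivative (f i) (at x) v)) (at x)"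
    by (rule has_derivative_sum) (rule complex_differentiable_onD(1)[OF assms x])
  show "(\<Sum>i\<in>I. frechet_derivative (f i) (at x) (a *s v)) = a *s (\<Sum>i\<in>I. frechet_derivative (f i) (at x) v)" for a v
    using complex_differentiable_onD(2)[OF assms x]
    by (simp add: bounded_bilinear.sum_right[OF bounded_bilinear_smult])
qed

lemma complex_differentiable_on_nth_smult:
  fixes f :: "complex^'m::finite \<Rightarrow> complex^'l::finite" and g :: "complex^'m \<Rightarrow> complex^'k::finite"
  assumes "complex_differentiable_on S f" "complex_differentiable_on S g"
  shows "complex_differentiable_on S (\<lambda>x. (f x $ j) *s g x)"
proof (rule complex_differentiable_onI)
  fix x assume x: "x \<in> S"
  show "((\<lambda>x. (f x $ j) *s g x) has_derivative
     (\<lambda>v. (f x $ j) *s frechet_derivative g (at x) v + (frechet_derivative f (at x) v $ j) *s g x)) (at x)"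
    by (rule bounded_bilinear.FDERIV[OF bounded_bilinear_smult
          bounded_linear.has_derivative[OF bounded_linear_vec_nth complex_differentiable_onD(1)[OF assms(1) x]]
          complex_differentiable_onD(1)[OF assms(2) x]])
  show "(f x $ j) *s frechet_derivative g (at x) (a *s v) + (frechet_derivative f (at x) (a *s v) $ j) *s g x
     = a *s ((f x $ j) *s frechet_derivative g (at x) v + (frechet_derivative f (at x) v $ j) *s g x)" for a v
    using complex_differentiable_onD(2)[OF assms(1) x] complex_differentiable_onD(2)[OF assms(2) x]
    by (simp add: vec_eq_iff algebra_simps)
qed

lemma complex_differentiable_on_vjoin:
  assumes "complex_differentiable_on S f" "complex_differentiable_on S g"
  shows "complex_differentiable_on S (\<lambda>x. vjoin (f x) (g x))"
proof (rule complex_differentiable_onI)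
  fix x assume x: "x \<in> S"
  show "((\<lambda>x. vjoin (f x) (g x)) has_derivative
     (\<lambda>v. vjoin (frechet_derivative f (at x) v) (frechet_derivative g (at x) v))) (at x)"
    by (rule has_derivative_vjoin[OF complex_differentiable_onD(1)[OF assms(1) x] complex_differentiable_onD(1)[OF assms(2) x]])
  show "vjoin (frechet_derivative f (at x) (a *s v)) (frechet_derivative g (at x) (a *s v))
     = a *s vjoin (frechet_derivative f (at x) v) (frechet_derivative g (at x) v)" for a v
    using complex_differentiable_onD(2)[OF assms(1) x] complex_differentiable_onD(2)[OF assms(2) x]
    by (simp add: vjoin_smult)
qed

text \<open>In the complex basis the derivative is a sum of coordinates of \<open>vsnd z\<close>
  times directional derivatives of \<open>\<kappa>\<close>, and those are holomorphic by
  \<open>complex_differentiable_on_deriv\<close>. Such maps are the transition maps of the tangent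
  bundle.\<close>

lemma complex_differentiable_on_tangent_map:
  fixes \<kappa> :: "complex^'m::finite \<Rightarrow> complex^'k::finite"
  assumes "complex_differentiable_on S \<kappa>" "open S"
  shows "complex_differentiable_on (vfst -` S) (\<lambda>z. vjoin (\<kappa> (vfst z)) (frechet_derivative \<kappa> (at (vfst z)) (vsnd z)))"
proof (rule complex_differentiable_on_vjoin)
  have v1: "complex_differentiable_on (vfst -` S) vfst" and v2: "complex_differentiable_on (vfst -` S) vsnd"
    by (auto intro!: complex_differentiable_on_linear bounded_linear_vfst bounded_linear_vsnd vfst_smult vsnd_smult)
  have im: "vfst ` vfst -` S \<subseteq> S" by blast
  show "complex_differentiable_on (vfst -` S) (\<lambda>z. \<kappa> (vfst z))"
    by (rule complex_differentiable_on_compose[OF v1 assms(1) im])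
  have "complex_differentiable_on (vfst -` S) (\<lambda>z. \<Sum>j\<in>UNIV. (vsnd z $ j) *s frechet_derivative \<kappa> (at (vfst z)) (axis j 1))"
    by (intro complex_differentiable_on_sum complex_differentiable_on_nth_smult v2
        complex_differentiable_on_compose[OF v1 complex_differentiable_on_deriv[OF assms] im])
  moreover have "(\<Sum>j\<in>UNIV. (vsnd z $ j) *s frechet_derivative \<kappa> (at (vfst z)) (axis j 1))
     = frechet_derivative \<kappa> (at (vfst z)) (vsnd z)" if "z \<in> vfst -` S" for z
  proof -
    have z: "vfst z \<in> S" using that by simp
    show ?thesis
      by (rule complex_linear_expand[OF has_derivative_linear[OF complex_differentiable_onD(1)[OF assms(1) z]]
          complex_differentiable_onD(2)[OF assms(1) z], symmetric])
  qed
  ultimately show "complex_differentiable_on (vfst -` S) (\<lambda>z. frechet_derivative \<kappa> (at (vfst z)) (vsnd z))"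
    by (rule complex_differentiable_on_cong_open[OF open_vfst_vimage[OF assms(2)], rotated])
qed

lemma charts_compatible_tangent:
  assumes A: "pre_manifold A" and cd: "c \<in> A" "d \<in> A"
  shows "charts_compatible (tangent_chart A c) (tangent_chart A d)"
proof -
  note ch = pre_manifoldD(1)[OF A cd(1)] pre_manifoldD(1)[OF A cd(2)] pre_manifoldD(2)[OF A cd]
  let ?U = "snd c ` (fst c \<inter> fst d)"
  have "fst (tangent_chart A c) \<inter> fst (tangent_chart A d) = (SIGMA p : fst c \<inter> fst d. tangent_space A p)"
    by (auto simp: fst_tangent_chart)
  then have im: "snd (tangent_chart A c) ` (fst (tangent_chart A c) \<inter> fst (tangent_chart A d)) = vfst -` ?U"
    using tangent_chart_image[OF A cd(1), of "fst c \<inter> fst d"] by simp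
  have o: "open (vfst -` ?U :: (complex^('b + 'b)) set)" by (rule open_vfst_vimage[OF charts_compatibleD(1)[OF ch(3)]])
  have "complex_differentiable_on (vfst -` ?U) (coord_rep (tangent_chart A c) (tangent_chart A d) id)"
  proof (rule complex_differentiable_on_cong_open[OF o _ complex_differentiable_on_tangent_map[OF charts_compatibleD(2,1)[OF ch(3)]]])
    fix z :: "complex^('b + 'b)" assume z: "z \<in> vfst -` ?U"
    then obtain e where e: "z = snd (tangent_chart A c) e" "e \<in> fst (tangent_chart A c)" "e \<in> fst (tangent_chart A d)"
      using im by blast
    then have p: "fst e \<in> fst c" "fst e \<in> fst d" "snd e \<in> tangent_space A (fst e)" by (auto simp: fst_tangent_chart)
    then have "snd e d = transition_deriv c d (fst e) (snd e c)"
      using tangent_spaceD(1)[OF _ cd] by blast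
    then show "vjoin (coord_rep c d id (vfst z)) (frechet_derivative (coord_rep c d id) (at (vfst z)) (vsnd z)) =
      coord_rep (tangent_chart A c) (tangent_chart A d) id z"
      unfolding e(1) coord_rep_chart[OF is_chart_tangent[OF A cd(1)] e(2)]
      using p ch by (simp add: snd_tangent_chart coord_rep_chart)
  qed
  then show ?thesis unfolding charts_compatible_def im using o by blast
qed

lemma pre_manifold_tangent: "pre_manifold A \<Longrightarrow> pre_manifold (tangent_atlas A)"
  unfolding pre_manifold_def[of "tangent_atlas A"]
  unfolding tangent_atlas_def ball_simps
  by (intro conjI ballI is_chart_tangent charts_compatible_tangent)

lemma tangent_chart_in: "c \<in> A \<Longrightarrow> tangent_chart A c \<in> tangent_atlas A"
  by (auto simp: tangent_atlas_def)

lemma points_tangent: "points (tangent_atlas A) = (SIGMA p : points A. tangent_space A p)"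
  unfolding points_def tangent_atlas_def by (auto simp: fst_tangent_chart)

lemma fibre_scale_tangent_space:
  assumes "pre_manifold A" "v \<in> tangent_space A p"
  shows "(\<lambda>c. l *s v c) \<in> tangent_space A p"
proof (rule tangent_spaceI)
  fix c d assume cd: "c \<in> A" "d \<in> A" "p \<in> fst c" "p \<in> fst d"
  show "l *s v d = transition_deriv c d p (l *s v c)"
    using transition_has_derivative(2)[OF pre_manifoldD(2)[OF assms(1) cd(1,2)] cd(3,4), of l "v c"]
      tangent_spaceD(1)[OF assms(2) cd] by simp
next
  show "l *s v c = 0" if "\<not> (c \<in> A \<and> p \<in> fst c)" for c
    using tangent_spaceD(2)[OF assms(2) that] by simp
qed

lemma fibre_scale_chart:
  assumes "pre_manifold A"
  shows "e \<in> fst (tangent_chart A c) \<Longrightarrow> fibre_scale l e \<in> fst (tangent_chart A c)"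
    and "snd (tangent_chart A c) (fibre_scale l e) = vjoin (snd c (fst e)) (l *s snd e c)"
  using fibre_scale_tangent_space[OF assms, of "snd e" "fst e" l]
  by (auto simp: fst_tangent_chart fibre_scale_def snd_tangent_chart)

lemma fibre_scale_inverse: "l \<noteq> 0 \<Longrightarrow> fibre_scale (inverse l) (fibre_scale l e) = e"
  by (simp add: fibre_scale_def vector_smult_assoc)

lemma openin_tangent_over:
  assumes A: "pre_manifold A" and U: "openin (atlas_topology A) U"
  shows "openin (atlas_topology (tangent_atlas A)) (SIGMA p : U. tangent_space A p)"
  unfolding openin_atlas_iff[OF pre_manifold_tangent[OF A]]
proof (intro conjI ballI)
  show "(SIGMA p : U. tangent_space A p) \<subseteq> points (tangent_atlas A)"
    using openin_subset[OF U] by (auto simp: points_tangent topspace_atlas)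
  fix e assume "e \<in> tangent_atlas A"
  then obtain c where c: "c \<in> A" "e = tangent_chart A c" by (auto simp: tangent_atlas_def)
  have "fst e \<inter> (SIGMA p : U. tangent_space A p) = (SIGMA p : fst c \<inter> U. tangent_space A p)"
    by (auto simp: c(2) fst_tangent_chart)
  then have "snd e ` (fst e \<inter> (SIGMA p : U. tangent_space A p)) = vfst -` (snd c ` (fst c \<inter> U))"
    using tangent_chart_image[OF A c(1), of "fst c \<inter> U"] c(2) by simp
  then show "open (snd e ` (fst e \<inter> (SIGMA p : U. tangent_space A p)))"
    using open_vfst_vimage[OF holomorphic_coordinates_open_image[OF chart_holomorphic_coordinates[OF A c(1)] U]] by simp
qed

lemma closedin_tangent_over:
  assumes A: "pre_manifold A" and Z: "closedin (atlas_topology A) Z"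
  shows "closedin (atlas_topology (tangent_atlas A)) (SIGMA p : Z. tangent_space A p)"
proof -
  have "openin (atlas_topology (tangent_atlas A)) (SIGMA p : points A - Z. tangent_space A p)"
    by (rule openin_tangent_over[OF A]) (use Z in \<open>auto simp: closedin_def topspace_atlas\<close>)
  moreover have "points (tangent_atlas A) - (SIGMA p : Z. tangent_space A p) = (SIGMA p : points A - Z. tangent_space A p)"
    by (auto simp: points_tangent)
  moreover have "(SIGMA p : Z. tangent_space A p) \<subseteq> points (tangent_atlas A)"
    using closedin_subset[OF Z] by (auto simp: points_tangent topspace_atlas)
  ultimately show ?thesis by (simp add: closedin_def topspace_atlas)
qed

text \<open>Fibrewise contraction pushes a compact set into any neighbourhood of the zero section.
  For a base ball of radius \<open>r / 2\<close> times a fibre ball of radius \<open>M\<close> the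
  threshold is \<open>2 * M / r\<close>, and finitely many such boxes cover \<open>K\<close>. This
  keeps pulled-back test forms near the diagonal.\<close>

lemma compact_tangent_shrinks:
  assumes A: "pre_manifold A" and K: "compactin (atlas_topology (tangent_atlas A)) K"
    and W: "openin (atlas_topology (tangent_atlas A)) W" "\<And>p. p \<in> points A \<Longrightarrow> (p, \<lambda>c. 0) \<in> W"
  obtains R where "\<And>l e. R < cmod l \<Longrightarrow> fibre_scale l e \<in> K \<Longrightarrow> e \<in> W"
proof -
  let ?T = "atlas_topology (tangent_atlas A)"
  have pt: "pre_manifold (tangent_atlas A)" by (rule pre_manifold_tangent[OF A])
  have "\<exists>U R. openin ?T U \<and> k \<in> U \<and> R \<ge> 0 \<and> (\<forall>l e. R < cmod l \<longrightarrow> fibre_scale l e \<in> U \<longrightarrow> e \<in> W)" if k: "k \<in> K" for k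
  proof -
    have "k \<in> points (tangent_atlas A)" using compactin_subset_topspace[OF K] k by (auto simp: topspace_atlas)
    then obtain c where c: "c \<in> A" "k \<in> fst (tangent_chart A c)" unfolding points_def tangent_atlas_def by blast
    let ?c = "tangent_chart A c"
    have ch: "is_chart ?c" by (rule is_chart_tangent[OF A c(1)])
    have p: "fst k \<in> fst c" using c(2) by (auto simp: fst_tangent_chart)
    then have "fst k \<in> points A" using chart_subset_points[OF c(1)] by blast
    from W(2)[OF this] have "(fst k, \<lambda>c. 0) \<in> fst ?c \<inter> W"
      using p zero_tangent[OF A, of "fst k"] by (auto simp: fst_tangent_chart)
    then have "snd ?c (fst k, \<lambda>c. 0) \<in> snd ?c ` (fst ?c \<inter> W)" by (rule imageI)
    moreover have "open (snd ?c ` (fst ?c \<inter> W))"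
      by (rule holomorphic_coordinates_open_image[OF chart_holomorphic_coordinates[OF pt tangent_chart_in[OF c(1)]] W(1)])
    moreover have "snd ?c (fst k, \<lambda>c. 0) = vjoin (snd c (fst k)) 0" by (simp add: snd_tangent_chart)
    ultimately obtain r where r: "r > 0" "ball (vjoin (snd c (fst k)) 0) r \<subseteq> snd ?c ` (fst ?c \<inter> W)"
      by (metis openE)
    define M where "M = norm (snd k c) + 1"
    have M: "M > 0" by (simp add: M_def add_nonneg_pos)
    define U where "U = fst ?c \<inter> snd ?c -` (vfst -` ball (snd c (fst k)) (r/2) \<inter> vsnd -` ball 0 M)"
    have oU: "openin ?T U" unfolding U_def
      by (rule openin_atlas_basic[OF tangent_chart_in[OF c(1)]])
        (use open_vfst_vimage[OF open_ball] open_vsnd_vimage[OF open_ball] in blast)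
    have kU: "k \<in> U" using c(2) r(1) by (auto simp: U_def snd_tangent_chart M_def)
    have "e \<in> W" if l: "2 * M / r < cmod l" and e: "fibre_scale l e \<in> U" for l e
    proof -
      have l0: "l \<noteq> 0" "cmod l > 0" using l M r(1) by (auto simp: field_simps intro: less_trans[of 0 "2 * M / r"])
      have e1: "fibre_scale l e \<in> fst ?c" "dist (snd c (fst k)) (snd c (fst e)) < r / 2" "norm (l *s snd e c) < M"
        using e unfolding U_def by (auto simp: fibre_scale_chart(2)[OF A])
      have ec: "e \<in> fst ?c" using fibre_scale_chart(1)[OF A e1(1), of "inverse l"] fibre_scale_inverse[OF l0(1)] by metis
      have "cmod l * norm (snd e c) < M" using e1(3) by (simp add: norm_smult_complex)
      then have "norm (snd e c) < M / cmod l" using l0 by (simp add: field_simps)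
      also have "M / cmod l \<le> r / 2" using l l0 r(1) by (simp add: field_simps)
      finally have n: "norm (snd e c) < r / 2" .
      have "dist (vjoin (snd c (fst k)) 0) (snd ?c e) = norm (vjoin (snd c (fst k) - snd c (fst e)) (0 - snd e c))"
        by (simp only: vjoin_diff dist_norm snd_tangent_chart)
      also have "\<dots> \<le> norm (snd c (fst k) - snd c (fst e)) + norm (0 - snd e c)" by (rule norm_vjoin_le)
      also have "\<dots> < r" using e1(2) n by (simp add: dist_norm)
      finally have "snd ?c e \<in> snd ?c ` (fst ?c \<inter> W)" using r(2) by auto
      then show "e \<in> W" using chart_image_mem_iff[OF ch ec, of "fst ?c \<inter> W"] by blast
    qed
    then show ?thesis using oU kU M r(1)
      by (intro exI[of _ U] exI[of _ "2 * M / r"]) auto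
  qed
  then obtain U R where U: "\<And>k. k \<in> K \<Longrightarrow> openin ?T (U k)" "\<And>k. k \<in> K \<Longrightarrow> k \<in> U k" "\<And>k. k \<in> K \<Longrightarrow> R k \<ge> (0::real)"
    "\<And>k l e. k \<in> K \<Longrightarrow> R k < cmod l \<Longrightarrow> fibre_scale l e \<in> U k \<Longrightarrow> e \<in> W" by metis
  have "\<exists>\<F>. finite \<F> \<and> \<F> \<subseteq> U ` K \<and> K \<subseteq> \<Union>\<F>"
    by (rule compactinD[OF K]) (use U(1,2) in blast)+
  then obtain F where F: "finite F" "F \<subseteq> K" "K \<subseteq> \<Union>(U ` F)"
    by (metis finite_subset_image)
  show thesis
  proof (rule that[of "Max (insert 0 (R ` F))"])
    fix l e assume l: "Max (insert 0 (R ` F)) < cmod l" and e: "fibre_scale l e \<in> K"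
    obtain k where k: "k \<in> F" "fibre_scale l e \<in> U k" using F(3) e by blast
    have "R k \<le> Max (insert 0 (R ` F))" using F(1) k(1) by (intro Max_ge) auto
    then show "e \<in> W" using U(4)[of k l e] k F(2) l by force
  qed
qed

section \<open>Partitions of unity\<close>

definition smooth_function :: "('a, 'm::finite) chart set \<Rightarrow> ('a \<Rightarrow> real) \<Rightarrow> bool" where
  "smooth_function A \<psi> \<longleftrightarrow> (\<forall>c\<in>A. smooth_on (chart_image c) (\<lambda>x. \<psi> (chart_inv c x)))"

definition chart_bump :: "('a, 'm::finite) chart \<Rightarrow> complex^'m \<Rightarrow> real \<Rightarrow> 'a \<Rightarrow> real" where
  "chart_bump c a r x = (if x \<in> fst c then bump a r (snd c x) else 0)"

text \<open>Outside the chart the bump has to vanish near each point and not only at it. The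
  preimage of the closed ball is compact, hence closed by the Hausdorff property, and the bump is 0
  on its open complement.\<close>

lemma smooth_function_chart_bump:
  fixes A :: "('a, 'm::finite) chart set"
  assumes A: "pre_manifold A" and H: "Hausdorff_space (atlas_topology A)" and c: "c \<in> A"
    and r: "0 < r" "cball a r \<subseteq> chart_image c"
  shows "smooth_function A (chart_bump c a r)"
  unfolding smooth_function_def
proof
  fix d assume d: "d \<in> A"
  note ch = pre_manifoldD(1)[OF A c] pre_manifoldD(1)[OF A d] pre_manifoldD(2)[OF A d c]
  define Z where "Z = chart_inv c ` cball a r"
  have "compactin (atlas_topology A) Z"
    unfolding Z_def by (rule compactin_chart_inv_image[OF chart_holomorphic_coordinates[OF A c] compact_cball r(2)])
  then have Z: "openin (atlas_topology A) (points A - Z)"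
    using compactin_imp_closedin[OF H] by (simp add: closedin_def topspace_atlas)
  show "smooth_on (chart_image d) (\<lambda>x. chart_bump c a r (chart_inv d x))"
  proof (rule smooth_on_local)
    fix x assume "x \<in> chart_image d"
    then obtain q where q: "q \<in> fst d" "x = snd d q" by blast
    show "\<exists>T. x \<in> T \<and> smooth_on T (\<lambda>x. chart_bump c a r (chart_inv d x))"
    proof (cases "q \<in> fst c")
      case True
      let ?T = "snd d ` (fst d \<inter> fst c)"
      have o: "open ?T" by (rule charts_compatibleD(1)[OF ch(3)])
      have "smooth_on ?T (\<lambda>x. bump a r (coord_rep d c id x))"
        by (rule smooth_on_compose[OF o open_UNIV _ holomorphic_imp_smooth_on[OF charts_compatibleD(2,1)[OF ch(3)]] smooth_on_bump[OF open_UNIV]]) simp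
      then have "smooth_on ?T (\<lambda>x. chart_bump c a r (chart_inv d x))"
      proof (rule smooth_on_cong_open[OF o, rotated])
        fix y assume "y \<in> ?T"
        then obtain p where "p \<in> fst d" "p \<in> fst c" "y = snd d p" by blast
        then show "bump a r (coord_rep d c id y) = chart_bump c a r (chart_inv d y)"
          using coord_rep_chart[OF ch(2), of p c id] chart_inv_chart[OF ch(2), of p] by (simp add: chart_bump_def)
      qed
      moreover have "x \<in> ?T" using q True by blast
      ultimately show ?thesis by metis
    next
      case False
      let ?T = "snd d ` (fst d \<inter> (points A - Z))"
      have o: "open ?T" by (rule holomorphic_coordinates_open_image[OF chart_holomorphic_coordinates[OF A d] Z])
      have "smooth_on ?T (\<lambda>x. chart_bump c a r (chart_inv d x))"
      proof (rule smooth_on_cong_open[OF o _ smooth_on_const[OF o, of 0]])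
        fix y assume "y \<in> ?T"
        then obtain p where p: "p \<in> fst d" "p \<notin> Z" "y = snd d p" by blast
        have "p \<notin> fst c \<or> r \<le> dist a (snd c p)"
        proof (rule ccontr)
          assume "\<not> ?thesis"
          then have "snd c p \<in> cball a r" "p \<in> fst c" by auto
          then have "p \<in> Z" unfolding Z_def using chart_inv_chart[OF ch(1), of p] by (metis imageI)
          then show False using p by simp
        qed
        then show "0 = chart_bump c a r (chart_inv d y)"
          using p chart_inv_chart[OF ch(2), of p] bump_zero[OF r(1), of a "snd c p"] by (auto simp: chart_bump_def)
      qed
      moreover have "q \<notin> Z" using False chart_inv_in[of _ c] r(2) unfolding Z_def by blast
      then have "x \<in> ?T" using q chart_subset_points[OF d] by blast
      ultimately show ?thesis by metis
    qed
  qed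
qed

text \<open>Bumps divided by the sum of finitely many whose positivity sets cover the compact space.
  The indices are points, so \<open>W\<close> may be any choice of neighbourhoods, and
  \<open>Z p\<close> is the preimage of a closed ball inside \<open>W p\<close>.\<close>

lemma partition_of_unity:
  fixes A :: "('a, 'm::finite) chart set"
  assumes A: "pre_manifold A" and H: "Hausdorff_space (atlas_topology A)" and K: "compact_space (atlas_topology A)"
    and W: "\<And>p. p \<in> points A \<Longrightarrow> openin (atlas_topology A) (W p)" "\<And>p. p \<in> points A \<Longrightarrow> p \<in> W p"
  obtains P \<psi> Z where "finite P" "P \<subseteq> points A" "\<And>p. p \<in> P \<Longrightarrow> smooth_function A (\<psi> p)"
    "\<And>p. p \<in> P \<Longrightarrow> compactin (atlas_topology A) (Z p)" "\<And>p. p \<in> P \<Longrightarrow> Z p \<subseteq> W p"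
    "\<And>p x. p \<in> P \<Longrightarrow> x \<in> points A \<Longrightarrow> x \<notin> Z p \<Longrightarrow> \<psi> p x = 0"
    "\<And>x. x \<in> points A \<Longrightarrow> (\<Sum>p\<in>P. \<psi> p x) = 1"
    "\<And>p x. p \<in> P \<Longrightarrow> 0 \<le> \<psi> p x"
proof -
  have "\<exists>c r. c \<in> A \<and> p \<in> fst c \<and> 0 < r \<and> cball (snd c p) r \<subseteq> snd c ` (fst c \<inter> W p)" if p: "p \<in> points A" for p
  proof -
    obtain c where c: "c \<in> A" "p \<in> fst c" using p unfolding points_def by blast
    have "open (snd c ` (fst c \<inter> W p))"
      by (rule holomorphic_coordinates_open_image[OF chart_holomorphic_coordinates[OF A c(1)] W(1)[OF p]])
    moreover have "snd c p \<in> snd c ` (fst c \<inter> W p)" using c W(2)[OF p] by blast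
    ultimately obtain r where "r > 0" "cball (snd c p) r \<subseteq> snd c ` (fst c \<inter> W p)"
      using open_contains_cball by metis
    then show ?thesis using c by blast
  qed
  then obtain c r where cr: "\<And>p. p \<in> points A \<Longrightarrow> c p \<in> A" "\<And>p. p \<in> points A \<Longrightarrow> p \<in> fst (c p)"
    "\<And>p. p \<in> points A \<Longrightarrow> 0 < r p"
    "\<And>p. p \<in> points A \<Longrightarrow> cball (snd (c p) p) (r p) \<subseteq> snd (c p) ` (fst (c p) \<inter> W p)" by metis
  define \<beta> where "\<beta> p = chart_bump (c p) (snd (c p) p) (r p)" for p
  define Z where "Z p = chart_inv (c p) ` cball (snd (c p) p) (r p)" for p
  define V where "V p = fst (c p) \<inter> snd (c p) -` ball (snd (c p) p) (r p)" for p
  have \<beta>_nonneg: "0 \<le> \<beta> p x" for p x by (simp add: \<beta>_def chart_bump_def bump_nonneg)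
  have \<beta>_pos: "0 < \<beta> p x" if "p \<in> points A" "x \<in> V p" for p x
    using that(2) bump_pos_iff[OF cr(3)[OF that(1)], of "snd (c p) p" "snd (c p) x"]
    by (simp add: \<beta>_def chart_bump_def V_def)
  have sub: "cball (snd (c p) p) (r p) \<subseteq> chart_image (c p)" if "p \<in> points A" for p
    using cr(4)[OF that] by blast
  have \<beta>_smooth: "smooth_function A (\<beta> p)" if "p \<in> points A" for p
    unfolding \<beta>_def by (rule smooth_function_chart_bump[OF A H cr(1,3)[OF that] sub[OF that]])
  have V_open: "openin (atlas_topology A) (V p)" if "p \<in> points A" for p
    unfolding V_def by (rule openin_atlas_basic[OF cr(1)[OF that] open_ball])
  have pV: "p \<in> V p" if "p \<in> points A" for p using cr(2,3)[OF that] by (simp add: V_def)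
  have Z_compact: "compactin (atlas_topology A) (Z p)" if "p \<in> points A" for p
    unfolding Z_def
    by (rule compactin_chart_inv_image[OF chart_holomorphic_coordinates[OF A cr(1)[OF that]] compact_cball sub[OF that]])
  have Z_sub: "Z p \<subseteq> W p" if pA: "p \<in> points A" for p
  proof
    fix x assume "x \<in> Z p"
    then obtain y where y: "y \<in> cball (snd (c p) p) (r p)" "x = chart_inv (c p) y" unfolding Z_def by blast
    then obtain q where "q \<in> fst (c p)" "q \<in> W p" "y = snd (c p) q" using cr(4)[OF pA] by blast
    then show "x \<in> W p" using y(2) chart_inv_chart[OF pre_manifoldD(1)[OF A cr(1)[OF pA]]] by simp
  qed
  have \<beta>_zero: "\<beta> p x = 0" if p: "p \<in> points A" and x: "x \<notin> Z p" for p x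
  proof (cases "x \<in> fst (c p)")
    case True
    have "snd (c p) x \<notin> cball (snd (c p) p) (r p)"
      using x chart_inv_chart[OF pre_manifoldD(1)[OF A cr(1)[OF p]] True] unfolding Z_def by (metis imageI)
    then show ?thesis using bump_zero[OF cr(3)[OF p], of "snd (c p) p" "snd (c p) x"] by (simp add: \<beta>_def chart_bump_def)
  qed (simp add: \<beta>_def chart_bump_def)
  have "compactin (atlas_topology A) (points A)" using K by (simp add: compact_space_def topspace_atlas)
  then have "\<exists>\<F>. finite \<F> \<and> \<F> \<subseteq> V ` points A \<and> points A \<subseteq> \<Union>\<F>"
    by (rule compactinD) (use V_open pV in blast)+
  then obtain P where P: "finite P" "P \<subseteq> points A" "points A \<subseteq> \<Union>(V ` P)"
    by (metis finite_subset_image)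
  define s where "s x = (\<Sum>p\<in>P. \<beta> p x)" for x
  have s_pos: "0 < s x" if x: "x \<in> points A" for x
  proof -
    obtain p where p: "p \<in> P" "x \<in> V p" using P(3) x by blast
    have "0 < \<beta> p x" using \<beta>_pos[OF _ p(2)] P(2) p(1) by blast
    also have "\<beta> p x \<le> s x" unfolding s_def by (rule member_le_sum[OF p(1)]) (use P(1) \<beta>_nonneg in auto)
    finally show ?thesis .
  qed
  have smooth: "smooth_function A (\<lambda>x. \<beta> p x * inverse (s x))" if p: "p \<in> P" for p
    unfolding smooth_function_def
  proof
    fix d assume d: "d \<in> A"
    have o: "open (chart_image d)" by (rule chart_image_open[OF pre_manifoldD(1)[OF A d]])
    have sm: "smooth_on (chart_image d) (\<lambda>x. \<beta> p (chart_inv d x))" if "p \<in> P" for p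
      using \<beta>_smooth[of p] P(2) that d unfolding smooth_function_def by blast
    have "smooth_on (chart_image d) (\<lambda>x. s (chart_inv d x))"
      unfolding s_def by (rule smooth_on_sum[OF o sm])
    then have "smooth_on (chart_image d) (\<lambda>x. inverse (s (chart_inv d x)))"
    proof (rule smooth_on_inverse[OF o, rotated])
      fix x assume "x \<in> chart_image d"
      then have "chart_inv d x \<in> points A" using chart_inv_in[of x d] chart_subset_points[OF d] by blast
      then show "s (chart_inv d x) \<noteq> 0" using s_pos by fastforce
    qed
    then show "smooth_on (chart_image d) (\<lambda>x. \<beta> p (chart_inv d x) * inverse (s (chart_inv d x)))"
      by (rule smooth_on_bilinear[OF bounded_bilinear_mult o sm[OF p]])
  qed
  show thesis
  proof (rule that[of P "\<lambda>p x. \<beta> p x * inverse (s x)" Z])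
    show "(\<Sum>p\<in>P. \<beta> p x * inverse (s x)) = 1" if "x \<in> points A" for x
      using s_pos[OF that] by (simp add: s_def flip: sum_distrib_right)
    show "0 \<le> \<beta> p x * inverse (s x)" for p x
      using \<beta>_nonneg by (simp add: s_def sum_nonneg)
    show "\<beta> p x * inverse (s x) = 0" if "p \<in> P" "x \<in> points A" "x \<notin> Z p" for p x
      using \<beta>_zero[of p x] P(2) that by auto
    show "Z p \<subseteq> W p" "compactin (atlas_topology A) (Z p)" if "p \<in> P" for p
      using Z_sub Z_compact P(2) that by blast+
  qed (use P(1,2) smooth in blast)+
qed

section \<open>Inverses of smooth maps\<close>

lemma linear_expand:
  fixes D :: "'v::euclidean_space \<Rightarrow> 'w::real_normed_vector"
  assumes "linear D"
  shows "(\<Sum>b\<in>Basis. (v \<bullet> b) *\<^sub>R D b) = D v"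
  using linear_sum[OF assms, of "\<lambda>b. (v \<bullet> b) *\<^sub>R b" Basis] linear_cmul[OF assms]
  by (simp add: euclidean_representation)

lemma Ck_on_linear_apply:
  fixes D :: "'u::real_normed_vector \<Rightarrow> 'v::euclidean_space \<Rightarrow> 'w::real_normed_vector"
  assumes S: "open S" and D: "\<And>b. b \<in> Basis \<Longrightarrow> Ck_on k S (\<lambda>x. D x b)" "\<And>x. x \<in> S \<Longrightarrow> linear (D x)"
    and v: "Ck_on k S v"
  shows "Ck_on k S (\<lambda>x. D x (v x))"
proof (rule Ck_on_cong_open[OF S])
  show "Ck_on k S (\<lambda>x. \<Sum>b\<in>Basis. (v x \<bullet> b) *\<^sub>R D x b)"
    by (rule Ck_on_sum[OF S], rule Ck_on_bilinear[OF bounded_bilinear_scaleR S])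
      (rule Ck_on_linear_compose[OF bounded_linear_inner_left S v], rule D(1))
qed (rule linear_expand[OF D(2)])

lemma smooth_on_apply_deriv:
  fixes f :: "'v::euclidean_space \<Rightarrow> 'w::real_normed_vector" and g :: "'u::real_normed_vector \<Rightarrow> 'v"
  assumes S: "open S" and T: "open T" and g: "g ` S \<subseteq> T" "smooth_on S g" and f: "smooth_on T f" and v: "smooth_on S v"
  shows "smooth_on S (\<lambda>x. frechet_derivative f (at (g x)) (v x))"
proof (rule smooth_onI, rule Ck_on_linear_apply[OF S _ _ smooth_onD[OF v]])
  show "Ck_on k S (\<lambda>x. frechet_derivative f (at (g x)) b)" for k b
    by (rule smooth_onD, rule smooth_on_compose[OF S T g smooth_on_deriv[OF f]])
  show "linear (frechet_derivative f (at (g x)))" if "x \<in> S" for x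
    by (rule has_derivative_linear[OF smooth_on_has_derivative[OF f]]) (use g that in blast)
qed

text \<open>Differentiability of the inverse of the derivative comes from the inverse function theorem,
  applied to the tangent map \<open>(x, v) \<mapsto> (f x, Df(x) v)\<close>.\<close>

lemma smooth_on_inv_into:
  fixes f :: "'v::euclidean_space \<Rightarrow> 'v"
  assumes U: "open U" and f: "smooth_on U f" and inj: "inj_on f U"
    and Dinj: "\<And>x. x \<in> U \<Longrightarrow> inj (frechet_derivative f (at x))"
  shows "open (f ` U)" "smooth_on (f ` U) (inv_into U f)"
proof -
  have contf: "continuous_on U f" by (rule smooth_on_imp_continuous_on[OF f])
  show o: "open (f ` U)" by (rule invariance_of_domain[OF contf U inj])
  define \<sigma> where "\<sigma> = inv_into U f"
  have \<sigma>f: "\<sigma> (f x) = x" if "x \<in> U" for x using inj that by (simp add: \<sigma>_def)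
  have \<sigma>U: "\<sigma> ` f ` U \<subseteq> U" using \<sigma>f by auto
  let ?D = "\<lambda>x. frechet_derivative f (at x)"
  have Df: "(f has_derivative ?D x) (at x)" if "x \<in> U" for x by (rule smooth_on_has_derivative[OF f that])
  have lin: "linear (?D x)" if "x \<in> U" for x by (rule has_derivative_linear[OF Df[OF that]])
  define Ai where "Ai y = inv (?D (\<sigma> y))" for y
  have bijD: "bij (?D x)" if "x \<in> U" for x
    using lin[OF that] Dinj[OF that] linear_injective_imp_surjective[of "?D x"] by (simp add: bij_def)
  have DAi: "?D (\<sigma> y) (Ai y v) = v" and AiD: "Ai y (?D (\<sigma> y) v) = v" if "y \<in> f ` U" for y v
  proof -
    have "\<sigma> y \<in> U" using \<sigma>U that by blast
    from bijD[OF this] show "?D (\<sigma> y) (Ai y v) = v" "Ai y (?D (\<sigma> y) v) = v"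
      unfolding Ai_def by (simp_all add: bij_is_surj surj_f_inv_f bij_is_inj)
  qed
  have linAi: "linear (Ai y)" if "y \<in> f ` U" for y
    unfolding Ai_def by (rule inj_linear_imp_inv_linear) (use lin Dinj \<sigma>U that in blast)+
  have D\<sigma>: "(\<sigma> has_derivative Ai y) (at y)" if y: "y \<in> f ` U" for y
  proof -
    obtain x where x: "x \<in> U" "y = f x" using y by blast
    show ?thesis unfolding x(2)
      by (rule has_derivative_inverse_strong[OF U x(1) contf \<sigma>f Df[OF x(1)]])
        (use DAi[OF y] \<sigma>f x in \<open>auto simp: fun_eq_iff\<close>)
  qed
  \<comment> \<open>The second derivative of \<open>f\<close> at \<open>x\<close> in the directions
    \<open>u\<close> and \<open>v\<close>, expanded in the entries of \<open>v\<close>, so that only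
    derivatives of the maps \<open>\<lambda>x. ?D x b\<close> occur.\<close>
  define Q where "Q x v u = (\<Sum>b\<in>Basis. (v \<bullet> b) *\<^sub>R frechet_derivative (\<lambda>x. ?D x b) (at x) u)" for x v u
  have linQ: "linear (Q x v)" if "x \<in> U" for x v
    unfolding Q_def
    by (intro linear_compose_sum ballI linear_compose_scale_right
        has_derivative_linear[OF smooth_on_has_derivative[OF smooth_on_deriv[OF f] that]])
  have DAi_deriv: "((\<lambda>y. Ai y w) has_derivative (\<lambda>a. - Ai y (Q (\<sigma> y) (Ai y w) (Ai y a)))) (at y)"
    if y: "y \<in> f ` U" for y w
  proof -
    define T where "T = (\<lambda>(x, v). (f x, ?D x v))"
    define S where "S = (\<lambda>(y, w). (\<sigma> y, Ai y w))"
    have x: "\<sigma> y \<in> U" "f (\<sigma> y) = y" using y \<sigma>f by auto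
    have DT: "(T has_derivative (\<lambda>(u, w). (?D x u, Q x v u + ?D x w))) (at (x, v))" if "x \<in> U" for x v
    proof -
      have 1: "((\<lambda>p. f (fst p)) has_derivative (\<lambda>p. ?D x (fst p))) (at (x, v))"
        by (rule has_derivative_compose[OF has_derivative_fst[OF has_derivative_ident]]) (simp add: Df[OF that])
      have 2: "((\<lambda>p. \<Sum>b\<in>Basis. (snd p \<bullet> b) *\<^sub>R ?D (fst p) b) has_derivative
          (\<lambda>p. \<Sum>b\<in>Basis. (v \<bullet> b) *\<^sub>R frechet_derivative (\<lambda>x. ?D x b) (at x) (fst p) + (snd p \<bullet> b) *\<^sub>R ?D x b)) (at (x, v))"
      proof (rule has_derivative_sum)
        fix b :: 'v
        have d1: "((\<lambda>p. ?D (fst p) b) has_derivative (\<lambda>p. frechet_derivative (\<lambda>x. ?D x b) (at x) (fst p))) (at (x, v))"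
          by (rule has_derivative_compose[OF has_derivative_fst[OF has_derivative_ident]])
            (simp add: smooth_on_has_derivative[OF smooth_on_deriv[OF f] that])
        have d2: "((\<lambda>p. snd p \<bullet> b) has_derivative (\<lambda>p. snd p \<bullet> b)) (at (x, v))"
          by (auto intro!: derivative_eq_intros)
        show "((\<lambda>p. (snd p \<bullet> b) *\<^sub>R ?D (fst p) b) has_derivative
          (\<lambda>p. (v \<bullet> b) *\<^sub>R frechet_derivative (\<lambda>x. ?D x b) (at x) (fst p) + (snd p \<bullet> b) *\<^sub>R ?D x b)) (at (x, v))"
          using has_derivative_scaleR[OF d2 d1] by simp
      qed
      have 3: "(\<Sum>b\<in>Basis. (v \<bullet> b) *\<^sub>R frechet_derivative (\<lambda>x. ?D x b) (at x) (fst p) + (snd p \<bullet> b) *\<^sub>R ?D x b)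
         = Q x v (fst p) + ?D x (snd p)" for p
        using linear_expand[OF lin[OF that], of "snd p"] by (simp add: Q_def sum.distrib)
      have 4: "((\<lambda>p. ?D (fst p) (snd p)) has_derivative (\<lambda>p. Q x v (fst p) + ?D x (snd p))) (at (x, v))"
      proof (rule has_derivative_transform_within_open[OF 2[unfolded 3] open_Times[OF U open_UNIV]])
        show "(x, v) \<in> U \<times> UNIV" using that by simp
        show "(\<Sum>b\<in>Basis. (snd p \<bullet> b) *\<^sub>R ?D (fst p) b) = ?D (fst p) (snd p)" if "p \<in> U \<times> UNIV" for p
          by (rule linear_expand[OF lin]) (use that in auto)
      qed
      show ?thesis using has_derivative_Pair[OF 1 4] unfolding T_def by (simp add: case_prod_unfold)
    qed
    \<comment> \<open>The inverse of the derivative of \<open>T\<close>, a triangular system: the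
      first line determines the base direction, which is substituted into the second line before
      that is solved.\<close>
    define G where "G = (\<lambda>(a, b). (Ai y a, Ai y (b - Q (\<sigma> y) (Ai y w) (Ai y a))))"
    have "(S has_derivative G) (at (T (\<sigma> y, Ai y w)))"
    proof (rule has_derivative_inverse_strong[OF open_Times[OF U open_UNIV] _ _ _ DT[OF x(1)]])
      show "(\<sigma> y, Ai y w) \<in> U \<times> UNIV" using x by simp
      show "continuous_on (U \<times> UNIV) T"
        by (rule continuous_at_imp_continuous_on) (use DT has_derivative_continuous in fastforce)
      show "S (T p) = p" if p: "p \<in> U \<times> UNIV" for p
        using AiD[of "f (fst p)" "snd p"] \<sigma>f[of "fst p"] p by (auto simp: S_def T_def)
      show "(\<lambda>(u, wa). (?D (\<sigma> y) u, Q (\<sigma> y) (Ai y w) u + ?D (\<sigma> y) wa)) \<circ> G = id"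
        using DAi[OF y] by (auto simp: fun_eq_iff G_def)
    qed
    moreover have "T (\<sigma> y, Ai y w) = (y, w)" using x DAi[OF y] by (simp add: T_def)
    ultimately have "(S has_derivative G) (at (y, w))" by simp
    then have "((\<lambda>a. S (a, w)) has_derivative (\<lambda>a. G (a, 0))) (at y)"
      by (rule has_derivative_compose[OF has_derivative_Pair[OF has_derivative_ident has_derivative_const]])
    from has_derivative_snd[OF this] show ?thesis
      using linear_neg[OF linAi[OF y]] by (simp add: S_def G_def)
  qed
  \<comment> \<open>Both statements must be proved together: the derivative of
    \<open>\<sigma>\<close> is \<open>Ai\<close>, and the derivative of \<open>Ai\<close> is
    expressed through \<open>\<sigma>\<close> and \<open>Ai\<close> again.\<close>
  have "Ck_on k (f ` U) \<sigma> \<and> (\<forall>w. Ck_on k (f ` U) (\<lambda>y. Ai y w))" for k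
  proof (induction k)
    case (Suc k)
    have Q: "Ck_on k (f ` U) (\<lambda>y. Q (\<sigma> y) (Ai y w) (Ai y v))" for w v
      unfolding Q_def
    proof (rule Ck_on_sum[OF o], rule Ck_on_bilinear[OF bounded_bilinear_scaleR o])
      fix b :: 'v
      show "Ck_on k (f ` U) (\<lambda>y. Ai y w \<bullet> b)"
        by (rule Ck_on_linear_compose[OF bounded_linear_inner_left o]) (use Suc in blast)
      show "Ck_on k (f ` U) (\<lambda>y. frechet_derivative (\<lambda>x. ?D x b) (at (\<sigma> y)) (Ai y v))"
      proof (rule Ck_on_linear_apply[OF o, where D="\<lambda>y. frechet_derivative (\<lambda>x. ?D x b) (at (\<sigma> y))" and v="\<lambda>y. Ai y v"])
        show "Ck_on k (f ` U) (\<lambda>y. frechet_derivative (\<lambda>x. ?D x b) (at (\<sigma> y)) b')" for b'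
          by (rule Ck_on_compose[OF o U \<sigma>U conjunct1[OF Suc] smooth_onD[OF smooth_on_deriv[OF smooth_on_deriv[OF f]]]])
        show "linear (frechet_derivative (\<lambda>x. ?D x b) (at (\<sigma> y)))" if "y \<in> f ` U" for y
          by (rule has_derivative_linear[OF smooth_on_has_derivative[OF smooth_on_deriv[OF f]]]) (use that \<sigma>U in blast)
      qed (use Suc in blast)
    qed
    have "Ck_on (Suc k) (f ` U) \<sigma>"
      by (rule Ck_on_SucI[OF o D\<sigma>]) (use Suc in auto)
    moreover have "Ck_on (Suc k) (f ` U) (\<lambda>y. Ai y w)" for w
    proof (rule Ck_on_SucI[OF o DAi_deriv])
      show "Ck_on k (f ` U) (\<lambda>y. - Ai y (Q (\<sigma> y) (Ai y w) (Ai y v)))" for v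
        by (rule Ck_on_linear_compose[OF bounded_linear_minus[OF bounded_linear_ident] o],
            rule Ck_on_linear_apply[OF o _ linAi Q]) (use Suc in auto)
    qed
    ultimately show ?case by blast
  qed simp
  then show "smooth_on (f ` U) (inv_into U f)"
    unfolding \<sigma>_def[symmetric] by (intro smooth_onI) blast
qed

text \<open>Injectivity is assumed on all of \<open>N\<close>; openness of the image and smoothness
  of the inverse are then local and reduce to \<open>smooth_on_inv_into\<close> in charts. Equal
  dimensions make an injective derivative invertible.\<close>

lemma smooth_inverse_map:
  fixes A :: "('a, 'm::finite) chart set" and B :: "('b, 'm) chart set"
  assumes A: "pre_manifold A" and B: "pre_manifold B" and N: "openin (atlas_topology A) N" and inj: "inj_on f N"
    and loc: "\<And>p. p \<in> N \<Longrightarrow> \<exists>c\<in>A. \<exists>d\<in>B. \<exists>U. openin (atlas_topology A) U \<and> p \<in> U \<and> U \<subseteq> fst c \<inter> N \<and>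
       f ` U \<subseteq> fst d \<and> smooth_on (snd c ` U) (coord_rep c d f) \<and>
       (\<forall>x\<in>snd c ` U. inj (frechet_derivative (coord_rep c d f) (at x)))"
  shows "smooth_map A B N f" "openin (atlas_topology B) (f ` N)" "smooth_map B A (f ` N) (inv_into N f)"
proof -
  show "smooth_map A B N f"
    by (rule smooth_map_local[OF A B N]) (use loc in metis)
  have loc2: "\<exists>d\<in>B. \<exists>c\<in>A. \<exists>V. openin (atlas_topology B) V \<and> f p \<in> V \<and> V \<subseteq> fst d \<inter> f ` N \<and>
       inv_into N f ` V \<subseteq> fst c \<and> smooth_on (snd d ` V) (coord_rep d c (inv_into N f))" if p: "p \<in> N" for p
  proof -
    obtain c d U where U: "c \<in> A" "d \<in> B" "openin (atlas_topology A) U" "p \<in> U" "U \<subseteq> fst c \<inter> N"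
      "f ` U \<subseteq> fst d" "smooth_on (snd c ` U) (coord_rep c d f)"
      "\<And>x. x \<in> snd c ` U \<Longrightarrow> inj (frechet_derivative (coord_rep c d f) (at x))" using loc[OF p] by metis
    note ch = pre_manifoldD(1)[OF A U(1)] pre_manifoldD(1)[OF B U(2)]
    have "fst c \<inter> U = U" using U(5) by blast
    then have oU: "open (snd c ` U)"
      using holomorphic_coordinates_open_image[OF chart_holomorphic_coordinates[OF A U(1)] U(3)] by simp
    have cr: "coord_rep c d f (snd c q) = snd d (f q)" if "q \<in> U" for q
      by (rule coord_rep_chart[OF ch(1)]) (use U(5) that in blast)
    have inj': "inj_on (coord_rep c d f) (snd c ` U)"
    proof (rule inj_onI)
      fix x y assume "x \<in> snd c ` U" "y \<in> snd c ` U" and e: "coord_rep c d f x = coord_rep c d f y"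
      then obtain q q' where q: "x = snd c q" "y = snd c q'" "q \<in> U" "q' \<in> U" by blast
      then have "snd d (f q) = snd d (f q')" using e cr by simp
      then have "f q = f q'" using chart_eqD[OF ch(2)] U(6) q by blast
      then have "q = q'" using inj_onD[OF inj] U(5) q by blast
      then show "x = y" using q by simp
    qed
    note sm = smooth_on_inv_into[OF oU U(7) inj' U(8)]
    have im: "coord_rep c d f ` snd c ` U = snd d ` f ` U"
      using cr by (simp add: image_image)
    have oV: "open (snd d ` f ` U)" using sm(1) im by simp
    have V: "openin (atlas_topology B) (f ` U)"
    proof -
      have "f ` U = fst d \<inter> snd d -` (snd d ` f ` U)"
        using U(6) chart_image_mem_iff[OF ch(2) _ U(6)] by blast
      then show ?thesis using openin_atlas_basic[OF U(2) oV] by simp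
    qed
    have "smooth_on (snd d ` f ` U) (coord_rep d c (inv_into N f))"
    proof (rule smooth_on_cong_open[OF oV _ sm(2)[unfolded im]])
      fix y assume "y \<in> snd d ` f ` U"
      then obtain q where q: "q \<in> U" "y = snd d (f q)" by blast
      have "q \<in> N" "f q \<in> fst d" using U(5,6) q by blast+
      have "inv_into (snd c ` U) (coord_rep c d f) y = snd c q"
        using inv_into_f_f[OF inj', of "snd c q"] cr[OF q(1)] q by simp
      moreover have "coord_rep d c (inv_into N f) y = snd c q"
        using coord_rep_chart[OF ch(2) \<open>f q \<in> fst d\<close>, of c "inv_into N f"] inv_into_f_f[OF inj \<open>q \<in> N\<close>] q(2) by simp
      ultimately show "inv_into (snd c ` U) (coord_rep c d f) y = coord_rep d c (inv_into N f) y" by simp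
    qed
    moreover have "inv_into N f ` f ` U \<subseteq> fst c"
    proof -
      have "inv_into N f (f q) = q" if "q \<in> U" for q by (rule inv_into_f_f[OF inj]) (use U(5) that in blast)
      then show ?thesis using U(5) by auto
    qed
    moreover have "f ` U \<subseteq> fst d \<inter> f ` N" "f p \<in> f ` U" using U(4-6) by blast+
    ultimately show ?thesis using U(1,2) V by metis
  qed
  show fN: "openin (atlas_topology B) (f ` N)"
  proof (subst openin_subopen, intro ballI)
    fix y assume "y \<in> f ` N"
    then obtain p where p: "p \<in> N" "y = f p" by blast
    show "\<exists>T. openin (atlas_topology B) T \<and> y \<in> T \<and> T \<subseteq> f ` N"
      using loc2[OF p(1)] p(2) by (metis le_inf_iff)
  qed
  show "smooth_map B A (f ` N) (inv_into N f)"
  proof (rule smooth_map_local[OF B A fN])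
    fix y assume "y \<in> f ` N"
    then obtain p where p: "p \<in> N" "y = f p" by blast
    show "\<exists>c\<in>B. \<exists>d\<in>A. \<exists>U. openin (atlas_topology B) U \<and> y \<in> U \<and> U \<subseteq> fst c \<inter> f ` N \<and>
       inv_into N f ` U \<subseteq> fst d \<and> smooth_on (snd c ` U) (coord_rep c d (inv_into N f))"
      unfolding p(2) by (rule loc2[OF p(1)])
  qed
qed

section \<open>Existence of admissible maps\<close>

locale chart_gluing =
  fixes A :: "('a, 'm::finite) chart set" and P :: "'i set" and \<psi> :: "'i \<Rightarrow> 'a \<Rightarrow> real"
    and ch :: "'i \<Rightarrow> ('a, 'm) chart" and Z :: "'i \<Rightarrow> 'a set"
  assumes A: "pre_manifold A" and finP: "finite P"
    and \<psi>_smooth: "\<And>i. i \<in> P \<Longrightarrow> smooth_function A (\<psi> i)"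
    and ch_in: "\<And>i. i \<in> P \<Longrightarrow> ch i \<in> A"
    and Z_closed: "\<And>i. i \<in> P \<Longrightarrow> closedin (atlas_topology A) (Z i)"
    and Z_sub: "\<And>i. i \<in> P \<Longrightarrow> Z i \<subseteq> fst (ch i)"
    and \<psi>_zero: "\<And>i x. i \<in> P \<Longrightarrow> x \<in> points A \<Longrightarrow> x \<notin> Z i \<Longrightarrow> \<psi> i x = 0"
    and \<psi>_sum: "\<And>x. x \<in> points A \<Longrightarrow> (\<Sum>i\<in>P. \<psi> i x) = 1"
begin

text \<open>Differences of coordinates are transported to the tangent space at \<open>x\<close> before averaging; each of
  them has the identity as its derivative in \<open>y\<close> at \<open>y = x\<close>, and so has every average.\<close>

definition dvec :: "'a \<Rightarrow> 'a \<Rightarrow> ('a, 'm) tvec" where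
  "dvec x y = (\<lambda>e. if e \<in> A \<and> x \<in> fst e then
     \<Sum>i\<in>P. \<psi> i x *\<^sub>R transition_deriv (ch i) e x (snd (ch i) y - snd (ch i) x) else 0)"

definition glued :: "'a \<times> 'a \<Rightarrow> 'a \<times> ('a, 'm) tvec" where
  "glued q = (fst q, dvec (fst q) (snd q))"

lemma dvec_in: "x \<in> points A \<Longrightarrow> dvec x y \<in> tangent_space A x"
proof (rule tangent_spaceI)
  fix e e' assume x: "x \<in> points A" and e: "e \<in> A" "e' \<in> A" "x \<in> fst e" "x \<in> fst e'"
  have lin: "linear (transition_deriv e e' x)"
    by (rule transition_has_derivative(3)[OF pre_manifoldD(2)[OF A e(1,2)] e(3,4)])
  \<comment> \<open>If \<open>x\<close> is outside the domain of \<open>ch i\<close>, the transition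
    derivative is a junk value; but then \<open>x\<close> is outside \<open>Z i\<close> as well, and
    the weight vanishes.\<close>
  have "\<psi> i x *\<^sub>R transition_deriv (ch i) e' x v = \<psi> i x *\<^sub>R transition_deriv e e' x (transition_deriv (ch i) e x v)"
    if i: "i \<in> P" for i v
  proof (cases "x \<in> Z i")
    case True
    then have "x \<in> fst (ch i)" using Z_sub[OF i] by blast
    then show ?thesis
      using transition_deriv_chain[OF pre_manifoldD(1)[OF A ch_in[OF i]] pre_manifoldD(1)[OF A e(1)]
          pre_manifoldD(2)[OF A ch_in[OF i] e(1)] pre_manifoldD(2)[OF A e(1,2)] _ e(3,4)] by simp
  qed (use \<psi>_zero[OF i x] in simp)
  then have "(\<Sum>i\<in>P. \<psi> i x *\<^sub>R transition_deriv (ch i) e' x (snd (ch i) y - snd (ch i) x))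
     = (\<Sum>i\<in>P. \<psi> i x *\<^sub>R transition_deriv e e' x (transition_deriv (ch i) e x (snd (ch i) y - snd (ch i) x)))"
    by (intro sum.cong refl) blast
  also have "\<dots> = transition_deriv e e' x (\<Sum>i\<in>P. \<psi> i x *\<^sub>R transition_deriv (ch i) e x (snd (ch i) y - snd (ch i) x))"
    by (simp add: linear_sum[OF lin] linear_cmul[OF lin])
  finally show "dvec x y e' = transition_deriv e e' x (dvec x y e)"
    using e by (simp only: dvec_def simp_thms if_True)
next
  show "dvec x y c = 0" if "\<not> (c \<in> A \<and> x \<in> fst c)" for c
    using that by (simp only: dvec_def if_False)
qed

lemma dvec_self: "x \<in> points A \<Longrightarrow> dvec x x = (\<lambda>c. 0)"
proof (rule ext)
  fix e assume x: "x \<in> points A"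
  have "\<psi> i x *\<^sub>R transition_deriv (ch i) e x (0::complex^'m) = 0" if i: "i \<in> P" and e: "e \<in> A" "x \<in> fst e" for i
  proof (cases "x \<in> Z i")
    case True
    then have "x \<in> fst (ch i)" using Z_sub[OF i] by blast
    then show ?thesis
      using linear_0[OF transition_has_derivative(3)[OF pre_manifoldD(2)[OF A ch_in[OF i] e(1)] _ e(2)]] by simp
  qed (use \<psi>_zero[OF i x] in simp)
  then show "dvec x x e = 0" by (auto simp: dvec_def intro!: sum.neutral)
qed

abbreviation (input) dcoord :: "('a, 'm) chart \<Rightarrow> complex^('m + 'm) \<Rightarrow> complex^'m" where
  "dcoord c z \<equiv> dvec (chart_inv c (vfst z)) (chart_inv c (vsnd z)) c"

text \<open>The last two conclusions serve different purposes: the exact derivative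
  \<open>w - u\<close> on the diagonal is the admissibility condition, whereas nearby a derivative
  in the second variable that is within 1/2 of the identity yields injectivity.\<close>

lemma dcoord_local:
  assumes c: "c \<in> A" and p: "p \<in> fst c"
  obtains r where "0 < r" "ball (snd c p) r \<subseteq> chart_image c"
    "smooth_on (vfst -` ball (snd c p) r \<inter> vsnd -` ball (snd c p) r) (dcoord c)"
    "\<And>z w. z \<in> vfst -` ball (snd c p) r \<inter> vsnd -` ball (snd c p) r \<Longrightarrow>
       norm (frechet_derivative (dcoord c) (at z) (vjoin 0 w) - w) \<le> norm w / 2"
    "\<And>u w. frechet_derivative (dcoord c) (at (vjoin (snd c p) (snd c p))) (vjoin u w) = w - u"
proof -
  note cc = pre_manifoldD(1)[OF A c]
  have pA: "p \<in> points A" using chart_subset_points[OF c] p by blast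
  define I where "I = {i \<in> P. p \<in> Z i}"
  have IP: "I \<subseteq> P" and finI: "finite I" using finP by (auto simp: I_def)
  \<comment> \<open>Near \<open>p\<close> only the indices with \<open>p \<in> Z i\<close>
    contribute: the others are switched off by removing \<open>Z i\<close>, and for the remaining
    ones the neighbourhood lies in the domain of \<open>ch i\<close>, where their summands are
    smooth.\<close>
  define nb where "nb i = (if i \<in> I then fst (ch i) else points A - Z i)" for i
  define O1 where "O1 = \<Inter>(insert (fst c) (nb ` P))"
  have "openin (atlas_topology A) O1" unfolding O1_def
  proof (rule openin_Inter)
    fix X assume "X \<in> insert (fst c) (nb ` P)"
    then consider "X = fst c" | i where "i \<in> P" "X = nb i" by blast
    then show "openin (atlas_topology A) X"
    proof cases
      case 1
      then show ?thesis using openin_chart_domain[OF c] by simp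
    next
      case 2
      then show ?thesis
        using openin_chart_domain[OF ch_in[OF 2(1)]] Z_closed[OF 2(1)]
        by (simp add: nb_def closedin_def topspace_atlas)
    qed
  qed (use finP in auto)
  then have oD: "open (snd c ` (fst c \<inter> O1))"
    by (rule holomorphic_coordinates_open_image[OF chart_holomorphic_coordinates[OF A c]])
  have O1c: "O1 \<subseteq> fst c" unfolding O1_def by blast
  have O1I: "x \<in> fst (ch i)" if "x \<in> O1" "i \<in> I" for x i
    using that IP unfolding O1_def nb_def by auto
  have O1Z: "x \<notin> Z i" if "x \<in> O1" "i \<in> P" "i \<notin> I" for x i
    using that unfolding O1_def nb_def by auto
  have pO1: "p \<in> O1"
    using p pA Z_sub unfolding O1_def nb_def I_def by auto
  define D1 where "D1 = snd c ` O1"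
  have oD1: "open D1" using oD O1c by (simp add: D1_def Int_absorb1)
  have D1c: "D1 \<subseteq> chart_image c" using O1c by (auto simp: D1_def)
  have D1e: "chart_inv c a \<in> O1 \<and> snd c (chart_inv c a) = a" if "a \<in> D1" for a
    using that O1c chart_inv_chart[OF cc] by (auto simp: D1_def)
  define \<kappa> where "\<kappa> i = coord_rep c (ch i) id" for i
  define \<nu> where "\<nu> i = coord_rep (ch i) c id" for i
  define S where "S = (vfst -` D1 \<inter> vsnd -` D1 :: (complex^('m + 'm)) set)"
  have oS: "open S" unfolding S_def using open_vfst_vimage[OF oD1] open_vsnd_vimage[OF oD1] by blast
  \<comment> \<open>The surviving summands of \<open>dvec\<close> with the coordinate changes to and
    from \<open>ch i\<close> written out, a form to which the smooth calculus applies
    directly.\<close>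
  define G where "G z = (\<Sum>i\<in>I. \<psi> i (chart_inv c (vfst z)) *\<^sub>R
     frechet_derivative (\<nu> i) (at (\<kappa> i (vfst z))) (\<kappa> i (vsnd z) - \<kappa> i (vfst z)))" for z :: "complex^('m + 'm)"
  have \<kappa>x: "\<kappa> i a = snd (ch i) (chart_inv c a)" if "a \<in> D1" for i a
    by (simp add: \<kappa>_def coord_rep_def)
  have G_eq: "G z = dcoord c z" if z: "z \<in> S" for z
  proof -
    define x where "x = chart_inv c (vfst z)"
    have x: "x \<in> O1" and y: "chart_inv c (vsnd z) \<in> O1" using z D1e by (auto simp: S_def x_def)
    have xA: "x \<in> points A" "x \<in> fst c" using x O1c chart_subset_points[OF c] by blast+
    have "dvec x (chart_inv c (vsnd z)) c = (\<Sum>i\<in>P. \<psi> i x *\<^sub>R transition_deriv (ch i) c x (snd (ch i) (chart_inv c (vsnd z)) - snd (ch i) x))"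
      using c xA by (simp only: dvec_def simp_thms if_True)
    also have "\<dots> = (\<Sum>i\<in>I. \<psi> i x *\<^sub>R transition_deriv (ch i) c x (snd (ch i) (chart_inv c (vsnd z)) - snd (ch i) x))"
      by (rule sum.mono_neutral_right[OF finP IP]) (use \<psi>_zero[OF _ xA(1)] O1Z[OF x] in auto)
    also have "\<dots> = G z"
      unfolding G_def \<nu>_def using z by (simp add: \<kappa>x S_def x_def)
    finally show ?thesis by (simp add: x_def)
  qed
  have sv: "smooth_on S vfst" "smooth_on S vsnd"
    by (auto intro: smooth_on_bounded_linear bounded_linear_vfst bounded_linear_vsnd oS)
  have smG: "smooth_on S G"
    unfolding G_def
  proof (rule smooth_on_sum[OF oS], rule smooth_on_bilinear[OF bounded_bilinear_scaleR oS])
    fix i assume i: "i \<in> I"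
    then have iP: "i \<in> P" using IP by blast
    show "smooth_on S (\<lambda>z. \<psi> i (chart_inv c (vfst z)))"
      by (rule smooth_on_compose[OF oS chart_image_open[OF cc] _ sv(1)])
        (use \<psi>_smooth[OF iP] c D1c in \<open>auto simp: S_def smooth_function_def\<close>)
    note co = pre_manifoldD(2)[OF A c ch_in[OF iP]] pre_manifoldD(2)[OF A ch_in[OF iP] c]
    have sub: "D1 \<subseteq> snd c ` (fst c \<inter> fst (ch i))" unfolding D1_def using O1I[OF _ i] O1c by blast
    have \<kappa>s: "smooth_on (snd c ` (fst c \<inter> fst (ch i))) (\<kappa> i)"
      unfolding \<kappa>_def by (rule holomorphic_imp_smooth_on[OF charts_compatibleD(2,1)[OF co(1)]])
    have k1: "smooth_on S (\<lambda>z. \<kappa> i (vfst z))"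
      by (rule smooth_on_compose[OF oS charts_compatibleD(1)[OF co(1)] _ sv(1) \<kappa>s]) (use sub in \<open>auto simp: S_def\<close>)
    have k2: "smooth_on S (\<lambda>z. \<kappa> i (vsnd z))"
      by (rule smooth_on_compose[OF oS charts_compatibleD(1)[OF co(1)] _ sv(2) \<kappa>s]) (use sub in \<open>auto simp: S_def\<close>)
    have im: "(\<lambda>z. \<kappa> i (vfst z)) ` S \<subseteq> snd (ch i) ` (fst (ch i) \<inter> fst c)"
    proof
      fix t assume "t \<in> (\<lambda>z. \<kappa> i (vfst z)) ` S"
      then obtain a where a: "a \<in> D1" "t = \<kappa> i a" by (auto simp: S_def)
      then have "t = snd (ch i) (chart_inv c a)" using \<kappa>x by simp
      then show "t \<in> snd (ch i) ` (fst (ch i) \<inter> fst c)"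
        using D1e[OF a(1)] O1I[OF _ i] O1c by blast
    qed
    show "smooth_on S (\<lambda>z. frechet_derivative (\<nu> i) (at (\<kappa> i (vfst z))) (\<kappa> i (vsnd z) - \<kappa> i (vfst z)))"
      unfolding \<nu>_def
      by (rule smooth_on_apply_deriv[OF oS charts_compatibleD(1)[OF co(2)] im k1
            holomorphic_imp_smooth_on[OF charts_compatibleD(2,1)[OF co(2)]] smooth_on_diff[OF oS k2 k1]])
  qed
  have sm: "smooth_on S (dcoord c)"
    by (rule smooth_on_cong_open[OF oS G_eq smG])
  define a0 where "a0 = snd c p"
  define z0 where "z0 = vjoin a0 a0"
  have a0: "a0 \<in> D1" using pO1 by (simp add: a0_def D1_def)
  have z0: "z0 \<in> S" using a0 by (simp add: z0_def S_def)
  have ca0: "chart_inv c a0 = p" unfolding a0_def by (rule chart_inv_chart[OF cc p])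
  let ?DG = "frechet_derivative (dcoord c) (at z0)"
  have DG: "(dcoord c has_derivative ?DG) (at z0)" by (rule smooth_on_has_derivative[OF sm z0])
  have linDG: "linear ?DG" by (rule has_derivative_linear[OF DG])
  \<comment> \<open>In the second variable each summand has as derivative a transition derivative
    followed by its inverse, and the weights sum to 1.\<close>
  have dG2: "?DG (vjoin 0 w) = w" for w
  proof -
    have 1: "((\<lambda>b. dcoord c (vjoin a0 b)) has_derivative (\<lambda>w. ?DG (vjoin 0 w))) (at a0)"
    proof (rule has_derivative_compose[of "\<lambda>b. vjoin a0 b" "\<lambda>w. vjoin 0 w" a0 UNIV "dcoord c" ?DG])
      show "(vjoin a0 has_derivative vjoin 0) (at a0)"
        using has_derivative_vjoin[OF has_derivative_const[of a0] has_derivative_ident] .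
    qed (use DG in \<open>simp add: z0_def\<close>)
    have 2: "((\<lambda>b. G (vjoin a0 b)) has_derivative
        (\<lambda>w. \<Sum>i\<in>I. \<psi> i p *\<^sub>R transition_deriv (ch i) c p (transition_deriv c (ch i) p w))) (at a0)"
      unfolding G_def vfst_vjoin vsnd_vjoin ca0
    proof (rule has_derivative_sum, rule bounded_linear.has_derivative[OF bounded_linear_scaleR_right])
      fix i assume i: "i \<in> I"
      then have iP: "i \<in> P" using IP by blast
      note co = pre_manifoldD(2)[OF A c ch_in[OF iP]] pre_manifoldD(2)[OF A ch_in[OF iP] c]
      have pi: "p \<in> fst (ch i)" by (rule O1I[OF pO1 i])
      have "bounded_linear (transition_deriv (ch i) c p)"
        by (rule has_derivative_bounded_linear[OF transition_has_derivative(1)[OF co(2) pi p]])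
      moreover have "\<kappa> i a0 = snd (ch i) p" using \<kappa>x[OF a0] ca0 by simp
      moreover have "(\<kappa> i has_derivative transition_deriv c (ch i) p) (at a0)"
        unfolding \<kappa>_def a0_def by (rule transition_has_derivative(1)[OF co(1) p pi])
      then have "((\<lambda>b. \<kappa> i b - \<kappa> i a0) has_derivative transition_deriv c (ch i) p) (at a0)"
        using has_derivative_diff[OF _ has_derivative_const] by fastforce
      ultimately show "((\<lambda>b. frechet_derivative (\<nu> i) (at (\<kappa> i a0)) (\<kappa> i b - \<kappa> i a0)) has_derivative
          (\<lambda>w. transition_deriv (ch i) c p (transition_deriv c (ch i) p w))) (at a0)"
        unfolding \<nu>_def using bounded_linear.has_derivative by metis
    qed
    have "(\<Sum>i\<in>I. \<psi> i p *\<^sub>R transition_deriv (ch i) c p (transition_deriv c (ch i) p w)) = w" for w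
    proof -
      have "transition_deriv (ch i) c p (transition_deriv c (ch i) p w) = w" if i: "i \<in> I" for i
      proof -
        have iP: "i \<in> P" using i IP by blast
        show ?thesis
          by (rule transition_deriv_inverse[OF cc pre_manifoldD(1)[OF A ch_in[OF iP]] pre_manifoldD(2)[OF A c ch_in[OF iP]]
                pre_manifoldD(2)[OF A ch_in[OF iP] c] p O1I[OF pO1 i]])
      qed
      then have "(\<Sum>i\<in>I. \<psi> i p *\<^sub>R transition_deriv (ch i) c p (transition_deriv c (ch i) p w)) = (\<Sum>i\<in>I. \<psi> i p) *\<^sub>R w"
        by (simp add: scaleR_sum_left)
      also have "(\<Sum>i\<in>I. \<psi> i p) = (\<Sum>i\<in>P. \<psi> i p)"
        by (rule sum.mono_neutral_left[OF finP IP]) (use \<psi>_zero[OF _ pA] in \<open>auto simp: I_def\<close>)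
      finally show ?thesis unfolding \<psi>_sum[OF pA] scaleR_one .
    qed
    then have "((\<lambda>b. G (vjoin a0 b)) has_derivative (\<lambda>w. w)) (at a0)" using 2 by simp
    then have 3: "((\<lambda>b. dcoord c (vjoin a0 b)) has_derivative (\<lambda>w. w)) (at a0)"
      by (rule has_derivative_transform_within_open[OF _ oD1 a0]) (use a0 G_eq in \<open>simp add: S_def\<close>)
    show ?thesis using fun_cong[OF has_derivative_unique[OF 1 3], of w] by simp
  qed
  \<comment> \<open>Along the diagonal the map is constantly 0, so the weights never have to be
    differentiated. Together with \<open>dG2\<close> this determines the whole derivative.\<close>
  have dGd: "?DG (vjoin u u) = 0" for u
  proof -
    have 1: "((\<lambda>a. dcoord c (vjoin a a)) has_derivative (\<lambda>u. ?DG (vjoin u u))) (at a0)"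
    proof (rule has_derivative_compose[of "\<lambda>a. vjoin a a" "\<lambda>u. vjoin u u" a0 UNIV "dcoord c" ?DG])
      show "((\<lambda>a. vjoin a a) has_derivative (\<lambda>u. vjoin u u)) (at a0)"
        by (rule has_derivative_vjoin[OF has_derivative_ident has_derivative_ident])
    qed (use DG in \<open>simp add: z0_def\<close>)
    have 2: "((\<lambda>a. dcoord c (vjoin a a)) has_derivative (\<lambda>u. 0)) (at a0)"
    proof (rule has_derivative_transform_within_open[OF has_derivative_const[of 0] oD1 a0])
      fix a assume "a \<in> D1"
      then have "chart_inv c a \<in> points A" using D1e[of a] O1c chart_subset_points[OF c] by blast
      then show "0 = dcoord c (vjoin a a)" using dvec_self by simp
    qed
    show ?thesis using fun_cong[OF has_derivative_unique[OF 1 2], of u] by simp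
  qed
  have dG: "?DG (vjoin u w) = w - u" for u w
  proof -
    have "vjoin u w = vjoin u u + vjoin 0 (w - u)" by (simp flip: vjoin_add)
    then have "?DG (vjoin u w) = ?DG (vjoin u u) + ?DG (vjoin 0 (w - u))" by (simp add: linear_add[OF linDG])
    then show ?thesis by (simp add: dG2 dGd)
  qed
  \<comment> \<open>Errors of this size for all basis vectors add up to
    \<open>norm w / 2\<close>.\<close>
  define \<epsilon> where "\<epsilon> = 1 / (2 * real DIM(complex^'m))"
  have \<epsilon>: "\<epsilon> > 0" by (simp add: \<epsilon>_def)
  have "\<forall>\<^sub>F z in nhds z0. \<forall>b\<in>Basis. dist (frechet_derivative (dcoord c) (at z) (vjoin 0 b)) b < \<epsilon>"
  proof (rule eventually_ball_finite[OF finite_Basis], rule ballI)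
    fix b :: "complex^'m"
    have "isCont (\<lambda>z. frechet_derivative (dcoord c) (at z) (vjoin 0 b)) z0"
      using smooth_on_imp_continuous_on[OF smooth_on_deriv[OF sm]] oS z0 by (simp add: continuous_on_eq_continuous_at)
    then have "((\<lambda>z. frechet_derivative (dcoord c) (at z) (vjoin 0 b)) \<longlongrightarrow> b) (nhds z0)"
      using dG2 by (simp add: isCont_def tendsto_nhds_iff)
    then show "\<forall>\<^sub>F z in nhds z0. dist (frechet_derivative (dcoord c) (at z) (vjoin 0 b)) b < \<epsilon>"
      using \<epsilon> by (rule tendstoD)
  qed
  moreover have "\<forall>\<^sub>F z in nhds z0. z \<in> S" using oS z0 by (rule eventually_nhds_in_open)
  ultimately have "\<forall>\<^sub>F z in nhds z0. z \<in> S \<and> (\<forall>b\<in>Basis. dist (frechet_derivative (dcoord c) (at z) (vjoin 0 b)) b < \<epsilon>)"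
    by eventually_elim blast
  then obtain \<rho> where \<rho>: "\<rho> > 0"
    "\<And>z. dist z z0 < \<rho> \<Longrightarrow> z \<in> S \<and> (\<forall>b\<in>Basis. dist (frechet_derivative (dcoord c) (at z) (vjoin 0 b)) b < \<epsilon>)"
    unfolding eventually_nhds_metric by blast
  have near: "dist z z0 < \<rho>" if "z \<in> vfst -` ball a0 (\<rho> / 2) \<inter> vsnd -` ball a0 (\<rho> / 2)" for z
  proof -
    have "dist z z0 = norm (vjoin (vfst z - a0) (vsnd z - a0))"
      unfolding vjoin_diff by (simp add: dist_norm z0_def)
    also have "\<dots> \<le> norm (vfst z - a0) + norm (vsnd z - a0)" by (rule norm_vjoin_le)
    also have "\<dots> < \<rho>" using that by (auto simp: dist_norm norm_minus_commute)
    finally show ?thesis .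
  qed
  show thesis
  proof (rule that[of "\<rho> / 2"])
    show "0 < \<rho> / 2" using \<rho> by simp
    show "ball (snd c p) (\<rho> / 2) \<subseteq> chart_image c"
    proof
      fix a assume "a \<in> ball (snd c p) (\<rho> / 2)"
      then have "vjoin a a \<in> S" using \<rho>(2)[OF near[of "vjoin a a"]] by (simp add: a0_def)
      then show "a \<in> chart_image c" using D1c by (auto simp: S_def)
    qed
    show "smooth_on (vfst -` ball (snd c p) (\<rho> / 2) \<inter> vsnd -` ball (snd c p) (\<rho> / 2)) (dcoord c)"
      by (rule smooth_on_subset[OF sm]) (use \<rho>(2)[OF near] in \<open>auto simp: a0_def\<close>)
    show "frechet_derivative (dcoord c) (at (vjoin (snd c p) (snd c p))) (vjoin u w) = w - u" for u w
      using dG by (simp add: z0_def a0_def)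
    fix z w assume z: "z \<in> vfst -` ball (snd c p) (\<rho> / 2) \<inter> vsnd -` ball (snd c p) (\<rho> / 2)"
    note zz = \<rho>(2)[OF near[unfolded a0_def, OF z]]
    let ?E = "\<lambda>w. frechet_derivative (dcoord c) (at z) (vjoin 0 w) - w"
    have "linear (frechet_derivative (dcoord c) (at z))"
      using smooth_on_has_derivative[OF sm] zz has_derivative_linear by blast
    then have "linear ?E"
      using linear_compose[OF bounded_linear.linear[OF bounded_linear_vjoin_right]]
      by (intro linear_compose_sub) (auto simp: comp_def linear_ident)
    then have "norm (?E w) = norm (\<Sum>b\<in>Basis. (w \<bullet> b) *\<^sub>R ?E b)" by (simp only: linear_expand)
    also have "\<dots> \<le> (\<Sum>b\<in>(Basis :: (complex^'m) set). norm w * \<epsilon>)"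
    proof (rule sum_norm_le)
      fix b :: "complex^'m" assume b: "b \<in> Basis"
      show "norm ((w \<bullet> b) *\<^sub>R ?E b) \<le> norm w * \<epsilon>"
        unfolding norm_scaleR
        by (rule mult_mono) (use zz b Basis_le_norm[OF b, of w] in \<open>auto simp: dist_norm less_imp_le\<close>)
    qed
    also have "\<dots> = norm w / 2" by (simp add: \<epsilon>_def)
    finally show "norm (frechet_derivative (dcoord c) (at z) (vjoin 0 w) - w) \<le> norm w / 2" .
  qed
qed

lemma glued_coord:
  assumes "c \<in> A" "x \<in> fst c" "y \<in> fst c"
  shows "coord_rep (prod_chart c c) (tangent_chart A c) glued (vjoin (snd c x) (snd c y))
    = vjoin (snd c x) (dcoord c (vjoin (snd c x) (snd c y)))"
proof -
  note cc = pre_manifoldD(1)[OF A assms(1)]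
  show ?thesis
    using coord_rep_chart[OF is_chart_prod[OF cc cc], of "(x, y)" "tangent_chart A c" glued] assms
    by (simp add: snd_tangent_chart glued_def chart_inv_chart[OF cc])
qed

lemma glued_derivative_diagonal:
  assumes c: "c \<in> A" and p: "p \<in> fst c"
  shows "vsnd (frechet_derivative (coord_rep (prod_chart c c) (tangent_chart A c) glued)
                (at (vjoin (snd c p) (snd c p))) (vjoin u w)) = w - u"
proof -
  obtain r where r: "0 < r" "ball (snd c p) r \<subseteq> chart_image c"
    "smooth_on (vfst -` ball (snd c p) r \<inter> vsnd -` ball (snd c p) r) (dcoord c)"
    "\<And>u w. frechet_derivative (dcoord c) (at (vjoin (snd c p) (snd c p))) (vjoin u w) = w - u"
    by (rule dcoord_local[OF c p], rule that; assumption)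
  let ?z = "vjoin (snd c p) (snd c p)"
  let ?S = "vfst -` ball (snd c p) r \<inter> vsnd -` ball (snd c p) r"
  have oS: "open ?S" using open_vfst_vimage[OF open_ball] open_vsnd_vimage[OF open_ball] by blast
  have z: "?z \<in> ?S" using r(1) by simp
  have D: "((\<lambda>z. vjoin (vfst z) (dcoord c z)) has_derivative (\<lambda>v. vjoin (vfst v) (frechet_derivative (dcoord c) (at ?z) v))) (at ?z)"
    by (rule has_derivative_vjoin[OF bounded_linear_imp_has_derivative[OF bounded_linear_vfst] smooth_on_has_derivative[OF r(3) z]])
  have "(coord_rep (prod_chart c c) (tangent_chart A c) glued has_derivative (\<lambda>v. vjoin (vfst v) (frechet_derivative (dcoord c) (at ?z) v))) (at ?z)"
  proof (rule has_derivative_transform_within_open[OF D oS z])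
    fix z assume "z \<in> ?S"
    then have "vfst z \<in> chart_image c" "vsnd z \<in> chart_image c" using r(2) by auto
    then obtain x y where xy: "x \<in> fst c" "y \<in> fst c" "vfst z = snd c x" "vsnd z = snd c y" by blast
    then have "z = vjoin (snd c x) (snd c y)" by (metis vjoin_vfst_vsnd)
    then show "vjoin (vfst z) (dcoord c z) = coord_rep (prod_chart c c) (tangent_chart A c) glued z"
      using glued_coord[OF c xy(1,2)] by simp
  qed
  then show ?thesis using r(4) by (simp add: frechet_derivative_at[symmetric])
qed

text \<open>\<open>glued\<close> keeps the first point, so injectivity of the map and of its
  derivative concern the second variable alone, where \<open>dcoord_local\<close> shows a small
  perturbation of the identity.\<close>

lemma glued_local:
  assumes p: "p \<in> points A"
  obtains c W where "c \<in> A" "openin (atlas_topology A) W" "p \<in> W" "W \<subseteq> fst c"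
    "glued ` (W \<times> W) \<subseteq> fst (tangent_chart A c)"
    "smooth_on (snd (prod_chart c c) ` (W \<times> W)) (coord_rep (prod_chart c c) (tangent_chart A c) glued)"
    "\<And>z. z \<in> snd (prod_chart c c) ` (W \<times> W) \<Longrightarrow> inj (frechet_derivative (coord_rep (prod_chart c c) (tangent_chart A c) glued) (at z))"
    "inj_on glued (W \<times> W)"
proof -
  obtain c where c: "c \<in> A" "p \<in> fst c" using p unfolding points_def by blast
  note cc = pre_manifoldD(1)[OF A c(1)]
  obtain r where r: "0 < r" "ball (snd c p) r \<subseteq> chart_image c"
    "smooth_on (vfst -` ball (snd c p) r \<inter> vsnd -` ball (snd c p) r) (dcoord c)"
    "\<And>z w. z \<in> vfst -` ball (snd c p) r \<inter> vsnd -` ball (snd c p) r \<Longrightarrow>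
       norm (frechet_derivative (dcoord c) (at z) (vjoin 0 w) - w) \<le> norm w / 2"
    by (rule dcoord_local[OF c], rule that; assumption)
  define W where "W = fst c \<inter> snd c -` ball (snd c p) r"
  let ?S = "vfst -` ball (snd c p) r \<inter> vsnd -` ball (snd c p) r"
  have oS: "open ?S" using open_vfst_vimage[OF open_ball] open_vsnd_vimage[OF open_ball] by blast
  have Wc: "W \<subseteq> fst c" by (auto simp: W_def)
  have imW: "snd c ` W = ball (snd c p) r"
  proof
    show "ball (snd c p) r \<subseteq> snd c ` W"
    proof
      fix a assume a: "a \<in> ball (snd c p) r"
      then obtain x where "x \<in> fst c" "a = snd c x" using r(2) by blast
      then show "a \<in> snd c ` W" using a by (auto simp: W_def)
    qed
  qed (auto simp: W_def)
  have imWW: "snd (prod_chart c c) ` (W \<times> W) = ?S"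
    using prod_chart_image[OF Wc Wc] imW by simp
  have eq: "coord_rep (prod_chart c c) (tangent_chart A c) glued z = vjoin (vfst z) (dcoord c z)" if z: "z \<in> ?S" for z
  proof -
    have "vfst z \<in> chart_image c" "vsnd z \<in> chart_image c" using r(2) z by auto
    then obtain x y where xy: "x \<in> fst c" "y \<in> fst c" "vfst z = snd c x" "vsnd z = snd c y" by blast
    then have "z = vjoin (snd c x) (snd c y)" by (metis vjoin_vfst_vsnd)
    then show ?thesis using glued_coord[OF c(1) xy(1,2)] by simp
  qed
  have sm: "smooth_on ?S (\<lambda>z. vjoin (vfst z) (dcoord c z))"
    by (rule smooth_on_vjoin[OF oS smooth_on_bounded_linear[OF bounded_linear_vfst oS] r(3)])
  have D: "frechet_derivative (coord_rep (prod_chart c c) (tangent_chart A c) glued) (at z) =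
     (\<lambda>v. vjoin (vfst v) (frechet_derivative (dcoord c) (at z) v))" if z: "z \<in> ?S" for z
  proof (rule frechet_derivative_at[symmetric])
    have D: "((\<lambda>z. vjoin (vfst z) (dcoord c z)) has_derivative (\<lambda>v. vjoin (vfst v) (frechet_derivative (dcoord c) (at z) v))) (at z)"
      by (rule has_derivative_vjoin[OF bounded_linear_imp_has_derivative[OF bounded_linear_vfst] smooth_on_has_derivative[OF r(3) z]])
    show "(coord_rep (prod_chart c c) (tangent_chart A c) glued has_derivative (\<lambda>v. vjoin (vfst v) (frechet_derivative (dcoord c) (at z) v))) (at z)"
      by (rule has_derivative_transform_within_open[OF D oS z]) (rule eq[symmetric])
  qed
  show thesis
  proof (rule that[OF c(1), of W])
    show "openin (atlas_topology A) W" unfolding W_def by (rule openin_atlas_basic[OF c(1) open_ball])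
    show "p \<in> W" using c(2) r(1) by (simp add: W_def)
    show "W \<subseteq> fst c" by (rule Wc)
    show "glued ` (W \<times> W) \<subseteq> fst (tangent_chart A c)"
      using Wc dvec_in chart_subset_points[OF c(1)] by (auto simp: glued_def fst_tangent_chart)
    show "smooth_on (snd (prod_chart c c) ` (W \<times> W)) (coord_rep (prod_chart c c) (tangent_chart A c) glued)"
      unfolding imWW by (rule smooth_on_cong_open[OF oS eq[symmetric] sm])
    show "inj (frechet_derivative (coord_rep (prod_chart c c) (tangent_chart A c) glued) (at z))"
      if "z \<in> snd (prod_chart c c) ` (W \<times> W)" for z
    proof -
      have z: "z \<in> ?S" using that imWW by simp
      have "linear (\<lambda>v. vjoin (vfst v) (frechet_derivative (dcoord c) (at z) v))"
        using has_derivative_linear[OF has_derivative_vjoin[OF bounded_linear_imp_has_derivative[OF bounded_linear_vfst] smooth_on_has_derivative[OF r(3) z]]] .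
      moreover have "v = 0" if v: "vjoin (vfst v) (frechet_derivative (dcoord c) (at z) v) = 0" for v
      proof -
        have v': "vfst v = 0" "frechet_derivative (dcoord c) (at z) v = 0"
          using v vjoin_eq_iff[of "vfst v" "frechet_derivative (dcoord c) (at z) v" 0 0] by simp_all
        then have e: "v = vjoin 0 (vsnd v)" by (metis vjoin_vfst_vsnd)
        then have "norm (vsnd v) \<le> norm (vsnd v) / 2" using r(4)[OF z, of "vsnd v"] v'(2) by simp
        then show "v = 0" using e by simp
      qed
      ultimately show ?thesis unfolding D[OF z] by (subst linear_injective_0) auto
    qed
    show "inj_on glued (W \<times> W)"
    proof (rule inj_onI)
      fix q q' assume q: "q \<in> W \<times> W" "q' \<in> W \<times> W" and e: "glued q = glued q'"
      define a b b' where "a = snd c (fst q)" and "b = snd c (snd q)" and "b' = snd c (snd q')"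
      have fq: "fst q = fst q'" using e by (simp add: glued_def)
      have bb: "a \<in> ball (snd c p) r" "b \<in> ball (snd c p) r" "b' \<in> ball (snd c p) r"
        using q by (auto simp: W_def a_def b_def b'_def)
      have inv: "chart_inv c a = fst q" "chart_inv c b = snd q" "chart_inv c b' = snd q'"
        using chart_inv_chart[OF cc] Wc q unfolding a_def b_def b'_def by auto
      have ge: "dcoord c (vjoin a b) = dcoord c (vjoin a b')"
        using e fq by (simp add: inv glued_def)
      \<comment> \<open>The identity perturbed by a 1/2-Lipschitz map is injective: equal values
        would give \<open>norm (b - b') \<le> norm (b - b') / 2\<close>.\<close>
      let ?h = "\<lambda>b. dcoord c (vjoin a b) - b"
      have "norm (?h b - ?h b') \<le> (1/2) * norm (b - b')"
      proof (rule differentiable_bound[OF convex_ball _ _ bb(2,3), where f'="\<lambda>b w. frechet_derivative (dcoord c) (at (vjoin a b)) (vjoin 0 w) - w"])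
        fix x assume x: "x \<in> ball (snd c p) r"
        have z: "vjoin a x \<in> ?S" using x bb(1) by simp
        have "((\<lambda>b. dcoord c (vjoin a b)) has_derivative (\<lambda>w. frechet_derivative (dcoord c) (at (vjoin a x)) (vjoin 0 w))) (at x)"
          by (rule has_derivative_compose[OF has_derivative_vjoin[OF has_derivative_const[of a] has_derivative_ident] smooth_on_has_derivative[OF r(3) z]])
        then have "(?h has_derivative (\<lambda>w. frechet_derivative (dcoord c) (at (vjoin a x)) (vjoin 0 w) - w)) (at x)"
          by (rule has_derivative_diff[OF _ has_derivative_ident])
        then show "(?h has_derivative (\<lambda>w. frechet_derivative (dcoord c) (at (vjoin a x)) (vjoin 0 w) - w)) (at x within ball (snd c p) r)"
          by (rule has_derivative_at_withinI)
        show "onorm (\<lambda>w. frechet_derivative (dcoord c) (at (vjoin a x)) (vjoin 0 w) - w) \<le> 1 / 2"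
          by (rule onorm_le) (use r(4)[OF z] in simp)
      qed
      moreover have "?h b - ?h b' = b' - b" using ge by simp
      ultimately have "norm (b' - b) \<le> (1/2) * norm (b - b')" by simp
      then have "b = b'" by (simp add: norm_minus_commute)
      then have "snd q = snd q'" using inv by metis
      then show "q = q'" using fq by (simp add: prod_eq_iff)
    qed
  qed
qed

end

lemma admissible_map_exists:
  fixes A :: "('a, 'm::finite) chart set"
  assumes M: "complex_manifold A" and K: "compact_space (atlas_topology A)"
  shows "\<exists>N \<tau>. admissible_map A N \<tau>"
proof -
  have A: "pre_manifold A" by (rule complex_manifold_imp_pre_manifold[OF M])
  have H: "Hausdorff_space (atlas_topology A)" using M by (simp add: complex_manifold_def)
  have "\<forall>p\<in>points A. \<exists>c. c \<in> A \<and> p \<in> fst c" unfolding points_def by blast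
  then obtain ch where ch: "\<And>p. p \<in> points A \<Longrightarrow> ch p \<in> A" "\<And>p. p \<in> points A \<Longrightarrow> p \<in> fst (ch p)" by metis
  obtain P \<psi> Z where P: "finite P" "P \<subseteq> points A" "\<And>p. p \<in> P \<Longrightarrow> smooth_function A (\<psi> p)"
    "\<And>p. p \<in> P \<Longrightarrow> compactin (atlas_topology A) (Z p)" "\<And>p. p \<in> P \<Longrightarrow> Z p \<subseteq> fst (ch p)"
    "\<And>p x. p \<in> P \<Longrightarrow> x \<in> points A \<Longrightarrow> x \<notin> Z p \<Longrightarrow> \<psi> p x = 0"
    "\<And>x. x \<in> points A \<Longrightarrow> (\<Sum>p\<in>P. \<psi> p x) = 1"
    by (rule partition_of_unity[OF A H K, of "\<lambda>p. fst (ch p)", OF openin_chart_domain[OF ch(1)] ch(2)], assumption, assumption,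
        rule that; assumption)
  interpret chart_gluing A P \<psi> ch Z
  proof
    show "ch i \<in> A" if "i \<in> P" for i using ch(1) P(2) that by blast
    show "closedin (atlas_topology A) (Z i)" if "i \<in> P" for i by (rule compactin_imp_closedin[OF H P(4)[OF that]])
  qed (use A P in \<open>auto simp del: split_paired_All\<close>)
  define Q where "Q p c W \<longleftrightarrow> c \<in> A \<and> openin (atlas_topology A) W \<and> p \<in> W \<and> W \<subseteq> fst c \<and>
    glued ` (W \<times> W) \<subseteq> fst (tangent_chart A c) \<and>
    smooth_on (snd (prod_chart c c) ` (W \<times> W)) (coord_rep (prod_chart c c) (tangent_chart A c) glued) \<and>
    (\<forall>z \<in> snd (prod_chart c c) ` (W \<times> W). inj (frechet_derivative (coord_rep (prod_chart c c) (tangent_chart A c) glued) (at z))) \<and>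
    inj_on glued (W \<times> W)" for p c W
  have "\<exists>c W. Q p c W" if p: "p \<in> points A" for p
    unfolding Q_def by (rule glued_local[OF p], intro exI conjI; (assumption | rule ballI))
  then obtain c W where "\<And>p. p \<in> points A \<Longrightarrow> Q p (c p) (W p)" by metis
  note W = this[unfolded Q_def, THEN conjunct1] this[unfolded Q_def, THEN conjunct2, THEN conjunct1]
    this[unfolded Q_def, THEN conjunct2, THEN conjunct2, THEN conjunct1]
    this[unfolded Q_def, THEN conjunct2, THEN conjunct2, THEN conjunct2, THEN conjunct1]
    this[unfolded Q_def, THEN conjunct2, THEN conjunct2, THEN conjunct2, THEN conjunct2, THEN conjunct1]
    this[unfolded Q_def, THEN conjunct2, THEN conjunct2, THEN conjunct2, THEN conjunct2, THEN conjunct2, THEN conjunct1]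
    this[unfolded Q_def, THEN conjunct2, THEN conjunct2, THEN conjunct2, THEN conjunct2, THEN conjunct2, THEN conjunct2, THEN conjunct1]
    this[unfolded Q_def, THEN conjunct2, THEN conjunct2, THEN conjunct2, THEN conjunct2, THEN conjunct2, THEN conjunct2, THEN conjunct2]
  \<comment> \<open>Taken for its supports: compact sets \<open>Z' p\<close> inside
    \<open>W p\<close> that cover the manifold.\<close>
  obtain J \<psi>' Z' where J: "finite J" "J \<subseteq> points A" "\<And>p. p \<in> J \<Longrightarrow> compactin (atlas_topology A) (Z' p)"
    "\<And>p. p \<in> J \<Longrightarrow> Z' p \<subseteq> W p" "\<And>p x. p \<in> J \<Longrightarrow> x \<in> points A \<Longrightarrow> x \<notin> Z' p \<Longrightarrow> \<psi>' p x = (0::real)"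
    "\<And>x. x \<in> points A \<Longrightarrow> (\<Sum>p\<in>J. \<psi>' p x) = 1"
    by (rule partition_of_unity[OF A H K, of W, OF W(2,3)], assumption, assumption, rule that; assumption)
  have cover: "\<exists>j\<in>J. x \<in> Z' j" if x: "x \<in> points A" for x
  proof (rule ccontr)
    assume "\<not> ?thesis"
    then have "(\<Sum>p\<in>J. \<psi>' p x) = 0" using J(5)[OF _ x] by (intro sum.neutral) blast
    then show False using J(6)[OF x] by simp
  qed
  \<comment> \<open>Injectivity on each square \<open>W j \<times> W j\<close> does not give
    injectivity on their union. Here the second point must lie in \<open>W j\<close> for every
    \<open>j\<close> whose \<open>Z' j\<close> contains the first one; two pairs with equal images
    share their first point and hence lie in a common square.\<close>
  define N where "N = {q \<in> points A \<times> points A. \<forall>j\<in>J. fst q \<in> Z' j \<longrightarrow> snd q \<in> W j}"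
  have oN: "openin (atlas_topology (prod_atlas A A)) N"
    unfolding N_def
    by (rule openin_near_diagonal[OF A J(1)]) (use compactin_imp_closedin[OF H J(3)] W(2) J(2) in blast)+
  have Nj: "\<exists>j\<in>J. fst q \<in> Z' j \<and> fst q \<in> W j \<and> snd q \<in> W j" if "q \<in> N" for q
    using that cover[of "fst q"] J(4) unfolding N_def by fastforce
  have diag: "(p, p) \<in> N" if "p \<in> points A" for p using that J(4) by (auto simp: N_def)
  have inj: "inj_on glued N"
  proof (rule inj_onI)
    fix q q' assume q: "q \<in> N" "q' \<in> N" and e: "glued q = glued q'"
    have f: "fst q = fst q'" using e by (simp add: glued_def)
    obtain j where j: "j \<in> J" "fst q \<in> Z' j" "fst q \<in> W j" "snd q \<in> W j" using Nj[OF q(1)] by blast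
    have "snd q' \<in> W j" using q(2) j(1,2) f unfolding N_def by simp
    then have "q \<in> W j \<times> W j" "q' \<in> W j \<times> W j" using j f by (auto simp: mem_Times_iff)
    then show "q = q'" using inj_onD[OF W(8) e] J(2) j(1) by blast
  qed
  have pp: "pre_manifold (prod_atlas A A)" by (rule pre_manifold_prod[OF A A])
  have pt: "pre_manifold (tangent_atlas A)" by (rule pre_manifold_tangent[OF A])
  have loc: "\<exists>e\<in>prod_atlas A A. \<exists>d\<in>tangent_atlas A. \<exists>U. openin (atlas_topology (prod_atlas A A)) U \<and> q \<in> U \<and> U \<subseteq> fst e \<inter> N \<and>
       glued ` U \<subseteq> fst d \<and> smooth_on (snd e ` U) (coord_rep e d glued) \<and>
       (\<forall>x\<in>snd e ` U. inj (frechet_derivative (coord_rep e d glued) (at x)))" if q: "q \<in> N" for q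
  proof -
    obtain j where j: "j \<in> J" "fst q \<in> W j" "snd q \<in> W j" using Nj[OF q] by blast
    have jA: "j \<in> points A" using J(2) j(1) by blast
    let ?U = "N \<inter> W j \<times> W j"
    have im: "snd (prod_chart (c j) (c j)) ` ?U \<subseteq> snd (prod_chart (c j) (c j)) ` (W j \<times> W j)" by blast
    show ?thesis
    proof (intro bexI[of _ "prod_chart (c j) (c j)"] bexI[of _ "tangent_chart A (c j)"] exI[of _ ?U] conjI)
      show "openin (atlas_topology (prod_atlas A A)) ?U"
        by (rule openin_Int[OF oN openin_prod_atlas[OF A A W(2)[OF jA] W(2)[OF jA]]])
      show "q \<in> ?U" using q j by (simp add: mem_Times_iff)
      show "?U \<subseteq> fst (prod_chart (c j) (c j)) \<inter> N" using W(4)[OF jA] by auto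
      show "glued ` ?U \<subseteq> fst (tangent_chart A (c j))" using W(5)[OF jA] by blast
      show "smooth_on (snd (prod_chart (c j) (c j)) ` ?U) (coord_rep (prod_chart (c j) (c j)) (tangent_chart A (c j)) glued)"
        by (rule smooth_on_subset[OF W(6)[OF jA] im])
      show "\<forall>x\<in>snd (prod_chart (c j) (c j)) ` ?U. inj (frechet_derivative (coord_rep (prod_chart (c j) (c j)) (tangent_chart A (c j)) glued) (at x))"
        using W(7)[OF jA] im by blast
    qed (rule tangent_chart_in[OF W(1)[OF jA]], rule prod_chart_in[OF W(1)[OF jA] W(1)[OF jA]])
  qed
  note inv = smooth_inverse_map[OF pp pt oN inj loc]
  have "admissible_map A N glued"
    unfolding admissible_map_def
  proof (intro conjI ballI allI)
    show "glued (p, p) = (p, \<lambda>c. 0)" if "p \<in> points A" for p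
      using dvec_self[OF that] by (simp add: glued_def)
    show "vsnd (frechet_derivative (coord_rep (prod_chart c c) (tangent_chart A c) glued)
                (at (vjoin (snd c p) (snd c p))) (vjoin u w)) = w - u" if "c \<in> A" "p \<in> fst c" for c p u w
      by (rule glued_derivative_diagonal[OF that])
    show "openin (atlas_topology (tangent_atlas A)) (glued ` N)" by (rule inv(2))
    show "smooth_map (prod_atlas A A) (tangent_atlas A) N glued" by (rule inv(1))
    show "smooth_map (tangent_atlas A) (prod_atlas A A) (glued ` N) (inv_into N glued)" by (rule inv(3))
  qed (fact oN inj diag)+
  then show ?thesis by metis
qed

section \<open>Local geometry of a transversally Lipschitz lamination\<close>

lemma open_polydisc: "open (polydisc :: (complex^'m::finite) set)"
proof -
  have "(polydisc :: (complex^'m) set) = (\<Inter>i\<in>UNIV. {z. cmod (z $ i) < 1})" by (auto simp: polydisc_def)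
  also have "open \<dots>" by (intro open_INT finite ballI open_Collect_less continuous_intros)
  finally show ?thesis .
qed

lemma ball_subset_polydisc: "ball 0 1 \<subseteq> (polydisc :: (complex^'m::finite) set)"
proof
  fix z :: "complex^'m" assume "z \<in> ball 0 1"
  then show "z \<in> polydisc"
    using le_less_trans[OF Finite_Cartesian_Product.norm_nth_le, of z 1] by (simp add: polydisc_def)
qed

lemma norm_polydisc_le: "z \<in> polydisc \<Longrightarrow> norm z \<le> CARD('m)" for z :: "complex^'m::finite"
  using norm_vec_le_card[of z 1] by (simp add: polydisc_def less_imp_le)

text \<open>For injective \<open>\<iota>\<close> a left inverse of \<open>leaf_vec\<close> which
  kills the transverse polydisc; it reads off the leaf coordinate of a point
  \<open>leaf_vec \<iota> z + h a z\<close> of a graph.\<close>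

definition leaf_proj :: "('q \<Rightarrow> 'n) \<Rightarrow> complex^'n \<Rightarrow> complex^'q" where
  "leaf_proj \<iota> y = (\<chi> j. y $ \<iota> j)"

lemma leaf_vec_add: "leaf_vec \<iota> (x + y) = leaf_vec \<iota> x + leaf_vec \<iota> y"
  and leaf_vec_scaleR: "leaf_vec \<iota> (r *\<^sub>R x) = r *\<^sub>R leaf_vec \<iota> x"
  and leaf_vec_smult: "leaf_vec \<iota> (c *s x) = c *s leaf_vec \<iota> x"
  by (auto simp: leaf_vec_def vec_eq_iff)

lemma norm_leaf_vec:
  fixes \<iota> :: "'q::finite \<Rightarrow> 'n::finite"
  assumes "inj \<iota>"
  shows "norm (leaf_vec \<iota> z) = norm z"
proof -
  have "(\<Sum>i\<in>UNIV. (norm (leaf_vec \<iota> z $ i))\<^sup>2) = (\<Sum>i\<in>range \<iota>. (norm (leaf_vec \<iota> z $ i))\<^sup>2)"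
    by (rule sum.mono_neutral_right) (auto simp: leaf_vec_def)
  also have "\<dots> = (\<Sum>j\<in>UNIV. (norm (z $ j))\<^sup>2)"
    by (subst sum.reindex[OF assms]) (simp add: leaf_vec_def assms)
  finally show ?thesis by (simp add: norm_vec_def L2_set_def)
qed

lemma bounded_linear_leaf_vec:
  fixes \<iota> :: "'q::finite \<Rightarrow> 'n::finite"
  shows "inj \<iota> \<Longrightarrow> bounded_linear (leaf_vec \<iota>)"
  by (rule bounded_linear_intro[of _ 1]) (simp_all add: leaf_vec_add leaf_vec_scaleR norm_leaf_vec)

lemma leaf_proj_leaf_vec: "inj \<iota> \<Longrightarrow> leaf_proj \<iota> (leaf_vec \<iota> z) = z"
  by (simp add: leaf_proj_def leaf_vec_def vec_eq_iff)

lemma leaf_proj_transverse: "t \<in> transverse_polydisc \<iota> \<Longrightarrow> leaf_proj \<iota> t = 0"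
  by (simp add: leaf_proj_def transverse_polydisc_def vec_eq_iff)

lemma leaf_proj_add: "leaf_proj \<iota> (x + y) = leaf_proj \<iota> x + leaf_proj \<iota> y"
  and leaf_proj_diff: "leaf_proj \<iota> (x - y) = leaf_proj \<iota> x - leaf_proj \<iota> y"
  by (auto simp: leaf_proj_def vec_eq_iff)

lemma norm_leaf_proj_le:
  fixes \<iota> :: "'q::finite \<Rightarrow> 'n::finite"
  assumes "inj \<iota>"
  shows "norm (leaf_proj \<iota> y) \<le> norm y"
proof -
  have "(\<Sum>j\<in>UNIV. (norm (leaf_proj \<iota> y $ j))\<^sup>2) = (\<Sum>i\<in>range \<iota>. (norm (y $ i))\<^sup>2)"
    by (subst sum.reindex[OF assms]) (simp add: leaf_proj_def)
  also have "\<dots> \<le> (\<Sum>i\<in>UNIV. (norm (y $ i))\<^sup>2)" by (rule sum_mono2) auto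
  finally show ?thesis by (simp add: norm_vec_def L2_set_def)
qed

lemma leaf_vec_plus_transverse_in_polydisc:
  assumes "inj \<iota>" "z \<in> polydisc" "t \<in> transverse_polydisc \<iota>"
  shows "leaf_vec \<iota> z + t \<in> polydisc"
  unfolding polydisc_def mem_Collect_eq
proof
  fix i
  show "cmod ((leaf_vec \<iota> z + t) $ i) < 1"
  proof (cases "i \<in> range \<iota>")
    case True
    then obtain j where "i = \<iota> j" by blast
    then show ?thesis using assms by (simp add: leaf_vec_def transverse_polydisc_def polydisc_def)
  next
    case False
    then show ?thesis using assms by (simp add: leaf_vec_def transverse_polydisc_def polydisc_def)
  qed
qed

text \<open>Cauchy's estimate, applied to \<open>h a - h b\<close>, turns the Lipschitz dependence of the plaques on the
  parameter into one of their tangent spaces.\<close>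

lemma plaque_graph_estimate:
  fixes h :: "complex^'n::finite \<Rightarrow> complex^'q::finite \<Rightarrow> complex^'n" and \<iota> :: "'q \<Rightarrow> 'n"
  assumes hol: "\<And>a. a \<in> K \<Longrightarrow> complex_differentiable_on polydisc (h a)"
    and tr: "\<And>a. a \<in> K \<Longrightarrow> h a ` polydisc \<subseteq> transverse_polydisc \<iota>"
    and C: "C > 0" "\<And>a b z. a \<in> K \<Longrightarrow> b \<in> K \<Longrightarrow> (\<forall>i. cmod (z $ i) \<le> 1/2) \<Longrightarrow>
        norm (a - b) / C \<le> norm (h a z - h b z) \<and> norm (h a z - h b z) \<le> C * norm (a - b)"
  obtains E where "E \<ge> 0"
    "\<And>a z u. a \<in> K \<Longrightarrow> norm z < 1/8 \<Longrightarrow> norm (frechet_derivative (h a) (at z) u) \<le> E * norm u"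
    "\<And>a b z w u. a \<in> K \<Longrightarrow> b \<in> K \<Longrightarrow> norm z < 1/8 \<Longrightarrow> norm w < 1/8 \<Longrightarrow>
       norm (frechet_derivative (h a) (at z) u - frechet_derivative (h b) (at w) u)
         \<le> E * (norm (z - w) + norm (h a z - h b w)) * norm u"
proof -
  define n where "n = real CARD('n)"
  have n: "n \<ge> 1" by (simp add: n_def Suc_leI)
  define D where "D = 2 * n * n / (1/2)"
  have D: "D \<ge> 0" using n by (simp add: D_def)
  have ball: "ball 0 (2 * (1/2)) \<subseteq> (polydisc :: (complex^'q) set)" using ball_subset_polydisc by simp
  have hM: "norm (h a z) \<le> n" if "a \<in> K" "z \<in> polydisc" for a z
    using tr[OF that(1)] that(2) norm_polydisc_le[of "h a z"] by (auto simp: transverse_polydisc_def n_def)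
  have half: "cmod (z $ i) \<le> 1/2" if "norm z < 1/2" for z :: "complex^'q" and i
    using le_less_trans[OF Finite_Cartesian_Product.norm_nth_le that, of i] by simp
  have L: "norm (frechet_derivative (h a) (at z) u) \<le> D * norm u" if "a \<in> K" "norm z < 1/2" for a z u
    unfolding D_def n_def
    by (rule holomorphic_Lipschitz(1)[OF complex_differentiable_on_subset[OF hol[OF that(1)] ball], of n, unfolded n_def])
      (use that ball hM[OF that(1)] in \<open>auto simp: n_def\<close>)
  have L2: "norm (h a z - h a w) \<le> D * norm (z - w)" if "a \<in> K" "norm z < 1/2" "norm w < 1/2" for a z w
    unfolding D_def n_def
    by (rule holomorphic_Lipschitz(2)[OF complex_differentiable_on_subset[OF hol[OF that(1)] ball], of n, unfolded n_def])
      (use that ball hM[OF that(1)] in \<open>auto simp: n_def\<close>)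
  \<comment> \<open>Collects the two ways in which the translated plaques differ: \<open>D\<close>
    for moving along one plaque, \<open>C * C * (1 + D)\<close> for the change of parameter, whose
    size is bounded in \<open>ab_le\<close>.\<close>
  define F where "F = D + C * C * (1 + D)"
  have F: "F \<ge> 0" using D C(1) by (simp add: F_def)
  define E where "E = D + 2 * n * F / (1/8)"
  have diff: "norm (frechet_derivative (h a) (at z) u - frechet_derivative (h b) (at w) u)
         \<le> 2 * n * F / (1/8) * (norm (z - w) + norm (h a z - h b w)) * norm u"
    if ab: "a \<in> K" "b \<in> K" and zw: "norm z < 1/8" "norm w < 1/8" for a b z w u
  proof -
    have sub: "ball z (1/8) \<subseteq> polydisc" "ball w (1/8) \<subseteq> polydisc"
    proof -
      have "ball v (1/8) \<subseteq> ball 0 1" if "norm v < 1/8" for v :: "complex^'q"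
        using that by (simp add: ball_subset_ball_iff)
      then show "ball z (1/8) \<subseteq> polydisc" "ball w (1/8) \<subseteq> polydisc"
        using zw ball_subset_polydisc by blast+
    qed
    \<comment> \<open>The lower Lipschitz bound recovers the distance of the parameters from two
      arbitrary points of the plaques, after sliding along one plaque to the common base point
      \<open>w\<close>.\<close>
    have ab_le: "norm (a - b) \<le> C * (1 + D) * (norm (z - w) + norm (h a z - h b w))"
    proof -
      have "norm (a - b) \<le> C * norm (h a w - h b w)"
        using C(2)[OF ab, of w] half[of w] zw C(1) by (auto simp: field_simps)
      also have "norm (h a w - h b w) \<le> norm (h a w - h a z) + norm (h a z - h b w)"
        using norm_triangle_ineq[of "h a w - h a z" "h a z - h b w"] by simp
      also have "norm (h a w - h a z) \<le> D * norm (z - w)"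
        using L2[OF ab(1), of w z] zw by (simp add: norm_minus_commute)
      also have "D * norm (z - w) + norm (h a z - h b w) \<le> (1 + D) * (norm (z - w) + norm (h a z - h b w))"
        using D by (simp add: algebra_simps)
      finally show ?thesis using C(1) by (simp add: mult.assoc)
    qed
    have "norm (frechet_derivative (h a) (at z) u - frechet_derivative (h b) (at w) u)
      \<le> 2 * real CARD('n) * (F * (norm (z - w) + norm (h a z - h b w))) / (1/8) * norm u"
    proof (rule Cauchy_estimate_diff[OF complex_differentiable_on_subset[OF hol[OF ab(1)] sub(1)]
          complex_differentiable_on_subset[OF hol[OF ab(2)] sub(2)]])
      fix \<zeta> assume "\<zeta> \<in> ball w (1/8)"
      then have \<zeta>: "norm \<zeta> < 1/4"
        using zw(2) norm_triangle_ineq2[of \<zeta> w] by (simp add: dist_norm norm_minus_commute)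
      \<comment> \<open>The radii 1/8 are chosen so that the shifted point stays in the ball of
        radius 1/2, where the bound \<open>L2\<close> along a plaque holds.\<close>
      have s: "norm (z - w + \<zeta>) < 1/2"
        using zw \<zeta> norm_triangle_ineq[of "z - w" \<zeta>] norm_triangle_ineq4[of z w] by simp
      have "norm (h a (z - w + \<zeta>) - h b \<zeta>) \<le> norm (h a (z - w + \<zeta>) - h a \<zeta>) + norm (h a \<zeta> - h b \<zeta>)"
        using norm_triangle_ineq[of "h a (z - w + \<zeta>) - h a \<zeta>" "h a \<zeta> - h b \<zeta>"] by simp
      also have "norm (h a (z - w + \<zeta>) - h a \<zeta>) \<le> D * norm (z - w)"
        using L2[OF ab(1) s, of \<zeta>] \<zeta> by simp
      also have "norm (h a \<zeta> - h b \<zeta>) \<le> C * norm (a - b)"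
        using C(2)[OF ab, of \<zeta>] half[of \<zeta>] \<zeta> by simp
      also have "C * norm (a - b) \<le> C * (C * (1 + D) * (norm (z - w) + norm (h a z - h b w)))"
        using ab_le C(1) by simp
      also have "D * norm (z - w) \<le> D * (norm (z - w) + norm (h a z - h b w))"
        using D by (simp add: mult_left_mono)
      finally show "norm (h a (z - w + \<zeta>) - h b \<zeta>) \<le> F * (norm (z - w) + norm (h a z - h b w))"
        by (simp add: F_def algebra_simps)
    qed simp
    then show ?thesis by (simp add: n_def mult_ac)
  qed
  show thesis
  proof (rule that[of E])
    show "E \<ge> 0" using D F n by (simp add: E_def)
    show "norm (frechet_derivative (h a) (at z) u) \<le> E * norm u" if "a \<in> K" "norm z < 1/8" for a z u
    proof -
      have "D * norm u \<le> E * norm u" using F n by (intro mult_right_mono) (auto simp: E_def)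
      then show ?thesis using L[OF that(1), of z u] that(2) by simp
    qed
    show "norm (frechet_derivative (h a) (at z) u - frechet_derivative (h b) (at w) u)
         \<le> E * (norm (z - w) + norm (h a z - h b w)) * norm u"
      if "a \<in> K" "b \<in> K" "norm z < 1/8" "norm w < 1/8" for a b z w u
    proof -
      have "2 * n * F / (1/8) * (norm (z - w) + norm (h a z - h b w)) * norm u
        \<le> E * (norm (z - w) + norm (h a z - h b w)) * norm u"
        using D by (intro mult_right_mono) (auto simp: E_def)
      then show ?thesis using diff[OF that, of u] by linarith
    qed
  qed
qed

section \<open>Flow boxes and plaques\<close>

lemma embedding_map_imp_continuous_map:
  assumes "embedding_map X Y f"
  shows "continuous_map X Y f"
  using homeomorphic_imp_continuous_map[OF assms[unfolded embedding_map_def]]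
  by (simp add: continuous_map_in_subtopology)

lemma embedding_map_imp_open_map:
  assumes "embedding_map X Y f" "openin Y (f ` topspace X)"
  shows "open_map X Y f"
  using homeomorphic_imp_open_map[OF assms(1)[unfolded embedding_map_def]] openin_trans_full[OF _ assms(2)]
  unfolding open_map_def by blast

lemma flow_box_inj:
  assumes "is_flow_box A \<iota> \<Sigma> b"
  shows "inj_on (fst b) (polydisc \<times> snd b)"
proof -
  have "embedding_map (top_of_set (polydisc \<times> snd b)) (subtopology (atlas_topology A) \<Sigma>) (fst b)"
    using assms by (simp add: is_flow_box_def)
  then have "homeomorphic_map (top_of_set (polydisc \<times> snd b))
     (subtopology (subtopology (atlas_topology A) \<Sigma>) (fst b ` topspace (top_of_set (polydisc \<times> snd b)))) (fst b)"
    unfolding embedding_map_def .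
  then show ?thesis using homeomorphic_imp_injective_map by fastforce
qed

lemma flow_box_continuous:
  assumes b: "is_flow_box A \<iota> \<Sigma> b" and O: "openin (subtopology (atlas_topology A) \<Sigma>) V"
    and p: "z \<in> polydisc" "s \<in> snd b" "fst b (z, s) \<in> V"
  obtains r where "0 < r" "\<And>z' s'. dist z' z < r \<Longrightarrow> s' \<in> snd b \<Longrightarrow> dist s' s < r \<Longrightarrow> z' \<in> polydisc \<and> fst b (z', s') \<in> V"
proof -
  have "continuous_map (top_of_set (polydisc \<times> snd b)) (subtopology (atlas_topology A) \<Sigma>) (fst b)"
    using b embedding_map_imp_continuous_map unfolding is_flow_box_def by blast
  from openin_continuous_map_preimage[OF this O]
  obtain G where G: "open G" "{x \<in> polydisc \<times> snd b. fst b x \<in> V} = (polydisc \<times> snd b) \<inter> G"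
    by (auto simp: openin_open)
  have "(z, s) \<in> G" using p G(2) by blast
  then obtain S T where ST: "open S" "open T" "z \<in> S" "s \<in> T" "S \<times> T \<subseteq> G"
    using open_prod_elim[OF G(1)] by (metis mem_Sigma_iff)
  have "open (S \<inter> polydisc)" using ST(1) open_polydisc by blast
  then obtain r1 where r1: "r1 > 0" "ball z r1 \<subseteq> S \<inter> polydisc" using ST(3) p(1) openE by blast
  obtain r2 where r2: "r2 > 0" "ball s r2 \<subseteq> T" using ST(2,4) openE by blast
  show thesis
  proof (rule that[of "min r1 r2"])
    show "0 < min r1 r2" using r1 r2 by simp
    fix z' s' assume d: "dist z' z < min r1 r2" "s' \<in> snd b" "dist s' s < min r1 r2"
    then have "z' \<in> S" "z' \<in> polydisc" "s' \<in> T" using r1(2) r2(2) by (auto simp: dist_commute)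
    then show "z' \<in> polydisc \<and> fst b (z', s') \<in> V" using ST(5) G(2) d(2) by blast
  qed
qed

text \<open>Continuity of the inverse of the flow box. Since the box is open in
  \<open>\<Sigma>\<close>, relative neighbourhoods come from open sets \<open>W\<close> of the
  manifold.\<close>

lemma flow_box_open:
  assumes b: "is_flow_box A \<iota> \<Sigma> b" and p: "z \<in> polydisc" "s \<in> snd b" and "0 < r"
  obtains W where "openin (atlas_topology A) W" "fst b (z, s) \<in> W"
    "\<And>z' s'. z' \<in> polydisc \<Longrightarrow> s' \<in> snd b \<Longrightarrow> fst b (z', s') \<in> W \<Longrightarrow> dist z' z < r \<and> dist s' s < r"
proof -
  let ?X = "top_of_set (polydisc \<times> snd b)" and ?Y = "subtopology (atlas_topology A) \<Sigma>"
  have em: "embedding_map ?X ?Y (fst b)" and op: "openin ?Y (fst b ` (polydisc \<times> snd b))"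
    using b by (auto simp: is_flow_box_def)
  have "open_map ?X ?Y (fst b)"
    using em op embedding_map_imp_open_map[of ?X ?Y "fst b"] by simp
  moreover have "openin ?X ((polydisc \<times> snd b) \<inter> (ball z r \<times> ball s r))"
    by (rule openin_open_Int) (intro open_Times open_ball)
  ultimately have "openin ?Y (fst b ` ((polydisc \<times> snd b) \<inter> (ball z r \<times> ball s r)))"
    unfolding open_map_def by blast
  then obtain W where W: "openin (atlas_topology A) W"
    "fst b ` ((polydisc \<times> snd b) \<inter> (ball z r \<times> ball s r)) = W \<inter> \<Sigma>"
    unfolding openin_subtopology by blast
  show thesis
  proof (rule that[OF W(1)])
    show "fst b (z, s) \<in> W" using W(2) p \<open>0 < r\<close> by auto
    fix z' s' assume zs: "z' \<in> polydisc" "s' \<in> snd b" "fst b (z', s') \<in> W"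
    have "fst b (z', s') \<in> fst b ` (polydisc \<times> snd b)" using zs by blast
    then have "fst b (z', s') \<in> \<Sigma>" using openin_subset[OF op] by auto
    then have "fst b (z', s') \<in> fst b ` ((polydisc \<times> snd b) \<inter> (ball z r \<times> ball s r))" using W(2) zs(3) by blast
    then obtain z2 s2 where e: "fst b (z', s') = fst b (z2, s2)" "z2 \<in> polydisc" "s2 \<in> snd b" "dist z z2 < r" "dist s s2 < r"
      by auto
    have "(z', s') = (z2, s2)" using inj_onD[OF flow_box_inj[OF b] e(1)] zs e by blast
    then show "dist z' z < r \<and> dist s' s < r" using e by (simp add: dist_commute)
  qed
qed

lemma flow_box_subset: "is_flow_box A \<iota> \<Sigma> b \<Longrightarrow> box_set b \<subseteq> \<Sigma> \<inter> points A"
  using openin_subset unfolding is_flow_box_def by (fastforce simp: topspace_atlas)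

text \<open>Holomorphy of an embedded box is phrased through the one-chart atlas of the polydisc,
  whose \<open>chart_inv\<close> is the identity on the polydisc only. Here it is translated into
  statements on plain functions, on open sets where both readings agree.\<close>

lemma plaque_holomorphic:
  fixes A :: "('a, 'n::finite) chart set" and \<iota> :: "'q::finite \<Rightarrow> 'n"
  assumes A: "pre_manifold A" and b: "is_embedded_flow_box A \<iota> \<Sigma> b" and t: "t \<in> transverse_polydisc \<iota>" and c: "c \<in> A"
  shows "open {z \<in> polydisc. fst b (z, t) \<in> fst c}"
    and "complex_differentiable_on {z \<in> polydisc. fst b (z, t) \<in> fst c} (\<lambda>z. snd c (fst b (z, t)))"
    and "z \<in> polydisc \<Longrightarrow> fst b (z, t) \<in> fst c \<Longrightarrow>
      frechet_derivative (coord_rep (polydisc, \<lambda>z. z) c (\<lambda>z. fst b (z, t))) (at z)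
       = frechet_derivative (\<lambda>z. snd c (fst b (z, t))) (at z)"
    and "z \<in> polydisc \<Longrightarrow> fst b (z, t) \<in> points A"
proof -
  have cm: "continuous_map (top_of_set (polydisc \<times> transverse_polydisc \<iota>)) (atlas_topology A) (fst b)"
    using b embedding_map_imp_continuous_map unfolding is_embedded_flow_box_def by blast
  have "continuous_map (top_of_set polydisc) (top_of_set (polydisc \<times> transverse_polydisc \<iota>)) (\<lambda>z. (z, t))"
    using t by (auto intro!: continuous_intros)
  from continuous_map_compose[OF this cm]
  have cz: "continuous_map (top_of_set polydisc) (atlas_topology A) (\<lambda>z. fst b (z, t))" by (simp add: comp_def)
  from openin_continuous_map_preimage[OF this openin_chart_domain[OF c]]
  show o: "open {z \<in> polydisc. fst b (z, t) \<in> fst c}"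
    by (simp add: openin_open_eq[OF open_polydisc])
  show "fst b (z, t) \<in> points A" if "z \<in> polydisc" for z
    using continuous_map_image_subset_topspace[OF cz] that by (auto simp: topspace_atlas)
  have inv: "chart_inv (polydisc, \<lambda>z. z) z = z" if "z \<in> polydisc" for z :: "complex^'q"
    using inv_into_f_f[of "\<lambda>z. z" polydisc z] that by simp
  have hm: "holomorphic_map polydisc_atlas A polydisc (\<lambda>z. fst b (z, t))"
    using b t unfolding is_embedded_flow_box_def by blast
  have "complex_differentiable_on (snd (polydisc, \<lambda>z. z) ` {z \<in> fst (polydisc, \<lambda>z. z :: complex^'q) \<inter> polydisc. fst b (z, t) \<in> fst c})
     (coord_rep (polydisc, \<lambda>z. z) c (\<lambda>z. fst b (z, t)))"
    using bspec[OF bspec[OF conjunct2[OF hm[unfolded manifold_map_def polydisc_atlas_def]] insertI1] c]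
    by (simp only: fst_conv snd_conv)
  then have cd: "complex_differentiable_on {z \<in> polydisc. fst b (z, t) \<in> fst c} (coord_rep (polydisc, \<lambda>z. z) c (\<lambda>z. fst b (z, t)))"
    by simp
  have eq: "coord_rep (polydisc, \<lambda>z. z) c (\<lambda>z. fst b (z, t)) z = snd c (fst b (z, t))" if "z \<in> {z \<in> polydisc. fst b (z, t) \<in> fst c}" for z
    using that inv[of z] by (simp add: coord_rep_def)
  show "complex_differentiable_on {z \<in> polydisc. fst b (z, t) \<in> fst c} (\<lambda>z. snd c (fst b (z, t)))"
    by (rule complex_differentiable_on_cong_open[OF o eq cd])
  show "frechet_derivative (coord_rep (polydisc, \<lambda>z. z) c (\<lambda>z. fst b (z, t))) (at z)
       = frechet_derivative (\<lambda>z. snd c (fst b (z, t))) (at z)" if "z \<in> polydisc" "fst b (z, t) \<in> fst c" for z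
    by (rule frechet_derivative_transform_within_open[OF _ o _ eq])
      (use complex_differentiable_onD(1)[OF cd, of z] that in \<open>auto simp: differentiable_def\<close>)
qed

abbreviation plaque_coord :: "('a, 'n) chart \<Rightarrow> ('a, 'q, 'n) flow_box \<Rightarrow> complex^'n \<Rightarrow> complex^'q \<Rightarrow> complex^'n::finite" where
  "plaque_coord c b t z \<equiv> snd c (fst b (z, t))"

text \<open>The hypothesis speaks of graphs in special coordinates \<open>c\<close>, whereas the
  cycle disintegrates along boxes of \<open>L\<close> and forms are read in charts of
  \<open>A\<close>. The holomorphic box changes and the change from \<open>c\<close> to
  \<open>c0\<close>, all bounded by Cauchy estimates, carry the graph estimates over. The last
  conclusion will limit the volume of the part of a plaque that is close to a given point.\<close>

lemma lamination_local:
  fixes A :: "('a, 'n::finite) chart set" and \<iota> :: "'q::finite \<Rightarrow> 'n"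
  assumes A: "pre_manifold A" and L: "embedded_lamination A \<iota> \<Sigma> L" and Lip: "transversally_Lipschitz A \<iota> \<Sigma> L"
    and p: "p \<in> \<Sigma>" and b: "b \<in> L" "p \<in> box_set b" and c0: "c0 \<in> A" "p \<in> fst c0"
  obtains W C where "openin (atlas_topology A) W" "p \<in> W" "W \<subseteq> fst c0" "W \<inter> \<Sigma> \<subseteq> box_set b"
    "W \<subseteq> fst b ` (polydisc \<times> transverse_polydisc \<iota>)" "(C::real) > 0"
    "\<And>z s v. z \<in> polydisc \<Longrightarrow> s \<in> snd b \<Longrightarrow> fst b (z, s) \<in> W \<Longrightarrow>
       norm (frechet_derivative (plaque_coord c0 b s) (at z) v) \<le> C * norm v"
    "\<And>z s w t v. z \<in> polydisc \<Longrightarrow> s \<in> snd b \<Longrightarrow> fst b (z, s) \<in> W \<Longrightarrow>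
       w \<in> polydisc \<Longrightarrow> t \<in> snd b \<Longrightarrow> fst b (w, t) \<in> W \<Longrightarrow>
       \<exists>v'. norm (frechet_derivative (plaque_coord c0 b s) (at z) v - frechet_derivative (plaque_coord c0 b t) (at w) v')
         \<le> C * norm (plaque_coord c0 b s z - plaque_coord c0 b t w) * norm v"
    "\<And>w w' t. t \<in> snd b \<Longrightarrow> w \<in> polydisc \<Longrightarrow> w' \<in> polydisc \<Longrightarrow> fst b (w, t) \<in> W \<Longrightarrow> fst b (w', t) \<in> W \<Longrightarrow>
       norm (w - w') \<le> C * norm (plaque_coord c0 b t w - plaque_coord c0 b t w')"
proof -
  have inj\<iota>: "inj \<iota>" using L by (simp add: embedded_lamination_def)
  have eb: "is_embedded_flow_box A \<iota> \<Sigma> b" using L b(1) unfolding embedded_lamination_def by blast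
  then have fb: "is_flow_box A \<iota> \<Sigma> b" by (simp add: is_embedded_flow_box_def)
  have Ktr: "snd b \<subseteq> transverse_polydisc \<iota>" using fb by (simp add: is_flow_box_def)
  obtain c K h where c: "holomorphic_coordinates A c" "chart_image c = polydisc" "p \<in> fst c" "snd c p = 0"
    and K: "0 \<in> K" "K \<subseteq> transverse_polydisc \<iota>" and h0: "\<forall>z\<in>polydisc. h 0 z = 0"
    and h: "\<forall>a\<in>K. complex_differentiable_on polydisc (h a) \<and> h a ` polydisc \<subseteq> transverse_polydisc \<iota> \<and> h a 0 = a"
    and fc: "let b = (\<lambda>(z, a). chart_inv c (leaf_vec \<iota> z + h a z), K) in
        is_flow_box A \<iota> \<Sigma> b \<and> (\<forall>b'\<in>L. flow_box_change b b' \<and> flow_box_change b' b)"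
    and hL: "\<forall>\<rho>. 0 < \<rho> \<and> \<rho> < 1 \<longrightarrow> (\<exists>C>0. \<forall>a\<in>K. \<forall>a'\<in>K. \<forall>z::complex^'q. (\<forall>i. cmod (z $ i) \<le> \<rho>) \<longrightarrow>
        norm (a - a') / C \<le> norm (h a z - h a' z) \<and> norm (h a z - h a' z) \<le> C * norm (a - a'))"
    using bspec[OF Lip[unfolded transversally_Lipschitz_def] p] apply -
    apply (elim exE conjE)
    apply (rule that)
    apply assumption+
    done
  define b0 where "b0 = (\<lambda>(z, a). chart_inv c (leaf_vec \<iota> z + h a z), K)"
  have fb0: "is_flow_box A \<iota> \<Sigma> b0" and ch01: "flow_box_change b0 b" and ch10: "flow_box_change b b0"
    using fc b(1) unfolding b0_def Let_def by blast+
  have K0: "snd b0 = K" by (simp add: b0_def)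
  have hol: "complex_differentiable_on polydisc (h a)" "h a ` polydisc \<subseteq> transverse_polydisc \<iota>" "h a 0 = a" if "a \<in> K" for a
    using h that by blast+
  have inY: "leaf_vec \<iota> z + h a z \<in> chart_image c" if "z \<in> polydisc" "a \<in> K" for z a
    unfolding c(2) by (rule leaf_vec_plus_transverse_in_polydisc[OF inj\<iota> that(1)]) (use hol(2)[OF that(2)] that(1) in blast)
  have b0c: "fst b0 (z, a) \<in> fst c" and cb0: "snd c (fst b0 (z, a)) = leaf_vec \<iota> z + h a z" if "z \<in> polydisc" "a \<in> K" for z a
    using chart_inv_in[OF inY[OF that]] chart_chart_inv[OF inY[OF that]] by (simp_all add: b0_def)
  have zero: "(0 :: complex^'q) \<in> polydisc" by (simp add: polydisc_def)
  have cc: "is_chart c" and co: "charts_compatible c c0" "charts_compatible c0 c"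
    using holomorphic_coordinatesD[OF c(1)] c0(1) by blast+
  have cc0: "is_chart c0" by (rule pre_manifoldD(1)[OF A c0(1)])
  have pb0: "fst b0 (0, 0) = p"
  proof -
    have "leaf_vec \<iota> 0 + h 0 0 = (0 :: complex^'n)"
      using h0 zero linear_simps(3)[OF bounded_linear_leaf_vec[OF inj\<iota>]] by simp
    then show ?thesis using chart_inv_chart[OF cc c(3)] c(4) by (simp add: b0_def)
  qed
  have pin0: "p \<in> box_set b0" using pb0 zero K(1) K0 by force
  obtain zp sp where zp: "zp \<in> polydisc" "sp \<in> snd b" "p = fst b (zp, sp)" using b(2) by auto
  have ob: "openin (subtopology (atlas_topology A) \<Sigma>) (box_set b)" "openin (subtopology (atlas_topology A) \<Sigma>) (box_set b0)"
    using fb fb0 by (auto simp: is_flow_box_def)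
  obtain r where r: "0 < r" "\<And>z s. dist z zp < r \<Longrightarrow> s \<in> snd b \<Longrightarrow> dist s sp < r \<Longrightarrow> z \<in> polydisc \<and> fst b (z, s) \<in> box_set b0"
    by (rule flow_box_continuous[OF fb ob(2) zp(1,2)]) (use zp(3) pin0 in auto)
  obtain r0' where r0': "0 < r0'" "\<And>z s. dist z 0 < r0' \<Longrightarrow> s \<in> snd b0 \<Longrightarrow> dist s 0 < r0' \<Longrightarrow> z \<in> polydisc \<and> fst b0 (z, s) \<in> box_set b"
    by (rule flow_box_continuous[OF fb0 ob(1) zero, of 0]) (use K(1) K0 pb0 b(2) in auto)
  \<comment> \<open>The cap makes leaf coordinates below \<open>r0 / 2\<close> smaller than 1/8, the
    range of \<open>plaque_graph_estimate\<close>.\<close>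
  define r0 where "r0 = min r0' (1/4)"
  have r0: "0 < r0" "r0 \<le> 1/4" "\<And>z s. dist z 0 < r0 \<Longrightarrow> s \<in> snd b0 \<Longrightarrow> dist s 0 < r0 \<Longrightarrow> z \<in> polydisc \<and> fst b0 (z, s) \<in> box_set b"
    using r0' by (auto simp: r0_def)
  \<comment> \<open>Half of \<open>r\<close> leaves a ball of radius \<open>r / 2\<close> around
    each box coordinate on which the box change is defined, as Cauchy's estimate requires.
    \<open>W2\<close> leaves similar room for the reverse change.\<close>
  obtain W1 where W1: "openin (atlas_topology A) W1" "p \<in> W1"
    "\<And>z s. z \<in> polydisc \<Longrightarrow> s \<in> snd b \<Longrightarrow> fst b (z, s) \<in> W1 \<Longrightarrow> dist z zp < r / 2 \<and> dist s sp < r / 2"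
    by (rule flow_box_open[OF fb zp(1,2), of "r / 2"]) (use r(1) zp(3) in auto)
  obtain W2 where W2: "openin (atlas_topology A) W2" "p \<in> W2"
    "\<And>z s. z \<in> polydisc \<Longrightarrow> s \<in> snd b0 \<Longrightarrow> fst b0 (z, s) \<in> W2 \<Longrightarrow> dist z 0 < r0 / 2 \<and> dist s 0 < r0 / 2"
    by (rule flow_box_open[OF fb0 zero, of 0 "r0 / 2"]) (use r0(1) K(1) K0 pb0 in auto)
  define \<kappa> where "\<kappa> = coord_rep c c0 id"
  define \<kappa>' where "\<kappa>' = coord_rep c0 c id"
  have k1: "complex_differentiable_on (snd c ` (fst c \<inter> fst c0)) \<kappa>" "open (snd c ` (fst c \<inter> fst c0))"
    and k2: "complex_differentiable_on (snd c0 ` (fst c0 \<inter> fst c)) \<kappa>'" "open (snd c0 ` (fst c0 \<inter> fst c))"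
    using charts_compatibleD[OF co(1)] charts_compatibleD[OF co(2)] by (simp_all add: \<kappa>_def \<kappa>'_def)
  have p1: "0 \<in> snd c ` (fst c \<inter> fst c0)" and p2: "snd c0 p \<in> snd c0 ` (fst c0 \<inter> fst c)"
    using c(3,4) c0(2) by (force, blast)
  obtain R M where R: "0 < R" "0 < M" "ball 0 R \<subseteq> snd c ` (fst c \<inter> fst c0)" "\<And>w. w \<in> ball 0 R \<Longrightarrow> norm (\<kappa> w) \<le> M"
    using complex_differentiable_on_locally_bounded[OF k1 p1] by metis
  obtain R' M' where R': "0 < R'" "0 < M'" "ball (snd c0 p) R' \<subseteq> snd c0 ` (fst c0 \<inter> fst c)" "\<And>w. w \<in> ball (snd c0 p) R' \<Longrightarrow> norm (\<kappa>' w) \<le> M'"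
    using complex_differentiable_on_locally_bounded[OF k2 p2] by metis
  define n where "n = real CARD('n)"
  define q where "q = real CARD('q)"
  define \<rho> where "\<rho> = R / 8"
  have \<rho>: "0 < \<rho>" "8 * \<rho> = R" using R(1) by (auto simp: \<rho>_def)
  define Ck where "Ck = 2 * n * M / \<rho>"
  define Ck2 where "Ck2 = n\<^sup>2 * M / \<rho>\<^sup>2"
  define Ck' where "Ck' = 2 * n * M' / (R' / 2)"
  have kD: "norm (frechet_derivative \<kappa> (at x) v) \<le> Ck * norm v" if "x \<in> ball 0 \<rho>" for x v
    unfolding Ck_def n_def
    by (rule holomorphic_Lipschitz(1)[OF complex_differentiable_on_subset[OF k1(1)] \<rho>(1) _ that])
      (use R(3,4) \<rho> in auto)
  have kD2: "norm (frechet_derivative \<kappa> (at x) v - frechet_derivative \<kappa> (at y) v) \<le> Ck2 * norm (x - y) * norm v"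
    if "x \<in> ball 0 \<rho>" "y \<in> ball 0 \<rho>" for x y v
    unfolding Ck2_def n_def
    by (rule holomorphic_deriv_Lipschitz[OF complex_differentiable_on_subset[OF k1(1)] \<rho>(1) _ that])
      (use R(3,4) \<rho> in auto)
  have k'L: "norm (\<kappa>' x - \<kappa>' y) \<le> Ck' * norm (x - y)" if "x \<in> ball (snd c0 p) (R'/2)" "y \<in> ball (snd c0 p) (R'/2)" for x y
    unfolding Ck'_def n_def
    by (rule holomorphic_Lipschitz(2)[OF complex_differentiable_on_subset[OF k2(1)] _ _ that])
      (use R' in auto)
  have nonneg: "Ck \<ge> 0" "Ck2 \<ge> 0" "Ck' \<ge> 0" using R(1,2) R'(1,2) \<rho> by (simp_all add: Ck_def Ck2_def Ck'_def n_def)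
  define W3 where "W3 = (fst c \<inter> snd c -` ball 0 \<rho>) \<inter> (fst c0 \<inter> snd c0 -` ball (snd c0 p) (R' / 2))"
  have W3: "openin (atlas_topology A) W3" "p \<in> W3"
    unfolding W3_def using openin_chart_vimage[OF A c(1) open_ball] openin_atlas_basic[OF c0(1) open_ball] c(3,4) c0(2) R'(1) \<rho>(1)
    by auto
  have cL: "norm (snd c x - snd c y) \<le> Ck' * norm (snd c0 x - snd c0 y)" if xy: "x \<in> W3" "y \<in> W3" for x y
  proof -
    have "\<kappa>' (snd c0 x) = snd c x" "\<kappa>' (snd c0 y) = snd c y"
      using coord_rep_chart[OF cc0, of _ c id] xy by (simp_all add: W3_def \<kappa>'_def)
    then show ?thesis using k'L[of "snd c0 x" "snd c0 y"] xy by (simp add: W3_def)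
  qed
  obtain f \<gamma> where f: "\<And>t z. t \<in> snd b \<Longrightarrow> z \<in> polydisc \<Longrightarrow> fst b (z, t) \<in> box_set b0 \<Longrightarrow>
        f z t \<in> polydisc \<and> \<gamma> t \<in> K \<and> fst b (z, t) = fst b0 (f z t, \<gamma> t)"
    "\<And>t. t \<in> snd b \<Longrightarrow> complex_differentiable_on {z \<in> polydisc. fst b (z, t) \<in> box_set b0} (\<lambda>z. f z t)"
    using ch10 unfolding flow_box_change_def K0 by blast
  obtain g \<eta> where g: "\<And>t z. t \<in> K \<Longrightarrow> z \<in> polydisc \<Longrightarrow> fst b0 (z, t) \<in> box_set b \<Longrightarrow>
        g z t \<in> polydisc \<and> \<eta> t \<in> snd b \<and> fst b0 (z, t) = fst b (g z t, \<eta> t)"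
    "\<And>t. t \<in> K \<Longrightarrow> complex_differentiable_on {z \<in> polydisc. fst b0 (z, t) \<in> box_set b} (\<lambda>z. g z t)"
    using ch01 unfolding flow_box_change_def K0 by blast
  define Cf where "Cf = 2 * q * q / (r / 2)"
  define Cg where "Cg = 2 * q * q / (r0 / 2)"
  have fgnn: "Cf \<ge> 0" "Cg \<ge> 0" using r(1) r0(1) by (simp_all add: Cf_def Cg_def q_def)
  obtain CL where CL: "CL > 0" "\<And>a b z. a \<in> K \<Longrightarrow> b \<in> K \<Longrightarrow> (\<forall>i. cmod (z $ i) \<le> 1/2) \<Longrightarrow>
        norm (a - b) / CL \<le> norm (h a z - h b z) \<and> norm (h a z - h b z) \<le> CL * norm (a - b)"
    using hL[rule_format, of "1/2"] by auto
  obtain E where E: "E \<ge> 0"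
    "\<And>a z u. a \<in> K \<Longrightarrow> norm z < 1/8 \<Longrightarrow> norm (frechet_derivative (h a) (at z) u) \<le> E * norm u"
    "\<And>a b z w u. a \<in> K \<Longrightarrow> b \<in> K \<Longrightarrow> norm z < 1/8 \<Longrightarrow> norm w < 1/8 \<Longrightarrow>
       norm (frechet_derivative (h a) (at z) u - frechet_derivative (h b) (at w) u)
         \<le> E * (norm (z - w) + norm (h a z - h b w)) * norm u"
    by (rule plaque_graph_estimate[OF hol(1,2) CL], assumption, assumption, assumption, assumption, assumption, rule that; assumption)
  obtain V1 where V1: "openin (atlas_topology A) V1" "box_set b = V1 \<inter> \<Sigma>"
    using ob(1) unfolding openin_subtopology by blast
  obtain V2 where V2: "openin (atlas_topology A) V2" "box_set b0 = V2 \<inter> \<Sigma>"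
    using ob(2) unfolding openin_subtopology by blast
  \<comment> \<open>\<open>V1\<close> and \<open>V2\<close> force the points of
    \<open>\<Sigma>\<close> in \<open>W\<close> into both boxes, \<open>W1\<close> and
    \<open>W2\<close> bound their box coordinates, and \<open>W3\<close> keeps both coordinate
    systems in the balls where the transition maps are controlled.\<close>
  define W where "W = W1 \<inter> W2 \<inter> W3 \<inter> V1 \<inter> V2 \<inter> fst b ` (polydisc \<times> transverse_polydisc \<iota>)"
  have oW: "openin (atlas_topology A) W"
    unfolding W_def
    by (intro openin_Int W1(1) W2(1) W3(1) V1(1) V2(1)) (use eb in \<open>simp add: is_embedded_flow_box_def\<close>)
  have pW: "p \<in> W"
  proof -
    have "p \<in> fst b ` (polydisc \<times> transverse_polydisc \<iota>)" using b(2) Ktr by blast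
    then show ?thesis unfolding W_def using W1(2) W2(2) W3(2) V1(2) V2(2) b(2) pin0 by blast
  qed
  have pt: "dist z zp < r / 2" "dist s sp < r / 2" "f z s \<in> polydisc" "\<gamma> s \<in> K" "fst b (z, s) = fst b0 (f z s, \<gamma> s)"
      "norm (f z s) < r0 / 2" "norm (\<gamma> s) < r0 / 2" "fst b (z, s) \<in> W3"
      "snd c (fst b (z, s)) = leaf_vec \<iota> (f z s) + h (\<gamma> s) (f z s)"
    if zs: "z \<in> polydisc" "s \<in> snd b" "fst b (z, s) \<in> W" for z s
  proof -
    have "fst b (z, s) \<in> box_set b" using zs by blast
    then have S: "fst b (z, s) \<in> \<Sigma>" using flow_box_subset[OF fb] by blast
    then have x0: "fst b (z, s) \<in> box_set b0" using V2(2) zs(3) by (auto simp: W_def)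
    show "dist z zp < r / 2" "dist s sp < r / 2" using W1(3)[OF zs(1,2)] zs(3) by (auto simp: W_def)
    show F: "f z s \<in> polydisc" "\<gamma> s \<in> K" "fst b (z, s) = fst b0 (f z s, \<gamma> s)"
      using f(1)[OF zs(2,1) x0] by auto
    show "norm (f z s) < r0 / 2" "norm (\<gamma> s) < r0 / 2"
      using W2(3)[OF F(1), of "\<gamma> s"] F zs(3) K0 by (auto simp: W_def)
    show "fst b (z, s) \<in> W3" using zs(3) by (simp add: W_def)
    show "snd c (fst b (z, s)) = leaf_vec \<iota> (f z s) + h (\<gamma> s) (f z s)" using cb0[OF F(1,2)] F(3) by simp
  qed
  have fball: "ball z (r / 2) \<subseteq> {z \<in> polydisc. fst b (z, s) \<in> box_set b0}"
    if zs: "z \<in> polydisc" "s \<in> snd b" "fst b (z, s) \<in> W" for z s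
  proof
    fix \<zeta> assume "\<zeta> \<in> ball z (r / 2)"
    then have "dist \<zeta> zp < r" using pt(1)[OF zs] dist_triangle[of \<zeta> zp z] by (simp add: dist_commute)
    moreover have "dist s sp < r" using pt(2)[OF zs] r(1) by simp
    ultimately show "\<zeta> \<in> {z \<in> polydisc. fst b (z, s) \<in> box_set b0}" using r(2)[OF _ zs(2)] by blast
  qed
  let ?Df = "\<lambda>s z. frechet_derivative (\<lambda>z. f z s) (at z)"
  have fD: "((\<lambda>z. f z s) has_derivative ?Df s z) (at z)" "norm (?Df s z v) \<le> Cf * norm v"
    if zs: "z \<in> polydisc" "s \<in> snd b" "fst b (z, s) \<in> W" for z s v
  proof -
    have cd: "complex_differentiable_on (ball z (r / 2)) (\<lambda>z. f z s)"
      by (rule complex_differentiable_on_subset[OF f(2)[OF zs(2)] fball[OF zs]])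
    show "((\<lambda>z. f z s) has_derivative ?Df s z) (at z)"
      by (rule complex_differentiable_onD(1)[OF cd]) (use r(1) in simp)
    show "norm (?Df s z v) \<le> Cf * norm v"
      unfolding Cf_def q_def
    proof (rule Cauchy_estimate[OF cd])
      fix w assume "w \<in> ball z (r / 2)"
      then have "f w s \<in> polydisc" using f(1)[OF zs(2)] fball[OF zs] by blast
      then show "norm (f w s) \<le> real CARD('q)" by (rule norm_polydisc_le)
    qed (use r(1) in simp)
  qed
  let ?V = "\<lambda>s z u. leaf_vec \<iota> u + frechet_derivative (h (\<gamma> s)) (at (f z s)) u"
  \<comment> \<open>A plaque tangent in \<open>c0\<close> factors into the reparametrization
    \<open>?Df\<close>, the graph tangent \<open>?V\<close> and the derivative of the coordinate
    change \<open>\<kappa>\<close>, and each factor has its own bound.\<close>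
  have DX: "frechet_derivative (plaque_coord c0 b s) (at z) v = frechet_derivative \<kappa> (at (snd c (fst b (z, s)))) (?V s z (?Df s z v))"
    if zs: "z \<in> polydisc" "s \<in> snd b" "fst b (z, s) \<in> W" for z s v
  proof -
    note P = pt[OF zs]
    have d1: "((\<lambda>\<zeta>. leaf_vec \<iota> (f \<zeta> s)) has_derivative (\<lambda>v. leaf_vec \<iota> (?Df s z v))) (at z)"
      by (rule bounded_linear.has_derivative[OF bounded_linear_leaf_vec[OF inj\<iota>] fD(1)[OF zs]])
    have d2: "((\<lambda>\<zeta>. h (\<gamma> s) (f \<zeta> s)) has_derivative (\<lambda>v. frechet_derivative (h (\<gamma> s)) (at (f z s)) (?Df s z v))) (at z)"
      by (rule has_derivative_compose[OF fD(1)[OF zs] complex_differentiable_onD(1)[OF hol(1)[OF P(4)] P(3)]])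
    have inU: "leaf_vec \<iota> (f z s) + h (\<gamma> s) (f z s) \<in> snd c ` (fst c \<inter> fst c0)"
      unfolding P(9)[symmetric] using P(8) unfolding W3_def by blast
    have "((\<lambda>\<zeta>. \<kappa> (leaf_vec \<iota> (f \<zeta> s) + h (\<gamma> s) (f \<zeta> s))) has_derivative
       (\<lambda>v. frechet_derivative \<kappa> (at (leaf_vec \<iota> (f z s) + h (\<gamma> s) (f z s))) (?V s z (?Df s z v)))) (at z)"
      by (rule has_derivative_compose[OF has_derivative_add[OF d1 d2] complex_differentiable_onD(1)[OF k1(1) inU]])
    then have "(plaque_coord c0 b s has_derivative
       (\<lambda>v. frechet_derivative \<kappa> (at (leaf_vec \<iota> (f z s) + h (\<gamma> s) (f z s))) (?V s z (?Df s z v)))) (at z)"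
    proof (rule has_derivative_transform_within_open[OF _ open_ball])
      show "z \<in> ball z (r / 2)" using r(1) by simp
      fix \<zeta> assume "\<zeta> \<in> ball z (r / 2)"
      then have "\<zeta> \<in> polydisc" "fst b (\<zeta>, s) \<in> box_set b0" using fball[OF zs] by blast+
      from f(1)[OF zs(2) this] have F: "f \<zeta> s \<in> polydisc" "\<gamma> s \<in> K" "fst b (\<zeta>, s) = fst b0 (f \<zeta> s, \<gamma> s)" by auto
      show "\<kappa> (leaf_vec \<iota> (f \<zeta> s) + h (\<gamma> s) (f \<zeta> s)) = snd c0 (fst b (\<zeta>, s))"
        using coord_rep_chart[OF cc b0c[OF F(1,2)], of c0 id] cb0[OF F(1,2)] F(3) by (simp add: \<kappa>_def)
    qed
    from fun_cong[OF frechet_derivative_at[OF this], of v] show ?thesis unfolding P(9) by (rule sym)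
  qed
  have Vbound: "norm (?V s z u) \<le> (1 + E) * norm u" if zs: "z \<in> polydisc" "s \<in> snd b" "fst b (z, s) \<in> W" for z s u
  proof -
    have "norm (?V s z u) \<le> norm (leaf_vec \<iota> u) + norm (frechet_derivative (h (\<gamma> s)) (at (f z s)) u)"
      by (rule norm_triangle_ineq)
    also have "\<dots> \<le> norm u + E * norm u"
      using E(2)[OF pt(4)[OF zs], of "f z s" u] pt(6)[OF zs] r0(2) by (simp add: norm_leaf_vec[OF inj\<iota>])
    finally show ?thesis by (simp add: algebra_simps)
  qed
  have cball: "snd c (fst b (z, s)) \<in> ball 0 \<rho>" if zs: "z \<in> polydisc" "s \<in> snd b" "fst b (z, s) \<in> W" for z s
    using pt(8)[OF zs] by (simp add: W3_def)
  define C1 where "C1 = Ck * ((1 + E) * Cf)"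
  define C2 where "C2 = (Ck2 * ((1 + E) * Cf) + Ck * (3 * E * Cf)) * Ck'"
  define C3 where "C3 = Cg * Ck'"
  have Cnn: "C1 \<ge> 0" "C2 \<ge> 0" "C3 \<ge> 0" using nonneg fgnn E(1) by (simp_all add: C1_def C2_def C3_def)
  have est1: "norm (frechet_derivative (plaque_coord c0 b s) (at z) v) \<le> C1 * norm v"
    if zs: "z \<in> polydisc" "s \<in> snd b" "fst b (z, s) \<in> W" for z s v
  proof -
    have "norm (frechet_derivative (plaque_coord c0 b s) (at z) v) \<le> Ck * norm (?V s z (?Df s z v))"
      unfolding DX[OF zs] by (rule kD[OF cball[OF zs]])
    also have "\<dots> \<le> Ck * ((1 + E) * norm (?Df s z v))"
      by (rule mult_left_mono[OF Vbound[OF zs] nonneg(1)])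
    also have "\<dots> \<le> Ck * ((1 + E) * (Cf * norm v))"
      using fD(2)[OF zs, of v] nonneg(1) E(1) by (intro mult_left_mono) auto
    finally show ?thesis by (simp add: C1_def mult.assoc)
  qed
  have gball: "ball 0 r0 \<subseteq> {z \<in> polydisc. fst b0 (z, \<gamma> t) \<in> box_set b}"
    if wt: "w \<in> polydisc" "t \<in> snd b" "fst b (w, t) \<in> W" for w t
  proof
    fix \<zeta> :: "complex^'q" assume "\<zeta> \<in> ball 0 r0"
    then have "dist \<zeta> 0 < r0" by simp
    moreover have "dist (\<gamma> t) 0 < r0" using pt(7)[OF wt] r0(1) by simp
    ultimately show "\<zeta> \<in> {z \<in> polydisc. fst b0 (z, \<gamma> t) \<in> box_set b}" using r0(3)[of \<zeta> "\<gamma> t"] pt(4)[OF wt] K0 by blast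
  qed
  have gf: "g (f w t) (\<gamma> t) = w" "\<eta> (\<gamma> t) = t" if wt: "w \<in> polydisc" "t \<in> snd b" "fst b (w, t) \<in> W" for w t
  proof -
    note P = pt[OF wt]
    have "fst b0 (f w t, \<gamma> t) \<in> box_set b" using P(5) wt(1,2) by (metis imageI mem_Sigma_iff)
    from g(1)[OF P(4,3) this] have G: "g (f w t) (\<gamma> t) \<in> polydisc" "\<eta> (\<gamma> t) \<in> snd b"
      "fst b (g (f w t) (\<gamma> t), \<eta> (\<gamma> t)) = fst b (w, t)" using P(5) by auto
    then have "(g (f w t) (\<gamma> t), \<eta> (\<gamma> t)) = (w, t)" using inj_onD[OF flow_box_inj[OF fb] G(3)] wt by blast
    then show "g (f w t) (\<gamma> t) = w" "\<eta> (\<gamma> t) = t" by auto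
  qed
  \<comment> \<open>Along a plaque \<open>f\<close> and \<open>g\<close> are inverse to each other,
    so the derivative of \<open>f\<close> is onto: every leaf direction of the graph comes from a
    vector in the box.\<close>
  have Dfg: "\<exists>v'. ?Df t w v' = u" if wt: "w \<in> polydisc" "t \<in> snd b" "fst b (w, t) \<in> W" for w t u
  proof -
    note P = pt[OF wt]
    have in0: "f w t \<in> ball 0 r0" using P(6) r0(1) by simp
    have cd: "complex_differentiable_on (ball 0 r0) (\<lambda>z. g z (\<gamma> t))"
      by (rule complex_differentiable_on_subset[OF g(2)[OF P(4)] gball[OF wt]])
    have "((\<lambda>\<zeta>. f (g \<zeta> (\<gamma> t)) t) has_derivative (\<lambda>u. ?Df t w (frechet_derivative (\<lambda>z. g z (\<gamma> t)) (at (f w t)) u))) (at (f w t))"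
      by (rule has_derivative_compose[OF complex_differentiable_onD(1)[OF cd in0]]) (simp add: gf[OF wt] fD(1)[OF wt])
    moreover have "((\<lambda>\<zeta>. f (g \<zeta> (\<gamma> t)) t) has_derivative (\<lambda>u. u)) (at (f w t))"
    proof (rule has_derivative_transform_within_open[OF has_derivative_ident open_ball in0])
      fix \<zeta> :: "complex^'q" assume "\<zeta> \<in> ball 0 r0"
      then have z: "\<zeta> \<in> polydisc" "fst b0 (\<zeta>, \<gamma> t) \<in> box_set b" using gball[OF wt] by blast+
      from g(1)[OF P(4) z] have G: "g \<zeta> (\<gamma> t) \<in> polydisc" "fst b0 (\<zeta>, \<gamma> t) = fst b (g \<zeta> (\<gamma> t), t)"
        using gf(2)[OF wt] by auto
      have "fst b0 (\<zeta>, \<gamma> t) \<in> box_set b0" using z(1) P(4) K0 by blast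
      then have "fst b (g \<zeta> (\<gamma> t), t) \<in> box_set b0" using G(2) by simp
      from f(1)[OF wt(2) G(1) this] have F: "f (g \<zeta> (\<gamma> t)) t \<in> polydisc" "fst b0 (\<zeta>, \<gamma> t) = fst b0 (f (g \<zeta> (\<gamma> t)) t, \<gamma> t)"
        using G(2) by auto
      have "(\<zeta>, \<gamma> t) = (f (g \<zeta> (\<gamma> t)) t, \<gamma> t)"
        using inj_onD[OF flow_box_inj[OF fb0] F(2)] F(1) z(1) P(4) K0 by blast
      then show "\<zeta> = f (g \<zeta> (\<gamma> t)) t" by simp
    qed
    ultimately have "(\<lambda>u. ?Df t w (frechet_derivative (\<lambda>z. g z (\<gamma> t)) (at (f w t)) u)) = (\<lambda>u. u)" by (rule has_derivative_unique)
    then show ?thesis by metis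
  qed
  \<comment> \<open>\<open>leaf_proj\<close> shows that the ambient distance bounds the difference
    of leaf coordinates; subtracting that part bounds the transverse one, at the price of a factor
    2.\<close>
  have leafdiff: "norm (f z s - f w t) \<le> norm (snd c (fst b (z, s)) - snd c (fst b (w, t)))"
    "norm (h (\<gamma> s) (f z s) - h (\<gamma> t) (f w t)) \<le> 2 * norm (snd c (fst b (z, s)) - snd c (fst b (w, t)))"
    if zs: "z \<in> polydisc" "s \<in> snd b" "fst b (z, s) \<in> W" and wt: "w \<in> polydisc" "t \<in> snd b" "fst b (w, t) \<in> W" for z s w t
  proof -
    have tr: "leaf_proj \<iota> (h (\<gamma> s) (f z s)) = 0" "leaf_proj \<iota> (h (\<gamma> t) (f w t)) = 0"
      using leaf_proj_transverse hol(2)[OF pt(4)[OF zs]] pt(3)[OF zs] hol(2)[OF pt(4)[OF wt]] pt(3)[OF wt] by blast+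
    let ?d = "snd c (fst b (z, s)) - snd c (fst b (w, t))"
    have "leaf_proj \<iota> ?d = f z s - f w t"
      unfolding pt(9)[OF zs] pt(9)[OF wt] by (simp add: leaf_proj_diff leaf_proj_add leaf_proj_leaf_vec[OF inj\<iota>] tr)
    then show 1: "norm (f z s - f w t) \<le> norm ?d" using norm_leaf_proj_le[OF inj\<iota>, of ?d] by simp
    have "h (\<gamma> s) (f z s) - h (\<gamma> t) (f w t) = ?d - leaf_vec \<iota> (f z s - f w t)"
      unfolding pt(9)[OF zs] pt(9)[OF wt] linear_simps(2)[OF bounded_linear_leaf_vec[OF inj\<iota>]] by simp
    then have "norm (h (\<gamma> s) (f z s) - h (\<gamma> t) (f w t)) \<le> norm ?d + norm (leaf_vec \<iota> (f z s - f w t))"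
      using norm_triangle_ineq4[of ?d "leaf_vec \<iota> (f z s - f w t)"] by simp
    then show "norm (h (\<gamma> s) (f z s) - h (\<gamma> t) (f w t)) \<le> 2 * norm ?d" using 1 by (simp add: norm_leaf_vec[OF inj\<iota>])
  qed
  \<comment> \<open>\<open>v'\<close> is taken with the same leaf direction \<open>u\<close> as
    \<open>v\<close>. The two tangents then differ only through the base point of the derivative of
    \<open>\<kappa>\<close>, bounded by \<open>kD2\<close>, and through the slopes of the graphs,
    bounded by \<open>E\<close>.\<close>
  have est2: "\<exists>v'. norm (frechet_derivative (plaque_coord c0 b s) (at z) v - frechet_derivative (plaque_coord c0 b t) (at w) v')
         \<le> C2 * norm (plaque_coord c0 b s z - plaque_coord c0 b t w) * norm v"
    if zs: "z \<in> polydisc" "s \<in> snd b" "fst b (z, s) \<in> W" and wt: "w \<in> polydisc" "t \<in> snd b" "fst b (w, t) \<in> W" for z s w t v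
  proof -
    define u where "u = ?Df s z v"
    obtain v' where v': "?Df t w v' = u" using Dfg[OF wt] by blast
    let ?x = "snd c (fst b (z, s))" and ?y = "snd c (fst b (w, t))"
    let ?d = "norm (?x - ?y)"
    have u: "norm u \<le> Cf * norm v" unfolding u_def by (rule fD(2)[OF zs])
    have lin: "linear (frechet_derivative \<kappa> (at ?y))"
      by (rule has_derivative_linear[OF complex_differentiable_onD(1)[OF k1(1)]])
        (use cball[OF wt] R(3) \<rho> in auto)
    have "frechet_derivative (plaque_coord c0 b s) (at z) v - frechet_derivative (plaque_coord c0 b t) (at w) v'
      = (frechet_derivative \<kappa> (at ?x) (?V s z u) - frechet_derivative \<kappa> (at ?y) (?V s z u)) + frechet_derivative \<kappa> (at ?y) (?V s z u - ?V t w u)"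
      unfolding DX[OF zs] DX[OF wt] v' linear_diff[OF lin] by (simp add: u_def)
    then have e1: "norm (frechet_derivative (plaque_coord c0 b s) (at z) v - frechet_derivative (plaque_coord c0 b t) (at w) v')
      \<le> Ck2 * ?d * norm (?V s z u) + Ck * norm (?V s z u - ?V t w u)"
      using order_trans[OF norm_triangle_ineq add_mono[OF kD2[OF cball[OF zs] cball[OF wt]] kD[OF cball[OF wt]]]] by simp
    have "norm (?V s z u - ?V t w u) \<le> E * (norm (f z s - f w t) + norm (h (\<gamma> s) (f z s) - h (\<gamma> t) (f w t))) * norm u"
      using E(3)[OF pt(4)[OF zs] pt(4)[OF wt], of "f z s" "f w t" u] pt(6)[OF zs] pt(6)[OF wt] r0(2) by simp
    also have "\<dots> \<le> E * (3 * ?d) * norm u"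
      using leafdiff[OF zs wt] E(1) by (intro mult_right_mono mult_left_mono) auto
    finally have "Ck * norm (?V s z u - ?V t w u) \<le> Ck * (E * (3 * ?d) * norm u)"
      by (rule mult_left_mono[OF _ nonneg(1)])
    moreover have "Ck2 * ?d * norm (?V s z u) \<le> Ck2 * ?d * ((1 + E) * norm u)"
      using Vbound[OF zs, of u] nonneg(2) by (intro mult_left_mono) auto
    ultimately have "norm (frechet_derivative (plaque_coord c0 b s) (at z) v - frechet_derivative (plaque_coord c0 b t) (at w) v')
      \<le> Ck2 * ?d * ((1 + E) * norm u) + Ck * (E * (3 * ?d) * norm u)" using e1 by linarith
    also have "Ck2 * ?d * ((1 + E) * norm u) + Ck * (E * (3 * ?d) * norm u) = (Ck2 * (1 + E) + Ck * (3 * E)) * norm u * ?d"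
      by (simp add: algebra_simps)
    also have "\<dots> \<le> (Ck2 * (1 + E) + Ck * (3 * E)) * (Cf * norm v) * (Ck' * norm (plaque_coord c0 b s z - plaque_coord c0 b t w))"
      using u cL[OF pt(8)[OF zs] pt(8)[OF wt]] nonneg E(1) fgnn
      by (intro mult_mono mult_left_mono) auto
    finally have "norm (frechet_derivative (plaque_coord c0 b s) (at z) v - frechet_derivative (plaque_coord c0 b t) (at w) v')
      \<le> C2 * norm (plaque_coord c0 b s z - plaque_coord c0 b t w) * norm v"
      by (simp add: C2_def algebra_simps)
    then show ?thesis by blast
  qed
  have est3: "norm (w - w') \<le> C3 * norm (plaque_coord c0 b t w - plaque_coord c0 b t w')"
    if wt: "w \<in> polydisc" "t \<in> snd b" "fst b (w, t) \<in> W" and wt': "w' \<in> polydisc" "fst b (w', t) \<in> W" for w w' t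
  proof -
    note wt2 = wt'(1) wt(2) wt'(2)
    have cd: "complex_differentiable_on (ball 0 (2 * (r0 / 2))) (\<lambda>z. g z (\<gamma> t))"
      using complex_differentiable_on_subset[OF g(2)[OF pt(4)[OF wt]] gball[OF wt]] by simp
    have "norm (g (f w t) (\<gamma> t) - g (f w' t) (\<gamma> t)) \<le> Cg * norm (f w t - f w' t)"
      unfolding Cg_def q_def
    proof (rule holomorphic_Lipschitz(2)[OF cd])
      fix \<zeta> :: "complex^'q" assume "\<zeta> \<in> ball 0 (2 * (r0 / 2))"
      then have "g \<zeta> (\<gamma> t) \<in> polydisc" using g(1)[OF pt(4)[OF wt]] gball[OF wt] by auto
      then show "norm (g \<zeta> (\<gamma> t)) \<le> real CARD('q)" by (rule norm_polydisc_le)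
    qed (use pt(6)[OF wt] pt(6)[OF wt2] r0(1) in auto)
    then have "norm (w - w') \<le> Cg * norm (f w t - f w' t)" by (simp only: gf(1)[OF wt] gf(1)[OF wt2])
    also have "\<dots> \<le> Cg * (Ck' * norm (plaque_coord c0 b t w - plaque_coord c0 b t w'))"
      using order_trans[OF leafdiff(1)[OF wt wt2] cL[OF pt(8)[OF wt] pt(8)[OF wt2]]] fgnn(2) by (rule mult_left_mono)
    finally show ?thesis by (simp add: C3_def mult.assoc)
  qed
  define C where "C = C1 + C2 + C3 + 1"
  have C: "C > 0" "C1 \<le> C" "C2 \<le> C" "C3 \<le> C" using Cnn by (auto simp: C_def)
  show thesis
  proof (rule that[OF oW pW _ _ _ C(1)])
    show "W \<subseteq> fst c0" "W \<inter> \<Sigma> \<subseteq> box_set b" "W \<subseteq> fst b ` (polydisc \<times> transverse_polydisc \<iota>)"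
      using V1(2) by (auto simp: W_def W3_def)
  next
    fix z s and v :: "complex^'q" assume zs: "z \<in> polydisc" "s \<in> snd b" "fst b (z, s) \<in> W"
    show "norm (frechet_derivative (plaque_coord c0 b s) (at z) v) \<le> C * norm v"
      by (rule order_trans[OF est1[OF zs] mult_right_mono[OF C(2) norm_ge_zero]])
  next
    fix z s w t and v :: "complex^'q" assume zs: "z \<in> polydisc" "s \<in> snd b" "fst b (z, s) \<in> W" and wt: "w \<in> polydisc" "t \<in> snd b" "fst b (w, t) \<in> W"
    have "C2 * norm (plaque_coord c0 b s z - plaque_coord c0 b t w) * norm v \<le> C * norm (plaque_coord c0 b s z - plaque_coord c0 b t w) * norm v"
      by (intro mult_right_mono C(3)) auto
    then show "\<exists>v'. norm (frechet_derivative (plaque_coord c0 b s) (at z) v - frechet_derivative (plaque_coord c0 b t) (at w) v')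
         \<le> C * norm (plaque_coord c0 b s z - plaque_coord c0 b t w) * norm v"
      using est2[OF zs wt, of v] order_trans by blast
  next
    fix w w' :: "complex^'q" and t assume wt: "t \<in> snd b" "w \<in> polydisc" "w' \<in> polydisc" "fst b (w, t) \<in> W" "fst b (w', t) \<in> W"
    show "norm (w - w') \<le> C * norm (plaque_coord c0 b t w - plaque_coord c0 b t w')"
      by (rule order_trans[OF est3[OF wt(2,1,4,3,5)] mult_right_mono[OF C(4) norm_ge_zero]])
  qed
qed

section \<open>Alternating forms\<close>

lemma alternating_multilinearD:
  assumes "alternating_multilinear k g"
  shows "length us \<noteq> k \<Longrightarrow> g us = 0"
    and "length us = k \<Longrightarrow> i < k \<Longrightarrow> linear (\<lambda>v. g (us[i := v]))"
    and "length us = k \<Longrightarrow> \<not> distinct us \<Longrightarrow> g us = 0"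
  using assms unfolding alternating_multilinear_def by blast+

text \<open>One slot after the other is expanded in the basis. In the induction all slots from
  \<open>j\<close> on already hold basis vectors, and each expansion costs a factor
  \<open>DIM(complex^'m)\<close>.\<close>

lemma alternating_multilinear_bound:
  fixes g :: "(complex^'m::finite) list \<Rightarrow> complex"
  assumes g: "alternating_multilinear k g" and "0 \<le> M"
    and M: "\<And>us. length us = k \<Longrightarrow> set us \<subseteq> Basis \<Longrightarrow> norm (g us) \<le> M"
    and us: "length us = k"
  shows "norm (g us) \<le> M * real DIM(complex^'m) ^ k * (\<Prod>i<k. norm (us ! i))"
proof -
  let ?d = "real DIM(complex^'m)"
  have "norm (g us) \<le> M * ?d ^ j * (\<Prod>i<j. norm (us ! i))"
    if "j \<le> k" "length us = k" "\<And>i. j \<le> i \<Longrightarrow> i < k \<Longrightarrow> us ! i \<in> Basis" for j us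
    using that
  proof (induction j arbitrary: us)
    case 0
    then have "set us \<subseteq> Basis" by (auto simp: in_set_conv_nth)
    then show ?case using M[OF 0(2)] by simp
  next
    case (Suc j)
    then have jk: "j < k" by simp
    have lin: "linear (\<lambda>v. g (us[j := v]))" by (rule alternating_multilinearD(2)[OF g Suc.prems(2) jk])
    have "g us = (\<Sum>b\<in>Basis. (us ! j \<bullet> b) *\<^sub>R g (us[j := b]))"
      using linear_expand[OF lin, of "us ! j"] by simp
    also have "norm \<dots> \<le> (\<Sum>b\<in>(Basis :: (complex^'m) set). norm (us ! j) * (M * ?d ^ j * (\<Prod>i<j. norm (us ! i))))"
    proof (rule sum_norm_le)
      fix b :: "complex^'m" assume b: "b \<in> Basis"
      have "norm (g (us[j := b])) \<le> M * ?d ^ j * (\<Prod>i<j. norm (us[j := b] ! i))"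
        by (rule Suc.IH) (use Suc.prems b jk in \<open>auto simp: nth_list_update\<close>)
      also have "(\<Prod>i<j. norm (us[j := b] ! i)) = (\<Prod>i<j. norm (us ! i))"
        by (rule prod.cong) auto
      finally show "norm ((us ! j \<bullet> b) *\<^sub>R g (us[j := b])) \<le> norm (us ! j) * (M * ?d ^ j * (\<Prod>i<j. norm (us ! i)))"
        unfolding norm_scaleR using Basis_le_norm[OF b, of "us ! j"] by (intro mult_mono) auto
    qed
    also have "\<dots> = M * ?d ^ Suc j * (\<Prod>i<Suc j. norm (us ! i))" by simp
    finally show ?case .
  qed
  from this[of k us] show ?thesis using us by simp
qed

lemma alternating_add_span:
  fixes g :: "(complex^'m::finite) list \<Rightarrow> complex"
  assumes g: "alternating_multilinear k g" and us: "length us = k" and i: "i < k"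
    and w: "w \<in> span {us ! j | j. j < k \<and> j \<noteq> i}"
  shows "g (us[i := us ! i + w]) = g us"
proof -
  have lin: "linear (\<lambda>v. g (us[i := v]))" by (rule alternating_multilinearD(2)[OF g us i])
  have "span {us ! j | j. j < k \<and> j \<noteq> i} \<subseteq> {v. g (us[i := v]) = 0}"
  proof (rule span_minimal)
    show "subspace {v. g (us[i := v]) = 0}" using linear_subspace_kernel[OF lin] .
    show "{us ! j | j. j < k \<and> j \<noteq> i} \<subseteq> {v. g (us[i := v]) = 0}"
    proof
      fix v assume "v \<in> {us ! j | j. j < k \<and> j \<noteq> i}"
      then obtain j where j: "v = us ! j" "j < k" "j \<noteq> i" by blast
      have "\<not> distinct (us[i := v])"
        using nth_eq_iff_index_eq[of "us[i := v]" i j] i j us by auto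
      then show "v \<in> {v. g (us[i := v]) = 0}" using alternating_multilinearD(3)[OF g] us by simp
    qed
  qed
  then have "g (us[i := w]) = 0" using w by blast
  then show ?thesis using linear_add[OF lin, of "us ! i" w] by simp
qed

text \<open>The entries are altered one at a time while the block \<open>ys\<close> stays in the
  list, so each change lies in the span of other entries. In the application \<open>ys\<close> spans
  the image of the tangent space of the second plaque.\<close>

lemma alternating_modify:
  fixes g :: "(complex^'m::finite) list \<Rightarrow> complex"
  assumes g: "alternating_multilinear k g" and \<delta>: "\<And>b. \<delta> b \<in> span (set ys)"
    and len: "length pre + length bs + length ys = k"
  shows "g (pre @ map (\<lambda>b. \<alpha> b + \<delta> b) bs @ ys) = g (pre @ map \<alpha> bs @ ys)"
  using len
proof (induction bs arbitrary: pre)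
  case (Cons b bs)
  let ?i = "length pre"
  let ?us = "pre @ (\<alpha> b # map \<alpha> bs) @ ys"
  have "g (pre @ map (\<lambda>b. \<alpha> b + \<delta> b) (b # bs) @ ys) = g ((pre @ [\<alpha> b + \<delta> b]) @ map (\<lambda>b. \<alpha> b + \<delta> b) bs @ ys)" by simp
  also have "\<dots> = g ((pre @ [\<alpha> b + \<delta> b]) @ map \<alpha> bs @ ys)" by (rule Cons.IH) (use Cons.prems in simp)
  also have "\<dots> = g (?us[?i := ?us ! ?i + \<delta> b])" by simp
  also have "\<dots> = g ?us"
  proof (rule alternating_add_span[OF g])
    show "length ?us = k" "?i < k" using Cons.prems by auto
    have "set ys \<subseteq> {?us ! j | j. j < k \<and> j \<noteq> ?i}"
    proof
      fix y assume "y \<in> set ys"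
      then obtain n where n: "n < length ys" "y = ys ! n" by (auto simp: in_set_conv_nth)
      let ?j = "length pre + Suc (length bs) + n"
      have "?us ! ?j = y" using n by (simp add: nth_append)
      moreover have "?j < k" "?j \<noteq> ?i" using Cons.prems n by auto
      ultimately show "y \<in> {?us ! j | j. j < k \<and> j \<noteq> ?i}" by blast
    qed
    then show "\<delta> b \<in> span {?us ! j | j. j < k \<and> j \<noteq> ?i}" using \<delta> span_mono by blast
  qed
  finally show ?case by simp
qed simp

lemma oriented_basis_properties:
  shows "set (oriented_basis :: (complex^'m::finite) list) = Basis"
    and "length (oriented_basis :: (complex^'m::finite) list) = 2 * CARD('m)"
proof -
  define js where "js = (SOME js. distinct js \<and> set js = (UNIV :: 'm set))"
  have js: "distinct js" "set js = (UNIV :: 'm set)"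
    using someI_ex[of "\<lambda>js. distinct js \<and> set js = (UNIV :: 'm set)"] finite_distinct_list[of "UNIV :: 'm set"]
    unfolding js_def by auto
  have ob: "oriented_basis = concat (map (\<lambda>i. [axis i 1, axis i \<i> :: complex^'m]) js)"
    by (simp add: oriented_basis_def js_def)
  show "set (oriented_basis :: (complex^'m) list) = Basis"
    unfolding ob using js(2) by (auto simp: Basis_vec_def Basis_complex_def)
  have "length (concat (map (\<lambda>i. [axis i 1, axis i \<i> :: complex^'m]) js)) = 2 * length js"
    by (induction js) auto
  then show "length (oriented_basis :: (complex^'m) list) = 2 * CARD('m)"
    unfolding ob using distinct_card[OF js(1)] js(2) by simp
qed

section \<open>Pullbacks of forms in coordinates\<close>

lemma smooth_formD:
  assumes "smooth_form A k \<alpha>"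
  shows "\<not> (c \<in> A \<and> x \<in> chart_image c) \<Longrightarrow> \<alpha> c x us = 0"
    and "c \<in> A \<Longrightarrow> x \<in> chart_image c \<Longrightarrow> alternating_multilinear k (\<alpha> c x)"
    and "c \<in> A \<Longrightarrow> smooth_on (chart_image c) (\<lambda>x. \<alpha> c x us)"
    and "c \<in> A \<Longrightarrow> d \<in> A \<Longrightarrow> p \<in> fst c \<Longrightarrow> p \<in> fst d \<Longrightarrow>
        \<alpha> c (snd c p) us = \<alpha> d (snd d p) (map (transition_deriv c d p) us)"
proof -
  note F = assms[unfolded smooth_form_def]
  show "\<alpha> c x us = 0" if "\<not> (c \<in> A \<and> x \<in> chart_image c)" using F that by blast
  show "alternating_multilinear k (\<alpha> c x)" if "c \<in> A" "x \<in> chart_image c" using F that by blast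
  show "smooth_on (chart_image c) (\<lambda>x. \<alpha> c x us)" if "c \<in> A" using F that by blast
  show "\<alpha> c (snd c p) us = \<alpha> d (snd d p) (map (transition_deriv c d p) us)" if "c \<in> A" "d \<in> A" "p \<in> fst c" "p \<in> fst d"
    using F[THEN conjunct2, THEN conjunct2, THEN conjunct2, rule_format, OF that(1,2)] that(3,4) by blast
qed

lemma form_pullback_outside:
  "\<not> (c \<in> A \<and> x \<in> snd c ` (fst c \<inter> S)) \<Longrightarrow> form_pullback A B S f \<beta> c x us = 0"
  by (simp only: form_pullback_def if_False)

lemma form_pullback_some:
  assumes c: "c \<in> A" "is_chart c" "p \<in> fst c" "p \<in> S" and f: "f p \<in> points B"
  obtains d where "d \<in> B" "f p \<in> fst d"
    "\<And>us. form_pullback A B S f \<beta> c (snd c p) us = \<beta> d (snd d (f p)) (map (frechet_derivative (coord_rep c d f) (at (snd c p))) us)"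
proof -
  define d where "d = (SOME d. d \<in> B \<and> f p \<in> fst d)"
  have "\<exists>d. d \<in> B \<and> f p \<in> fst d" using f unfolding points_def by blast
  then have d: "d \<in> B" "f p \<in> fst d" using someI_ex[of "\<lambda>d. d \<in> B \<and> f p \<in> fst d"] unfolding d_def by blast+
  have x: "snd c p \<in> snd c ` (fst c \<inter> S)" using c by blast
  show thesis
  proof (rule that[OF d])
    show "form_pullback A B S f \<beta> c (snd c p) us = \<beta> d (snd d (f p)) (map (frechet_derivative (coord_rep c d f) (at (snd c p))) us)" for us
      unfolding form_pullback_def Let_def chart_inv_chart[OF c(2,3)] d_def[symmetric] coord_rep_chart[OF c(2,3)]
      using c(1) x by (simp only: simp_thms if_True)
  qed
qed

text \<open>Frees the computation from the charts at which \<open>form_pullback\<close> happens to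
  be evaluated: the transition from \<open>d'\<close> to the chosen target chart, which enters
  through the derivative, is cancelled by the inverse transition coming from the compatibility of
  the expressions of \<open>\<beta>\<close>.\<close>

lemma form_pullback_coord:
  assumes A: "pre_manifold A" and B: "pre_manifold B" and \<beta>: "smooth_form B k \<beta>"
    and c: "c \<in> A" "c' \<in> A" "p \<in> fst c" "p \<in> fst c'" and S: "p \<in> S" and d': "d' \<in> B" "f p \<in> fst d'"
    and U: "open U" "snd c' p \<in> U" "U \<subseteq> snd c' ` {q \<in> fst c'. f q \<in> fst d'}"
    and D: "(coord_rep c' d' f has_derivative D) (at (snd c' p))"
  shows "form_pullback A B S f \<beta> c (snd c p) us = \<beta> d' (snd d' (f p)) (map (\<lambda>u. D (transition_deriv c c' p u)) us)"
proof -
  have "f p \<in> points B" using chart_subset_points[OF d'(1)] d'(2) by blast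
  then obtain d where d: "d \<in> B" "f p \<in> fst d"
    "\<And>us. form_pullback A B S f \<beta> c (snd c p) us = \<beta> d (snd d (f p)) (map (frechet_derivative (coord_rep c d f) (at (snd c p))) us)"
    using form_pullback_some[OF c(1) pre_manifoldD(1)[OF A c(1)] c(3) S] by metis
  have "(coord_rep c d f has_derivative transition_deriv d' d (f p) \<circ> D \<circ> transition_deriv c c' p) (at (snd c p))"
    by (rule coord_rep_change_eventually[OF pre_manifoldD(1)[OF A c(2)] pre_manifoldD(1)[OF A c(1)] pre_manifoldD(2)[OF A c(1,2)]
          pre_manifoldD(1)[OF B d'(1)] pre_manifoldD(2)[OF B d'(1) d(1)] c(4,3) d'(2) d(2) U D])
  then have fr: "frechet_derivative (coord_rep c d f) (at (snd c p)) = transition_deriv d' d (f p) \<circ> D \<circ> transition_deriv c c' p"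
    by (rule frechet_derivative_at[symmetric])
  have "form_pullback A B S f \<beta> c (snd c p) us =
     \<beta> d' (snd d' (f p)) (map (transition_deriv d d' (f p)) (map (frechet_derivative (coord_rep c d f) (at (snd c p))) us))"
    unfolding d(3) by (rule smooth_formD(4)[OF \<beta> d(1) d'(1) d(2) d'(2)])
  also have "map (transition_deriv d d' (f p)) (map (frechet_derivative (coord_rep c d f) (at (snd c p))) us) = map (\<lambda>u. D (transition_deriv c c' p u)) us"
    unfolding fr map_map
    using transition_deriv_inverse[OF pre_manifoldD(1)[OF B d'(1)] pre_manifoldD(1)[OF B d(1)] pre_manifoldD(2)[OF B d'(1) d(1)]
        pre_manifoldD(2)[OF B d(1) d'(1)] d'(2) d(2)]
    by (simp add: comp_def)
  finally show ?thesis .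
qed

section \<open>Local estimates for admissible maps\<close>

lemma smooth_on_deriv_locally_bounded:
  fixes f :: "'v::euclidean_space \<Rightarrow> 'w::real_normed_vector"
  assumes f: "smooth_on S f" and S: "open S" "z \<in> S"
  obtains r E where "0 < r" "0 \<le> E" "ball z r \<subseteq> S" "\<And>x v. x \<in> ball z r \<Longrightarrow> norm (frechet_derivative f (at x) v) \<le> E * norm v"
proof -
  let ?D = "\<lambda>b x. frechet_derivative f (at x) b"
  have "\<forall>\<^sub>F x in nhds z. \<forall>b\<in>Basis. norm (?D b x) < norm (?D b z) + 1"
  proof (rule eventually_ball_finite[OF finite_Basis], rule ballI)
    fix b :: 'v
    have "isCont (\<lambda>x. norm (?D b x)) z"
      using smooth_on_imp_continuous_on[OF smooth_on_deriv[OF f]] S by (simp add: continuous_on_eq_continuous_at)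
    then have "((\<lambda>x. norm (?D b x)) \<longlongrightarrow> norm (?D b z)) (nhds z)" by (simp add: isCont_def tendsto_nhds_iff)
    then show "\<forall>\<^sub>F x in nhds z. norm (?D b x) < norm (?D b z) + 1" by (rule order_tendstoD) simp
  qed
  moreover have "\<forall>\<^sub>F x in nhds z. x \<in> S" using S by (rule eventually_nhds_in_open)
  ultimately have "\<forall>\<^sub>F x in nhds z. x \<in> S \<and> (\<forall>b\<in>Basis. norm (?D b x) < norm (?D b z) + 1)"
    by eventually_elim blast
  then obtain r where r: "r > 0" "\<And>x. dist x z < r \<Longrightarrow> x \<in> S \<and> (\<forall>b\<in>Basis. norm (?D b x) < norm (?D b z) + 1)"
    unfolding eventually_nhds_metric by blast
  define E where "E = (\<Sum>b\<in>Basis. norm (?D b z) + 1)"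
  show thesis
  proof (rule that[of r E])
    show "0 \<le> E" unfolding E_def by (intro sum_nonneg) (simp add: add_nonneg_nonneg)
    show "ball z r \<subseteq> S" using r(2) by (auto simp: dist_commute)
    fix x v assume "x \<in> ball z r"
    then have x: "x \<in> S" "\<And>b. b \<in> Basis \<Longrightarrow> norm (?D b x) \<le> norm (?D b z) + 1"
      using r(2)[of x] by (auto simp: dist_commute less_imp_le)
    have "?D v x = (\<Sum>b\<in>Basis. (v \<bullet> b) *\<^sub>R ?D b x)"
      by (rule linear_expand[symmetric, OF has_derivative_linear[OF smooth_on_has_derivative[OF f x(1)]]])
    also have "norm \<dots> \<le> (\<Sum>b\<in>Basis. norm v * (norm (?D b z) + 1))"
    proof (rule sum_norm_le)
      fix b :: 'v assume b: "b \<in> Basis"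
      show "norm ((v \<bullet> b) *\<^sub>R ?D b x) \<le> norm v * (norm (?D b z) + 1)"
        unfolding norm_scaleR using Basis_le_norm[OF b, of v] x(2)[OF b] by (intro mult_mono) auto
    qed
    also have "\<dots> = E * norm v" unfolding E_def by (simp add: sum_distrib_left mult.commute flip: sum_distrib_right)
    finally show "norm (?D v x) \<le> E * norm v" .
  qed (rule r(1))
qed

lemma smooth_on_deriv_locally_Lipschitz:
  fixes f :: "'v::euclidean_space \<Rightarrow> 'w::real_normed_vector"
  assumes f: "smooth_on S f" and S: "open S" "z \<in> S"
  obtains r E where "0 < r" "0 \<le> E" "ball z r \<subseteq> S"
    "\<And>x y v. x \<in> ball z r \<Longrightarrow> y \<in> ball z r \<Longrightarrow> norm (frechet_derivative f (at x) v - frechet_derivative f (at y) v) \<le> E * norm (x - y) * norm v"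
proof -
  let ?D = "\<lambda>b x. frechet_derivative f (at x) b"
  have "\<exists>r E. 0 < r \<and> 0 \<le> E \<and> ball z r \<subseteq> S \<and> (\<forall>x\<in>ball z r. \<forall>v. norm (frechet_derivative (?D b) (at x) v) \<le> E * norm v)" for b
    by (rule smooth_on_deriv_locally_bounded[OF smooth_on_deriv[OF f, of b] S]) blast
  then obtain r E where rE: "\<And>b. 0 < r b" "\<And>b. 0 \<le> E b" "\<And>b. ball z (r b) \<subseteq> S"
    "\<And>b x v. x \<in> ball z (r b) \<Longrightarrow> norm (frechet_derivative (?D b) (at x) v) \<le> E b * norm v" by metis
  define \<rho> where "\<rho> = Min (r ` Basis)"
  have \<rho>: "\<rho> > 0" "\<And>b. b \<in> Basis \<Longrightarrow> \<rho> \<le> r b" using rE(1) by (auto simp: \<rho>_def)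
  have L: "norm (?D b x - ?D b y) \<le> E b * norm (x - y)" if b: "b \<in> Basis" and xy: "x \<in> ball z \<rho>" "y \<in> ball z \<rho>" for b x y
  proof (rule differentiable_bound[OF convex_ball _ _ xy, of _ "\<lambda>x. frechet_derivative (?D b) (at x)"])
    fix w assume "w \<in> ball z \<rho>"
    then have w: "w \<in> ball z (r b)" using \<rho>(2)[OF b] by auto
    then show "(?D b has_derivative frechet_derivative (?D b) (at w)) (at w within ball z \<rho>)"
      using smooth_on_has_derivative[OF smooth_on_deriv[OF f], of w b] rE(3)[of b] has_derivative_at_withinI by blast
    show "onorm (frechet_derivative (?D b) (at w)) \<le> E b" by (rule onorm_le) (rule rE(4)[OF w])
  qed
  obtain b0 :: 'v where b0: "b0 \<in> Basis" using nonempty_Basis by blast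
  have sub: "ball z \<rho> \<subseteq> S" using \<rho>(2)[OF b0] rE(3)[of b0] by (meson order_trans subset_ball)
  show thesis
  proof (rule that[OF \<rho>(1) _ sub])
    show "0 \<le> (\<Sum>b\<in>Basis. E b)" by (intro sum_nonneg rE)
    fix x y v assume xy: "x \<in> ball z \<rho>" "y \<in> ball z \<rho>"
    have lin: "linear (\<lambda>v. ?D v x - ?D v y)"
      using has_derivative_linear[OF smooth_on_has_derivative[OF f]] sub xy by (intro linear_compose_sub) blast+
    have "?D v x - ?D v y = (\<Sum>b\<in>Basis. (v \<bullet> b) *\<^sub>R (?D b x - ?D b y))"
      by (rule linear_expand[symmetric, OF lin])
    also have "norm \<dots> \<le> (\<Sum>b\<in>Basis. norm v * (E b * norm (x - y)))"
    proof (rule sum_norm_le)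
      fix b :: 'v assume b: "b \<in> Basis"
      show "norm ((v \<bullet> b) *\<^sub>R (?D b x - ?D b y)) \<le> norm v * (E b * norm (x - y))"
        unfolding norm_scaleR using Basis_le_norm[OF b, of v] L[OF b xy] by (intro mult_mono) auto
    qed
    also have "\<dots> = (\<Sum>b\<in>Basis. E b) * norm (x - y) * norm v"
      by (simp add: mult_ac flip: sum_distrib_left sum_distrib_right)
    finally show "norm (?D v x - ?D v y) \<le> (\<Sum>b\<in>Basis. E b) * norm (x - y) * norm v" .
  qed
qed

lemma admissible_mapD:
  assumes "admissible_map A N \<tau>"
  shows "openin (atlas_topology (prod_atlas A A)) N" "p \<in> points A \<Longrightarrow> (p, p) \<in> N" "inj_on \<tau> N"
    "openin (atlas_topology (tangent_atlas A)) (\<tau> ` N)" "smooth_map (prod_atlas A A) (tangent_atlas A) N \<tau>"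
    "smooth_map (tangent_atlas A) (prod_atlas A A) (\<tau> ` N) (inv_into N \<tau>)"
    "p \<in> points A \<Longrightarrow> \<tau> (p, p) = (p, \<lambda>c. 0)"
    "c \<in> A \<Longrightarrow> p \<in> fst c \<Longrightarrow> vsnd (frechet_derivative (coord_rep (prod_chart c c) (tangent_chart A c) \<tau>)
                (at (vjoin (snd c p) (snd c p))) (vjoin u w)) = w - u"
  using assms unfolding admissible_map_def by blast+

text \<open>The dilation multiplies only the fibre part of \<open>F\<close>, so that part needs
  sharper bounds: its derivative is small on nearly diagonal vectors, up to an error proportional to
  the distance of the two points, and its value dominates half of this distance. The last conclusion
  keeps the base point in the set on which a test form is bounded.\<close>

lemma admissible_map_local:
  fixes A :: "('a, 'm::finite) chart set"
  assumes A: "pre_manifold A" and adm: "admissible_map A N \<tau>" and c: "c \<in> A" "p \<in> fst c" and R: "0 < R"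
  defines "F \<equiv> coord_rep (prod_chart c c) (tangent_chart A c) \<tau>"
  obtains \<rho> E where "0 < \<rho>" "0 < E"
    "vfst -` ball (snd c p) \<rho> \<inter> vsnd -` ball (snd c p) \<rho> \<subseteq> snd (prod_chart c c) ` {q \<in> fst (prod_chart c c) \<inter> N. \<tau> q \<in> fst (tangent_chart A c)}"
    "\<And>z. z \<in> vfst -` ball (snd c p) \<rho> \<inter> vsnd -` ball (snd c p) \<rho> \<Longrightarrow> (F has_derivative frechet_derivative F (at z)) (at z)"
    "\<And>z v. z \<in> vfst -` ball (snd c p) \<rho> \<inter> vsnd -` ball (snd c p) \<rho> \<Longrightarrow> norm (frechet_derivative F (at z) v) \<le> E * norm v"
    "\<And>z u w. z \<in> vfst -` ball (snd c p) \<rho> \<inter> vsnd -` ball (snd c p) \<rho> \<Longrightarrow>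
       norm (vsnd (frechet_derivative F (at z) (vjoin u w))) \<le> norm (u - w) + E * norm (vfst z - vsnd z) * (norm u + norm w)"
    "\<And>z. z \<in> vfst -` ball (snd c p) \<rho> \<inter> vsnd -` ball (snd c p) \<rho> \<Longrightarrow> norm (vfst z - vsnd z) \<le> 2 * norm (vsnd (F z))"
    "\<And>z. z \<in> vfst -` ball (snd c p) \<rho> \<inter> vsnd -` ball (snd c p) \<rho> \<Longrightarrow> vfst (F z) \<in> ball (snd c p) R"
proof -
  let ?pc = "prod_chart c c" and ?e = "tangent_chart A c"
  have pp: "pre_manifold (prod_atlas A A)" and pt: "pre_manifold (tangent_atlas A)"
    using pre_manifold_prod[OF A A] pre_manifold_tangent[OF A] by auto
  note cc = pre_manifoldD(1)[OF A c(1)]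
  have cpp: "is_chart ?pc" by (rule is_chart_prod[OF cc cc])
  define D where "D = snd ?pc ` {q \<in> fst ?pc \<inter> N. \<tau> q \<in> fst ?e}"
  note sd = smooth_mapD[OF pp pt admissible_mapD(1)[OF adm] admissible_mapD(5)[OF adm] prod_chart_in[OF c(1) c(1)] tangent_chart_in[OF c(1)]]
  have oD: "open D" and smF: "smooth_on D F" using sd(2,3) by (simp_all add: D_def F_def)
  have diag: "vjoin (snd c x) (snd c x) \<in> D" and Fdiag: "F (vjoin (snd c x) (snd c x)) = vjoin (snd c x) 0" if x: "x \<in> fst c" for x
  proof -
    have xA: "x \<in> points A" using chart_subset_points[OF c(1)] x by blast
    have "(x, x) \<in> {q \<in> fst ?pc \<inter> N. \<tau> q \<in> fst ?e}"
      using admissible_mapD(2,7)[OF adm xA] x zero_tangent[OF A] by (simp add: fst_tangent_chart)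
    then have "snd ?pc (x, x) \<in> D" unfolding D_def by (rule imageI)
    then show "vjoin (snd c x) (snd c x) \<in> D" by simp
    show "F (vjoin (snd c x) (snd c x)) = vjoin (snd c x) 0"
      using coord_rep_chart[OF cpp, of "(x, x)" ?e \<tau>] admissible_mapD(7)[OF adm xA] x
      by (simp add: F_def snd_tangent_chart)
  qed
  define z0 where "z0 = vjoin (snd c p) (snd c p)"
  have z0: "z0 \<in> D" unfolding z0_def by (rule diag[OF c(2)])
  obtain r1 E1 where r1: "0 < r1" "0 \<le> E1" "ball z0 r1 \<subseteq> D" "\<And>x v. x \<in> ball z0 r1 \<Longrightarrow> norm (frechet_derivative F (at x) v) \<le> E1 * norm v"
    using smooth_on_deriv_locally_bounded[OF smF oD z0] by metis
  obtain r2 E2 where r2: "0 < r2" "0 \<le> E2" "ball z0 r2 \<subseteq> D"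
    "\<And>x y v. x \<in> ball z0 r2 \<Longrightarrow> y \<in> ball z0 r2 \<Longrightarrow> norm (frechet_derivative F (at x) v - frechet_derivative F (at y) v) \<le> E2 * norm (x - y) * norm v"
    using smooth_on_deriv_locally_Lipschitz[OF smF oD z0] by metis
  have "isCont (\<lambda>z. vfst (F z)) z0"
    by (rule bounded_linear.isCont[OF bounded_linear_vfst])
      (use smooth_on_imp_continuous_on[OF smF] oD z0 in \<open>simp add: continuous_on_eq_continuous_at\<close>)
  moreover have Fz0: "vfst (F z0) = snd c p" using Fdiag[OF c(2)] by (simp add: z0_def)
  ultimately obtain r3 where r3: "r3 > 0" "\<And>z. dist z z0 < r3 \<Longrightarrow> dist (vfst (F z)) (snd c p) < R"
    unfolding continuous_at_eps_delta using R by metis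
  have oci: "open (chart_image c)" by (rule chart_image_open[OF cc])
  obtain r4 where r4: "r4 > 0" "ball (snd c p) r4 \<subseteq> chart_image c"
    by (rule openE[OF oci imageI[OF c(2)]])
  define E where "E = E1 + E2 + 1"
  have E: "E > 0" "E1 \<le> E" "E2 \<le> E" using r1(2) r2(2) by (auto simp: E_def)
  \<comment> \<open>Halved radii, because the point \<open>z\<close> has two components near
    \<open>snd c p\<close>. The bound \<open>1 / (4 * E)\<close> makes the perturbation in
    \<open>T3\<close> at most 1/2, as points of the ball are less than \<open>2 * \<rho>\<close>
    apart.\<close>
  define \<rho> where "\<rho> = Min {r1 / 2, r2 / 2, r3 / 2, r4, 1 / (4 * E)}"
  have \<rho>: "0 < \<rho>" "\<rho> \<le> r1 / 2" "\<rho> \<le> r2 / 2" "\<rho> \<le> r3 / 2" "\<rho> \<le> r4" "\<rho> \<le> 1 / (4 * E)"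
    using r1(1) r2(1) r3(1) r4(1) E(1) by (auto simp: \<rho>_def)
  define U where "U = (vfst -` ball (snd c p) \<rho> \<inter> vsnd -` ball (snd c p) \<rho> :: (complex^('m + 'm)) set)"
  have near: "dist z z0 < 2 * \<rho>" if "z \<in> U" for z
  proof -
    have "dist z z0 = norm (vjoin (vfst z - snd c p) (vsnd z - snd c p))"
      unfolding vjoin_diff by (simp add: dist_norm z0_def)
    also have "\<dots> \<le> norm (vfst z - snd c p) + norm (vsnd z - snd c p)" by (rule norm_vjoin_le)
    also have "\<dots> < 2 * \<rho>" using that by (auto simp: U_def dist_norm norm_minus_commute)
    finally show ?thesis .
  qed
  have Ub: "z \<in> ball z0 r1" "z \<in> ball z0 r2" "dist z z0 < r3" if "z \<in> U" for z
    using near[OF that] \<rho> by (auto simp: dist_commute)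
  have UD: "U \<subseteq> D" using Ub(1) r1(3) by blast
  have Uc: "\<exists>x\<in>fst c. vfst z = snd c x" if "z \<in> U" for z
    using that \<rho>(5) r4(2) by (auto simp: U_def image_iff subset_iff)
  have FD: "(F has_derivative frechet_derivative F (at z)) (at z)" if "z \<in> U" for z
    by (rule smooth_on_has_derivative[OF smF]) (use UD that in blast)
  \<comment> \<open>Comparison with the diagonal point that has the same first component: there the
    fibre derivative is exactly \<open>w - u\<close>, and the derivative of \<open>F\<close> is
    Lipschitz.\<close>
  have T2: "norm (vsnd (frechet_derivative F (at z) (vjoin u w)) - (w - u)) \<le> E * norm (vfst z - vsnd z) * norm (vjoin u w)" if z: "z \<in> U" for z u w
  proof -
    obtain x where x: "x \<in> fst c" "vfst z = snd c x" using Uc[OF z] by blast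
    let ?zd = "vjoin (vfst z) (vfst z)"
    have zd: "?zd \<in> U" using z by (simp add: U_def)
    have "vsnd (frechet_derivative F (at ?zd) (vjoin u w)) = w - u"
      using admissible_mapD(8)[OF adm c(1) x(1), of u w] x(2) by (simp add: F_def)
    then have "norm (vsnd (frechet_derivative F (at z) (vjoin u w)) - (w - u))
       = norm (vsnd (frechet_derivative F (at z) (vjoin u w) - frechet_derivative F (at ?zd) (vjoin u w)))"
      by (simp add: vsnd_linear_simps)
    also have "\<dots> \<le> norm (frechet_derivative F (at z) (vjoin u w) - frechet_derivative F (at ?zd) (vjoin u w))" by (rule norm_vsnd_le)
    also have "\<dots> \<le> E2 * norm (z - ?zd) * norm (vjoin u w)" by (rule r2(4)[OF Ub(2)[OF z] Ub(2)[OF zd]])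
    also have "norm (z - ?zd) = norm (vfst z - vsnd z)"
    proof -
      have "z - ?zd = vjoin 0 (vsnd z - vfst z)"
        using vjoin_diff[of "vfst z" "vfst z" "vsnd z" "vfst z"] by simp
      then have "(norm (z - ?zd))\<^sup>2 = (norm (vfst z - vsnd z))\<^sup>2" by (simp add: norm_vjoin_power2 norm_minus_commute)
      then show ?thesis by (simp add: power2_eq_iff_nonneg)
    qed
    also have "E2 * norm (vfst z - vsnd z) * norm (vjoin u w) \<le> E * norm (vfst z - vsnd z) * norm (vjoin u w)"
      using E(3) by (intro mult_right_mono) auto
    finally show ?thesis .
  qed
  \<comment> \<open>In the second variable the fibre part of \<open>F\<close> is the identity up to
    a 1/2-Lipschitz error, and it vanishes on the diagonal; so it moves away from 0 at least half as
    fast as the second point moves away from the first.\<close>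
  have T3: "norm (vfst z - vsnd z) \<le> 2 * norm (vsnd (F z))" if z: "z \<in> U" for z
  proof -
    define a where "a = vfst z"
    obtain x where x: "x \<in> fst c" "a = snd c x" using Uc[OF z] by (auto simp: a_def)
    have ab: "a \<in> ball (snd c p) \<rho>" "vsnd z \<in> ball (snd c p) \<rho>" using z by (auto simp: U_def a_def)
    let ?h = "\<lambda>b. vsnd (F (vjoin a b)) - b"
    have "norm (?h (vsnd z) - ?h a) \<le> (1/2) * norm (vsnd z - a)"
    proof (rule differentiable_bound[OF convex_ball _ _ ab(2,1), where f'="\<lambda>b w. vsnd (frechet_derivative F (at (vjoin a b)) (vjoin 0 w)) - w"])
      fix b assume b: "b \<in> ball (snd c p) \<rho>"
      have zb: "vjoin a b \<in> U" using ab(1) b by (simp add: U_def)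
      have "((\<lambda>b. F (vjoin a b)) has_derivative (\<lambda>w. frechet_derivative F (at (vjoin a b)) (vjoin 0 w))) (at b)"
        by (rule has_derivative_compose[OF has_derivative_vjoin[OF has_derivative_const[of a] has_derivative_ident] FD[OF zb]])
      from has_derivative_diff[OF bounded_linear.has_derivative[OF bounded_linear_vsnd this] has_derivative_ident]
      show "(?h has_derivative (\<lambda>w. vsnd (frechet_derivative F (at (vjoin a b)) (vjoin 0 w)) - w)) (at b within ball (snd c p) \<rho>)"
        by (rule has_derivative_at_withinI)
      show "onorm (\<lambda>w. vsnd (frechet_derivative F (at (vjoin a b)) (vjoin 0 w)) - w) \<le> 1 / 2"
      proof (rule onorm_le)
        fix w
        have "norm (vsnd (frechet_derivative F (at (vjoin a b)) (vjoin 0 w)) - w) \<le> E * norm (a - b) * norm w"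
        proof -
          have "norm (vjoin (0::complex^'m) w) = norm w"
            using norm_vjoin_le[of "0::complex^'m" w] norm_vsnd_le[of "vjoin (0::complex^'m) w"] by simp
          then show ?thesis using T2[OF zb, of 0 w] by simp
        qed
        also have "E * norm (a - b) \<le> E * (2 * \<rho>)"
          using ab(1) b dist_triangle2[of a b "snd c p"] E(1) by (intro mult_left_mono) (auto simp: dist_norm norm_minus_commute)
        also have "\<dots> \<le> 1/2" using \<rho>(6) E(1) by (simp add: field_simps)
        finally show "norm (vsnd (frechet_derivative F (at (vjoin a b)) (vjoin 0 w)) - w) \<le> 1 / 2 * norm w"
          by (simp add: mult_right_mono)
      qed
    qed
    moreover have "?h a = - a" using Fdiag[OF x(1)] x(2) by simp
    moreover have "?h (vsnd z) = vsnd (F z) - vsnd z" by (simp add: a_def)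
    ultimately have "norm (vsnd (F z) - (vsnd z - a)) \<le> (1/2) * norm (vsnd z - a)" by (simp add: algebra_simps)
    then have "norm (vsnd z - a) \<le> 2 * norm (vsnd (F z))"
      using norm_triangle_ineq2[of "vsnd z - a" "vsnd (F z)"] by (simp add: norm_minus_commute)
    then show ?thesis by (simp add: a_def norm_minus_commute)
  qed
  show thesis
  proof (rule that[OF \<rho>(1) E(1), folded U_def])
    show "U \<subseteq> snd ?pc ` {q \<in> fst ?pc \<inter> N. \<tau> q \<in> fst ?e}" using UD by (simp add: D_def)
    show "(F has_derivative frechet_derivative F (at z)) (at z)" if "z \<in> U" for z by (rule FD[OF that])
    show "norm (frechet_derivative F (at z) v) \<le> E * norm v" if "z \<in> U" for z v
      using order_trans[OF r1(4)[OF Ub(1)[OF that]] mult_right_mono[OF E(2) norm_ge_zero]] .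
    show "norm (vsnd (frechet_derivative F (at z) (vjoin u w))) \<le> norm (u - w) + E * norm (vfst z - vsnd z) * (norm u + norm w)"
      if z: "z \<in> U" for z u w
    proof -
      have "norm (vsnd (frechet_derivative F (at z) (vjoin u w))) \<le> norm (vsnd (frechet_derivative F (at z) (vjoin u w)) - (w - u)) + norm (w - u)"
        using norm_triangle_ineq[of "vsnd (frechet_derivative F (at z) (vjoin u w)) - (w - u)" "w - u"] by simp
      moreover have "E * norm (vfst z - vsnd z) * norm (vjoin u w) \<le> E * norm (vfst z - vsnd z) * (norm u + norm w)"
        using E(1) norm_vjoin_le[of u w] by (intro mult_left_mono) auto
      ultimately show ?thesis using T2[OF z, of u w] by (simp add: norm_minus_commute)
    qed
    show "norm (vfst z - vsnd z) \<le> 2 * norm (vsnd (F z))" if "z \<in> U" for z by (rule T3[OF that])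
    show "vfst (F z) \<in> ball (snd c p) R" if "z \<in> U" for z using r3(2)[OF Ub(3)[OF that]] by (simp add: dist_commute)
  qed
qed

lemma form_supportI:
  assumes A: "pre_manifold A" and "c \<in> A" "p \<in> fst c" "\<alpha> c (snd c p) us \<noteq> 0"
  shows "p \<in> form_support A \<alpha>"
proof -
  have "{p. \<exists>c\<in>A. p \<in> fst c \<and> (\<exists>us. \<alpha> c (snd c p) us \<noteq> 0)} \<subseteq> topspace (atlas_topology A)"
    unfolding topspace_atlas points_def by blast
  from closure_of_subset[OF this] show ?thesis unfolding form_support_def using assms by blast
qed

lemma form_support_subset:
  assumes "closedin (atlas_topology A) Y" "\<And>c p us. c \<in> A \<Longrightarrow> p \<in> fst c \<Longrightarrow> \<alpha> c (snd c p) us \<noteq> 0 \<Longrightarrow> p \<in> Y"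
  shows "form_support A \<alpha> \<subseteq> Y"
  unfolding form_support_def by (rule closure_of_minimal[OF _ assms(1)]) (use assms(2) in blast)

text \<open>Over a compact set of base coordinates the support is compact inside one tangent chart:
  it is intersected with the closed set of fibres over the image of \<open>B\<close>. This bounds
  the fibre coordinate, and by continuity the coefficients on the finitely many lists of basis
  vectors.\<close>

lemma test_form_bound:
  fixes A :: "('a, 'm::finite) chart set"
  assumes A: "pre_manifold A" and H: "Hausdorff_space (atlas_topology A)" and \<Phi>: "test_form (tangent_atlas A) k \<Phi>"
    and c: "c \<in> A" and B: "compact B" "B \<subseteq> chart_image c"
  obtains M where "0 < M" "\<And>\<xi> us. vfst \<xi> \<in> B \<Longrightarrow> \<Phi> (tangent_chart A c) \<xi> us \<noteq> 0 \<Longrightarrow> norm (vsnd \<xi>) \<le> M"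
    "\<And>\<xi> us. vfst \<xi> \<in> B \<Longrightarrow> length us = k \<Longrightarrow> norm (\<Phi> (tangent_chart A c) \<xi> us) \<le> M * (\<Prod>i<k. norm (us ! i))"
proof -
  let ?e = "tangent_chart A c" and ?T = "atlas_topology (tangent_atlas A)"
  have pt: "pre_manifold (tangent_atlas A)" by (rule pre_manifold_tangent[OF A])
  have e: "?e \<in> tangent_atlas A" by (rule tangent_chart_in[OF c])
  have sf: "smooth_form (tangent_atlas A) k \<Phi>" and comp: "compactin ?T (form_support (tangent_atlas A) \<Phi>)"
    using \<Phi> by (auto simp: test_form_def)
  define Z where "Z = chart_inv c ` B"
  have "closedin (atlas_topology A) Z" unfolding Z_def
    by (rule compactin_imp_closedin[OF H compactin_chart_inv_image[OF chart_holomorphic_coordinates[OF A c] B]])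
  then have "closedin ?T (SIGMA p : Z. tangent_space A p)" by (rule closedin_tangent_over[OF A])
  then have comp2: "compactin ?T ((SIGMA p : Z. tangent_space A p) \<inter> form_support (tangent_atlas A) \<Phi>)" (is "compactin _ ?K")
    using comp by (rule closed_Int_compactin)
  have Zc: "Z \<subseteq> fst c" unfolding Z_def using B(2) chart_inv_in[of _ c] by blast
  have Ke: "?K \<subseteq> fst ?e" using Zc by (auto simp: fst_tangent_chart)
  define Q where "Q = snd ?e ` ?K"
  have Q: "compact Q" unfolding Q_def
    by (rule compact_chart_image[OF pt chart_holomorphic_coordinates[OF pt e] comp2 Ke])
  have nz: "\<xi> \<in> Q" if "vfst \<xi> \<in> B" "\<Phi> ?e \<xi> us \<noteq> 0" for \<xi> us
  proof -
    have "\<xi> \<in> chart_image ?e" using smooth_formD(1)[OF sf, of ?e \<xi> us] that(2) by blast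
    then obtain q where q: "q \<in> fst ?e" "\<xi> = snd ?e q" by blast
    have "q \<in> form_support (tangent_atlas A) \<Phi>"
      using form_supportI[OF pt e q(1), of \<Phi> us] that(2) q(2) by simp
    moreover have "fst q \<in> Z"
    proof -
      have "fst q \<in> fst c" "vfst \<xi> = snd c (fst q)" using q by (auto simp: fst_tangent_chart snd_tangent_chart)
      then show ?thesis unfolding Z_def using that(1) chart_inv_chart[OF pre_manifoldD(1)[OF A c], of "fst q"] by (metis imageI)
    qed
    ultimately have "q \<in> ?K" using q(1) by (auto simp: fst_tangent_chart)
    then show ?thesis unfolding Q_def q(2) by (rule imageI)
  qed
  have QU: "Q \<subseteq> chart_image ?e" unfolding Q_def using Ke by blast
  obtain M1 where M1: "M1 > 0" "\<And>\<xi>. \<xi> \<in> Q \<Longrightarrow> norm \<xi> \<le> M1"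
    using compact_imp_bounded[OF Q] unfolding bounded_pos by blast
  have "\<exists>M. \<forall>\<xi>\<in>Q. norm (\<Phi> ?e \<xi> us) \<le> M" for us
  proof -
    have "continuous_on Q (\<lambda>\<xi>. \<Phi> ?e \<xi> us)"
      by (rule continuous_on_subset[OF smooth_on_imp_continuous_on[OF smooth_formD(3)[OF sf e]] QU])
    from compact_imp_bounded[OF compact_continuous_image[OF this Q]] show ?thesis
      unfolding bounded_iff by blast
  qed
  then obtain M2 where M2: "\<And>us \<xi>. \<xi> \<in> Q \<Longrightarrow> norm (\<Phi> ?e \<xi> us) \<le> M2 us" by metis
  define BL where "BL = {us :: (complex^('m + 'm)) list. set us \<subseteq> Basis \<and> length us = k}"
  have fBL: "finite BL" unfolding BL_def by (rule finite_lists_length_eq[OF finite_Basis])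
  define M3 where "M3 = (\<Sum>us\<in>BL. \<bar>M2 us\<bar>)"
  have M3: "0 \<le> M3" by (simp add: M3_def sum_nonneg)
  have b3: "norm (\<Phi> ?e \<xi> us) \<le> M3" if "\<xi> \<in> Q" "us \<in> BL" for \<xi> us
  proof -
    have "norm (\<Phi> ?e \<xi> us) \<le> \<bar>M2 us\<bar>" using M2[OF that(1), of us] by simp
    also have "\<dots> \<le> M3" unfolding M3_def by (rule member_le_sum[OF that(2) _ fBL]) simp
    finally show ?thesis .
  qed
  define M4 where "M4 = M3 * real DIM(complex^('m + 'm)) ^ k"
  have M4: "0 \<le> M4" using M3 by (simp add: M4_def)
  show thesis
  proof (rule that[of "M1 + M4"])
    show "0 < M1 + M4" using M1(1) M4 by simp
    show "norm (vsnd \<xi>) \<le> M1 + M4" if "vfst \<xi> \<in> B" "\<Phi> ?e \<xi> us \<noteq> 0" for \<xi> us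
      using norm_vsnd_le[of \<xi>] M1(2)[OF nz[OF that]] M4 by linarith
    show "norm (\<Phi> ?e \<xi> us) \<le> (M1 + M4) * (\<Prod>i<k. norm (us ! i))" if "vfst \<xi> \<in> B" "length us = k" for \<xi> us
    proof (cases "\<Phi> ?e \<xi> us = 0")
      case True
      then show ?thesis using M1(1) M4 by (simp add: prod_nonneg)
    next
      case False
      then have \<xi>: "\<xi> \<in> Q" using nz that by blast
      have "norm (\<Phi> ?e \<xi> us) \<le> M3 * real DIM(complex^('m + 'm)) ^ k * (\<Prod>i<k. norm (us ! i))"
      proof (rule alternating_multilinear_bound[OF smooth_formD(2)[OF sf e] M3 _ that(2)])
        show "\<xi> \<in> chart_image ?e" using \<xi> QU by blast
        show "norm (\<Phi> ?e \<xi> us) \<le> M3" if "length us = k" "set us \<subseteq> Basis" for us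
          by (rule b3[OF \<xi>]) (use that in \<open>simp add: BL_def\<close>)
      qed
      also have "\<dots> \<le> (M1 + M4) * (\<Prod>i<k. norm (us ! i))"
        using M1(1) by (intro mult_right_mono) (auto simp: M4_def prod_nonneg)
      finally show ?thesis .
    qed
  qed
qed

section \<open>The pointwise estimate\<close>

lemma prod_norm_nth_append_le:
  fixes xs ys :: "'v::real_normed_vector list"
  assumes "\<And>x. x \<in> set xs \<Longrightarrow> norm x \<le> a" "\<And>y. y \<in> set ys \<Longrightarrow> norm y \<le> b" "0 \<le> a" "0 \<le> b"
  shows "(\<Prod>i<length xs + length ys. norm ((xs @ ys) ! i)) \<le> a ^ length xs * b ^ length ys"
proof -
  have *: "prod_list (map norm zs) \<le> e ^ length zs" if "\<And>z. z \<in> set zs \<Longrightarrow> norm z \<le> e" "0 \<le> e" for zs :: "'v list" and e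
    using that
  proof (induction zs)
    case (Cons z zs)
    have "norm z * prod_list (map norm zs) \<le> e * e ^ length zs"
      using Cons by (intro mult_mono Cons.IH) (auto intro!: prod_list_nonneg)
    then show ?case by simp
  qed simp
  have "(\<Prod>i<length xs + length ys. norm ((xs @ ys) ! i)) = prod_list (map norm (xs @ ys))"
    by (simp add: prod.list_conv_set_nth atLeast0LessThan del: map_append)
  also have "\<dots> = prod_list (map norm xs) * prod_list (map norm ys)" by simp
  also have "\<dots> \<le> a ^ length xs * b ^ length ys"
    using assms by (intro mult_mono *) (auto intro!: prod_list_nonneg)
  finally show ?thesis .
qed

abbreviation plaque_deriv :: "('a, 'n::finite) chart \<Rightarrow> ('a, 'q::finite, 'n) flow_box \<Rightarrow> complex^'n \<Rightarrow> complex^'q \<Rightarrow> complex^'q \<Rightarrow> complex^'n" where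
  "plaque_deriv d b t z \<equiv> frechet_derivative (coord_rep (polydisc, \<lambda>z. z) d (\<lambda>z. fst b (z, t))) (at z)"

text \<open>The pullback in \<open>plaque_integral\<close> reads plaque tangents in a chart
  \<open>d\<close> that is not under control; this carries them to the chart \<open>c\<close> in
  which the estimates are available.\<close>

lemma plaque_deriv_change:
  fixes A :: "('a, 'n::finite) chart set" and \<iota> :: "'q::finite \<Rightarrow> 'n"
  assumes A: "pre_manifold A" and b: "is_embedded_flow_box A \<iota> \<Sigma> b" and t: "t \<in> transverse_polydisc \<iota>"
    and cd: "c \<in> A" "d \<in> A" and z: "z \<in> polydisc" "fst b (z, t) \<in> fst c" "fst b (z, t) \<in> fst d"
  shows "transition_deriv d c (fst b (z, t)) (plaque_deriv d b t z v) = frechet_derivative (plaque_coord c b t) (at z) v"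
proof -
  let ?S = "{z \<in> polydisc. fst b (z, t) \<in> fst d} \<inter> {z \<in> polydisc. fst b (z, t) \<in> fst c}"
  have o: "open ?S" using plaque_holomorphic(1)[OF A b t cd(2)] plaque_holomorphic(1)[OF A b t cd(1)] by blast
  have zS: "z \<in> ?S" using z by simp
  have P: "(plaque_coord d b t has_derivative plaque_deriv d b t z) (at z)"
    unfolding plaque_holomorphic(3)[OF A b t cd(2) z(1,3)]
    by (rule complex_differentiable_onD(1)[OF plaque_holomorphic(2)[OF A b t cd(2)]]) (use z in simp)
  have "((\<lambda>z. coord_rep d c id (plaque_coord d b t z)) has_derivative
     (\<lambda>v. transition_deriv d c (fst b (z, t)) (plaque_deriv d b t z v))) (at z)"
    by (rule has_derivative_compose[OF P transition_has_derivative(1)[OF pre_manifoldD(2)[OF A cd(2,1)] z(3,2)]])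
  then have "(plaque_coord c b t has_derivative (\<lambda>v. transition_deriv d c (fst b (z, t)) (plaque_deriv d b t z v))) (at z)"
  proof (rule has_derivative_transform_within_open[OF _ o zS])
    fix w assume "w \<in> ?S"
    then show "coord_rep d c id (plaque_coord d b t w) = plaque_coord c b t w"
      using coord_rep_chart[OF pre_manifoldD(1)[OF A cd(2)], of "fst b (w, t)" c id] by simp
  qed
  from fun_cong[OF frechet_derivative_at[OF this], of v] show ?thesis .
qed

text \<open>On the product of two plaques, the vectors \<open>(u, 0)\<close> tangent to the first factor may be replaced
  by nearly diagonal vectors \<open>(u, u')\<close>, on which the derivative of the dilated map stays bounded.\<close>

lemma tangent_form_estimate:
  fixes \<Phi> :: "(complex^('n::finite + 'n)) list \<Rightarrow> complex" and X Y :: "complex^'q::finite \<Rightarrow> complex^'n"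
    and F' :: "complex^('n + 'n) \<Rightarrow> complex^('n + 'n)" and l :: complex
  defines "D \<equiv> \<lambda>v. vjoin (vfst (F' v)) (l *s vsnd (F' v))"
  assumes \<Phi>: "alternating_multilinear (2 * CARD('q) + 2 * CARD('q)) \<Phi>" and "0 \<le> M"
    and \<Phi>M: "\<And>us. length us = 2 * CARD('q) + 2 * CARD('q) \<Longrightarrow> norm (\<Phi> us) \<le> M * (\<Prod>i<2 * CARD('q) + 2 * CARD('q). norm (us ! i))"
    and F': "linear F'" "0 \<le> E" "\<And>v. norm (F' v) \<le> E * norm v"
    and F'2: "\<And>u w. norm (vsnd (F' (vjoin u w))) \<le> norm (u - w) + E * \<delta> * (norm u + norm w)"
    and Y: "linear Y" and "0 \<le> C" and XC: "\<And>v. norm (X v) \<le> C * norm v" and YC: "\<And>v. norm (Y v) \<le> C * norm v"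
    and XY: "\<And>v. \<exists>v'. norm (X v - Y v') \<le> C * \<delta> * norm v"
    and l: "1 \<le> cmod l" and \<delta>: "0 \<le> \<delta>" "cmod l * \<delta> \<le> K"
  shows "norm (\<Phi> (map (\<lambda>b. D (vjoin (X b) 0)) oriented_basis @ map (\<lambda>b. D (vjoin 0 (Y b))) oriented_basis))
    \<le> M * ((E * (2 * C + K * C) + K * (C + E * (2 * C + K * C))) ^ (2 * CARD('q)) * (2 * cmod l * (E * C)) ^ (2 * CARD('q)))"
proof -
  let ?bs = "oriented_basis :: (complex^'q) list"
  \<comment> \<open>A pointwise choice without linearity: only finitely many basis vectors are
    modified, and each modification need only lie in the image of \<open>Y\<close>.\<close>
  obtain \<nu> where \<nu>: "\<And>v. norm (X v - Y (\<nu> v)) \<le> C * \<delta> * norm v" using XY by metis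
  have K: "0 \<le> K" "\<delta> \<le> K"
  proof -
    have "1 * \<delta> \<le> cmod l * \<delta>" using l \<delta>(1) by (rule mult_right_mono)
    then show "\<delta> \<le> K" using \<delta>(2) by simp
    then show "0 \<le> K" using \<delta>(1) by simp
  qed
  have linD: "linear D"
  proof (rule linearI)
    have sm: "l *s (r *\<^sub>R x) = r *\<^sub>R (l *s x)" for r and x :: "complex^'n"
      by (simp add: scaleR_eq_smult vector_smult_assoc mult.commute)
    show "D (u + v) = D u + D v" for u v
      by (simp add: D_def linear_add[OF F'(1)] vfst_linear_simps vsnd_linear_simps vjoin_add
          bounded_bilinear.add_right[OF bounded_bilinear_smult])
    show "D (r *\<^sub>R v) = r *\<^sub>R D v" for r v
      by (simp add: D_def linear_cmul[OF F'(1)] vfst_linear_simps vsnd_linear_simps sm vjoin_scaleR)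
  qed
  have Dn: "norm (D v) \<le> norm (F' v) + cmod l * norm (vsnd (F' v))" for v
  proof -
    have "norm (D v) \<le> norm (vfst (F' v)) + norm (l *s vsnd (F' v))" unfolding D_def by (rule norm_vjoin_le)
    then show ?thesis using norm_vfst_le[of "F' v"] by (simp add: norm_smult_complex)
  qed
  \<comment> \<open>Bounds \<open>norm (X b) + norm (Y (\<nu> b))\<close> for a basis vector: twice
    \<open>C\<close> from \<open>X b\<close>, and the gap between the two, at most
    \<open>C * \<delta> \<le> K * C\<close>.\<close>
  define K1 where "K1 = 2 * C + K * C"
  have K1: "K1 \<ge> 0" using \<open>0 \<le> C\<close> K(1) by (simp add: K1_def)
  define \<alpha> where "\<alpha> b = D (vjoin (X b) 0)" for b
  define \<beta> where "\<beta> b = D (vjoin 0 (Y b))" for b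
  have lin\<beta>: "linear \<beta>"
  proof -
    have "linear (\<lambda>b. vjoin 0 (Y b) :: complex^('n + 'n))"
      using linear_compose[OF Y bounded_linear.linear[OF bounded_linear_vjoin_right]] by (simp add: comp_def)
    from linear_compose[OF this linD] show ?thesis unfolding \<beta>_def[abs_def] by (simp add: comp_def)
  qed
  \<comment> \<open>\<open>\<beta>\<close> is linear and the second block holds its values on all of
    \<open>Basis\<close>, so that block spans every possible modification.\<close>
  have sp: "\<beta> v \<in> span (set (map \<beta> ?bs))" for v
  proof -
    have "span (\<beta> ` Basis) = \<beta> ` span Basis" by (rule linear_span_image[OF lin\<beta>])
    then show ?thesis by (simp add: oriented_basis_properties(1))
  qed
  have len: "length ?bs = 2 * CARD('q)" by (rule oriented_basis_properties(2))
  have nb: "norm b = 1" if "b \<in> set ?bs" for b using that by (simp add: oriented_basis_properties(1))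
  have sum: "\<alpha> b + \<beta> (\<nu> b) = D (vjoin (X b) (Y (\<nu> b)))" for b
    unfolding \<alpha>_def \<beta>_def linear_add[OF linD, symmetric] by (simp flip: vjoin_add)
  have "\<Phi> (map \<alpha> ?bs @ map \<beta> ?bs) = \<Phi> (map (\<lambda>b. D (vjoin (X b) (Y (\<nu> b)))) ?bs @ map \<beta> ?bs)"
    using alternating_modify[OF \<Phi>, of "\<lambda>b. \<beta> (\<nu> b)" "map \<beta> ?bs" "[]" ?bs \<alpha>] sp len by (simp add: sum)
  also have "norm \<dots> \<le> M * (\<Prod>i<2 * CARD('q) + 2 * CARD('q). norm ((map (\<lambda>b. D (vjoin (X b) (Y (\<nu> b)))) ?bs @ map \<beta> ?bs) ! i))"
    by (rule \<Phi>M) (simp add: len)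
  also have "\<dots> \<le> M * ((E * K1 + K * (C + E * K1)) ^ (2 * CARD('q)) * (2 * cmod l * (E * C)) ^ (2 * CARD('q)))"
  proof (rule mult_left_mono[OF _ \<open>0 \<le> M\<close>])
    \<comment> \<open>The factor \<open>cmod l\<close> meets only the fibre part of a nearly
      diagonal vector, which is O(\<open>\<delta>\<close>); the product
      \<open>cmod l * \<delta> \<le> K\<close> does not depend on the dilation.\<close>
    have 1: "norm (D (vjoin (X b) (Y (\<nu> b)))) \<le> E * K1 + K * (C + E * K1)" if b: "b \<in> set ?bs" for b
    proof -
      have X1: "norm (X b) \<le> C" using XC[of b] nb[OF b] by simp
      have XY1: "norm (X b - Y (\<nu> b)) \<le> C * \<delta>" using \<nu>[of b] nb[OF b] by simp
      have "norm (Y (\<nu> b)) \<le> norm (X b) + norm (X b - Y (\<nu> b))"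
        using norm_triangle_ineq2[of "Y (\<nu> b)" "X b"] by (simp add: norm_minus_commute)
      also have "\<dots> \<le> C + C * K" using X1 XY1 mult_left_mono[OF K(2) \<open>0 \<le> C\<close>] by linarith
      finally have s: "norm (X b) + norm (Y (\<nu> b)) \<le> K1" using X1 by (simp add: K1_def mult.commute)
      have "norm (F' (vjoin (X b) (Y (\<nu> b)))) \<le> E * K1"
        using F'(3)[of "vjoin (X b) (Y (\<nu> b))"] order_trans[OF norm_vjoin_le s] F'(2)
        by (meson mult_left_mono order_trans)
      moreover have "cmod l * norm (vsnd (F' (vjoin (X b) (Y (\<nu> b))))) \<le> K * (C + E * K1)"
      proof -
        have "norm (vsnd (F' (vjoin (X b) (Y (\<nu> b))))) \<le> C * \<delta> + E * \<delta> * K1"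
          using F'2[of "X b" "Y (\<nu> b)"] XY1 mult_left_mono[OF s, of "E * \<delta>"] F'(2) \<delta>(1) by simp
        also have "\<dots> = \<delta> * (C + E * K1)" by (simp add: algebra_simps)
        finally have "cmod l * norm (vsnd (F' (vjoin (X b) (Y (\<nu> b))))) \<le> cmod l * (\<delta> * (C + E * K1))"
          by (rule mult_left_mono) simp
        also have "\<dots> \<le> K * (C + E * K1)"
          unfolding mult.assoc[symmetric] using \<delta>(2) \<open>0 \<le> C\<close> F'(2) K1 by (intro mult_right_mono) auto
        finally show ?thesis .
      qed
      ultimately show ?thesis using Dn[of "vjoin (X b) (Y (\<nu> b))"] by linarith
    qed
    have 2: "norm (\<beta> b) \<le> 2 * cmod l * (E * C)" if b: "b \<in> set ?bs" for b
    proof -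
      have "norm (vjoin 0 (Y b) :: complex^('n + 'n)) \<le> C" using norm_vjoin_le[of "0::complex^'n" "Y b"] YC[of b] nb[OF b] by simp
      then have f: "norm (F' (vjoin 0 (Y b))) \<le> E * C"
        using F'(3)[of "vjoin 0 (Y b)"] F'(2) by (meson mult_left_mono order_trans)
      then have "cmod l * norm (vsnd (F' (vjoin 0 (Y b)))) \<le> cmod l * (E * C)"
        using norm_vsnd_le[of "F' (vjoin 0 (Y b))"] by (intro mult_left_mono) auto
      moreover have "E * C \<le> cmod l * (E * C)" using mult_right_mono[OF l, of "E * C"] F'(2) \<open>0 \<le> C\<close> by simp
      ultimately show ?thesis using Dn[of "vjoin 0 (Y b)"] f unfolding \<beta>_def by linarith
    qed
    have nn: "0 \<le> E * K1 + K * (C + E * K1)" "0 \<le> 2 * cmod l * (E * C)" using F'(2) K1 K(1) \<open>0 \<le> C\<close> by auto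
    show "(\<Prod>i<2 * CARD('q) + 2 * CARD('q). norm ((map (\<lambda>b. D (vjoin (X b) (Y (\<nu> b)))) ?bs @ map \<beta> ?bs) ! i))
      \<le> (E * K1 + K * (C + E * K1)) ^ (2 * CARD('q)) * (2 * cmod l * (E * C)) ^ (2 * CARD('q))"
      using prod_norm_nth_append_le[of "map (\<lambda>b. D (vjoin (X b) (Y (\<nu> b)))) ?bs" "E * K1 + K * (C + E * K1)" "map \<beta> ?bs" "2 * cmod l * (E * C)"]
        1 2 nn len by auto
  qed
  finally show ?thesis by (simp add: \<alpha>_def[abs_def] \<beta>_def[abs_def] K1_def)
qed

text \<open>Here dilation, test form and lamination meet. The charts \<open>d\<close> and
  \<open>d'\<close> are arbitrary because the iterated plaque integrals evaluate the form in charts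
  chosen elsewhere; everything is first moved to \<open>c0\<close>. Distance and size are only
  bounded where the value is nonzero, since it is the support of \<open>\<Phi>\<close> that forces
  the two points together.\<close>

lemma local_bound:
  fixes A :: "('a, 'n::finite) chart set" and \<iota> :: "'q::finite \<Rightarrow> 'n"
  assumes A: "pre_manifold A" and H: "Hausdorff_space (atlas_topology A)"
    and L: "embedded_lamination A \<iota> \<Sigma> L" and Lip: "transversally_Lipschitz A \<iota> \<Sigma> L"
    and p: "p \<in> \<Sigma>" and b: "b \<in> L" "p \<in> box_set b" and c0: "c0 \<in> A" "p \<in> fst c0"
    and adm: "admissible_map A N \<tau>" and \<Phi>: "test_form (tangent_atlas A) (2 * CARD('q) + 2 * CARD('q)) \<Phi>"
  defines "\<Psi> \<equiv> \<lambda>l. form_pullback (prod_atlas A A) (tangent_atlas A) N (fibre_scale l \<circ> \<tau>) \<Phi>"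
  obtains W C where "openin (atlas_topology A) W" "p \<in> W" "W \<subseteq> fst c0" "W \<inter> \<Sigma> \<subseteq> box_set b"
    "W \<subseteq> fst b ` (polydisc \<times> transverse_polydisc \<iota>)" "(C::real) > 0"
    "\<And>l z s w t d d'. 1 \<le> cmod l \<Longrightarrow> z \<in> polydisc \<Longrightarrow> s \<in> snd b \<Longrightarrow> fst b (z, s) \<in> W \<Longrightarrow>
       w \<in> polydisc \<Longrightarrow> t \<in> snd b \<Longrightarrow> fst b (w, t) \<in> W \<Longrightarrow>
       d \<in> A \<Longrightarrow> fst b (z, s) \<in> fst d \<Longrightarrow> d' \<in> A \<Longrightarrow> fst b (w, t) \<in> fst d' \<Longrightarrow>
       \<Psi> l (prod_chart d d') (vjoin (plaque_coord d b s z) (plaque_coord d' b t w))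
         (map (\<lambda>u. vjoin u 0) (map (plaque_deriv d b s z) oriented_basis) @ map (\<lambda>u. vjoin 0 u) (map (plaque_deriv d' b t w) oriented_basis)) \<noteq> 0 \<Longrightarrow>
       norm (plaque_coord c0 b s z - plaque_coord c0 b t w) \<le> C / cmod l \<and>
       norm (\<Psi> l (prod_chart d d') (vjoin (plaque_coord d b s z) (plaque_coord d' b t w))
         (map (\<lambda>u. vjoin u 0) (map (plaque_deriv d b s z) oriented_basis) @ map (\<lambda>u. vjoin 0 u) (map (plaque_deriv d' b t w) oriented_basis)))
         \<le> C * cmod l ^ (2 * CARD('q))"
    "\<And>w w' t. t \<in> snd b \<Longrightarrow> w \<in> polydisc \<Longrightarrow> w' \<in> polydisc \<Longrightarrow> fst b (w, t) \<in> W \<Longrightarrow> fst b (w', t) \<in> W \<Longrightarrow>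
       norm (w - w') \<le> C * norm (plaque_coord c0 b t w - plaque_coord c0 b t w')"
proof -
  let ?k = "2 * CARD('q) + 2 * CARD('q)"
  let ?pc = "prod_chart c0 c0" and ?e = "tangent_chart A c0"
  have eb: "is_embedded_flow_box A \<iota> \<Sigma> b" using L b(1) unfolding embedded_lamination_def by blast
  have Ktr: "snd b \<subseteq> transverse_polydisc \<iota>" using eb by (simp add: is_embedded_flow_box_def is_flow_box_def)
  have pp: "pre_manifold (prod_atlas A A)" and pt: "pre_manifold (tangent_atlas A)"
    using pre_manifold_prod[OF A A] pre_manifold_tangent[OF A] by auto
  note cc0 = pre_manifoldD(1)[OF A c0(1)]
  have cpp: "is_chart ?pc" by (rule is_chart_prod[OF cc0 cc0])
  have cpe: "is_chart ?e" by (rule is_chart_tangent[OF A c0(1)])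
  have sf: "smooth_form (tangent_atlas A) ?k \<Phi>" using \<Phi> by (simp add: test_form_def)
  obtain R where R: "R > 0" "cball (snd c0 p) R \<subseteq> chart_image c0"
    using chart_image_open[OF cc0] c0(2) by (metis imageI open_contains_cball)
  obtain M where M: "0 < M" "\<And>\<xi> us. vfst \<xi> \<in> cball (snd c0 p) R \<Longrightarrow> \<Phi> ?e \<xi> us \<noteq> 0 \<Longrightarrow> norm (vsnd \<xi>) \<le> M"
    "\<And>\<xi> us. vfst \<xi> \<in> cball (snd c0 p) R \<Longrightarrow> length us = ?k \<Longrightarrow> norm (\<Phi> ?e \<xi> us) \<le> M * (\<Prod>i<?k. norm (us ! i))"
    using test_form_bound[OF A H \<Phi> c0(1) compact_cball R(2)] by metis
  define F where "F = coord_rep ?pc ?e \<tau>"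
  obtain \<rho> E where \<rho>: "0 < \<rho>" "0 < E"
    "vfst -` ball (snd c0 p) \<rho> \<inter> vsnd -` ball (snd c0 p) \<rho> \<subseteq> snd ?pc ` {q \<in> fst ?pc \<inter> N. \<tau> q \<in> fst ?e}"
    "\<And>z. z \<in> vfst -` ball (snd c0 p) \<rho> \<inter> vsnd -` ball (snd c0 p) \<rho> \<Longrightarrow> (F has_derivative frechet_derivative F (at z)) (at z)"
    "\<And>z v. z \<in> vfst -` ball (snd c0 p) \<rho> \<inter> vsnd -` ball (snd c0 p) \<rho> \<Longrightarrow> norm (frechet_derivative F (at z) v) \<le> E * norm v"
    "\<And>z u w. z \<in> vfst -` ball (snd c0 p) \<rho> \<inter> vsnd -` ball (snd c0 p) \<rho> \<Longrightarrow>
       norm (vsnd (frechet_derivative F (at z) (vjoin u w))) \<le> norm (u - w) + E * norm (vfst z - vsnd z) * (norm u + norm w)"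
    "\<And>z. z \<in> vfst -` ball (snd c0 p) \<rho> \<inter> vsnd -` ball (snd c0 p) \<rho> \<Longrightarrow> norm (vfst z - vsnd z) \<le> 2 * norm (vsnd (F z))"
    "\<And>z. z \<in> vfst -` ball (snd c0 p) \<rho> \<inter> vsnd -` ball (snd c0 p) \<rho> \<Longrightarrow> vfst (F z) \<in> ball (snd c0 p) R"
    by (rule admissible_map_local[OF A adm c0 R(1), folded F_def], rule that,
        assumption, assumption, assumption, assumption, assumption, assumption, assumption, assumption)
  obtain W1 C1 where W1: "openin (atlas_topology A) W1" "p \<in> W1" "W1 \<subseteq> fst c0" "W1 \<inter> \<Sigma> \<subseteq> box_set b"
    "W1 \<subseteq> fst b ` (polydisc \<times> transverse_polydisc \<iota>)" and C1: "(C1::real) > 0"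
    "\<And>z s v. z \<in> polydisc \<Longrightarrow> s \<in> snd b \<Longrightarrow> fst b (z, s) \<in> W1 \<Longrightarrow>
       norm (frechet_derivative (plaque_coord c0 b s) (at z) v) \<le> C1 * norm v"
    "\<And>z s w t v. z \<in> polydisc \<Longrightarrow> s \<in> snd b \<Longrightarrow> fst b (z, s) \<in> W1 \<Longrightarrow>
       w \<in> polydisc \<Longrightarrow> t \<in> snd b \<Longrightarrow> fst b (w, t) \<in> W1 \<Longrightarrow>
       \<exists>v'. norm (frechet_derivative (plaque_coord c0 b s) (at z) v - frechet_derivative (plaque_coord c0 b t) (at w) v')
         \<le> C1 * norm (plaque_coord c0 b s z - plaque_coord c0 b t w) * norm v"
    "\<And>w w' t. t \<in> snd b \<Longrightarrow> w \<in> polydisc \<Longrightarrow> w' \<in> polydisc \<Longrightarrow> fst b (w, t) \<in> W1 \<Longrightarrow> fst b (w', t) \<in> W1 \<Longrightarrow>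
       norm (w - w') \<le> C1 * norm (plaque_coord c0 b t w - plaque_coord c0 b t w')"
    by (rule lamination_local[OF A L Lip p b c0], rule that,
        assumption, assumption, assumption, assumption, assumption, assumption, assumption, assumption, assumption)
  define W where "W = W1 \<inter> (fst c0 \<inter> snd c0 -` ball (snd c0 p) \<rho>)"
  have oW: "openin (atlas_topology A) W"
    unfolding W_def by (rule openin_Int[OF W1(1) openin_atlas_basic[OF c0(1) open_ball]])
  have pW: "p \<in> W" using W1(2) c0(2) \<rho>(1) by (simp add: W_def)
  \<comment> \<open>On the support the dilated fibre coordinate is at most \<open>M\<close>, and the
    distance of the two points is at most twice the undilated one. \<open>C2\<close> below is the
    bound of \<open>tangent_form_estimate\<close> with the power of \<open>cmod l\<close> taken
    out.\<close>
  define K where "K = 2 * M"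
  define C2 where "C2 = M * ((E * (2 * C1 + K * C1) + K * (C1 + E * (2 * C1 + K * C1))) ^ (2 * CARD('q)) * (2 * (E * C1)) ^ (2 * CARD('q)))"
  have K0: "0 < K" using M(1) by (simp add: K_def)
  have C2: "0 \<le> C2" using M(1) \<rho>(2) C1(1) K0 by (simp add: C2_def)
  define C where "C = K + C1 + C2"
  have C: "0 < C" "K \<le> C" "C1 \<le> C" "C2 \<le> C" using K0 C1(1) C2 by (auto simp: C_def)
  note sd = smooth_mapD[OF pp pt admissible_mapD(1)[OF adm] admissible_mapD(5)[OF adm] prod_chart_in[OF c0(1) c0(1)] tangent_chart_in[OF c0(1)]]
  have main: "norm (plaque_coord c0 b s z - plaque_coord c0 b t w) \<le> C / cmod l \<and>
       norm (\<Psi> l (prod_chart d d') (vjoin (plaque_coord d b s z) (plaque_coord d' b t w))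
         (map (\<lambda>u. vjoin u 0) (map (plaque_deriv d b s z) oriented_basis) @ map (\<lambda>u. vjoin 0 u) (map (plaque_deriv d' b t w) oriented_basis)))
         \<le> C * cmod l ^ (2 * CARD('q))"
    if l: "1 \<le> cmod l" and zs: "z \<in> polydisc" "s \<in> snd b" "fst b (z, s) \<in> W"
      and wt: "w \<in> polydisc" "t \<in> snd b" "fst b (w, t) \<in> W"
      and d: "d \<in> A" "fst b (z, s) \<in> fst d" and d': "d' \<in> A" "fst b (w, t) \<in> fst d'"
      and nz: "\<Psi> l (prod_chart d d') (vjoin (plaque_coord d b s z) (plaque_coord d' b t w))
         (map (\<lambda>u. vjoin u 0) (map (plaque_deriv d b s z) oriented_basis) @ map (\<lambda>u. vjoin 0 u) (map (plaque_deriv d' b t w) oriented_basis)) \<noteq> 0"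
    for l z s w t d d'
  proof -
    define x y where "x = fst b (z, s)" and "y = fst b (w, t)"
    have xy: "x \<in> W1" "y \<in> W1" "x \<in> fst c0" "y \<in> fst c0" "snd c0 x \<in> ball (snd c0 p) \<rho>" "snd c0 y \<in> ball (snd c0 p) \<rho>"
      using zs(3) wt(3) by (auto simp: W_def x_def y_def)
    define \<xi> where "\<xi> = vjoin (snd c0 x) (snd c0 y)"
    have \<xi>: "\<xi> \<in> vfst -` ball (snd c0 p) \<rho> \<inter> vsnd -` ball (snd c0 p) \<rho>" using xy by (simp add: \<xi>_def)
    have \<xi>pc: "\<xi> = snd ?pc (x, y)" by (simp add: \<xi>_def)
    have xyc: "(x, y) \<in> fst ?pc" using xy by simp
    have xyN: "(x, y) \<in> N" "\<tau> (x, y) \<in> fst ?e"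
    proof -
      have "snd ?pc (x, y) \<in> snd ?pc ` {q \<in> fst ?pc \<inter> N. \<tau> q \<in> fst ?e}" using \<rho>(3) \<xi> unfolding \<xi>pc by blast
      then have "(x, y) \<in> {q \<in> fst ?pc \<inter> N. \<tau> q \<in> fst ?e}"
        using chart_image_mem_iff[OF cpp xyc, of "{q \<in> fst ?pc \<inter> N. \<tau> q \<in> fst ?e}"] by blast
      then show "(x, y) \<in> N" "\<tau> (x, y) \<in> fst ?e" by auto
    qed
    let ?G = "fibre_scale l \<circ> \<tau>"
    let ?F' = "frechet_derivative F (at \<xi>)"
    define D where "D v = vjoin (vfst (?F' v)) (l *s vsnd (?F' v))" for v
    have G_eq: "vjoin (vfst (F \<zeta>)) (l *s vsnd (F \<zeta>)) = coord_rep ?pc ?e ?G \<zeta>"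
      if \<zeta>: "\<zeta> \<in> snd ?pc ` {q \<in> fst ?pc \<inter> N. \<tau> q \<in> fst ?e}" for \<zeta>
    proof -
      obtain q where q: "\<zeta> = snd ?pc q" "q \<in> fst ?pc" using \<zeta> by blast
      show ?thesis
        unfolding q(1) F_def coord_rep_chart[OF cpp q(2)] by (simp add: snd_tangent_chart fibre_scale_def)
    qed
    have FD: "((\<lambda>\<zeta>. vjoin (vfst (F \<zeta>)) (l *s vsnd (F \<zeta>))) has_derivative D) (at \<xi>)"
      unfolding D_def[abs_def]
      by (rule has_derivative_vjoin[OF bounded_linear.has_derivative[OF bounded_linear_vfst \<rho>(4)[OF \<xi>]]
            bounded_linear.has_derivative[OF bounded_linear_smult bounded_linear.has_derivative[OF bounded_linear_vsnd \<rho>(4)[OF \<xi>]]]])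
    have GD: "(coord_rep ?pc ?e ?G has_derivative D) (at (snd ?pc (x, y)))"
      unfolding \<xi>pc[symmetric]
      by (rule has_derivative_transform_within_open[OF FD sd(2)]) (use \<rho>(3) \<xi> G_eq in blast)+
    have Ge: "?G (x, y) \<in> fst ?e" using fibre_scale_chart(1)[OF A xyN(2)] by simp
    have sub: "snd ?pc ` {q \<in> fst ?pc \<inter> N. \<tau> q \<in> fst ?e} \<subseteq> snd ?pc ` {q \<in> fst ?pc. ?G q \<in> fst ?e}"
      by (rule image_mono) (auto intro: fibre_scale_chart(1)[OF A])
    define X where "X = frechet_derivative (plaque_coord c0 b s) (at z)"
    define Y where "Y = frechet_derivative (plaque_coord c0 b t) (at w)"
    let ?vs = "map (\<lambda>u. vjoin u 0) (map (plaque_deriv d b s z) oriented_basis) @ map (\<lambda>u. vjoin 0 u) (map (plaque_deriv d' b t w) oriented_basis)"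
    let ?ws = "map (\<lambda>b. D (vjoin (X b) 0)) oriented_basis @ map (\<lambda>b. D (vjoin 0 (Y b))) oriented_basis"
    have xd: "x \<in> fst d \<inter> fst c0" "y \<in> fst d' \<inter> fst c0" using d d' xy by (auto simp: x_def y_def)
    have tr: "transition_deriv (prod_chart d d') ?pc (x, y) (vjoin u v) = vjoin (transition_deriv d c0 x u) (transition_deriv d' c0 y v)" for u v
      using fun_cong[OF frechet_derivative_at[OF prod_transition(3)[OF pre_manifoldD(1)[OF A d(1)] pre_manifoldD(1)[OF A d'(1)]
            pre_manifoldD(2)[OF A d(1) c0(1)] pre_manifoldD(2)[OF A d'(1) c0(1)] xd]], of "vjoin u v"]
      by (simp only: vfst_vjoin vsnd_vjoin)
    have tr0: "transition_deriv d c0 x 0 = 0" "transition_deriv d' c0 y 0 = 0"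
      using linear_0[OF transition_has_derivative(3)[OF pre_manifoldD(2)[OF A d(1) c0(1)]]]
        linear_0[OF transition_has_derivative(3)[OF pre_manifoldD(2)[OF A d'(1) c0(1)]]] xd by blast+
    have trX: "transition_deriv d c0 x (plaque_deriv d b s z v) = X v" for v
      unfolding x_def X_def
      by (rule plaque_deriv_change[OF A eb _ c0(1) d(1) zs(1) _ d(2)]) (use zs(2) Ktr xy(3) in \<open>auto simp: x_def\<close>)
    have trY: "transition_deriv d' c0 y (plaque_deriv d' b t w v) = Y v" for v
      unfolding y_def Y_def
      by (rule plaque_deriv_change[OF A eb _ c0(1) d'(1) wt(1) _ d'(2)]) (use wt(2) Ktr xy(4) in \<open>auto simp: y_def\<close>)
    have e1: "vjoin (plaque_coord d b s z) (plaque_coord d' b t w) = snd (prod_chart d d') (x, y)" by (simp add: x_def y_def)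
    have v_eq: "\<Psi> l (prod_chart d d') (vjoin (plaque_coord d b s z) (plaque_coord d' b t w)) ?vs = \<Phi> ?e (snd ?e (?G (x, y))) ?ws"
    proof -
      have xydd: "(x, y) \<in> fst (prod_chart d d')" using xd by simp
      have "\<xi> \<in> snd ?pc ` {q \<in> fst ?pc \<inter> N. \<tau> q \<in> fst ?e}" using \<rho>(3) \<xi> by blast
      then have "\<Psi> l (prod_chart d d') (snd (prod_chart d d') (x, y)) ?vs =
        \<Phi> ?e (snd ?e (?G (x, y))) (map (\<lambda>u. D (transition_deriv (prod_chart d d') ?pc (x, y) u)) ?vs)"
        unfolding \<Psi>_def \<xi>pc
        by (rule form_pullback_coord[OF pp pt sf prod_chart_in[OF d(1) d'(1)] prod_chart_in[OF c0(1) c0(1)] xydd xyc xyN(1)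
              tangent_chart_in[OF c0(1)] Ge sd(2) _ sub GD])
      also have "map (\<lambda>u. D (transition_deriv (prod_chart d d') ?pc (x, y) u)) ?vs = ?ws"
        by (simp only: map_append map_map comp_def tr tr0 trX trY)
      finally show ?thesis unfolding e1 .
    qed
    define \<eta> where "\<eta> = vjoin (vfst (F \<xi>)) (l *s vsnd (F \<xi>))"
    have \<eta>: "snd ?e (?G (x, y)) = \<eta>"
      using G_eq[OF subsetD[OF \<rho>(3) \<xi>]] coord_rep_chart[OF cpp xyc, of ?e ?G] unfolding \<eta>_def \<xi>pc[symmetric] by simp
    have nz2: "\<Phi> ?e \<eta> ?ws \<noteq> 0" using nz unfolding v_eq \<eta> .
    have \<eta>R: "vfst \<eta> \<in> cball (snd c0 p) R" using \<rho>(8)[OF \<xi>] by (simp add: \<eta>_def)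
    \<comment> \<open>The value being nonzero places \<open>\<eta>\<close> where the fibre
      coordinate of \<open>\<Phi>\<close> is bounded by \<open>M\<close>.\<close>
    have lF: "cmod l * norm (vsnd (F \<xi>)) \<le> M" using M(2)[OF \<eta>R nz2] by (simp add: \<eta>_def norm_smult_complex)
    define \<delta> where "\<delta> = norm (snd c0 x - snd c0 y)"
    have l\<delta>: "cmod l * \<delta> \<le> K"
    proof -
      have "\<delta> \<le> 2 * norm (vsnd (F \<xi>))" using \<rho>(7)[OF \<xi>] by (simp add: \<xi>_def \<delta>_def)
      then have "cmod l * \<delta> \<le> cmod l * (2 * norm (vsnd (F \<xi>)))" by (rule mult_left_mono) simp
      then show ?thesis using lF by (simp add: K_def)
    qed
    have first: "\<delta> \<le> C / cmod l"
    proof -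
      have l0: "0 < cmod l" using l by linarith
      have "\<delta> \<le> K / cmod l" using l\<delta> l0 by (simp add: field_simps)
      also have "\<dots> \<le> C / cmod l" using C(2) l0 by (simp add: divide_right_mono)
      finally show ?thesis .
    qed
    have \<eta>im: "\<eta> \<in> chart_image ?e" unfolding \<eta>[symmetric] by (rule imageI[OF Ge])
    have tc: "s \<in> transverse_polydisc \<iota>" "t \<in> transverse_polydisc \<iota>" using zs(2) wt(2) Ktr by auto
    have "norm (\<Phi> ?e \<eta> ?ws) \<le> M * ((E * (2 * C1 + K * C1) + K * (C1 + E * (2 * C1 + K * C1))) ^ (2 * CARD('q)) * (2 * cmod l * (E * C1)) ^ (2 * CARD('q)))"
      unfolding D_def
    proof (rule tangent_form_estimate[where \<delta>=\<delta>])
      show "alternating_multilinear ?k (\<Phi> ?e \<eta>)" by (rule smooth_formD(2)[OF sf tangent_chart_in[OF c0(1)] \<eta>im])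
      show "norm (\<Phi> ?e \<eta> us) \<le> M * (\<Prod>i<?k. norm (us ! i))" if "length us = ?k" for us by (rule M(3)[OF \<eta>R that])
      show "linear ?F'" by (rule has_derivative_linear[OF \<rho>(4)[OF \<xi>]])
      show "norm (?F' v) \<le> E * norm v" for v by (rule \<rho>(5)[OF \<xi>])
      show "norm (vsnd (?F' (vjoin u w))) \<le> norm (u - w) + E * \<delta> * (norm u + norm w)" for u w
        using \<rho>(6)[OF \<xi>, of u w] by (simp add: \<xi>_def \<delta>_def)
      show "linear Y" unfolding Y_def
        by (rule has_derivative_linear[OF complex_differentiable_onD(1)[OF plaque_holomorphic(2)[OF A eb tc(2) c0(1)]]])
          (use wt(1) xy(4) in \<open>simp add: y_def\<close>)
      show "norm (X v) \<le> C1 * norm v" for v unfolding X_def using C1(2)[OF zs(1,2)] xy(1) by (simp add: x_def)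
      show "norm (Y v) \<le> C1 * norm v" for v unfolding Y_def using C1(2)[OF wt(1,2)] xy(2) by (simp add: y_def)
      show "\<exists>v'. norm (X v - Y v') \<le> C1 * \<delta> * norm v" for v
        unfolding X_def Y_def \<delta>_def x_def y_def using C1(3)[OF zs(1,2) _ wt(1,2)] xy(1,2) by (simp add: x_def y_def)
    qed (use M(1) \<rho>(2) C1(1) l l\<delta> in \<open>auto simp: \<delta>_def\<close>)
    also have "\<dots> = C2 * cmod l ^ (2 * CARD('q))"
      by (simp add: C2_def power_mult_distrib mult_ac)
    also have "\<dots> \<le> C * cmod l ^ (2 * CARD('q))" using C(4) by (intro mult_right_mono) auto
    finally show ?thesis unfolding v_eq \<eta> using first by (simp add: \<delta>_def x_def y_def)
  qed
  show thesis
  proof (rule that[OF oW pW _ _ _ C(1)])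
    show "W \<subseteq> fst c0" "W \<inter> \<Sigma> \<subseteq> box_set b" "W \<subseteq> fst b ` (polydisc \<times> transverse_polydisc \<iota>)"
      using W1(3-5) by (auto simp: W_def)
  next
    fix w w' :: "complex^'q" and t assume wt: "t \<in> snd b" "w \<in> polydisc" "w' \<in> polydisc" "fst b (w, t) \<in> W" "fst b (w', t) \<in> W"
    have "norm (w - w') \<le> C1 * norm (plaque_coord c0 b t w - plaque_coord c0 b t w')"
      by (rule C1(4)) (use wt in \<open>auto simp: W_def\<close>)
    also have "\<dots> \<le> C * norm (plaque_coord c0 b t w - plaque_coord c0 b t w')"
      using C(3) by (rule mult_right_mono) simp
    finally show "norm (w - w') \<le> C * norm (plaque_coord c0 b t w - plaque_coord c0 b t w')" .
  qed (rule main)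
qed

section \<open>Localization of currents\<close>

definition form_mult :: "('a \<Rightarrow> real) \<Rightarrow> ('a, 'm::finite) mform \<Rightarrow> ('a, 'm) mform" where
  "form_mult \<psi> \<alpha> = (\<lambda>c x us. complex_of_real (\<psi> (chart_inv c x)) * \<alpha> c x us)"

lemma smooth_form_mult:
  assumes A: "pre_manifold A" and \<psi>: "smooth_function A \<psi>" and \<alpha>: "smooth_form A k \<alpha>"
  shows "smooth_form A k (form_mult \<psi> \<alpha>)"
  unfolding smooth_form_def
proof (intro conjI allI impI ballI)
  show "form_mult \<psi> \<alpha> c x us = 0" if "\<not> (c \<in> A \<and> x \<in> chart_image c)" for c x us
    using smooth_formD(1)[OF \<alpha> that] by (simp add: form_mult_def)
  show "alternating_multilinear k (form_mult \<psi> \<alpha> c x)" if cx: "c \<in> A" "x \<in> chart_image c" for c x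
    unfolding alternating_multilinear_def
  proof (intro conjI allI impI)
    note alt = smooth_formD(2)[OF \<alpha> cx]
    show "form_mult \<psi> \<alpha> c x us = 0" if "length us \<noteq> k" for us
      using alternating_multilinearD(1)[OF alt that] by (simp add: form_mult_def)
    show "form_mult \<psi> \<alpha> c x us = 0" if "length us = k \<and> \<not> distinct us" for us
      using alternating_multilinearD(3)[OF alt] that by (simp add: form_mult_def)
    show "linear (\<lambda>v. form_mult \<psi> \<alpha> c x (us[i := v]))" if "length us = k \<and> i < k" for us i
      using linear_compose_scale_right[OF alternating_multilinearD(2)[OF alt, of us i], of "\<psi> (chart_inv c x)"] that
      by (simp add: form_mult_def scaleR_conv_of_real)
  qed
  show "smooth_on (chart_image c) (\<lambda>x. form_mult \<psi> \<alpha> c x us)" if c: "c \<in> A" for c us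
  proof -
    have "smooth_on (chart_image c) (\<lambda>x. \<psi> (chart_inv c x) *\<^sub>R \<alpha> c x us)"
      by (rule smooth_on_bilinear[OF bounded_bilinear_scaleR chart_image_open[OF pre_manifoldD(1)[OF A c]] _ smooth_formD(3)[OF \<alpha> c]])
        (use \<psi> c in \<open>unfold smooth_function_def, blast\<close>)
    then show ?thesis by (simp add: form_mult_def scaleR_conv_of_real)
  qed
  show "form_mult \<psi> \<alpha> c (snd c p) us = form_mult \<psi> \<alpha> d (snd d p) (map (transition_deriv c d p) us)"
    if "c \<in> A" "d \<in> A" "p \<in> fst c \<inter> fst d" for c d p us
  proof -
    have p: "p \<in> fst c" "p \<in> fst d" using that(3) by auto
    show ?thesis
      unfolding form_mult_def chart_inv_chart[OF pre_manifoldD(1)[OF A that(1)] p(1)] chart_inv_chart[OF pre_manifoldD(1)[OF A that(2)] p(2)]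
      by (simp only: smooth_formD(4)[OF \<alpha> that(1,2) p])
  qed
qed

lemma smooth_form_imp_test_form:
  "compact_space (atlas_topology A) \<Longrightarrow> smooth_form A k \<alpha> \<Longrightarrow> test_form A k \<alpha>"
  unfolding test_form_def form_support_def by (simp add: closedin_compact_space)

lemma form_mult_support:
  assumes A: "pre_manifold A" and Z: "closedin (atlas_topology A) Z" "\<And>x. x \<in> points A \<Longrightarrow> x \<notin> Z \<Longrightarrow> \<psi> x = 0"
  shows "form_support A (form_mult \<psi> \<alpha>) \<subseteq> Z"
proof (rule form_support_subset[OF Z(1)])
  fix c p us assume cp: "c \<in> A" "p \<in> fst c" "form_mult \<psi> \<alpha> c (snd c p) us \<noteq> 0"
  then have "\<psi> p \<noteq> 0" unfolding form_mult_def chart_inv_chart[OF pre_manifoldD(1)[OF A cp(1)] cp(2)] by auto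
  moreover have "p \<in> points A" using chart_subset_points[OF cp(1)] cp(2) by blast
  ultimately show "p \<in> Z" using Z(2) by blast
qed

lemma smooth_function_sum:
  assumes A: "pre_manifold A" and "\<And>p. p \<in> F \<Longrightarrow> smooth_function A (\<psi> p)"
  shows "smooth_function A (\<lambda>x. \<Sum>p\<in>F. \<psi> p x)"
  unfolding smooth_function_def
proof
  fix c assume c: "c \<in> A"
  show "smooth_on (chart_image c) (\<lambda>x. \<Sum>p\<in>F. \<psi> p (chart_inv c x))"
    by (rule smooth_on_sum[OF chart_image_open[OF pre_manifoldD(1)[OF A c]]])
      (use assms(2) c in \<open>unfold smooth_function_def, blast\<close>)
qed

lemma current_partition:
  assumes A: "pre_manifold A" and K: "compact_space (atlas_topology A)" and T: "is_current A k T" and \<alpha>: "test_form A k \<alpha>"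
    and F: "finite F" "\<And>p. p \<in> F \<Longrightarrow> smooth_function A (\<psi> p)"
  shows "T (form_mult (\<lambda>x. \<Sum>p\<in>F. \<psi> p x) \<alpha>) = (\<Sum>p\<in>F. T (form_mult (\<psi> p) \<alpha>))"
  using F
proof (induction F)
  have lin: "T (\<lambda>c x us. a * \<beta> c x us + b * \<gamma> c x us) = a * T \<beta> + b * T \<gamma>" if "test_form A k \<beta>" "test_form A k \<gamma>" for \<beta> \<gamma> a b
    using T that unfolding is_current_def by blast
  have sf: "smooth_form A k \<alpha>" using \<alpha> by (simp add: test_form_def)
  have tf: "test_form A k (form_mult \<psi> \<alpha>)" if "smooth_function A \<psi>" for \<psi>
    by (rule smooth_form_imp_test_form[OF K smooth_form_mult[OF A that sf]])
  {
    case empty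
    \<comment> \<open>The zero form is the combination of \<open>\<alpha>\<close> with itself with
      coefficients 0, so the current vanishes on it.\<close>
    show ?case using lin[OF \<alpha> \<alpha>, of 0 0] by (simp add: form_mult_def)
  next
    case (insert p F)
    have s: "smooth_function A (\<lambda>x. \<Sum>p\<in>F. \<psi> p x)" by (rule smooth_function_sum[OF A]) (use insert.prems in blast)
    have "form_mult (\<lambda>x. \<Sum>p\<in>insert p F. \<psi> p x) \<alpha> = (\<lambda>c x us. 1 * form_mult (\<psi> p) \<alpha> c x us + 1 * form_mult (\<lambda>x. \<Sum>p\<in>F. \<psi> p x) \<alpha> c x us)"
      using insert.hyps by (simp add: form_mult_def fun_eq_iff distrib_right)
    then have "T (form_mult (\<lambda>x. \<Sum>p\<in>insert p F. \<psi> p x) \<alpha>) = T (form_mult (\<psi> p) \<alpha>) + T (form_mult (\<lambda>x. \<Sum>p\<in>F. \<psi> p x) \<alpha>)"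
      using lin[OF tf[of "\<psi> p"] tf[OF s], of 1 1] insert.prems by simp
    then show ?case using insert by simp
  }
qed

lemma form_mult_one:
  assumes \<alpha>: "smooth_form A k \<alpha>" and \<psi>: "\<And>x. x \<in> points A \<Longrightarrow> \<psi> x = 1"
  shows "form_mult \<psi> \<alpha> = \<alpha>"
proof (intro ext)
  fix c x us
  show "form_mult \<psi> \<alpha> c x us = \<alpha> c x us"
  proof (cases "c \<in> A \<and> x \<in> chart_image c")
    case True
    then have "chart_inv c x \<in> points A" using chart_inv_in[of x c] chart_subset_points[of c A] by blast
    then show ?thesis using \<psi> by (simp add: form_mult_def)
  next
    case False
    then show ?thesis using smooth_formD(1)[OF \<alpha> False] by (simp add: form_mult_def)
  qed
qed

text \<open>The form in the first variable that remains after the second current has been applied.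
  As a form of its own it can be multiplied by cut-offs.\<close>

definition tensor_inner :: "('a, 'n::finite) chart set \<Rightarrow> ('a, 'n) current \<Rightarrow> ('a \<times> 'a, 'n + 'n) mform \<Rightarrow> ('a, 'n) mform" where
  "tensor_inner A T \<Phi> = (\<lambda>c x us. if c \<in> A then
       T (\<lambda>d y ws. if d \<in> A then
         \<Phi> (prod_chart c d) (vjoin x y)
            (map (\<lambda>u. vjoin u 0) us @ map (\<lambda>w. vjoin 0 w) ws) else 0) else 0)"

lemma current_tensor_eq: "current_tensor A A T T \<Phi> = T (tensor_inner A T \<Phi>)"
  by (simp only: current_tensor_def tensor_inner_def)

section \<open>Integral estimates\<close>

text \<open>Holds for arbitrary \<open>f\<close> because the integral of a non-integrable function
  is 0; only the set \<open>S\<close> has to be measurable.\<close>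

lemma norm_integral_le_measure:
  fixes f :: "'x \<Rightarrow> 'w::{banach, second_countable_topology}"
  assumes S: "S \<in> sets M" "emeasure M S < \<infinity>" and "0 \<le> B"
    and f: "\<And>x. x \<in> space M \<Longrightarrow> f x \<noteq> 0 \<Longrightarrow> x \<in> S \<and> norm (f x) \<le> B"
  shows "norm (integral\<^sup>L M f) \<le> B * measure M S"
proof (cases "integrable M f")
  case True
  have i: "integrable M (\<lambda>x. indicator S x *\<^sub>R B)" using S by simp
  have "norm (integral\<^sup>L M f) \<le> (LINT x|M. norm (f x))" by (rule integral_norm_bound)
  also have "\<dots> \<le> (LINT x|M. indicator S x *\<^sub>R B)"
  proof (rule integral_mono[OF integrable_norm[OF True] i])
    fix x assume "x \<in> space M"
    then show "norm (f x) \<le> indicator S x *\<^sub>R B"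
      using f[of x] \<open>0 \<le> B\<close> by (cases "f x = 0") (auto simp: indicator_def)
  qed
  also have "\<dots> = B * measure M S" using S by (simp add: mult.commute)
  finally show ?thesis .
next
  case False
  then show ?thesis using \<open>0 \<le> B\<close> by (simp add: not_integrable_integral_eq)
qed

text \<open>Around each point the measure of shrinking balls tends to that of the point, which is 0;
  a Lebesgue number of the resulting cover of \<open>K'\<close> makes the radius uniform.
  Intersection with the compact set \<open>K'\<close> keeps the measures finite.\<close>

lemma diffuse_uniformly_small:
  fixes m :: "(complex^'n::finite) measure"
  assumes m: "sets m = sets (restrict_space borel K)" and K': "compact K'" "K' \<subseteq> K" "emeasure m K' < \<infinity>"
    and d: "\<And>t. t \<in> K \<Longrightarrow> emeasure m {t} = 0" and \<delta>: "0 < \<delta>"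
  obtains \<epsilon> where "0 < \<epsilon>" "\<And>s. s \<in> K' \<Longrightarrow> K' \<inter> ball s \<epsilon> \<in> sets m \<and> emeasure m (K' \<inter> ball s \<epsilon>) < \<infinity> \<and> measure m (K' \<inter> ball s \<epsilon>) \<le> \<delta>"
proof -
  have sets: "K' \<inter> S \<in> sets m" if "S \<in> sets borel" for S
  proof -
    have "K' \<in> sets borel" using K'(1) by (simp add: borel_compact)
    then have "K \<inter> (K' \<inter> S) \<in> sets (restrict_space borel K)" using that unfolding sets_restrict_space by blast
    moreover have "K \<inter> (K' \<inter> S) = K' \<inter> S" using K'(2) by blast
    ultimately show ?thesis using m by simp
  qed
  have K's: "K' \<in> sets m" using sets[of UNIV] by simp
  have fin: "emeasure m (K' \<inter> S) < \<infinity>" if "S \<in> sets borel" for S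
  proof -
    have "emeasure m (K' \<inter> S) \<le> emeasure m K'" by (rule emeasure_mono) (use K's in auto)
    then show ?thesis using K'(3) by (rule le_less_trans)
  qed
  have "\<exists>r>0. emeasure m (K' \<inter> ball s r) < ennreal \<delta>" if s: "s \<in> K'" for s
  proof -
    have "(\<lambda>n. emeasure m (K' \<inter> ball s (inverse (real (Suc n))))) \<longlonglongrightarrow> emeasure m (\<Inter>n. K' \<inter> ball s (inverse (real (Suc n))))"
    proof (rule Lim_emeasure_decseq)
      show "range (\<lambda>n. K' \<inter> ball s (inverse (real (Suc n)))) \<subseteq> sets m" using sets by auto
      show "decseq (\<lambda>n. K' \<inter> ball s (inverse (real (Suc n))))"
      proof (rule decseq_SucI)
        fix n
        have "inverse (real (Suc (Suc n))) \<le> inverse (real (Suc n))" by (rule le_imp_inverse_le) auto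
        then show "K' \<inter> ball s (inverse (real (Suc (Suc n)))) \<subseteq> K' \<inter> ball s (inverse (real (Suc n)))"
          using subset_ball by blast
      qed
      show "emeasure m (K' \<inter> ball s (inverse (real (Suc i)))) \<noteq> \<infinity>" for i using fin[of "ball s (inverse (real (Suc i)))"] by simp
    qed
    also have "(\<Inter>n. K' \<inter> ball s (inverse (real (Suc n)))) = {s}"
    proof
      show "(\<Inter>n. K' \<inter> ball s (inverse (real (Suc n)))) \<subseteq> {s}"
      proof
        fix t assume t: "t \<in> (\<Inter>n. K' \<inter> ball s (inverse (real (Suc n))))"
        have "dist s t \<le> 0"
        proof (rule ccontr)
          assume "\<not> dist s t \<le> 0"
          then obtain n where "inverse (real (Suc n)) < dist s t" using reals_Archimedean[of "dist s t"] by auto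
          moreover have "t \<in> ball s (inverse (real (Suc n)))" using t by blast
          ultimately show False by simp
        qed
        then show "t \<in> {s}" by simp
      qed
    qed (use s in auto)
    finally have "(\<lambda>n. emeasure m (K' \<inter> ball s (inverse (real (Suc n))))) \<longlonglongrightarrow> 0" using d s K'(2) by auto
    then have "\<forall>\<^sub>F n in sequentially. emeasure m (K' \<inter> ball s (inverse (real (Suc n)))) < ennreal \<delta>"
      by (rule order_tendstoD) (use \<delta> in simp)
    then obtain n where "emeasure m (K' \<inter> ball s (inverse (real (Suc n)))) < ennreal \<delta>"
      unfolding eventually_sequentially by blast
    then show ?thesis by (intro exI[of _ "inverse (real (Suc n))"]) simp
  qed
  then obtain r where r: "\<And>s. s \<in> K' \<Longrightarrow> 0 < r s" "\<And>s. s \<in> K' \<Longrightarrow> emeasure m (K' \<inter> ball s (r s)) < ennreal \<delta>" by metis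
  \<comment> \<open>A Lebesgue number: every ball of radius \<open>e\<close> centred in
    \<open>K'\<close> lies in one of the balls of small measure.\<close>
  have "\<exists>e>0. \<forall>x\<in>K'. \<exists>G\<in>(\<lambda>s. ball s (r s)) ` K'. ball x e \<subseteq> G"
  proof -
    have c: "K' \<subseteq> \<Union>((\<lambda>s. ball s (r s)) ` K')" using r(1) by force
    show ?thesis
      by (rule Heine_Borel_lemma[OF K'(1) c]) auto
  qed
  then obtain e where e: "e > 0" "\<And>x. x \<in> K' \<Longrightarrow> \<exists>s\<in>K'. ball x e \<subseteq> ball s (r s)" by auto
  show thesis
  proof (rule that[OF e(1)], intro conjI)
    fix x assume x: "x \<in> K'"
    obtain s where s: "s \<in> K'" "ball x e \<subseteq> ball s (r s)" using e(2)[OF x] by blast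
    show "K' \<inter> ball x e \<in> sets m" "emeasure m (K' \<inter> ball x e) < \<infinity>" using sets fin by auto
    have "emeasure m (K' \<inter> ball x e) \<le> emeasure m (K' \<inter> ball s (r s))"
      by (rule emeasure_mono) (use s(2) sets in auto)
    also have "\<dots> \<le> ennreal \<delta>" using r(2)[OF s(1)] by simp
    finally show "measure m (K' \<inter> ball x e) \<le> \<delta>" unfolding measure_def using \<delta> by (simp add: enn2real_leI)
  qed
qed

lemma emeasure_cball_vec:
  assumes "0 \<le> r"
  shows "emeasure lborel (cball (w :: complex^'q::finite) r) < \<infinity>"
    and "measure lborel (cball (w :: complex^'q::finite) r) = unit_ball_vol (2 * real CARD('q)) * r ^ (2 * CARD('q))"
proof -
  have e: "emeasure lborel (cball w r) = ennreal (unit_ball_vol (2 * real CARD('q)) * r ^ (2 * CARD('q)))"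
    using emeasure_cball[OF assms, of w] by (simp add: mult.commute)
  then show "emeasure lborel (cball w r) < \<infinity>" by simp
  show "measure lborel (cball w r) = unit_ball_vol (2 * real CARD('q)) * r ^ (2 * CARD('q))"
    unfolding measure_def e using assms by (simp add: unit_ball_vol_nonneg)
qed

lemma plaque_integrand:
  fixes A :: "('a, 'n::finite) chart set" and \<iota> :: "'q::finite \<Rightarrow> 'n"
  assumes A: "pre_manifold A" and b: "is_embedded_flow_box A \<iota> \<Sigma> b" and t: "t \<in> transverse_polydisc \<iota>"
    and z: "z \<in> polydisc"
  obtains d where "d \<in> A" "fst b (z, t) \<in> fst d"
    "form_pullback polydisc_atlas A polydisc (\<lambda>z. fst b (z, t)) \<alpha> (polydisc, \<lambda>z. z) z oriented_basis
      = \<alpha> d (plaque_coord d b t z) (map (plaque_deriv d b t z) oriented_basis)"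
proof -
  have "is_chart (polydisc, \<lambda>z. z :: complex^'q)" using open_polydisc by (simp add: is_chart_def)
  moreover have "fst b (z, t) \<in> points A"
  proof -
    have "continuous_map (top_of_set (polydisc \<times> transverse_polydisc \<iota>)) (atlas_topology A) (fst b)"
      using b embedding_map_imp_continuous_map unfolding is_embedded_flow_box_def by blast
    from continuous_map_image_subset_topspace[OF this] show ?thesis using z t by (auto simp: topspace_atlas)
  qed
  ultimately obtain d where d: "d \<in> A" "fst b (z, t) \<in> fst d"
    "\<And>us. form_pullback polydisc_atlas A polydisc (\<lambda>z. fst b (z, t)) \<alpha> (polydisc, \<lambda>z. z) (snd (polydisc :: (complex^'q) set, \<lambda>z. z) z) us
      = \<alpha> d (snd d (fst b (z, t))) (map (frechet_derivative (coord_rep (polydisc, \<lambda>z. z) d (\<lambda>z. fst b (z, t))) (at (snd (polydisc :: (complex^'q) set, \<lambda>z. z) z))) us)"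
    using form_pullback_some[of "(polydisc, \<lambda>z. z)" polydisc_atlas z polydisc "\<lambda>z. fst b (z, t)" A \<alpha>] z
    unfolding polydisc_atlas_def by auto
  then show thesis by (intro that[OF d(1,2)]) simp
qed

text \<open>The gap between \<open>Z\<close> and \<open>Y\<close> absorbs the distance between the
  two points: the cut-off lives on \<open>Z\<close>, and by \<open>near\<close> the second point is
  then in \<open>Y\<close>. As \<open>Y\<close> is closed and contained in \<open>W\<close>, both
  applications of \<open>T\<close> disintegrate in the same flow box. The inner integration produces
  a small factor, the outer one only a finite mass.\<close>

lemma local_limit:
  fixes A :: "('a, 'n::finite) chart set" and \<iota> :: "'q::finite \<Rightarrow> 'n" and T :: "('a, 'n) current"
    and \<Psi> :: "complex \<Rightarrow> ('a \<times> 'a, 'n + 'n) mform"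
  assumes A: "pre_manifold A" and H: "Hausdorff_space (atlas_topology A)" and CS: "compact_space (atlas_topology A)"
    and L: "embedded_lamination A \<iota> \<Sigma> L" and fol: "foliated_cycle A \<iota> \<Sigma> L \<mu> T" and dif: "diffuse L \<mu>"
    and T: "is_current A (2 * CARD('q)) T" and b: "b \<in> L" and c0: "c0 \<in> A"
    and W: "W \<subseteq> fst c0" "W \<inter> \<Sigma> \<subseteq> box_set b" "W \<subseteq> fst b ` (polydisc \<times> transverse_polydisc \<iota>)" and C: "(C::real) > 0"
    and est: "\<And>l z s w t d d'. 1 \<le> cmod l \<Longrightarrow> z \<in> polydisc \<Longrightarrow> s \<in> snd b \<Longrightarrow> fst b (z, s) \<in> W \<Longrightarrow>
       w \<in> polydisc \<Longrightarrow> t \<in> snd b \<Longrightarrow> fst b (w, t) \<in> W \<Longrightarrow>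
       d \<in> A \<Longrightarrow> fst b (z, s) \<in> fst d \<Longrightarrow> d' \<in> A \<Longrightarrow> fst b (w, t) \<in> fst d' \<Longrightarrow>
       \<Psi> l (prod_chart d d') (vjoin (plaque_coord d b s z) (plaque_coord d' b t w))
         (map (\<lambda>u. vjoin u 0) (map (plaque_deriv d b s z) oriented_basis) @ map (\<lambda>u. vjoin 0 u) (map (plaque_deriv d' b t w) oriented_basis)) \<noteq> 0 \<Longrightarrow>
       norm (plaque_coord c0 b s z - plaque_coord c0 b t w) \<le> C / cmod l \<and>
       norm (\<Psi> l (prod_chart d d') (vjoin (plaque_coord d b s z) (plaque_coord d' b t w))
         (map (\<lambda>u. vjoin u 0) (map (plaque_deriv d b s z) oriented_basis) @ map (\<lambda>u. vjoin 0 u) (map (plaque_deriv d' b t w) oriented_basis)))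
         \<le> C * cmod l ^ (2 * CARD('q))"
    and emb: "\<And>w w' t. t \<in> snd b \<Longrightarrow> w \<in> polydisc \<Longrightarrow> w' \<in> polydisc \<Longrightarrow> fst b (w, t) \<in> W \<Longrightarrow> fst b (w', t) \<in> W \<Longrightarrow>
       norm (w - w') \<le> C * norm (plaque_coord c0 b t w - plaque_coord c0 b t w')"
    and Z: "closedin (atlas_topology A) Z" and Y: "closedin (atlas_topology A) Y" and ZY: "Z \<subseteq> Y" and YW: "Y \<subseteq> W"
    and \<psi>: "smooth_function A \<psi>" "\<And>x. 0 \<le> \<psi> x" "\<And>x. x \<in> points A \<Longrightarrow> \<psi> x \<le> 1" "\<And>x. x \<in> points A \<Longrightarrow> x \<notin> Z \<Longrightarrow> \<psi> x = 0"
    and near: "\<And>l d d' x y vs. R0 < cmod l \<Longrightarrow> d \<in> A \<Longrightarrow> d' \<in> A \<Longrightarrow> x \<in> fst d \<Longrightarrow> y \<in> fst d' \<Longrightarrow> x \<in> Z \<Longrightarrow>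
       \<Psi> l (prod_chart d d') (vjoin (snd d x) (snd d' y)) vs \<noteq> 0 \<Longrightarrow> y \<in> Y"
    and \<eta>: "0 < \<eta>"
  shows "\<exists>R. \<forall>l. R < cmod l \<longrightarrow> test_form A (2 * CARD('q)) (tensor_inner A T (\<Psi> l)) \<longrightarrow>
     norm (T (form_mult \<psi> (tensor_inner A T (\<Psi> l)))) \<le> \<eta>"
proof -
  let ?TA = "atlas_topology A" and ?q = "2 * CARD('q)"
  define m where "m = \<mu> b"
  define K where "K = snd b"
  have eb: "is_embedded_flow_box A \<iota> \<Sigma> b" using L b unfolding embedded_lamination_def by blast
  have fb: "is_flow_box A \<iota> \<Sigma> b" using eb by (simp add: is_embedded_flow_box_def)
  have Ktr: "K \<subseteq> transverse_polydisc \<iota>" using fb by (simp add: is_flow_box_def K_def)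
  have sets_m: "sets m = sets (restrict_space borel K)"
    and fin_m: "\<And>D. compact D \<Longrightarrow> D \<subseteq> K \<Longrightarrow> emeasure m D < \<infinity>"
    and T_int: "\<And>\<alpha>. test_form A ?q \<alpha> \<Longrightarrow> form_support A \<alpha> \<subseteq> fst b ` (polydisc \<times> transverse_polydisc \<iota>) \<Longrightarrow>
             form_support A \<alpha> \<inter> \<Sigma> \<subseteq> box_set b \<Longrightarrow> T \<alpha> = (LINT t|m. plaque_integral A b t \<alpha>)"
    using fol b unfolding foliated_cycle_def m_def K_def by blast+
  have space_m: "space m = K" using sets_eq_imp_space_eq[OF sets_m] by (simp add: space_restrict_space)
  have \<Sigma>c: "compactin ?TA \<Sigma>" using L unfolding embedded_lamination_def by blast
  define X0 where "X0 = Y \<inter> \<Sigma>"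
  have X0: "compactin ?TA X0" unfolding X0_def by (rule closed_Int_compactin[OF Y \<Sigma>c])
  have X0b: "X0 \<subseteq> box_set b" and X0c: "X0 \<subseteq> fst c0" using YW W(1,2) by (auto simp: X0_def)
  let ?X = "top_of_set (polydisc \<times> K)" and ?S = "subtopology (subtopology ?TA \<Sigma>) (box_set b)"
  have "homeomorphic_map ?X ?S (fst b)"
    using fb unfolding is_flow_box_def embedding_map_def K_def by simp
  then obtain g where g: "homeomorphic_maps ?X ?S (fst b) g" unfolding homeomorphic_map_maps by blast
  have gc: "continuous_map ?S ?X g" and gb: "\<And>z s. z \<in> polydisc \<Longrightarrow> s \<in> K \<Longrightarrow> g (fst b (z, s)) = (z, s)"
    using g by (auto simp: homeomorphic_maps_def)
  have box\<Sigma>: "box_set b \<subseteq> \<Sigma>" using flow_box_subset[OF fb] by blast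
  have X0S: "compactin ?S X0" using X0 X0b box\<Sigma> by (auto simp: compactin_subtopology)
  define Q where "Q = g ` X0"
  have "compactin ?X Q" unfolding Q_def by (rule image_compactin[OF X0S gc])
  then have Q: "compact Q" "Q \<subseteq> polydisc \<times> K" by (simp_all add: compactin_subtopology)
  have Qm: "(z, s) \<in> Q" "fst b (z, s) \<in> X0" if "z \<in> polydisc" "s \<in> K" "fst b (z, s) \<in> Y" for z s
  proof -
    have "fst b (z, s) \<in> box_set b" using that(1,2) by (auto simp: K_def)
    then show X: "fst b (z, s) \<in> X0" using that(3) box\<Sigma> by (auto simp: X0_def)
    then have "g (fst b (z, s)) \<in> Q" unfolding Q_def by (rule imageI)
    then show "(z, s) \<in> Q" using gb[OF that(1,2)] by simp
  qed
  \<comment> \<open>The parameters of all plaques meeting \<open>Y\<close>: a compact set, hence of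
    finite measure.\<close>
  define K' where "K' = snd ` Q"
  have K': "compact K'" "K' \<subseteq> K"
    unfolding K'_def using Q by (auto intro!: compact_continuous_image continuous_intros)
  have mK': "emeasure m K' < \<infinity>" by (rule fin_m[OF K'])
  have K's: "K' \<in> sets m"
  proof -
    have "K' \<in> sets borel" using K'(1) by (simp add: borel_compact)
    then have "K \<inter> K' \<in> sets (restrict_space borel K)" unfolding sets_restrict_space by blast
    then show ?thesis using sets_m K'(2) by (simp add: Int_absorb1)
  qed
  \<comment> \<open>The transverse parameter as a function of the chart coordinates. It is uniformly
    continuous on the compact set in question, so a distance of at most \<open>C / cmod l\<close>
    between two points forces their parameters to be \<open>\<epsilon>\<close>-close.\<close>
  define \<sigma> where "\<sigma> x = snd (g (chart_inv c0 x))" for x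
  have cX0: "compact (snd c0 ` X0)"
    by (rule compact_chart_image[OF A chart_holomorphic_coordinates[OF A c0] X0 X0c])
  have cont\<sigma>: "continuous_on (snd c0 ` X0) \<sigma>"
  proof -
    have 1: "continuous_map (top_of_set (snd c0 ` X0)) ?TA (chart_inv c0)"
      by (rule continuous_map_from_subtopology_mono[OF chart_inv_continuous_map[OF chart_holomorphic_coordinates[OF A c0]]]) (use X0c in blast)
    have im: "chart_inv c0 ` (snd c0 ` X0) \<subseteq> X0" using chart_inv_chart[OF pre_manifoldD(1)[OF A c0]] X0c by auto
    have 2: "continuous_map (top_of_set (snd c0 ` X0)) ?S (chart_inv c0)"
      unfolding subtopology_subtopology
      by (rule continuous_map_into_subtopology[OF 1]) (use im X0b box\<Sigma> in auto)
    have "continuous_map (top_of_set (snd c0 ` X0)) euclidean (g \<circ> chart_inv c0)"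
      using continuous_map_compose[OF 2 gc] by (simp add: continuous_map_in_subtopology)
    then have "continuous_on (snd c0 ` X0) (g \<circ> chart_inv c0)" by simp
    then have "continuous_on (snd c0 ` X0) (\<lambda>x. snd ((g \<circ> chart_inv c0) x))" by (rule continuous_on_snd)
    then show ?thesis by (simp add: \<sigma>_def[abs_def] comp_def)
  qed
  have \<sigma>b: "\<sigma> (plaque_coord c0 b s z) = s" if zs: "z \<in> polydisc" "s \<in> K" "fst b (z, s) \<in> Y" for z s
  proof -
    have "fst b (z, s) \<in> fst c0" using Qm(2)[OF zs] X0c by blast
    then show ?thesis using chart_inv_chart[OF pre_manifoldD(1)[OF A c0]] gb[OF zs(1,2)] by (simp add: \<sigma>_def)
  qed
  define Vq where "Vq = unit_ball_vol (2 * real CARD('q))"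
  have Vq: "0 \<le> Vq" by (simp add: Vq_def unit_ball_vol_nonneg)
  \<comment> \<open>The bound \<open>C * cmod l ^ (2 * CARD('q))\<close> of the integrand times the
    volume of a ball of radius \<open>C * (2 * C) / cmod l\<close>; the powers of
    \<open>cmod l\<close> cancel.\<close>
  define C5 where "C5 = C * (Vq * (C * (2 * C)) ^ ?q)"
  have C5: "0 \<le> C5" using C Vq by (simp add: C5_def)
  define Vp where "Vp = measure lborel (cball (0 :: complex^'q) (real CARD('q)))"
  have Vp: "0 \<le> Vp" by (simp add: Vp_def)
  define D where "D = C5 * Vp * measure m K'"
  have D: "0 \<le> D" using C5 Vp by (simp add: D_def)
  \<comment> \<open>Chosen so that the final bound \<open>D * \<delta>1\<close> is at most
    \<open>\<eta>\<close>; the summand 1 covers \<open>D = 0\<close>.\<close>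
  define \<delta>1 where "\<delta>1 = \<eta> / (D + 1)"
  have \<delta>1: "0 < \<delta>1" using \<eta> D by (simp add: \<delta>1_def)
  obtain \<epsilon> where \<epsilon>: "0 < \<epsilon>" "\<And>s. s \<in> K' \<Longrightarrow> K' \<inter> ball s \<epsilon> \<in> sets m \<and> emeasure m (K' \<inter> ball s \<epsilon>) < \<infinity> \<and> measure m (K' \<inter> ball s \<epsilon>) \<le> \<delta>1"
    by (rule diffuse_uniformly_small[OF sets_m K' mK' _ \<delta>1]) (use dif b in \<open>auto simp: diffuse_def m_def K_def\<close>)
  obtain \<delta>2 where \<delta>2: "0 < \<delta>2" "\<And>x y. x \<in> snd c0 ` X0 \<Longrightarrow> y \<in> snd c0 ` X0 \<Longrightarrow> dist y x < \<delta>2 \<Longrightarrow> dist (\<sigma> y) (\<sigma> x) < \<epsilon>"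
    using compact_uniformly_continuous[OF cont\<sigma> cX0] \<epsilon>(1) unfolding uniformly_continuous_on_def by metis
  \<comment> \<open>1 for the pointwise estimate, \<open>R0\<close> for the localization of the
    second point, and \<open>C / \<delta>2\<close> to make the distance of the points smaller than
    \<open>\<delta>2\<close>.\<close>
  define R where "R = Max {1, R0, C / \<delta>2}"
  have "norm (T (form_mult \<psi> (tensor_inner A T (\<Psi> l)))) \<le> \<eta>"
    if lR: "R < cmod l" and tf: "test_form A ?q (tensor_inner A T (\<Psi> l))" for l
  proof -
    have l: "1 \<le> cmod l" "R0 < cmod l" "C / \<delta>2 < cmod l" using lR by (auto simp: R_def)
    have l0: "0 < cmod l" using l(1) by linarith
    have Cl: "C / cmod l < \<delta>2" using l(3) l0 \<delta>2(1) by (simp add: field_simps)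
    define \<alpha> where "\<alpha> = tensor_inner A T (\<Psi> l)"
    have sf: "smooth_form A ?q \<alpha>" using tf by (simp add: test_form_def \<alpha>_def)
    have inner: "norm (\<alpha> d (plaque_coord d b s z) (map (plaque_deriv d b s z) oriented_basis)) \<le> C5 * \<delta>1"
      if zs: "z \<in> polydisc" "s \<in> K" "fst b (z, s) \<in> Z" and d: "d \<in> A" "fst b (z, s) \<in> fst d" for z s d
    proof -
      define us where "us = map (plaque_deriv d b s z) oriented_basis"
      \<comment> \<open>The form in the second variable when the first point and the tangent basis
        of its plaque are frozen.\<close>
      define \<beta> where "\<beta> = (\<lambda>d' y ws. if d' \<in> A then \<Psi> l (prod_chart d d') (vjoin (plaque_coord d b s z) y)
            (map (\<lambda>u. vjoin u 0) us @ map (\<lambda>w. vjoin 0 w) ws) else 0)"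
      have \<alpha>\<beta>: "\<alpha> d (plaque_coord d b s z) us = T \<beta>"
        unfolding \<alpha>_def tensor_inner_def \<beta>_def using d(1) by (simp only: if_True)
      have xY: "fst b (z, s) \<in> Y" using zs(3) ZY by blast
      have xW: "fst b (z, s) \<in> W" using xY YW by blast
      have sK': "s \<in> K'" using Qm(1)[OF zs(1,2) xY] unfolding K'_def by force
      have \<beta>Y: "y \<in> Y" if "d' \<in> A" "y \<in> fst d'" "\<beta> d' (snd d' y) ws \<noteq> 0" for d' y ws
      proof -
        have "\<Psi> l (prod_chart d d') (vjoin (plaque_coord d b s z) (snd d' y)) (map (\<lambda>u. vjoin u 0) us @ map (\<lambda>w. vjoin 0 w) ws) \<noteq> 0"
          using that by (simp add: \<beta>_def)
        then show ?thesis by (rule near[OF l(2) d(1) that(1) d(2) that(2) zs(3)])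
      qed
      have "norm (T \<beta>) \<le> C5 * \<delta>1"
      \<comment> \<open>If \<open>\<beta>\<close> is not a test form, \<open>T\<close> vanishes on
        it by convention; otherwise its integral representation is available.\<close>
      proof (cases "test_form A ?q \<beta>")
        case False
        then have "T \<beta> = 0" using T unfolding is_current_def by blast
        then show ?thesis using C5 \<delta>1 by simp
      next
        case True
        have sup: "form_support A \<beta> \<subseteq> Y" by (rule form_support_subset[OF Y \<beta>Y])
        have "T \<beta> = (LINT t|m. plaque_integral A b t \<beta>)"
          by (rule T_int[OF True]) (use sup YW W(2,3) in blast)+
        also have "norm \<dots> \<le> C5 * measure m (K' \<inter> ball s \<epsilon>)"
        proof (rule norm_integral_le_measure[OF _ _ C5])
          show "K' \<inter> ball s \<epsilon> \<in> sets m" "emeasure m (K' \<inter> ball s \<epsilon>) < \<infinity>" using \<epsilon>(2)[OF sK'] by auto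
          fix t assume "t \<in> space m" and nz: "plaque_integral A b t \<beta> \<noteq> 0"
          then have t: "t \<in> K" using space_m by simp
          then have ttr: "t \<in> transverse_polydisc \<iota>" using Ktr by blast
          define I where "I w = form_pullback polydisc_atlas A polydisc (\<lambda>z. fst b (z, t)) \<beta> (polydisc, \<lambda>z. z) w oriented_basis" for w
          have pI: "plaque_integral A b t \<beta> = (LINT w|lborel. indicator polydisc w *\<^sub>R I w)"
            by (simp add: plaque_integral_def I_def set_lebesgue_integral_def)
          have I: "fst b (w, t) \<in> Y \<and> norm (plaque_coord c0 b s z - plaque_coord c0 b t w) \<le> C / cmod l \<and> norm (I w) \<le> C * cmod l ^ ?q"
            if w: "w \<in> polydisc" "I w \<noteq> 0" for w
          proof -
            obtain d' where d': "d' \<in> A" "fst b (w, t) \<in> fst d'"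
              "I w = \<beta> d' (plaque_coord d' b t w) (map (plaque_deriv d' b t w) oriented_basis)"
              using plaque_integrand[OF A eb ttr w(1), of \<beta>] unfolding I_def by metis
            have yY: "fst b (w, t) \<in> Y" by (rule \<beta>Y[OF d'(1,2)]) (use w(2) d'(3) in simp)
            have e: "I w = \<Psi> l (prod_chart d d') (vjoin (plaque_coord d b s z) (plaque_coord d' b t w))
              (map (\<lambda>u. vjoin u 0) (map (plaque_deriv d b s z) oriented_basis) @ map (\<lambda>u. vjoin 0 u) (map (plaque_deriv d' b t w) oriented_basis))"
              unfolding d'(3) \<beta>_def us_def using d'(1) by (simp only: if_True)
            show ?thesis
              using est[OF l(1) zs(1) _ xW w(1) _ _ d d'(1,2)] w(2) yY YW zs(2) t unfolding e K_def by blast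
          qed
          \<comment> \<open>A nonzero integral provides a point of the plaque where the integrand is
            nonzero. It shows that \<open>t\<close> is close to \<open>s\<close>, and it is the
            centre of the ball that contains all other such points.\<close>
          have "\<exists>w0. w0 \<in> polydisc \<and> I w0 \<noteq> 0"
          proof (rule ccontr)
            assume "\<not> ?thesis"
            then have "indicator polydisc w *\<^sub>R I w = 0" for w by (auto simp: indicator_def)
            then have "plaque_integral A b t \<beta> = 0" unfolding pI by (simp only: integral_zero)
            then show False using nz by contradiction
          qed
          then obtain w0 where w0: "w0 \<in> polydisc" "I w0 \<noteq> 0" by blast
          note I0 = I[OF w0]
          have "dist (\<sigma> (plaque_coord c0 b t w0)) (\<sigma> (plaque_coord c0 b s z)) < \<epsilon>"
            by (rule \<delta>2(2)) (use Qm(2)[OF zs(1,2) xY] Qm(2)[OF w0(1) t] I0 Cl in \<open>auto simp: dist_norm norm_minus_commute\<close>)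
          then have "dist t s < \<epsilon>" using \<sigma>b[OF zs(1,2) xY] \<sigma>b[OF w0(1) t] I0 by simp
          moreover have "t \<in> K'" using Qm(1)[OF w0(1) t] I0 unfolding K'_def by force
          ultimately have tin: "t \<in> K' \<inter> ball s \<epsilon>" by (simp add: dist_commute)
          \<comment> \<open>Two points of the plaque with nonzero integrand are each within
            \<open>C / cmod l\<close> of the first point, hence within twice that of each other, and
            \<open>emb\<close> turns this into a distance of plaque coordinates.\<close>
          define r where "r = C * (2 * C) / cmod l"
          have r: "0 \<le> r" using C l0 by (simp add: r_def)
          have "norm (plaque_integral A b t \<beta>) \<le> (C * cmod l ^ ?q) * measure lborel (cball w0 r)"
            unfolding pI
          proof (rule norm_integral_le_measure)
            show "cball w0 r \<in> sets lborel" by simp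
            show "emeasure lborel (cball w0 r) < \<infinity>" by (rule emeasure_cball_vec(1)[OF r])
            show "0 \<le> C * cmod l ^ ?q" using C by simp
            fix w assume "indicator polydisc w *\<^sub>R I w \<noteq> 0"
            then have w: "w \<in> polydisc" "I w \<noteq> 0" by (auto simp: indicator_def split: if_splits)
            note Iw = I[OF w]
            have "norm (w0 - w) \<le> C * norm (plaque_coord c0 b t w0 - plaque_coord c0 b t w)"
              by (rule emb) (use t w0(1) w(1) I0 Iw YW in \<open>auto simp: K_def\<close>)
            also have "norm (plaque_coord c0 b t w0 - plaque_coord c0 b t w) \<le> 2 * (C / cmod l)"
              using norm_triangle_ineq4[of "plaque_coord c0 b s z - plaque_coord c0 b t w" "plaque_coord c0 b s z - plaque_coord c0 b t w0"] I0 Iw by simp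
            finally have "norm (w0 - w) \<le> r" using C by (simp add: r_def)
            then show "w \<in> cball w0 r \<and> norm (indicator polydisc w *\<^sub>R I w) \<le> C * cmod l ^ ?q"
              using Iw w(1) by (simp add: dist_norm)
          qed
          also have "\<dots> = C5"
            unfolding emeasure_cball_vec(2)[OF r] using l0 by (simp add: C5_def Vq_def r_def power_divide)
          finally show "t \<in> K' \<inter> ball s \<epsilon> \<and> norm (plaque_integral A b t \<beta>) \<le> C5" using tin by blast
        qed
        also have "\<dots> \<le> C5 * \<delta>1" using \<epsilon>(2)[OF sK'] C5 by (intro mult_left_mono) auto
        finally show ?thesis .
      qed
      then show ?thesis using \<alpha>\<beta> by (simp add: us_def)
    qed
    have sup: "form_support A (form_mult \<psi> \<alpha>) \<subseteq> Z" by (rule form_mult_support[OF A Z \<psi>(4)])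
    have "T (form_mult \<psi> \<alpha>) = (LINT s|m. plaque_integral A b s (form_mult \<psi> \<alpha>))"
      by (rule T_int[OF smooth_form_imp_test_form[OF CS smooth_form_mult[OF A \<psi>(1) sf]]]) (use sup ZY YW W(2,3) in blast)+
    also have "norm \<dots> \<le> (C5 * \<delta>1 * Vp) * measure m K'"
    proof (rule norm_integral_le_measure[OF K's mK'])
      show "0 \<le> C5 * \<delta>1 * Vp" using C5 \<delta>1 Vp by simp
      fix s assume "s \<in> space m" and nz: "plaque_integral A b s (form_mult \<psi> \<alpha>) \<noteq> 0"
      then have s: "s \<in> K" using space_m by simp
      then have str: "s \<in> transverse_polydisc \<iota>" using Ktr by blast
      define J where "J z = form_pullback polydisc_atlas A polydisc (\<lambda>z. fst b (z, s)) (form_mult \<psi> \<alpha>) (polydisc, \<lambda>z. z) z oriented_basis" for z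
      have pJ: "plaque_integral A b s (form_mult \<psi> \<alpha>) = (LINT z|lborel. indicator polydisc z *\<^sub>R J z)"
        by (simp add: plaque_integral_def J_def set_lebesgue_integral_def)
      have J: "fst b (z, s) \<in> Z \<and> norm (J z) \<le> C5 * \<delta>1" if z: "z \<in> polydisc" "J z \<noteq> 0" for z
      proof -
        obtain d where d: "d \<in> A" "fst b (z, s) \<in> fst d"
          "J z = form_mult \<psi> \<alpha> d (plaque_coord d b s z) (map (plaque_deriv d b s z) oriented_basis)"
          using plaque_integrand[OF A eb str z(1), of "form_mult \<psi> \<alpha>"] unfolding J_def by metis
        have xA: "fst b (z, s) \<in> points A" using chart_subset_points[OF d(1)] d(2) by blast
        have e: "J z = complex_of_real (\<psi> (fst b (z, s))) * \<alpha> d (plaque_coord d b s z) (map (plaque_deriv d b s z) oriented_basis)"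
          unfolding d(3) form_mult_def chart_inv_chart[OF pre_manifoldD(1)[OF A d(1)] d(2)] ..
        then have "\<psi> (fst b (z, s)) \<noteq> 0" using z(2) by auto
        then have xZ: "fst b (z, s) \<in> Z" using \<psi>(4)[OF xA] by blast
        have "norm (J z) = \<psi> (fst b (z, s)) * norm (\<alpha> d (plaque_coord d b s z) (map (plaque_deriv d b s z) oriented_basis))"
          unfolding e norm_mult using \<psi>(2) by simp
        also have "\<dots> \<le> 1 * (C5 * \<delta>1)"
          by (rule mult_mono[OF \<psi>(3)[OF xA] inner[OF z(1) s xZ d(1,2)]]) auto
        finally show ?thesis using xZ by simp
      qed
      have "\<exists>z0. z0 \<in> polydisc \<and> J z0 \<noteq> 0"
      proof (rule ccontr)
        assume "\<not> ?thesis"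
        then have "indicator polydisc z *\<^sub>R J z = 0" for z by (auto simp: indicator_def)
        then have "plaque_integral A b s (form_mult \<psi> \<alpha>) = 0" unfolding pJ by (simp only: integral_zero)
          then show False using nz by contradiction
      qed
      then obtain z0 where z0: "z0 \<in> polydisc" "J z0 \<noteq> 0" by blast
      have "fst b (z0, s) \<in> Y" using J[OF z0] ZY by blast
      then have sK': "s \<in> K'" using Qm(1)[OF z0(1) s] unfolding K'_def by force
      have "norm (plaque_integral A b s (form_mult \<psi> \<alpha>)) \<le> (C5 * \<delta>1) * measure lborel (cball (0 :: complex^'q) (real CARD('q)))"
        unfolding pJ
      proof (rule norm_integral_le_measure)
        show "cball (0 :: complex^'q) (real CARD('q)) \<in> sets lborel" by simp
        show "emeasure lborel (cball (0 :: complex^'q) (real CARD('q))) < \<infinity>" by (rule emeasure_cball_vec(1)) simp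
        show "0 \<le> C5 * \<delta>1" using C5 \<delta>1 by simp
        fix z :: "complex^'q" assume "indicator polydisc z *\<^sub>R J z \<noteq> 0"
        then have z: "z \<in> polydisc" "J z \<noteq> 0" by (auto simp: indicator_def split: if_splits)
        then show "z \<in> cball 0 (real CARD('q)) \<and> norm (indicator polydisc z *\<^sub>R J z) \<le> C5 * \<delta>1"
          using J[OF z] norm_polydisc_le[OF z(1)] by simp
      qed
      then show "s \<in> K' \<and> norm (plaque_integral A b s (form_mult \<psi> \<alpha>)) \<le> C5 * \<delta>1 * Vp" using sK' by (simp add: Vp_def)
    qed
    also have "\<dots> = D * \<delta>1" by (simp add: D_def mult_ac)
    also have "\<dots> \<le> \<eta>" using D \<eta> by (simp add: \<delta>1_def field_simps)
    finally show ?thesis by (simp add: \<alpha>_def)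
  qed
  then show ?thesis by blast
qed

section \<open>The product\<close>

lemma fibre_scale_points:
  "pre_manifold A \<Longrightarrow> e \<in> points (tangent_atlas A) \<Longrightarrow> fibre_scale l e \<in> points (tangent_atlas A)"
  using fibre_scale_tangent_space[of A "snd e" "fst e" l] by (auto simp: points_tangent fibre_scale_def)

text \<open>The pairs \<open>(x, y)\<close> with \<open>y \<in> V j\<close> whenever
  \<open>x \<in> Z j\<close> form an open neighbourhood of the diagonal, and \<open>\<tau>\<close>
  carries its intersection with \<open>N\<close> to a neighbourhood of the zero section.
  \<open>compact_tangent_shrinks\<close> then provides the threshold from the compact support of
  \<open>\<Phi>\<close>.\<close>

lemma pullback_near_diagonal:
  fixes A :: "('a, 'm::finite) chart set"
  assumes A: "pre_manifold A" and adm: "admissible_map A N \<tau>" and \<Phi>: "test_form (tangent_atlas A) k \<Phi>"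
    and P: "finite P" "\<And>j. j \<in> P \<Longrightarrow> closedin (atlas_topology A) (Z j)" "\<And>j. j \<in> P \<Longrightarrow> openin (atlas_topology A) (V j)"
      "\<And>j. j \<in> P \<Longrightarrow> Z j \<subseteq> V j"
  obtains R where "\<And>l d d' x y vs j. R < cmod l \<Longrightarrow> d \<in> A \<Longrightarrow> d' \<in> A \<Longrightarrow> x \<in> fst d \<Longrightarrow> y \<in> fst d' \<Longrightarrow> j \<in> P \<Longrightarrow> x \<in> Z j \<Longrightarrow>
     form_pullback (prod_atlas A A) (tangent_atlas A) N (fibre_scale l \<circ> \<tau>) \<Phi> (prod_chart d d') (vjoin (snd d x) (snd d' y)) vs \<noteq> 0 \<Longrightarrow> y \<in> V j"
proof -
  let ?TT = "atlas_topology (tangent_atlas A)" and ?PT = "atlas_topology (prod_atlas A A)"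
  have pp: "pre_manifold (prod_atlas A A)" and pt: "pre_manifold (tangent_atlas A)"
    using pre_manifold_prod[OF A A] pre_manifold_tangent[OF A] by auto
  define B where "B = {p \<in> points A \<times> points A. \<forall>j\<in>P. fst p \<in> Z j \<longrightarrow> snd p \<in> V j}"
  have "openin ?PT B" unfolding B_def by (rule openin_near_diagonal[OF A P(1-3)])
  then have oNB: "openin ?PT (N \<inter> B)" using admissible_mapD(1)[OF adm] by blast
  have inj: "inj_on \<tau> N" by (rule admissible_mapD(3)[OF adm])
  have "continuous_map (subtopology ?TT (\<tau> ` N)) ?PT (inv_into N \<tau>)"
    using admissible_mapD(6)[OF adm] unfolding manifold_map_def by blast
  from openin_trans_full[OF openin_continuous_map_preimage[OF this oNB] admissible_mapD(4)[OF adm]]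
  have o: "openin ?TT {e \<in> topspace (subtopology ?TT (\<tau> ` N)). inv_into N \<tau> e \<in> N \<inter> B}" .
  have sub: "\<tau> ` N \<subseteq> topspace ?TT" by (rule openin_subset[OF admissible_mapD(4)[OF adm]])
  have "{e \<in> topspace (subtopology ?TT (\<tau> ` N)). inv_into N \<tau> e \<in> N \<inter> B} = \<tau> ` (N \<inter> B)"
  proof (intro equalityI subsetI)
    fix e assume "e \<in> {e \<in> topspace (subtopology ?TT (\<tau> ` N)). inv_into N \<tau> e \<in> N \<inter> B}"
    then have "e \<in> \<tau> ` N" "inv_into N \<tau> e \<in> N \<inter> B" by auto
    then show "e \<in> \<tau> ` (N \<inter> B)" using f_inv_into_f[of e \<tau> N] by (metis imageI)
  next
    fix e assume "e \<in> \<tau> ` (N \<inter> B)"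
    then obtain r where "r \<in> N" "r \<in> B" "e = \<tau> r" by blast
    then show "e \<in> {e \<in> topspace (subtopology ?TT (\<tau> ` N)). inv_into N \<tau> e \<in> N \<inter> B}"
      using sub inv_into_f_f[OF inj] by auto
  qed
  then have oW: "openin ?TT (\<tau> ` (N \<inter> B))" using o by simp
  have zero: "(p, \<lambda>c. 0) \<in> \<tau> ` (N \<inter> B)" if p: "p \<in> points A" for p
  proof -
    have "(p, p) \<in> N \<inter> B" using admissible_mapD(2)[OF adm p] p P(4) by (auto simp: B_def)
    then have "\<tau> (p, p) \<in> \<tau> ` (N \<inter> B)" by (rule imageI)
    then show ?thesis using admissible_mapD(7)[OF adm p] by simp
  qed
  have comp: "compactin ?TT (form_support (tangent_atlas A) \<Phi>)" using \<Phi> by (simp add: test_form_def)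
  obtain R where R: "\<And>l e. R < cmod l \<Longrightarrow> fibre_scale l e \<in> form_support (tangent_atlas A) \<Phi> \<Longrightarrow> e \<in> \<tau> ` (N \<inter> B)"
    using compact_tangent_shrinks[OF A comp oW zero] by metis
  show thesis
  proof (rule that[of R])
    fix l d d' x y vs j
    assume l: "R < cmod l" and d: "d \<in> A" "d' \<in> A" and xy: "x \<in> fst d" "y \<in> fst d'" and j: "j \<in> P" "x \<in> Z j"
      and nz: "form_pullback (prod_atlas A A) (tangent_atlas A) N (fibre_scale l \<circ> \<tau>) \<Phi> (prod_chart d d') (vjoin (snd d x) (snd d' y)) vs \<noteq> 0"
    let ?c = "prod_chart d d'"
    have cc: "is_chart ?c" by (rule is_chart_prod[OF pre_manifoldD(1)[OF A d(1)] pre_manifoldD(1)[OF A d(2)]])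
    have e: "vjoin (snd d x) (snd d' y) = snd ?c (x, y)" by simp
    have c: "(x, y) \<in> fst ?c" using xy by simp
    have "snd ?c (x, y) \<in> snd ?c ` (fst ?c \<inter> N)"
      using form_pullback_outside[of ?c "prod_atlas A A" "snd ?c (x, y)" N "tangent_atlas A" "fibre_scale l \<circ> \<tau>" \<Phi> vs] nz unfolding e by blast
    then have xyN: "(x, y) \<in> N" using chart_image_mem_iff[OF cc c, of "fst ?c \<inter> N"] by blast
    have "\<tau> (x, y) \<in> points (tangent_atlas A)" using sub xyN unfolding topspace_atlas by blast
    then have G: "(fibre_scale l \<circ> \<tau>) (x, y) \<in> points (tangent_atlas A)" using fibre_scale_points[OF A] by simp
    obtain e' where e': "e' \<in> tangent_atlas A" "(fibre_scale l \<circ> \<tau>) (x, y) \<in> fst e'"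
      "\<And>us. form_pullback (prod_atlas A A) (tangent_atlas A) N (fibre_scale l \<circ> \<tau>) \<Phi> ?c (snd ?c (x, y)) us
         = \<Phi> e' (snd e' ((fibre_scale l \<circ> \<tau>) (x, y))) (map (frechet_derivative (coord_rep ?c e' (fibre_scale l \<circ> \<tau>)) (at (snd ?c (x, y)))) us)"
      by (rule form_pullback_some[OF prod_chart_in[OF d] cc c xyN, where f = "fibre_scale l \<circ> \<tau>" and B = "tangent_atlas A"]; (rule G | rule that, assumption, assumption, assumption)?)
    have "(fibre_scale l \<circ> \<tau>) (x, y) \<in> form_support (tangent_atlas A) \<Phi>"
      by (rule form_supportI[OF pt e'(1,2)]) (use nz e'(3) in \<open>simp only: e\<close>)
    then have "\<tau> (x, y) \<in> \<tau> ` (N \<inter> B)" using R[OF l] by simp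
    then have "(x, y) \<in> B" using inj_onD[OF inj _ xyN] by blast
    then show "y \<in> V j" using j by (simp add: B_def)
  qed
qed

text \<open>By compactness finitely many cut-offs suffice, each handled in one flow box or away from
  \<open>\<Sigma>\<close>. The limit is 0 for every admissible map and every sequence of dilations,
  which at once rules out other density currents and verifies that 0 is one.\<close>

lemma density_limit:
  fixes A :: "('a, 'n::finite) chart set" and \<iota> :: "'q::finite \<Rightarrow> 'n" and T :: "('a, 'n) current"
  assumes A: "pre_manifold A" and H: "Hausdorff_space (atlas_topology A)" and CS: "compact_space (atlas_topology A)"
    and L: "embedded_lamination A \<iota> \<Sigma> L" and Lip: "transversally_Lipschitz A \<iota> \<Sigma> L"
    and fol: "foliated_cycle A \<iota> \<Sigma> L \<mu> T" and dif: "diffuse L \<mu>" and T: "is_current A (2 * CARD('q)) T"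
    and adm: "admissible_map A N \<tau>" and \<Phi>: "test_form (tangent_atlas A) (2 * CARD('q) + 2 * CARD('q)) \<Phi>"
    and l: "filterlim l at_infinity sequentially"
  shows "(\<lambda>j. current_tensor A A T T (form_pullback (prod_atlas A A) (tangent_atlas A) N (fibre_scale (l j) \<circ> \<tau>) \<Phi>)) \<longlonglongrightarrow> 0"
proof -
  let ?TA = "atlas_topology A" and ?q = "2 * CARD('q)"
  define \<Psi> where "\<Psi> l = form_pullback (prod_atlas A A) (tangent_atlas A) N (fibre_scale l \<circ> \<tau>) \<Phi>" for l
  define \<alpha> where "\<alpha> l = tensor_inner A T (\<Psi> l)" for l
  have "compactin ?TA \<Sigma>" using L unfolding embedded_lamination_def by blast
  then have \<Sigma>: "closedin ?TA \<Sigma>" by (rule compactin_imp_closedin[OF H])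
  \<comment> \<open>The neighbourhoods \<open>W\<close> must be fixed before the partition of unity
    subordinate to them. Hence \<open>good\<close> quantifies over all cut-offs, closed sets and
    thresholds that the partition may produce later.\<close>
  define good where "good W \<longleftrightarrow> (\<forall>\<psi> Z Y R0 \<eta>. closedin ?TA Z \<longrightarrow> closedin ?TA Y \<longrightarrow> Z \<subseteq> Y \<longrightarrow> Y \<subseteq> W \<longrightarrow> smooth_function A \<psi> \<longrightarrow>
      (\<forall>x. 0 \<le> \<psi> x) \<longrightarrow> (\<forall>x\<in>points A. \<psi> x \<le> 1) \<longrightarrow> (\<forall>x\<in>points A. x \<notin> Z \<longrightarrow> \<psi> x = 0) \<longrightarrow>
      (\<forall>l d d' x y vs. R0 < cmod l \<longrightarrow> d \<in> A \<longrightarrow> d' \<in> A \<longrightarrow> x \<in> fst d \<longrightarrow> y \<in> fst d' \<longrightarrow> x \<in> Z \<longrightarrow>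
         \<Psi> l (prod_chart d d') (vjoin (snd d x) (snd d' y)) vs \<noteq> 0 \<longrightarrow> y \<in> Y) \<longrightarrow> 0 < \<eta> \<longrightarrow>
      (\<exists>R. \<forall>l. R < cmod l \<longrightarrow> test_form A ?q (\<alpha> l) \<longrightarrow> norm (T (form_mult \<psi> (\<alpha> l))) \<le> \<eta>))" for W
  have "\<exists>W. openin ?TA W \<and> p \<in> W \<and> good W" if p: "p \<in> points A" for p
  proof (cases "p \<in> \<Sigma>")
    case False
    \<comment> \<open>The cycle vanishes on forms supported away from
      \<open>\<Sigma>\<close>.\<close>
    have "good (points A - \<Sigma>)"
      unfolding good_def
    proof (intro allI impI)
      fix \<psi> Z Y and R0 \<eta> :: real
      assume Z: "closedin ?TA Z" "Z \<subseteq> Y" "Y \<subseteq> points A - \<Sigma>" and \<psi>: "smooth_function A \<psi>" "\<forall>x\<in>points A. x \<notin> Z \<longrightarrow> \<psi> x = 0" and \<eta>: "0 < \<eta>"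
      have "norm (T (form_mult \<psi> (\<alpha> l))) \<le> \<eta>" if tf: "test_form A ?q (\<alpha> l)" for l
      proof -
        have sf: "smooth_form A ?q (\<alpha> l)" using tf by (simp add: test_form_def)
        have "form_support A (form_mult \<psi> (\<alpha> l)) \<subseteq> Z" by (rule form_mult_support[OF A Z(1)]) (use \<psi>(2) in blast)
        then have "form_support A (form_mult \<psi> (\<alpha> l)) \<inter> \<Sigma> = {}" using Z(2,3) by blast
        then have "T (form_mult \<psi> (\<alpha> l)) = 0"
          using fol smooth_form_imp_test_form[OF CS smooth_form_mult[OF A \<psi>(1) sf]] unfolding foliated_cycle_def by blast
        then show ?thesis using \<eta> by simp
      qed
      then show "\<exists>R. \<forall>l. R < cmod l \<longrightarrow> test_form A ?q (\<alpha> l) \<longrightarrow> norm (T (form_mult \<psi> (\<alpha> l))) \<le> \<eta>" by blast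
    qed
    moreover have "openin ?TA (points A - \<Sigma>)" using \<Sigma> by (simp add: closedin_def topspace_atlas)
    ultimately show ?thesis using p False by blast
  next
    case True
    obtain b where b: "b \<in> L" "p \<in> box_set b" using L True unfolding embedded_lamination_def by blast
    obtain c0 where c0: "c0 \<in> A" "p \<in> fst c0" using p unfolding points_def by blast
    show ?thesis
    proof (rule local_bound[OF A H L Lip True b c0 adm \<Phi>])
      fix W :: "'a set" and C :: real
      assume W: "openin ?TA W" "p \<in> W" "W \<subseteq> fst c0" "W \<inter> \<Sigma> \<subseteq> box_set b"
        "W \<subseteq> fst b ` (polydisc \<times> transverse_polydisc \<iota>)" "0 < C"
        and est: "\<And>l z s w t d d'. 1 \<le> cmod l \<Longrightarrow> z \<in> polydisc \<Longrightarrow> s \<in> snd b \<Longrightarrow> fst b (z, s) \<in> W \<Longrightarrow>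
       w \<in> polydisc \<Longrightarrow> t \<in> snd b \<Longrightarrow> fst b (w, t) \<in> W \<Longrightarrow>
       d \<in> A \<Longrightarrow> fst b (z, s) \<in> fst d \<Longrightarrow> d' \<in> A \<Longrightarrow> fst b (w, t) \<in> fst d' \<Longrightarrow>
       form_pullback (prod_atlas A A) (tangent_atlas A) N (fibre_scale l \<circ> \<tau>) \<Phi> (prod_chart d d') (vjoin (plaque_coord d b s z) (plaque_coord d' b t w))
         (map (\<lambda>u. vjoin u 0) (map (plaque_deriv d b s z) oriented_basis) @ map (\<lambda>u. vjoin 0 u) (map (plaque_deriv d' b t w) oriented_basis)) \<noteq> 0 \<Longrightarrow>
       norm (plaque_coord c0 b s z - plaque_coord c0 b t w) \<le> C / cmod l \<and>
       norm (form_pullback (prod_atlas A A) (tangent_atlas A) N (fibre_scale l \<circ> \<tau>) \<Phi> (prod_chart d d') (vjoin (plaque_coord d b s z) (plaque_coord d' b t w))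
         (map (\<lambda>u. vjoin u 0) (map (plaque_deriv d b s z) oriented_basis) @ map (\<lambda>u. vjoin 0 u) (map (plaque_deriv d' b t w) oriented_basis)))
         \<le> C * cmod l ^ (2 * CARD('q))"
        and emb: "\<And>w w' t. t \<in> snd b \<Longrightarrow> w \<in> polydisc \<Longrightarrow> w' \<in> polydisc \<Longrightarrow> fst b (w, t) \<in> W \<Longrightarrow> fst b (w', t) \<in> W \<Longrightarrow>
       norm (w - w') \<le> C * norm (plaque_coord c0 b t w - plaque_coord c0 b t w')"
      have "good W"
        unfolding good_def \<alpha>_def
      proof (intro allI impI)
        fix \<psi> Z Y and R0 \<eta> :: real
        assume Z: "closedin ?TA Z" and Y: "closedin ?TA Y" and ZY: "Z \<subseteq> Y" "Y \<subseteq> W"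
          and \<psi>: "smooth_function A \<psi>" "\<forall>x. 0 \<le> \<psi> x" "\<forall>x\<in>points A. \<psi> x \<le> 1" "\<forall>x\<in>points A. x \<notin> Z \<longrightarrow> \<psi> x = 0"
          and nr: "\<forall>l d d' x y vs. R0 < cmod l \<longrightarrow> d \<in> A \<longrightarrow> d' \<in> A \<longrightarrow> x \<in> fst d \<longrightarrow> y \<in> fst d' \<longrightarrow> x \<in> Z \<longrightarrow>
            \<Psi> l (prod_chart d d') (vjoin (snd d x) (snd d' y)) vs \<noteq> 0 \<longrightarrow> y \<in> Y" and \<eta>: "0 < \<eta>"
        show "\<exists>R. \<forall>l. R < cmod l \<longrightarrow> test_form A ?q (tensor_inner A T (\<Psi> l)) \<longrightarrow> norm (T (form_mult \<psi> (tensor_inner A T (\<Psi> l)))) \<le> \<eta>"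
        proof (rule local_limit[OF A H CS L fol dif T b(1) c0(1) W(3-6) _ emb Z Y ZY \<psi>(1) _ _ _ _ \<eta>])
          show "0 \<le> \<psi> x" for x using \<psi>(2) by blast
          show "\<psi> x \<le> 1" if "x \<in> points A" for x using \<psi>(3) that by blast
          show "\<psi> x = 0" if "x \<in> points A" "x \<notin> Z" for x using \<psi>(4) that by blast
          show "y \<in> Y" if "R0 < cmod l" "d \<in> A" "d' \<in> A" "x \<in> fst d" "y \<in> fst d'" "x \<in> Z"
            "\<Psi> l (prod_chart d d') (vjoin (snd d x) (snd d' y)) vs \<noteq> 0" for l d d' x y vs
            using nr[rule_format, OF that] .
        qed (unfold \<Psi>_def, rule est)
      qed
      then show ?thesis using W(1,2) by blast
    qed
  qed
  then obtain W where W: "\<And>p. p \<in> points A \<Longrightarrow> openin ?TA (W p)" "\<And>p. p \<in> points A \<Longrightarrow> p \<in> W p" "\<And>p. p \<in> points A \<Longrightarrow> good (W p)"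
    by metis
  obtain P \<psi> Z where P: "finite P" "P \<subseteq> points A" "\<And>p. p \<in> P \<Longrightarrow> smooth_function A (\<psi> p)"
    "\<And>p. p \<in> P \<Longrightarrow> compactin ?TA (Z p)" "\<And>p. p \<in> P \<Longrightarrow> Z p \<subseteq> W p"
    "\<And>p x. p \<in> P \<Longrightarrow> x \<in> points A \<Longrightarrow> x \<notin> Z p \<Longrightarrow> \<psi> p x = 0"
    "\<And>x. x \<in> points A \<Longrightarrow> (\<Sum>p\<in>P. \<psi> p x) = 1" "\<And>p x. p \<in> P \<Longrightarrow> 0 \<le> \<psi> p x"
    by (rule partition_of_unity[OF A H CS, of W, OF W(1,2)], assumption, assumption, rule that; assumption)
  have Zc: "closedin ?TA (Z p)" if "p \<in> P" for p by (rule compactin_imp_closedin[OF H P(4)[OF that]])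
  \<comment> \<open>Normality inserts an open \<open>V p\<close> between the support
    \<open>Z p\<close> and \<open>W p\<close>, with closure still in \<open>W p\<close>; this
    closure is the set \<open>Y\<close> for the second point.\<close>
  have "normal_space ?TA" by (rule compact_Hausdorff_or_regular_imp_normal_space[OF CS]) (use H in simp)
  then have "\<exists>V. openin ?TA V \<and> Z p \<subseteq> V \<and> ?TA closure_of V \<subseteq> W p" if "p \<in> P" for p
    using normal_space_alt[THEN iffD1, rule_format, of ?TA "Z p" "W p"] Zc[OF that] W(1)[OF subsetD[OF P(2) that]] P(5)[OF that]
    by presburger
  then obtain V where V: "\<And>p. p \<in> P \<Longrightarrow> openin ?TA (V p)" "\<And>p. p \<in> P \<Longrightarrow> Z p \<subseteq> V p" "\<And>p. p \<in> P \<Longrightarrow> ?TA closure_of (V p) \<subseteq> W p"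
    by metis
  have VY: "V p \<subseteq> ?TA closure_of (V p)" if "p \<in> P" for p by (rule closure_of_subset[OF openin_subset[OF V(1)[OF that]]])
  obtain R0 where R0: "\<And>l d d' x y vs j. R0 < cmod l \<Longrightarrow> d \<in> A \<Longrightarrow> d' \<in> A \<Longrightarrow> x \<in> fst d \<Longrightarrow> y \<in> fst d' \<Longrightarrow> j \<in> P \<Longrightarrow> x \<in> Z j \<Longrightarrow>
     \<Psi> l (prod_chart d d') (vjoin (snd d x) (snd d' y)) vs \<noteq> 0 \<Longrightarrow> y \<in> V j"
    by (rule pullback_near_diagonal[OF A adm \<Phi> P(1) Zc V(1,2), folded \<Psi>_def], assumption, assumption, assumption, rule that)
  have lim: "\<exists>R. \<forall>l. R < cmod l \<longrightarrow> norm (T (\<alpha> l)) \<le> \<eta>" if \<eta>: "0 < \<eta>" for \<eta>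
  proof -
    \<comment> \<open>An equal share for each cut-off; the summand 1 prevents division by 0 and
      keeps the total at most \<open>\<eta>\<close>.\<close>
    define \<eta>' where "\<eta>' = \<eta> / (real (card P) + 1)"
    have \<eta>': "0 < \<eta>'" using \<eta> by (simp add: \<eta>'_def)
    have "\<exists>R. \<forall>l. R < cmod l \<longrightarrow> test_form A ?q (\<alpha> l) \<longrightarrow> norm (T (form_mult (\<psi> p) (\<alpha> l))) \<le> \<eta>'" if p: "p \<in> P" for p
    proof -
      have pA: "p \<in> points A" using P(2) p by blast
      have "\<psi> p x \<le> 1" if "x \<in> points A" for x
        using member_le_sum[of p P "\<lambda>p. \<psi> p x"] P(1,7,8) p that by simp
      moreover have "y \<in> ?TA closure_of (V p)" if "R0 < cmod l" "d \<in> A" "d' \<in> A" "x \<in> fst d" "y \<in> fst d'" "x \<in> Z p"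
            "\<Psi> l (prod_chart d d') (vjoin (snd d x) (snd d' y)) vs \<noteq> 0" for l d d' x y vs
        using R0[OF that(1-5) p that(6,7)] VY[OF p] by blast
      ultimately show ?thesis
        using W(3)[OF pA, unfolded good_def, rule_format, of "Z p" "?TA closure_of (V p)" "\<psi> p" R0 \<eta>']
          Zc[OF p] closedin_closure_of order_trans[OF V(2)[OF p] VY[OF p]] V(3)[OF p] P(3)[OF p] P(6,8)[OF p] \<eta>' by blast
    qed
    then obtain R where R: "\<And>p l. p \<in> P \<Longrightarrow> R p < cmod l \<Longrightarrow> test_form A ?q (\<alpha> l) \<Longrightarrow> norm (T (form_mult (\<psi> p) (\<alpha> l))) \<le> \<eta>'" by metis
    have "norm (T (\<alpha> l)) \<le> \<eta>" if l: "Max (insert 0 (R ` P)) < cmod l" for l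
    proof (cases "test_form A ?q (\<alpha> l)")
      case False
      then have "T (\<alpha> l) = 0" using T unfolding is_current_def by blast
      then show ?thesis using \<eta> by simp
    next
      case True
      then have sf: "smooth_form A ?q (\<alpha> l)" by (simp add: test_form_def)
      have "T (\<alpha> l) = T (form_mult (\<lambda>x. \<Sum>p\<in>P. \<psi> p x) (\<alpha> l))" by (simp only: form_mult_one[OF sf P(7)])
      also have "\<dots> = (\<Sum>p\<in>P. T (form_mult (\<psi> p) (\<alpha> l)))" by (rule current_partition[OF A CS T True P(1,3)])
      also have "norm \<dots> \<le> (\<Sum>p\<in>P. \<eta>')"
      proof (rule sum_norm_le)
        fix p assume p: "p \<in> P"
        have "R p \<le> Max (insert 0 (R ` P))" using P(1) p by (intro Max_ge) auto
        then show "norm (T (form_mult (\<psi> p) (\<alpha> l))) \<le> \<eta>'" using R[OF p _ True] l by simp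
      qed
      also have "\<dots> \<le> \<eta>" using \<eta> by (simp add: \<eta>'_def field_simps)
      finally show ?thesis .
    qed
    then show ?thesis by blast
  qed
  show ?thesis
    unfolding current_tensor_eq \<Psi>_def[symmetric] \<alpha>_def[symmetric]
  proof (rule tendstoI)
    fix e :: real assume "0 < e"
    then obtain R where R: "\<And>l. R < cmod l \<Longrightarrow> norm (T (\<alpha> l)) \<le> e / 2" using lim[of "e / 2"] by auto
    have "\<forall>\<^sub>F j in sequentially. R < cmod (l j)"
      using filterlim_at_infinity_imp_norm_at_top[OF l] unfolding filterlim_at_top_dense by blast
    then show "\<forall>\<^sub>F j in sequentially. dist (T (\<alpha> (l j))) 0 < e"
    proof eventually_elim
      case (elim j)
      then show ?case using R[OF elim] \<open>0 < e\<close> by simp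
    qed
  qed
qed

theorem mainTheorem3:
  fixes A :: "('a, 'n::finite) chart set"
    and \<iota> :: "'q::finite \<Rightarrow> 'n"
    and \<Sigma> :: "'a set"
    and L :: "('a, 'q, 'n) flow_box set"
    and \<mu> :: "('a, 'q, 'n) flow_box \<Rightarrow> (complex^'n) measure"
    and T :: "('a, 'n) current"
  assumes "compact_kaehler_manifold A"
    and "embedded_lamination A \<iota> \<Sigma> L"
    and "transversally_Lipschitz A \<iota> \<Sigma> L"
    and "foliated_cycle A \<iota> \<Sigma> L \<mu> T"
    and "diffuse L \<mu>"
    and "2 * CARD('q) \<ge> CARD('n)"
  shows "DS_product_is A (CARD('n) - CARD('q)) (CARD('n) - CARD('q)) T T (\<lambda>_. 0)"
proof -
  have M: "complex_manifold A" and CS: "compact_space (atlas_topology A)"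
    using assms(1) by (auto simp: compact_kaehler_manifold_def)
  have A: "pre_manifold A" by (rule complex_manifold_imp_pre_manifold[OF M])
  have H: "Hausdorff_space (atlas_topology A)" using M by (simp add: complex_manifold_def)
  have "inj \<iota>" using assms(2) by (simp add: embedded_lamination_def)
  then have qn: "CARD('q) \<le> CARD('n)" by (metis card_inj_on_le finite subset_UNIV)
  then have nq: "CARD('n) - (CARD('n) - CARD('q)) = CARD('q)" by simp
  have T: "is_current A (2 * CARD('q)) T"
    using assms(4) unfolding foliated_cycle_def positive_closed_current_def Let_def nq by blast
  have zero: "is_current B k (\<lambda>_. 0)" for B :: "('b, 'k::finite) chart set" and k by (simp add: is_current_def)
  \<comment> \<open>The dimension hypothesis enters here: the product has bidegree twice
    \<open>CARD('n) - CARD('q)\<close>, which must not exceed \<open>CARD('n)\<close>.\<close>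
  have "positive_closed_current A (CARD('n) - CARD('q) + (CARD('n) - CARD('q))) (\<lambda>_. 0)"
    using assms(6) qn unfolding positive_closed_current_def Let_def by (simp add: zero closed_current_def)
  moreover have "{S. density_current A (CARD('n) - CARD('q)) (CARD('n) - CARD('q)) T T S} = {\<lambda>_. 0}"
  proof (intro equalityI subsetI)
    fix S assume "S \<in> {S. density_current A (CARD('n) - CARD('q)) (CARD('n) - CARD('q)) T T S}"
    then obtain N \<tau> l where S: "is_current (tangent_atlas A) (2 * CARD('q) + 2 * CARD('q)) S" and adm: "admissible_map A N \<tau>"
      and l: "filterlim l at_infinity sequentially"
      and lim: "\<And>\<Phi>. test_form (tangent_atlas A) (2 * CARD('q) + 2 * CARD('q)) \<Phi> \<Longrightarrow>
        (\<lambda>j. current_tensor A A T T (form_pullback (prod_atlas A A) (tangent_atlas A) N (fibre_scale (l j) \<circ> \<tau>) \<Phi>)) \<longlonglongrightarrow> S \<Phi>"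
      unfolding mem_Collect_eq density_current_def Let_def nq by blast
    \<comment> \<open>On test forms by uniqueness of limits, on all other arguments by the
      convention in \<open>is_current\<close>; only both together give equality of
      functions.\<close>
    have "S \<Phi> = 0" for \<Phi>
    proof (cases "test_form (tangent_atlas A) (2 * CARD('q) + 2 * CARD('q)) \<Phi>")
      case True
      show ?thesis
        by (rule LIMSEQ_unique[OF lim[OF True] density_limit[OF A H CS assms(2-5) T adm True l]])
    next
      case False
      then show ?thesis using S unfolding is_current_def by blast
    qed
    then show "S \<in> {\<lambda>_. 0}" by auto
  next
    fix S :: "('a \<times> ('a, 'n) tvec, 'n + 'n) current" assume "S \<in> {\<lambda>_. 0}"
    then have S: "S = (\<lambda>_. 0)" by simp
    obtain N \<tau> where adm: "admissible_map A N \<tau>" using admissible_map_exists[OF M CS] by blast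
    \<comment> \<open>Any sequence of nonzero numbers tending to infinity would do; the successor
      avoids 0.\<close>
    define l :: "nat \<Rightarrow> complex" where "l j = of_nat (Suc j)" for j
    have l: "filterlim l at_infinity sequentially"
      unfolding l_def using filterlim_compose[OF tendsto_of_nat filterlim_Suc] by simp
    have l0: "l j \<noteq> 0" for j unfolding l_def by (simp del: of_nat_Suc)
    show "S \<in> {S. density_current A (CARD('n) - CARD('q)) (CARD('n) - CARD('q)) T T S}"
      unfolding mem_Collect_eq density_current_def Let_def nq S
      using zero adm l l0 density_limit[OF A H CS assms(2-5) T adm _ l] by blast
  qed
  moreover have "current_pullback_proj A k (\<lambda>_. 0) = (\<lambda>_. 0)" for k by (simp add: current_pullback_proj_def fun_eq_iff)
  ultimately show ?thesis unfolding DS_product_is_def by simp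
qed

end
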